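(* Let $A\in\mathrm{obj}(\mathcal C)$. The naïve construction $(BC_{\mathcal C}^\bullet(A,-),\tau^\bullet)$ forms a Mislin completion of $(\mathrm{Ext}_{\mathcal C}^\bullet(A,-),\delta^\bullet)$. More specifically, $(BC_{\mathcal C}^\bullet(A,-),\tau^\bullet)$ forms a cohomological functor and $\beta^\bullet:(\widehat{\mathrm{Ext}}_{\mathcal C}^\bullet(A,-),\widehat\delta^\bullet)\to(BC_{\mathcal C}^\bullet(A,-),\tau^\bullet)$ is an isomorphism of cohomological functors.
   Context: $\mathcal C$ is an abelian category with enough projectives. A cohomological functor $(T^\bullet,\delta^\bullet):\mathcal C\to\mathbf{Ab}$ is a family of additive functors $(T^n)_{n\in\mathbb Z}$ with natural connecting homomorphisms $\delta^n:T^n(D)\to T^{n+1}(B)$ for every short exact sequence $0\to B\to C\to D\to0$, giving a long exact sequence; morphisms are families of natural transformations commuting with connecting homomorphisms. A Mislin completion of $T^\bullet$ is a cohomological functor $\widehat T^\bullet$ with a morphism $\nu^\bullet:T^\bullet\to\widehat T^\bullet$ such that $\widehat T^n(P)=0$ for all projective $P$ and $n\in\mathbb Z$ and every morphism from $T^\bullet$ to a cohomological functor vanishing on projectives factors uniquely through $\nu^\bullet$. $\mathrm{Ext}_{\mathcal C}^\bullet(A,-)$ is a cohomological functor with $\mathrm{Ext}^n=0$ for $n<0$. For an object $M$ with projective resolution $M_\bullet$, the syzygies are $\widetilde M_0=M$, $\widetilde M_k=\mathrm{Ker}(M_{k-1}\to\widetilde M_{k-1})$. For $f:B\to C$ a sequence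 of lifts $\widetilde f_k:\widetilde B_k\to\widetilde C_k$ is defined by $\widetilde f_0=f$ and $\widetilde f_{k+1}$ induced by a lift $B_k\to C_k$ of $\widetilde f_k$. For $0\to B\to C\to D\to0$ exact, the Horseshoe Lemma gives projective resolutions with short exact sequences $0\to\widetilde B_k\to\widetilde C_k\to\widetilde D_k\to0$ compatible with $0\to B_k\to C_k\to D_k\to0$. Constructions using different resolutions are identified through lifts of identities. Resolution construction: $\widehat{\mathrm{Ext}}_{\mathcal C}^n(A,B)=\varinjlim_{k\in\mathbb N_0}(\mathrm{Ext}_{\mathcal C}^{n+k}(A,\widetilde B_k),\delta^{n+k})$ with the connecting homomorphisms of $0\to\widetilde B_{k+1}\to B_k\to\widetilde B_k\to0$; $\widehat{\mathrm{Ext}}_{\mathcal C}^n(A,f)=\varinjlim_k\mathrm{Ext}_{\mathcal C}^{n+k}(A,\widetilde f_k)$; $\widehat\delta^n=\varinjlim_k(-1)^k\delta^{n+k}$ with $\delta^{n+k}:\mathrm{Ext}_{\mathcal C}^{n+k}(A,\widetilde D_k)\to\mathrm{Ext}_{\mathcal C}^{n+k+1}(A,\widetilde B_k)$ for the horseshoe sequences. It is a Mislin completion of $\mathrm{Ext}_{\mathcal C}^\bullet(A,-)$ via the canonical morphism given by the stage $k=0$. Naïve construction: $[X,Y]_{\mathcal C}=\mathrm{Hom}_{\mathcal C}(X,Y)/\mathcal P_{\mathcal C}(X,Y)$, with $\mathcal P_{\mathcal C}(X,Y)$ the morphisms factoring through a projective. For $f:\widetilde A_{n+k}\to\widetilde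 B_k$ let $\overline f^*:\widetilde A_{n+k+1}\to\widetilde B_{k+1}$ be induced by a lift $A_{n+k}\to B_k$; $t_{\widetilde A_{n+k},\widetilde B_k}$ sends the class of $f$ to that of $\overline f^*$. $BC_{\mathcal C}^n(A,B)=\varinjlim_{k\in\mathbb N_0,\,n+k\ge0}([\widetilde A_{n+k},\widetilde B_k]_{\mathcal C},t_{\widetilde A_{n+k},\widetilde B_k})$; for $f:B\to C$, $BC_{\mathcal C}^n(A,f)=\varinjlim_k(\text{composition with }\widetilde f_k)$. For $0\to B\to C\to D\to0$ exact, $\tau^n=\varinjlim_{k,\,n+k\ge1}(-1)^k\tau_{n+k,k}:BC_{\mathcal C}^n(A,D)\to BC_{\mathcal C}^{n+1}(A,B)$, where $\tau_{n+k,k}:[\widetilde A_{n+k},\widetilde D_k]_{\mathcal C}\to[\widetilde A_{n+k+1},\widetilde B_k]_{\mathcal C}$ sends the class of $f$ to that of $h^*\circ\overline f^*$, with $h^*:\widetilde D_{k+1}\to\widetilde B_k$ induced by a lift $D_k\to\widetilde C_k$ of $\mathrm{id}_{\widetilde D_k}$. $\beta^n(B)=\varinjlim_{k,\,n+k\ge1}\beta_{n+k}(\widetilde B_k):\widehat{\mathrm{Ext}}_{\mathcal C}^n(A,B)\to BC_{\mathcal C}^n(A,B)$, where for $m\ge1$ and differentials $\partial_m:A_m\xrightarrow{\pi_m}\widetilde A_m\xrightarrow{\iota_m}A_{m-1}$, $\beta_m(Y):\mathrm{Ext}_{\mathcal C}^m(A,Y)\to[\widetilde A_m,Y]_{\mathcal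 C}$ sends the class of $f\in\mathrm{Ker}(\mathrm{Hom}_{\mathcal C}(\partial_{m+1},Y))$ to the class of the unique $f'$ with $f=f'\circ\pi_m$. The morphism $\mathrm{Ext}_{\mathcal C}^\bullet(A,-)\to BC_{\mathcal C}^\bullet(A,-)$ of the Mislin completion is the composite of the canonical morphism to $\widehat{\mathrm{Ext}}_{\mathcal C}^\bullet(A,-)$ with $\beta^\bullet$. *)

theory Defs
  imports "HOL-Algebra.Exact_Sequence"
begin

section \<open>Abelian categories\<close>

text \<open>Objects and arrows live in carrier sets of arbitrary types. The fields \<open>Plus\<close> and \<open>Nul\<close> are
  the addition of parallel arrows and the zero arrows; \<open>Cmp C g f\<close> is \<open>g\<close> after \<open>f\<close>.\<close>

record ('o, 'm) abcat =
  Obj :: "'o set"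
  Arr :: "'m set"
  Dom :: "'m \<Rightarrow> 'o"
  Cod :: "'m \<Rightarrow> 'o"
  Idt :: "'o \<Rightarrow> 'm"
  Cmp :: "'m \<Rightarrow> 'm \<Rightarrow> 'm" (infixr "\<cdot>\<index>" 70)
  Plus :: "'m \<Rightarrow> 'm \<Rightarrow> 'm"
  Nul :: "'o \<Rightarrow> 'o \<Rightarrow> 'm"

definition Hom :: "('o, 'm) abcat \<Rightarrow> 'o \<Rightarrow> 'o \<Rightarrow> 'm set" where
  "Hom C X Y = {f \<in> Arr C. Dom C f = X \<and> Cod C f = Y}"

text \<open>All abelian groups are written multiplicatively, as in \<open>HOL-Algebra\<close>.\<close>

definition hom_group :: "('o, 'm) abcat \<Rightarrow> 'o \<Rightarrow> 'o \<Rightarrow> 'm monoid" where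
  "hom_group C X Y = \<lparr>carrier = Hom C X Y, monoid.mult = Plus C, one = Nul C X Y\<rparr>"

definition monic :: "('o, 'm) abcat \<Rightarrow> 'm \<Rightarrow> bool" where
  "monic C f \<longleftrightarrow> f \<in> Arr C \<and>
     (\<forall>W. \<forall>g \<in> Hom C W (Dom C f). \<forall>h \<in> Hom C W (Dom C f). f \<cdot>\<^bsub>C\<^esub> g = f \<cdot>\<^bsub>C\<^esub> h \<longrightarrow> g = h)"

definition epic :: "('o, 'm) abcat \<Rightarrow> 'm \<Rightarrow> bool" where
  "epic C f \<longleftrightarrow> f \<in> Arr C \<and>
     (\<forall>W. \<forall>g \<in> Hom C (Cod C f) W. \<forall>h \<in> Hom C (Cod C f) W. g \<cdot>\<^bsub>C\<^esub> f = h \<cdot>\<^bsub>C\<^esub> f \<longrightarrow> g = h)"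

definition is_kernel :: "('o, 'm) abcat \<Rightarrow> 'm \<Rightarrow> 'm \<Rightarrow> bool" where
  "is_kernel C k f \<longleftrightarrow> f \<in> Arr C \<and> k \<in> Arr C \<and> Cod C k = Dom C f \<and>
     f \<cdot>\<^bsub>C\<^esub> k = Nul C (Dom C k) (Cod C f) \<and>
     (\<forall>W. \<forall>g \<in> Hom C W (Dom C f). f \<cdot>\<^bsub>C\<^esub> g = Nul C W (Cod C f) \<longrightarrow>
        (\<exists>!h. h \<in> Hom C W (Dom C k) \<and> k \<cdot>\<^bsub>C\<^esub> h = g))"

definition is_cokernel :: "('o, 'm) abcat \<Rightarrow> 'm \<Rightarrow> 'm \<Rightarrow> bool" where
  "is_cokernel C c f \<longleftrightarrow> f \<in> Arr C \<and> c \<in> Arr C \<and> Dom C c = Cod C f \<and>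
     c \<cdot>\<^bsub>C\<^esub> f = Nul C (Dom C f) (Cod C c) \<and>
     (\<forall>W. \<forall>g \<in> Hom C (Cod C f) W. g \<cdot>\<^bsub>C\<^esub> f = Nul C (Dom C f) W \<longrightarrow>
        (\<exists>!h. h \<in> Hom C (Cod C c) W \<and> h \<cdot>\<^bsub>C\<^esub> c = g))"

locale abelian_category =
  fixes C :: "('o, 'm) abcat" (structure)
  assumes dom_obj: "f \<in> Arr C \<Longrightarrow> Dom C f \<in> Obj C"
    and cod_obj: "f \<in> Arr C \<Longrightarrow> Cod C f \<in> Obj C"
    and ident: "X \<in> Obj C \<Longrightarrow> Idt C X \<in> Hom C X X"
    and comp: "\<lbrakk>f \<in> Hom C X Y; g \<in> Hom C Y Z\<rbrakk> \<Longrightarrow> g \<cdot> f \<in> Hom C X Z"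
    and comp_ident: "f \<in> Hom C X Y \<Longrightarrow> f \<cdot> Idt C X = f"
    and ident_comp: "f \<in> Hom C X Y \<Longrightarrow> Idt C Y \<cdot> f = f"
    and comp_assoc: "\<lbrakk>f \<in> Hom C W X; g \<in> Hom C X Y; h \<in> Hom C Y Z\<rbrakk> \<Longrightarrow> (h \<cdot> g) \<cdot> f = h \<cdot> (g \<cdot> f)"
    and hom_comm_group: "\<lbrakk>X \<in> Obj C; Y \<in> Obj C\<rbrakk> \<Longrightarrow> comm_group (hom_group C X Y)"
    and comp_plus_left: "\<lbrakk>f \<in> Hom C X Y; g \<in> Hom C Y Z; h \<in> Hom C Y Z\<rbrakk> \<Longrightarrow>
      (Plus C g h) \<cdot> f = Plus C (g \<cdot> f) (h \<cdot> f)"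
    and comp_plus_right: "\<lbrakk>f \<in> Hom C X Y; g \<in> Hom C X Y; h \<in> Hom C Y Z\<rbrakk> \<Longrightarrow>
      h \<cdot> (Plus C f g) = Plus C (h \<cdot> f) (h \<cdot> g)"
    and zero_object: "\<exists>Z \<in> Obj C. \<forall>X \<in> Obj C. (\<exists>!f. f \<in> Hom C X Z) \<and> (\<exists>!f. f \<in> Hom C Z X)"
    and biproduct: "\<lbrakk>X \<in> Obj C; Y \<in> Obj C\<rbrakk> \<Longrightarrow>
      \<exists>Z \<in> Obj C. \<exists>i1 \<in> Hom C X Z. \<exists>i2 \<in> Hom C Y Z. \<exists>p1 \<in> Hom C Z X. \<exists>p2 \<in> Hom C Z Y.
        p1 \<cdot> i1 = Idt C X \<and> p2 \<cdot> i2 = Idt C Y \<and> p1 \<cdot> i2 = Nul C Y X \<and> p2 \<cdot> i1 = Nul C X Y \<and>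
        Plus C (i1 \<cdot> p1) (i2 \<cdot> p2) = Idt C Z"
    and has_kernel: "f \<in> Arr C \<Longrightarrow> \<exists>k. is_kernel C k f"
    and has_cokernel: "f \<in> Arr C \<Longrightarrow> \<exists>c. is_cokernel C c f"
    and monic_normal: "monic C f \<Longrightarrow> \<exists>g. is_kernel C f g"
    and epic_normal: "epic C f \<Longrightarrow> \<exists>g. is_cokernel C f g"

text \<open>\<open>0 \<rightarrow> Dom i \<rightarrow> Cod i = Dom p \<rightarrow> Cod p \<rightarrow> 0\<close> is exact.\<close>

definition short_exact :: "('o, 'm) abcat \<Rightarrow> 'm \<Rightarrow> 'm \<Rightarrow> bool" where
  "short_exact C i p \<longleftrightarrow> is_kernel C i p \<and> is_cokernel C p i"

definition projective :: "('o, 'm) abcat \<Rightarrow> 'o \<Rightarrow> bool" where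
  "projective C P \<longleftrightarrow> P \<in> Obj C \<and>
     (\<forall>e f. epic C e \<and> f \<in> Hom C P (Cod C e) \<longrightarrow> (\<exists>g \<in> Hom C P (Dom C e). e \<cdot>\<^bsub>C\<^esub> g = f))"

definition enough_projectives :: "('o, 'm) abcat \<Rightarrow> bool" where
  "enough_projectives C \<longleftrightarrow>
     (\<forall>X \<in> Obj C. \<exists>e. epic C e \<and> Cod C e = X \<and> projective C (Dom C e))"


section \<open>Cohomological functors and Mislin completions\<close>

text \<open>\<open>Fcon T n i p\<close> is the connecting homomorphism \<open>T\<^sup>n(Cod p) \<rightarrow> T\<^sup>n\<^sup>+\<^sup>1(Dom i)\<close> of the short exact
  sequence \<open>(i, p)\<close>.\<close>

record ('o, 'm, 'g) cohfun =
  Fobj :: "int \<Rightarrow> 'o \<Rightarrow> 'g monoid"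
  Fmor :: "int \<Rightarrow> 'm \<Rightarrow> 'g \<Rightarrow> 'g"
  Fcon :: "int \<Rightarrow> 'm \<Rightarrow> 'm \<Rightarrow> 'g \<Rightarrow> 'g"

locale cohomological_functor =
  fixes C :: "('o, 'm) abcat" (structure) and T :: "('o, 'm, 'g) cohfun"
  assumes obj_group: "X \<in> Obj C \<Longrightarrow> comm_group (Fobj T n X)"
    and mor_hom: "f \<in> Hom C X Y \<Longrightarrow> Fmor T n f \<in> hom (Fobj T n X) (Fobj T n Y)"
    and mor_ident: "\<lbrakk>X \<in> Obj C; x \<in> carrier (Fobj T n X)\<rbrakk> \<Longrightarrow> Fmor T n (Idt C X) x = x"
    and mor_comp: "\<lbrakk>f \<in> Hom C X Y; g \<in> Hom C Y Z; x \<in> carrier (Fobj T n X)\<rbrakk> \<Longrightarrow>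
      Fmor T n (g \<cdot> f) x = Fmor T n g (Fmor T n f x)"
    and mor_plus: "\<lbrakk>f \<in> Hom C X Y; g \<in> Hom C X Y; x \<in> carrier (Fobj T n X)\<rbrakk> \<Longrightarrow>
      Fmor T n (Plus C f g) x = Fmor T n f x \<otimes>\<^bsub>Fobj T n Y\<^esub> Fmor T n g x"
    and con_hom: "short_exact C i p \<Longrightarrow>
      Fcon T n i p \<in> hom (Fobj T n (Cod C p)) (Fobj T (n + 1) (Dom C i))"
    and con_natural: "\<lbrakk>short_exact C i p; short_exact C i' p';
        a \<in> Hom C (Dom C i) (Dom C i'); b \<in> Hom C (Cod C i) (Cod C i');
        c \<in> Hom C (Cod C p) (Cod C p'); b \<cdot> i = i' \<cdot> a; c \<cdot> p = p' \<cdot> b;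
        x \<in> carrier (Fobj T n (Cod C p))\<rbrakk> \<Longrightarrow>
      Fmor T (n + 1) a (Fcon T n i p x) = Fcon T n i' p' (Fmor T n c x)"
    and long_exact: "short_exact C i p \<Longrightarrow>
      exact_seq
        ([Fobj T (n + 1) (Cod C i), Fobj T (n + 1) (Dom C i), Fobj T n (Cod C p),
          Fobj T n (Cod C i), Fobj T n (Dom C i)],
         [Fmor T (n + 1) i, Fcon T n i p, Fmor T n p, Fmor T n i])"

definition coh_morphism ::
  "('o, 'm) abcat \<Rightarrow> ('o, 'm, 'g) cohfun \<Rightarrow> ('o, 'm, 'h) cohfun \<Rightarrow> (int \<Rightarrow> 'o \<Rightarrow> 'g \<Rightarrow> 'h) \<Rightarrow> bool" where
  "coh_morphism C T U \<mu> \<longleftrightarrow>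
     cohomological_functor C T \<and> cohomological_functor C U \<and>
     (\<forall>n. \<forall>X \<in> Obj C. \<mu> n X \<in> hom (Fobj T n X) (Fobj U n X)) \<and>
     (\<forall>n X Y. \<forall>f \<in> Hom C X Y. \<forall>x \<in> carrier (Fobj T n X).
        \<mu> n Y (Fmor T n f x) = Fmor U n f (\<mu> n X x)) \<and>
     (\<forall>n i p. short_exact C i p \<longrightarrow> (\<forall>x \<in> carrier (Fobj T n (Cod C p)).
        \<mu> (n + 1) (Dom C i) (Fcon T n i p x) = Fcon U n i p (\<mu> n (Cod C p) x)))"

definition coh_isomorphism ::
  "('o, 'm) abcat \<Rightarrow> ('o, 'm, 'g) cohfun \<Rightarrow> ('o, 'm, 'h) cohfun \<Rightarrow> (int \<Rightarrow> 'o \<Rightarrow> 'g \<Rightarrow> 'h) \<Rightarrow> bool" where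
  "coh_isomorphism C T U \<mu> \<longleftrightarrow> coh_morphism C T U \<mu> \<and>
     (\<exists>\<kappa>. coh_morphism C U T \<kappa> \<and>
        (\<forall>n. \<forall>X \<in> Obj C. (\<forall>x \<in> carrier (Fobj T n X). \<kappa> n X (\<mu> n X x) = x) \<and>
                           (\<forall>y \<in> carrier (Fobj U n X). \<mu> n X (\<kappa> n X y) = y)))"

definition vanishes_on_projectives :: "('o, 'm) abcat \<Rightarrow> ('o, 'm, 'g) cohfun \<Rightarrow> bool" where
  "vanishes_on_projectives C T \<longleftrightarrow>
     (\<forall>n P. projective C P \<longrightarrow> carrier (Fobj T n P) = {\<one>\<^bsub>Fobj T n P\<^esub>})"

text \<open>The type argument is the type of elements of the groups in the range of the cohomological
  functors \<open>U\<close> that the universal property is tested against. It cannot be quantified inside a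
  definition, but a theorem with a free type variable there covers all types. Uniqueness is
  equality on the carriers.\<close>

definition mislin_completion ::
  "'h itself \<Rightarrow> ('o, 'm) abcat \<Rightarrow> ('o, 'm, 'g) cohfun \<Rightarrow> ('o, 'm, 'k) cohfun \<Rightarrow>
    (int \<Rightarrow> 'o \<Rightarrow> 'g \<Rightarrow> 'k) \<Rightarrow> bool" where
  "mislin_completion TY C T T' \<nu> \<longleftrightarrow>
     coh_morphism C T T' \<nu> \<and> vanishes_on_projectives C T' \<and>
     (\<forall>(U :: ('o, 'm, 'h) cohfun) \<phi>.
        vanishes_on_projectives C U \<and> coh_morphism C T U \<phi> \<longrightarrow>
        (\<exists>\<mu>. coh_morphism C T' U \<mu> \<and>
           (\<forall>n. \<forall>X \<in> Obj C. \<forall>x \<in> carrier (Fobj T n X). \<mu> n X (\<nu> n X x) = \<phi> n X x) \<and>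
           (\<forall>\<mu>'. coh_morphism C T' U \<mu>' \<and>
              (\<forall>n. \<forall>X \<in> Obj C. \<forall>x \<in> carrier (Fobj T n X). \<mu>' n X (\<nu> n X x) = \<phi> n X x) \<longrightarrow>
              (\<forall>n. \<forall>X \<in> Obj C. \<forall>y \<in> carrier (Fobj T' n X). \<mu>' n X y = \<mu> n X y))))"


section \<open>Projective resolutions, syzygies, lifts and horseshoes\<close>

text \<open>A projective resolution together with its syzygies, i.e. with the factorisation of the
  augmented complex into the short exact sequences
  \<open>0 \<rightarrow> Syz R (k+1) \<rightarrow> Pr R k \<rightarrow> Syz R k \<rightarrow> 0\<close> with maps \<open>inc R k\<close> and \<open>prj R k\<close>.
  The augmentation is \<open>prj R 0\<close>. In the usual indexing of maps by their domains,
  \<open>prj R m\<close> is \<open>\<pi>\<^sub>m\<close>, while \<open>inc R m\<close> is \<open>\<iota>\<^bsub>m+1\<^esub>\<close> and \<open>diff C R m\<close> is \<open>\<partial>\<^bsub>m+1\<^esub> : Pr R (m+1) \<rightarrow> Pr R m\<close>.\<close>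

record ('o, 'm) resolution =
  Pr :: "nat \<Rightarrow> 'o"
  Syz :: "nat \<Rightarrow> 'o"
  prj :: "nat \<Rightarrow> 'm"
  inc :: "nat \<Rightarrow> 'm"

definition proj_resolution :: "('o, 'm) abcat \<Rightarrow> 'o \<Rightarrow> ('o, 'm) resolution \<Rightarrow> bool" where
  "proj_resolution C M R \<longleftrightarrow> Syz R 0 = M \<and>
     (\<forall>k. projective C (Pr R k) \<and>
          prj R k \<in> Hom C (Pr R k) (Syz R k) \<and> inc R k \<in> Hom C (Syz R (Suc k)) (Pr R k) \<and>
          short_exact C (inc R k) (prj R k))"

definition diff :: "('o, 'm) abcat \<Rightarrow> ('o, 'm) resolution \<Rightarrow> nat \<Rightarrow> 'm" where
  "diff C R k = inc R k \<cdot>\<^bsub>C\<^esub> prj R (Suc k)"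

text \<open>\<open>h\<close> is induced on the next syzygies by a lift of \<open>f : Syz R k \<rightarrow> Syz S l\<close> to
  \<open>Pr R k \<rightarrow> Pr S l\<close>. For \<open>k = l\<close> this is one step of a sequence of lifts; in general it is the
  passage from \<open>f\<close> to \<open>f\<^sup>*\<close> in the naive construction.\<close>

definition syz_lift ::
  "('o, 'm) abcat \<Rightarrow> ('o, 'm) resolution \<Rightarrow> nat \<Rightarrow> ('o, 'm) resolution \<Rightarrow> nat \<Rightarrow> 'm \<Rightarrow> 'm \<Rightarrow> bool" where
  "syz_lift C R k S l f h \<longleftrightarrow>
     f \<in> Hom C (Syz R k) (Syz S l) \<and> h \<in> Hom C (Syz R (Suc k)) (Syz S (Suc l)) \<and>
     (\<exists>g \<in> Hom C (Pr R k) (Pr S l).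
        prj S l \<cdot>\<^bsub>C\<^esub> g = f \<cdot>\<^bsub>C\<^esub> prj R k \<and> inc S l \<cdot>\<^bsub>C\<^esub> h = g \<cdot>\<^bsub>C\<^esub> inc R k)"

definition lift_sequence ::
  "('o, 'm) abcat \<Rightarrow> ('o, 'm) resolution \<Rightarrow> ('o, 'm) resolution \<Rightarrow> 'm \<Rightarrow> (nat \<Rightarrow> 'm) \<Rightarrow> bool" where
  "lift_sequence C R S f F \<longleftrightarrow> F 0 = f \<and> (\<forall>k. syz_lift C R k S k (F k) (F (Suc k)))"

definition lifts ::
  "('o, 'm) abcat \<Rightarrow> ('o, 'm) resolution \<Rightarrow> ('o, 'm) resolution \<Rightarrow> 'm \<Rightarrow> nat \<Rightarrow> 'm" where
  "lifts C R S f = (SOME F. lift_sequence C R S f F)"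

text \<open>The data produced by the Horseshoe Lemma for a short exact sequence \<open>(i, p)\<close> and given
  resolutions \<open>R\<close> of \<open>Dom i\<close> and \<open>S\<close> of \<open>Cod p\<close>: a resolution \<open>Mid\<close> of the middle term, the short
  exact sequences \<open>(Pin k, Pout k)\<close> of projectives and \<open>(Sin k, Sout k)\<close> of syzygies.\<close>

record ('o, 'm) horseshoe =
  Mid :: "('o, 'm) resolution"
  Pin :: "nat \<Rightarrow> 'm"
  Pout :: "nat \<Rightarrow> 'm"
  Sin :: "nat \<Rightarrow> 'm"
  Sout :: "nat \<Rightarrow> 'm"

definition is_horseshoe ::
  "('o, 'm) abcat \<Rightarrow> ('o, 'm) resolution \<Rightarrow> ('o, 'm) resolution \<Rightarrow> 'm \<Rightarrow> 'm \<Rightarrow>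
    ('o, 'm) horseshoe \<Rightarrow> bool" where
  "is_horseshoe C R S i p H \<longleftrightarrow>
     proj_resolution C (Cod C i) (Mid H) \<and> Sin H 0 = i \<and> Sout H 0 = p \<and>
     (\<forall>k. Pin H k \<in> Hom C (Pr R k) (Pr (Mid H) k) \<and> Pout H k \<in> Hom C (Pr (Mid H) k) (Pr S k) \<and>
          Sin H k \<in> Hom C (Syz R k) (Syz (Mid H) k) \<and> Sout H k \<in> Hom C (Syz (Mid H) k) (Syz S k) \<and>
          short_exact C (Pin H k) (Pout H k) \<and> short_exact C (Sin H k) (Sout H k) \<and>
          prj (Mid H) k \<cdot>\<^bsub>C\<^esub> Pin H k = Sin H k \<cdot>\<^bsub>C\<^esub> prj R k \<and>
          prj S k \<cdot>\<^bsub>C\<^esub> Pout H k = Sout H k \<cdot>\<^bsub>C\<^esub> prj (Mid H) k \<and>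
          inc (Mid H) k \<cdot>\<^bsub>C\<^esub> Sin H (Suc k) = Pin H k \<cdot>\<^bsub>C\<^esub> inc R k \<and>
          inc S k \<cdot>\<^bsub>C\<^esub> Sout H (Suc k) = Pout H k \<cdot>\<^bsub>C\<^esub> inc (Mid H) k)"


section \<open>Maps on classes, signs, sequential direct limits\<close>

text \<open>If every representative \<open>x\<close> of the class \<open>X\<close> is assigned classes by \<open>r x\<close>, all of them equal to
  one class \<open>Y\<close>, then \<open>class_map r X = Y\<close>. This renders "the class of \<open>x\<close> is sent to the class of
  ..." without choosing representatives or lifts. If the assignment is not well defined, the
  value is in general not a class.\<close>

definition class_map :: "('a \<Rightarrow> 'b set \<Rightarrow> bool) \<Rightarrow> 'a set \<Rightarrow> 'b set" where
  "class_map r X = \<Union>{Y. \<exists>x \<in> X. r x Y}"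

text \<open>\<open>(-1)\<^sup>k\<close> times \<open>x\<close>.\<close>

definition signed :: "'a monoid \<Rightarrow> nat \<Rightarrow> 'a \<Rightarrow> 'a" where
  "signed G k x = (if even k then x else inv\<^bsub>G\<^esub> x)"

text \<open>Direct limit of \<open>(G k)\<close>, \<open>k \<in> I\<close>, along \<open>t k : G k \<rightarrow> G (k+1)\<close>, for an upward closed set \<open>I\<close>
  of natural numbers.\<close>

fun trans_map :: "(nat \<Rightarrow> 'a \<Rightarrow> 'a) \<Rightarrow> nat \<Rightarrow> nat \<Rightarrow> 'a \<Rightarrow> 'a" where
  "trans_map t k 0 a = a"
| "trans_map t k (Suc j) a = t (k + j) (trans_map t k j a)"

definition dirlim_rel ::
  "nat set \<Rightarrow> (nat \<Rightarrow> 'a monoid) \<Rightarrow> (nat \<Rightarrow> 'a \<Rightarrow> 'a) \<Rightarrow> ((nat \<times> 'a) \<times> (nat \<times> 'a)) set" where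
  "dirlim_rel I G t = {((k, a), (l, b)). k \<in> I \<and> l \<in> I \<and> a \<in> carrier (G k) \<and> b \<in> carrier (G l) \<and>
     (\<exists>j j'. k + j = l + j' \<and> trans_map t k j a = trans_map t l j' b)}"

definition dirlim ::
  "nat set \<Rightarrow> (nat \<Rightarrow> 'a monoid) \<Rightarrow> (nat \<Rightarrow> 'a \<Rightarrow> 'a) \<Rightarrow> (nat \<times> 'a) set monoid" where
  "dirlim I G t =
     \<lparr>carrier = (SIGMA k:I. carrier (G k)) // dirlim_rel I G t,
      mult = (\<lambda>X Y. \<Union>{dirlim_rel I G t `` {(k, a \<otimes>\<^bsub>G k\<^esub> b)} | k a b. (k, a) \<in> X \<and> (k, b) \<in> Y}),
      one = \<Union>{dirlim_rel I G t `` {(k, \<one>\<^bsub>G k\<^esub>)} | k. k \<in> I}\<rparr>"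

text \<open>The direct limit of maps \<open>\<phi> k\<close> defined for \<open>k\<close> in a cofinal set \<open>J\<close>; \<open>r\<close> is the relation
  defining the target.\<close>

definition dirlim_map ::
  "nat set \<Rightarrow> ((nat \<times> 'b) \<times> (nat \<times> 'b)) set \<Rightarrow> (nat \<Rightarrow> 'a \<Rightarrow> 'b) \<Rightarrow>
    (nat \<times> 'a) set \<Rightarrow> (nat \<times> 'b) set" where
  "dirlim_map J r \<phi> X = \<Union>{r `` {(k, \<phi> k a)} | k a. k \<in> J \<and> (k, a) \<in> X}"


section \<open>Ext\<close>

text \<open>\<open>R\<close> is a projective resolution of the first argument.\<close>

definition cocycles :: "('o, 'm) abcat \<Rightarrow> ('o, 'm) resolution \<Rightarrow> nat \<Rightarrow> 'o \<Rightarrow> 'm set" where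
  "cocycles C R n Y = {f \<in> Hom C (Pr R n) Y. f \<cdot>\<^bsub>C\<^esub> diff C R n = Nul C (Pr R (Suc n)) Y}"

fun coboundaries :: "('o, 'm) abcat \<Rightarrow> ('o, 'm) resolution \<Rightarrow> nat \<Rightarrow> 'o \<Rightarrow> 'm set" where
  "coboundaries C R 0 Y = {Nul C (Pr R 0) Y}"
| "coboundaries C R (Suc n) Y = (\<lambda>g. g \<cdot>\<^bsub>C\<^esub> diff C R n) ` Hom C (Pr R n) Y"

definition cocycle_group :: "('o, 'm) abcat \<Rightarrow> ('o, 'm) resolution \<Rightarrow> nat \<Rightarrow> 'o \<Rightarrow> 'm monoid" where
  "cocycle_group C R n Y = (hom_group C (Pr R n) Y)\<lparr>carrier := cocycles C R n Y\<rparr>"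

definition ext_class :: "('o, 'm) abcat \<Rightarrow> ('o, 'm) resolution \<Rightarrow> nat \<Rightarrow> 'o \<Rightarrow> 'm \<Rightarrow> 'm set" where
  "ext_class C R n Y f = coboundaries C R n Y #>\<^bsub>cocycle_group C R n Y\<^esub> f"

definition ext_group :: "('o, 'm) abcat \<Rightarrow> ('o, 'm) resolution \<Rightarrow> int \<Rightarrow> 'o \<Rightarrow> 'm set monoid" where
  "ext_group C R n Y =
     (if n < 0 then singleton_group {}
      else cocycle_group C R (nat n) Y Mod coboundaries C R (nat n) Y)"

definition ext_map :: "('o, 'm) abcat \<Rightarrow> ('o, 'm) resolution \<Rightarrow> int \<Rightarrow> 'm \<Rightarrow> 'm set \<Rightarrow> 'm set" where
  "ext_map C R n f X =
     (if n < 0 then \<one>\<^bsub>ext_group C R n (Cod C f)\<^esub>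
      else class_map (\<lambda>x Y. Y = ext_class C R (nat n) (Cod C f) (f \<cdot>\<^bsub>C\<^esub> x)) X)"

text \<open>The connecting homomorphism of the Snake Lemma: lift \<open>x : Pr R n \<rightarrow> Cod p\<close> along \<open>p\<close> to \<open>g\<close> and
  factor \<open>g \<cdot> \<partial>\<close> through \<open>i\<close>.\<close>

definition ext_con ::
  "('o, 'm) abcat \<Rightarrow> ('o, 'm) resolution \<Rightarrow> int \<Rightarrow> 'm \<Rightarrow> 'm \<Rightarrow> 'm set \<Rightarrow> 'm set" where
  "ext_con C R n i p X =
     (if n < 0 then \<one>\<^bsub>ext_group C R (n + 1) (Dom C i)\<^esub>
      else class_map (\<lambda>x Y. \<exists>g \<in> Hom C (Pr R (nat n)) (Cod C i).
                         \<exists>h \<in> Hom C (Pr R (Suc (nat n))) (Dom C i).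
             p \<cdot>\<^bsub>C\<^esub> g = x \<and> i \<cdot>\<^bsub>C\<^esub> h = g \<cdot>\<^bsub>C\<^esub> diff C R (nat n) \<and>
             Y = ext_class C R (Suc (nat n)) (Dom C i) h) X)"

definition Ext_functor :: "('o, 'm) abcat \<Rightarrow> ('o, 'm) resolution \<Rightarrow> ('o, 'm, 'm set) cohfun" where
  "Ext_functor C R = \<lparr>Fobj = ext_group C R, Fmor = ext_map C R, Fcon = ext_con C R\<rparr>"


section \<open>The resolution construction\<close>

text \<open>From here on \<open>res\<close> assigns a projective resolution to every object, and \<open>hs i p\<close> is a
  horseshoe for the short exact sequence \<open>(i, p)\<close> over the assigned resolutions of its outer terms.
  Hence the source and target of the connecting homomorphisms below are literally the limits
  formed with the assigned resolutions, and no identification along lifts of identities is needed;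
  the resolution \<open>Mid (hs i p)\<close> of the middle term need not be the assigned one.\<close>

definition hatext_stage ::
  "('o, 'm) abcat \<Rightarrow> ('o \<Rightarrow> ('o, 'm) resolution) \<Rightarrow> 'o \<Rightarrow> int \<Rightarrow> 'o \<Rightarrow> nat \<Rightarrow> 'm set monoid" where
  "hatext_stage C res A n B k = ext_group C (res A) (n + int k) (Syz (res B) k)"

definition hatext_trans ::
  "('o, 'm) abcat \<Rightarrow> ('o \<Rightarrow> ('o, 'm) resolution) \<Rightarrow> 'o \<Rightarrow> int \<Rightarrow> 'o \<Rightarrow> nat \<Rightarrow> 'm set \<Rightarrow> 'm set" where
  "hatext_trans C res A n B k =
     ext_con C (res A) (n + int k) (inc (res B) k) (prj (res B) k)"

definition hatext_rel ::
  "('o, 'm) abcat \<Rightarrow> ('o \<Rightarrow> ('o, 'm) resolution) \<Rightarrow> 'o \<Rightarrow> int \<Rightarrow> 'o \<Rightarrow>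
    ((nat \<times> 'm set) \<times> (nat \<times> 'm set)) set" where
  "hatext_rel C res A n B =
     dirlim_rel UNIV (hatext_stage C res A n B) (hatext_trans C res A n B)"

definition hatext_group ::
  "('o, 'm) abcat \<Rightarrow> ('o \<Rightarrow> ('o, 'm) resolution) \<Rightarrow> 'o \<Rightarrow> int \<Rightarrow> 'o \<Rightarrow> (nat \<times> 'm set) set monoid" where
  "hatext_group C res A n B =
     dirlim UNIV (hatext_stage C res A n B) (hatext_trans C res A n B)"

definition hatext_map ::
  "('o, 'm) abcat \<Rightarrow> ('o \<Rightarrow> ('o, 'm) resolution) \<Rightarrow> 'o \<Rightarrow> int \<Rightarrow> 'm \<Rightarrow>
    (nat \<times> 'm set) set \<Rightarrow> (nat \<times> 'm set) set" where
  "hatext_map C res A n f =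
     dirlim_map UNIV (hatext_rel C res A n (Cod C f))
       (\<lambda>k. ext_map C (res A) (n + int k) (lifts C (res (Dom C f)) (res (Cod C f)) f k))"

definition hatext_con ::
  "('o, 'm) abcat \<Rightarrow> ('o \<Rightarrow> ('o, 'm) resolution) \<Rightarrow> ('m \<Rightarrow> 'm \<Rightarrow> ('o, 'm) horseshoe) \<Rightarrow> 'o \<Rightarrow> int \<Rightarrow>
    'm \<Rightarrow> 'm \<Rightarrow> (nat \<times> 'm set) set \<Rightarrow> (nat \<times> 'm set) set" where
  "hatext_con C res hs A n i p =
     dirlim_map UNIV (hatext_rel C res A (n + 1) (Dom C i))
       (\<lambda>k x. signed (hatext_stage C res A (n + 1) (Dom C i) k) k
                (ext_con C (res A) (n + int k) (Sin (hs i p) k) (Sout (hs i p) k) x))"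

definition HatExt_functor ::
  "('o, 'm) abcat \<Rightarrow> ('o \<Rightarrow> ('o, 'm) resolution) \<Rightarrow> ('m \<Rightarrow> 'm \<Rightarrow> ('o, 'm) horseshoe) \<Rightarrow> 'o \<Rightarrow>
    ('o, 'm, (nat \<times> 'm set) set) cohfun" where
  "HatExt_functor C res hs A =
     \<lparr>Fobj = hatext_group C res A, Fmor = hatext_map C res A, Fcon = hatext_con C res hs A\<rparr>"

definition canonical_map ::
  "('o, 'm) abcat \<Rightarrow> ('o \<Rightarrow> ('o, 'm) resolution) \<Rightarrow> 'o \<Rightarrow> int \<Rightarrow> 'o \<Rightarrow>
    'm set \<Rightarrow> (nat \<times> 'm set) set" where
  "canonical_map C res A n B x = hatext_rel C res A n B `` {(0, x)}"


section \<open>The naive construction\<close>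

definition factor_proj :: "('o, 'm) abcat \<Rightarrow> 'o \<Rightarrow> 'o \<Rightarrow> 'm set" where
  "factor_proj C X Y =
     {f. \<exists>P. projective C P \<and> (\<exists>g \<in> Hom C X P. \<exists>h \<in> Hom C P Y. f = h \<cdot>\<^bsub>C\<^esub> g)}"

definition stable_hom :: "('o, 'm) abcat \<Rightarrow> 'o \<Rightarrow> 'o \<Rightarrow> 'm set monoid" where
  "stable_hom C X Y = hom_group C X Y Mod factor_proj C X Y"

definition stable_class :: "('o, 'm) abcat \<Rightarrow> 'o \<Rightarrow> 'o \<Rightarrow> 'm \<Rightarrow> 'm set" where
  "stable_class C X Y f = factor_proj C X Y #>\<^bsub>hom_group C X Y\<^esub> f"

definition bc_stage ::
  "('o, 'm) abcat \<Rightarrow> ('o \<Rightarrow> ('o, 'm) resolution) \<Rightarrow> 'o \<Rightarrow> int \<Rightarrow> 'o \<Rightarrow> nat \<Rightarrow> 'm set monoid" where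
  "bc_stage C res A n B k = stable_hom C (Syz (res A) (nat (n + int k))) (Syz (res B) k)"

definition bc_trans ::
  "('o, 'm) abcat \<Rightarrow> ('o \<Rightarrow> ('o, 'm) resolution) \<Rightarrow> 'o \<Rightarrow> int \<Rightarrow> 'o \<Rightarrow> nat \<Rightarrow> 'm set \<Rightarrow> 'm set" where
  "bc_trans C res A n B k =
     class_map (\<lambda>f Y. \<exists>h. syz_lift C (res A) (nat (n + int k)) (res B) k f h \<and>
       Y = stable_class C (Syz (res A) (Suc (nat (n + int k)))) (Syz (res B) (Suc k)) h)"

definition bc_rel ::
  "('o, 'm) abcat \<Rightarrow> ('o \<Rightarrow> ('o, 'm) resolution) \<Rightarrow> 'o \<Rightarrow> int \<Rightarrow> 'o \<Rightarrow>
    ((nat \<times> 'm set) \<times> (nat \<times> 'm set)) set" where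
  "bc_rel C res A n B =
     dirlim_rel {k. n + int k \<ge> 0} (bc_stage C res A n B) (bc_trans C res A n B)"

definition bc_group ::
  "('o, 'm) abcat \<Rightarrow> ('o \<Rightarrow> ('o, 'm) resolution) \<Rightarrow> 'o \<Rightarrow> int \<Rightarrow> 'o \<Rightarrow> (nat \<times> 'm set) set monoid" where
  "bc_group C res A n B =
     dirlim {k. n + int k \<ge> 0} (bc_stage C res A n B) (bc_trans C res A n B)"

definition bc_map ::
  "('o, 'm) abcat \<Rightarrow> ('o \<Rightarrow> ('o, 'm) resolution) \<Rightarrow> 'o \<Rightarrow> int \<Rightarrow> 'm \<Rightarrow>
    (nat \<times> 'm set) set \<Rightarrow> (nat \<times> 'm set) set" where
  "bc_map C res A n f =
     dirlim_map {k. n + int k \<ge> 0} (bc_rel C res A n (Cod C f))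
       (\<lambda>k. class_map (\<lambda>g Y.
          Y = stable_class C (Syz (res A) (nat (n + int k))) (Syz (res (Cod C f)) k)
                (lifts C (res (Dom C f)) (res (Cod C f)) f k \<cdot>\<^bsub>C\<^esub> g)))"

text \<open>\<open>h : Syz S (k+1) \<rightarrow> Syz R k\<close> is induced by a lift \<open>l : Pr S k \<rightarrow> Syz (Mid H) k\<close> of the identity
  of \<open>Syz S k\<close>.\<close>

definition con_lift ::
  "('o, 'm) abcat \<Rightarrow> ('o, 'm) resolution \<Rightarrow> ('o, 'm) resolution \<Rightarrow> ('o, 'm) horseshoe \<Rightarrow> nat \<Rightarrow>
    'm \<Rightarrow> bool" where
  "con_lift C R S H k h \<longleftrightarrow> h \<in> Hom C (Syz S (Suc k)) (Syz R k) \<and>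
     (\<exists>l \<in> Hom C (Pr S k) (Syz (Mid H) k).
        Sout H k \<cdot>\<^bsub>C\<^esub> l = Idt C (Syz S k) \<cdot>\<^bsub>C\<^esub> prj S k \<and> Sin H k \<cdot>\<^bsub>C\<^esub> h = l \<cdot>\<^bsub>C\<^esub> inc S k)"

text \<open>The map \<open>\<tau>\<close> from stage \<open>[Syz (res A) m, Syz (res D) k]\<close> to stage
  \<open>[Syz (res A) (m+1), Syz (res B) k]\<close>, for \<open>B = Dom i\<close> and \<open>D = Cod p\<close>.\<close>

definition bc_con_stage ::
  "('o, 'm) abcat \<Rightarrow> ('o \<Rightarrow> ('o, 'm) resolution) \<Rightarrow> ('m \<Rightarrow> 'm \<Rightarrow> ('o, 'm) horseshoe) \<Rightarrow> 'o \<Rightarrow>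
    'm \<Rightarrow> 'm \<Rightarrow> nat \<Rightarrow> nat \<Rightarrow> 'm set \<Rightarrow> 'm set" where
  "bc_con_stage C res hs A i p m k =
     class_map (\<lambda>f Y. \<exists>g h.
       syz_lift C (res A) m (res (Cod C p)) k f g \<and>
       con_lift C (res (Dom C i)) (res (Cod C p)) (hs i p) k h \<and>
       Y = stable_class C (Syz (res A) (Suc m)) (Syz (res (Dom C i)) k) (h \<cdot>\<^bsub>C\<^esub> g))"

definition bc_con ::
  "('o, 'm) abcat \<Rightarrow> ('o \<Rightarrow> ('o, 'm) resolution) \<Rightarrow> ('m \<Rightarrow> 'm \<Rightarrow> ('o, 'm) horseshoe) \<Rightarrow> 'o \<Rightarrow> int \<Rightarrow>
    'm \<Rightarrow> 'm \<Rightarrow> (nat \<times> 'm set) set \<Rightarrow> (nat \<times> 'm set) set" where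
  "bc_con C res hs A n i p =
     dirlim_map {k. n + int k \<ge> 1} (bc_rel C res A (n + 1) (Dom C i))
       (\<lambda>k x. signed (bc_stage C res A (n + 1) (Dom C i) k) k
                (bc_con_stage C res hs A i p (nat (n + int k)) k x))"

definition BC_functor ::
  "('o, 'm) abcat \<Rightarrow> ('o \<Rightarrow> ('o, 'm) resolution) \<Rightarrow> ('m \<Rightarrow> 'm \<Rightarrow> ('o, 'm) horseshoe) \<Rightarrow> 'o \<Rightarrow>
    ('o, 'm, (nat \<times> 'm set) set) cohfun" where
  "BC_functor C res hs A =
     \<lparr>Fobj = bc_group C res A, Fmor = bc_map C res A, Fcon = bc_con C res hs A\<rparr>"


section \<open>The comparison map\<close>

text \<open>\<open>R\<close> is a resolution of the first argument and \<open>m \<ge> 1\<close>.\<close>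

definition beta_stage ::
  "('o, 'm) abcat \<Rightarrow> ('o, 'm) resolution \<Rightarrow> nat \<Rightarrow> 'o \<Rightarrow> 'm set \<Rightarrow> 'm set" where
  "beta_stage C R m Y =
     class_map (\<lambda>f Z. \<exists>f' \<in> Hom C (Syz R m) Y.
       f = f' \<cdot>\<^bsub>C\<^esub> prj R m \<and> Z = stable_class C (Syz R m) Y f')"

definition beta_map ::
  "('o, 'm) abcat \<Rightarrow> ('o \<Rightarrow> ('o, 'm) resolution) \<Rightarrow> 'o \<Rightarrow> int \<Rightarrow> 'o \<Rightarrow>
    (nat \<times> 'm set) set \<Rightarrow> (nat \<times> 'm set) set" where
  "beta_map C res A n B =
     dirlim_map {k. n + int k \<ge> 1} (bc_rel C res A n B)
       (\<lambda>k. beta_stage C (res A) (nat (n + int k)) (Syz (res B) k))"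

end

theory Submission
  imports Defs
begin

text \<open>
  In the stable category, passing to syzygies is a functor \<open>\<Omega>\<close>, and a sequence of arrows
  \<open>F\<^sub>k : \<Omega>\<^bsup>k+a\<^esup>B \<rightarrow> \<Omega>\<^sup>kD\<close> with \<open>F\<^bsub>k+1\<^esub> = \<Omega>F\<^sub>k\<close> acts on \<open>BC(A,-)\<close> and is determined by
  \<open>F\<^sub>0\<close>. The arrows \<open>h\<^sub>k : \<Omega>\<^bsup>k+1\<^esup>D \<rightarrow> \<Omega>\<^sup>kB\<close> attached to a short exact sequence satisfy
  \<open>h\<^bsub>k+1\<^esub> = -\<Omega>h\<^sub>k\<close>, so \<open>(-1)\<^sup>kh\<^sub>k\<close> is such a sequence, and naturality of \<open>\<tau>\<close> only has to be
  checked for \<open>h\<^sub>0\<close>. Exactness of \<open>BC(A,-)\<close> follows from the exactness of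
  \<open>[X,\<Omega>C] \<rightarrow> [X,\<Omega>D] \<rightarrow> [X,B] \<rightarrow> [X,C] \<rightarrow> [X,D]\<close> at every stage.

  An element of \<open>Ext\<^sup>m(A,Y)\<close> is represented by an arrow \<open>\<Omega>\<^sup>mA \<rightarrow> Y\<close>, and the transition maps of the
  resolution construction send \<open>f\<close> to \<open>\<Omega>f\<close>. Thus \<open>\<beta>\<close> is surjective at every stage \<open>m \<ge> 1\<close>, and an
  element of its kernel dies under a single transition. Hence \<open>\<beta>\<close> is bijective, and the
  structure of a cohomological functor is carried over from \<open>BC(A,-)\<close> to the resolution construction.

  A cohomological functor that vanishes on projectives turns connecting homomorphisms of short exact
  sequences with projective middle term into bijections. Finitely many of these move every element of
  \<open>BC\<^sup>n(A,B)\<close> into the image of \<open>Ext\<close> and annihilate every element of the kernel of \<open>Ext \<rightarrow> BC\<close>,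
  which yields the universal property.
\<close>

section \<open>Arithmetic of arrows\<close>

text \<open>Three obstacles shape the proof. Lifts are unique only up to arrows through projectives,
  so every identity is one of stable equality, and \<open>slift\<close> asks a family of arrows
  between syzygies to be compatible with lifting only up to stable equality. This absorbs the
  choices made by \<open>lifts\<close>, by the horseshoes and by the lifts of identities. Secondly,
  a horseshoe resolves the middle term in its own way, and the horseshoes of two related short exact
  sequences are not related to each other. Hence naturality is accessible only in degree 0, and
  exactness is proved for the horseshoe and then carried to the assigned resolution by lifts of the
  identity. Thirdly, triviality in a direct limit shows only at some later stage, so before
  stagewise exactness applies, a class with trivial image needs a representative with stably null
  image (\<open>bc_class_slift_one\<close>). The sign has one source: the lift of the identity in
  the next degree is, up to corrections, a difference of two arrows, and the restriction to the
  following syzygy kills the first of them.\<close>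

context abelian_category
begin

abbreviation add (infixl "\<boxplus>" 65) where "f \<boxplus> g \<equiv> Plus C f g"

text \<open>The Hom group is read off from \<open>f\<close>, so that \<open>neg\<close> needs no
  objects as arguments.\<close>

definition neg :: "'m \<Rightarrow> 'm" where
  "neg f = inv\<^bsub>hom_group C (Dom C f) (Cod C f)\<^esub> f"

abbreviation sub (infixl "\<boxminus>" 65) where "f \<boxminus> g \<equiv> f \<boxplus> neg g"

lemma Hom_iff: "f \<in> Hom C X Y \<longleftrightarrow> f \<in> Arr C \<and> Dom C f = X \<and> Cod C f = Y"
  by (simp add: Hom_def)

lemma HomI: "f \<in> Arr C \<Longrightarrow> f \<in> Hom C (Dom C f) (Cod C f)"
  by (simp add: Hom_def)

lemma Hom_objs: "f \<in> Hom C X Y \<Longrightarrow> X \<in> Obj C" "f \<in> Hom C X Y \<Longrightarrow> Y \<in> Obj C"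
  using dom_obj cod_obj by (auto simp: Hom_iff)

lemma hom_group_simps [simp]:
  "carrier (hom_group C X Y) = Hom C X Y"
  "x \<otimes>\<^bsub>hom_group C X Y\<^esub> y = x \<boxplus> y"
  "\<one>\<^bsub>hom_group C X Y\<^esub> = Nul C X Y"
  by (simp_all add: hom_group_def)

lemma typing_comp:
  assumes "f \<in> Arr C" "g \<in> Arr C" "Dom C g = Cod C f"
  shows "g \<cdot> f \<in> Arr C" "Dom C (g \<cdot> f) = Dom C f" "Cod C (g \<cdot> f) = Cod C g"
  using comp[of f "Dom C f" "Cod C f" g "Cod C g"] assms by (auto simp: Hom_iff)

lemma typing_Idt:
  assumes "X \<in> Obj C"
  shows "Idt C X \<in> Arr C" "Dom C (Idt C X) = X" "Cod C (Idt C X) = X"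
  using ident[OF assms] by (auto simp: Hom_iff)

lemma typing_add:
  assumes "f \<in> Arr C" "g \<in> Arr C" "Dom C g = Dom C f" "Cod C g = Cod C f"
  shows "f \<boxplus> g \<in> Arr C" "Dom C (f \<boxplus> g) = Dom C f" "Cod C (f \<boxplus> g) = Cod C f"
proof -
  interpret comm_group "hom_group C (Dom C f) (Cod C f)"
    using assms dom_obj cod_obj hom_comm_group by blast
  show "f \<boxplus> g \<in> Arr C" "Dom C (f \<boxplus> g) = Dom C f" "Cod C (f \<boxplus> g) = Cod C f"
    using m_closed[of f g] assms by (auto simp: Hom_iff)
qed

lemma typing_Nul:
  assumes "X \<in> Obj C" "Y \<in> Obj C"
  shows "Nul C X Y \<in> Arr C" "Dom C (Nul C X Y) = X" "Cod C (Nul C X Y) = Y"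
proof -
  interpret comm_group "hom_group C X Y"
    using assms hom_comm_group by blast
  show "Nul C X Y \<in> Arr C" "Dom C (Nul C X Y) = X" "Cod C (Nul C X Y) = Y"
    using one_closed by (auto simp: Hom_iff)
qed

lemma typing_neg:
  assumes "f \<in> Arr C"
  shows "neg f \<in> Arr C" "Dom C (neg f) = Dom C f" "Cod C (neg f) = Cod C f"
proof -
  interpret comm_group "hom_group C (Dom C f) (Cod C f)"
    using assms dom_obj cod_obj hom_comm_group by blast
  show "neg f \<in> Arr C" "Dom C (neg f) = Dom C f" "Cod C (neg f) = Cod C f"
    using inv_closed[of f] assms unfolding neg_def by (auto simp: Hom_iff)
qed

lemmas typing = typing_comp typing_Idt typing_add typing_Nul typing_neg dom_obj cod_obj

lemma comp_assoc':
  "\<lbrakk>f \<in> Arr C; g \<in> Arr C; h \<in> Arr C; Dom C g = Cod C f; Dom C h = Cod C g\<rbrakk>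
   \<Longrightarrow> (h \<cdot> g) \<cdot> f = h \<cdot> (g \<cdot> f)"
  using comp_assoc[of f "Dom C f" "Cod C f" g "Cod C g" h "Cod C h"] by (simp add: Hom_iff)

lemma comp_reduce:
  "\<lbrakk>h \<cdot> g = k; f \<in> Arr C; g \<in> Arr C; h \<in> Arr C; Dom C g = Cod C f; Dom C h = Cod C g\<rbrakk>
   \<Longrightarrow> h \<cdot> (g \<cdot> f) = k \<cdot> f"
  using comp_assoc' by metis

lemma comp_Idt: "f \<in> Arr C \<Longrightarrow> Dom C f = X \<Longrightarrow> f \<cdot> Idt C X = f"
  using comp_ident by (auto simp: Hom_iff)

lemma Idt_comp: "f \<in> Arr C \<Longrightarrow> Cod C f = X \<Longrightarrow> Idt C X \<cdot> f = f"
  using ident_comp by (auto simp: Hom_iff)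

lemma comp_add:
  "\<lbrakk>f \<in> Arr C; g \<in> Arr C; h \<in> Arr C; Dom C g = Dom C f; Cod C g = Cod C f; Dom C h = Cod C f\<rbrakk>
   \<Longrightarrow> h \<cdot> (f \<boxplus> g) = h \<cdot> f \<boxplus> h \<cdot> g"
  using comp_plus_right[of f "Dom C f" "Cod C f" g h "Cod C h"] by (simp add: Hom_iff)

lemma add_comp:
  "\<lbrakk>f \<in> Arr C; g \<in> Arr C; h \<in> Arr C; Dom C g = Dom C f; Cod C g = Cod C f; Dom C f = Cod C h\<rbrakk>
   \<Longrightarrow> (f \<boxplus> g) \<cdot> h = f \<cdot> h \<boxplus> g \<cdot> h"
  using comp_plus_left[of h "Dom C h" "Cod C h" f "Cod C f" g] by (simp add: Hom_iff)

lemma add_assoc: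
  assumes "f \<in> Arr C" "g \<in> Arr C" "h \<in> Arr C" "Dom C g = Dom C f" "Cod C g = Cod C f"
    "Dom C h = Dom C f" "Cod C h = Cod C f"
  shows "f \<boxplus> g \<boxplus> h = f \<boxplus> (g \<boxplus> h)"
proof -
  interpret comm_group "hom_group C (Dom C f) (Cod C f)"
    using assms dom_obj cod_obj hom_comm_group by blast
  show ?thesis using m_assoc[of f g h] assms by (simp add: Hom_iff)
qed

lemma add_comm:
  assumes "f \<in> Arr C" "g \<in> Arr C" "Dom C g = Dom C f" "Cod C g = Cod C f"
  shows "f \<boxplus> g = g \<boxplus> f"
proof -
  interpret comm_group "hom_group C (Dom C f) (Cod C f)"
    using assms dom_obj cod_obj hom_comm_group by blast
  show ?thesis using m_comm[of f g] assms by (simp add: Hom_iff)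
qed

lemma add_left_comm:
  assumes "f \<in> Arr C" "g \<in> Arr C" "h \<in> Arr C" "Dom C g = Dom C f" "Cod C g = Cod C f"
    "Dom C h = Dom C f" "Cod C h = Cod C f"
  shows "g \<boxplus> (f \<boxplus> h) = f \<boxplus> (g \<boxplus> h)"
proof -
  interpret comm_group "hom_group C (Dom C f) (Cod C f)"
    using assms dom_obj cod_obj hom_comm_group by blast
  show ?thesis using m_lcomm[of g f h] assms by (simp add: Hom_iff)
qed

lemma add_Nul:
  assumes "f \<in> Arr C" "Dom C f = X" "Cod C f = Y"
  shows "f \<boxplus> Nul C X Y = f" "Nul C X Y \<boxplus> f = f"
proof -
  interpret comm_group "hom_group C (Dom C f) (Cod C f)"
    using assms dom_obj cod_obj hom_comm_group by blast
  show "f \<boxplus> Nul C X Y = f" "Nul C X Y \<boxplus> f = f"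
    using r_one[of f] l_one[of f] assms by (auto simp: Hom_iff)
qed

lemma sub_self:
  assumes "f \<in> Arr C"
  shows "f \<boxminus> f = Nul C (Dom C f) (Cod C f)" "neg f \<boxplus> f = Nul C (Dom C f) (Cod C f)"
proof -
  interpret comm_group "hom_group C (Dom C f) (Cod C f)"
    using assms dom_obj cod_obj hom_comm_group by blast
  show "f \<boxminus> f = Nul C (Dom C f) (Cod C f)" "neg f \<boxplus> f = Nul C (Dom C f) (Cod C f)"
    using r_inv[of f] l_inv[of f] assms by (auto simp: Hom_iff neg_def)
qed

lemma neg_unique:
  assumes "f \<in> Arr C" "g \<in> Arr C" "Dom C g = Dom C f" "Cod C g = Cod C f"
    "f \<boxplus> g = Nul C (Dom C f) (Cod C f)"
  shows "neg f = g"
proof -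
  interpret comm_group "hom_group C (Dom C f) (Cod C f)"
    using assms dom_obj cod_obj hom_comm_group by blast
  show ?thesis unfolding neg_def
    by (rule inv_equality) (use assms add_comm in \<open>auto simp: Hom_iff\<close>)
qed

lemma add_cancel:
  assumes "f \<in> Arr C" "g \<in> Arr C" "Dom C g = Dom C f" "Cod C g = Cod C f"
  shows "f \<boxplus> (neg f \<boxplus> g) = g" "neg f \<boxplus> (f \<boxplus> g) = g"
  using assms by (simp_all flip: add_assoc add: typing sub_self add_Nul)

lemma neg_add:
  assumes "f \<in> Arr C" "g \<in> Arr C" "Dom C g = Dom C f" "Cod C g = Cod C f"
  shows "neg (f \<boxplus> g) = neg f \<boxplus> neg g"
proof (rule neg_unique)
  have "f \<boxplus> g \<boxplus> (neg f \<boxminus> g) = f \<boxplus> (g \<boxplus> (neg f \<boxminus> g))"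
    using assms by (simp add: typing add_assoc)
  also have "g \<boxplus> (neg f \<boxminus> g) = neg f \<boxplus> (g \<boxminus> g)"
    by (rule add_left_comm) (use assms in \<open>simp_all add: typing\<close>)
  finally show "f \<boxplus> g \<boxplus> (neg f \<boxminus> g) = Nul C (Dom C (f \<boxplus> g)) (Cod C (f \<boxplus> g))"
    using assms by (simp add: typing add_cancel sub_self)
qed (use assms in \<open>simp_all add: typing\<close>)

lemma neg_neg: "f \<in> Arr C \<Longrightarrow> neg (neg f) = f"
  by (rule neg_unique) (simp_all add: typing sub_self)

lemma neg_Nul: "X \<in> Obj C \<Longrightarrow> Y \<in> Obj C \<Longrightarrow> neg (Nul C X Y) = Nul C X Y"
  by (rule neg_unique) (simp_all add: typing add_Nul)

lemma comp_Nul: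
  assumes "f \<in> Arr C" "X \<in> Obj C" "Dom C f = Y"
  shows "f \<cdot> Nul C X Y = Nul C X (Cod C f)"
proof -
  have Y: "Y \<in> Obj C" using assms dom_obj by auto
  let ?z = "Nul C X Y"
  \<comment> \<open>The composite is idempotent in its Hom group, hence neutral.\<close>
  have "f \<cdot> ?z \<boxplus> f \<cdot> ?z = f \<cdot> ?z"
    using comp_add[of ?z ?z f] assms Y by (simp add: typing add_Nul)
  then have "f \<cdot> ?z \<boxplus> f \<cdot> ?z \<boxminus> f \<cdot> ?z = f \<cdot> ?z \<boxminus> f \<cdot> ?z" by simp
  then show ?thesis using assms Y by (simp add: typing add_assoc sub_self add_Nul)
qed

lemma Nul_comp:
  assumes "f \<in> Arr C" "X \<in> Obj C" "Cod C f = Y"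
  shows "Nul C Y X \<cdot> f = Nul C (Dom C f) X"
proof -
  have Y: "Y \<in> Obj C" using assms cod_obj by auto
  let ?z = "Nul C Y X"
  have "?z \<cdot> f \<boxplus> ?z \<cdot> f = ?z \<cdot> f"
    using add_comp[of ?z ?z f] assms Y by (simp add: typing add_Nul)
  then have "?z \<cdot> f \<boxplus> ?z \<cdot> f \<boxminus> ?z \<cdot> f = ?z \<cdot> f \<boxminus> ?z \<cdot> f" by simp
  then show ?thesis using assms Y by (simp add: typing add_assoc sub_self add_Nul)
qed

lemma comp_neg:
  "\<lbrakk>f \<in> Arr C; g \<in> Arr C; Dom C g = Cod C f\<rbrakk> \<Longrightarrow> g \<cdot> neg f = neg (g \<cdot> f)"
  by (rule neg_unique[symmetric]) (simp_all flip: comp_add add: typing sub_self comp_Nul)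

lemma neg_comp:
  "\<lbrakk>f \<in> Arr C; g \<in> Arr C; Dom C g = Cod C f\<rbrakk> \<Longrightarrow> neg g \<cdot> f = neg (g \<cdot> f)"
  by (rule neg_unique[symmetric]) (simp_all flip: add_comp add: typing sub_self Nul_comp)

text \<open>The term order used by AC rewriting need not place \<open>f\<close> next to \<open>neg f\<close>.\<close>

lemma add_cancel_gap:
  assumes "f \<in> Arr C" "x \<in> Arr C" "Dom C x = Dom C f" "Cod C x = Cod C f"
  shows "f \<boxplus> (x \<boxminus> f) = x" "neg f \<boxplus> (x \<boxplus> f) = x"
    "\<lbrakk>y \<in> Arr C; Dom C y = Dom C f; Cod C y = Cod C f\<rbrakk>
     \<Longrightarrow> f \<boxplus> (x \<boxplus> (neg f \<boxplus> y)) = x \<boxplus> y"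
    "\<lbrakk>y \<in> Arr C; Dom C y = Dom C f; Cod C y = Cod C f\<rbrakk>
     \<Longrightarrow> neg f \<boxplus> (x \<boxplus> (f \<boxplus> y)) = x \<boxplus> y"
    "\<lbrakk>y \<in> Arr C; Dom C y = Dom C f; Cod C y = Cod C f\<rbrakk>
     \<Longrightarrow> f \<boxplus> (x \<boxplus> (y \<boxminus> f)) = x \<boxplus> y"
    "\<lbrakk>y \<in> Arr C; Dom C y = Dom C f; Cod C y = Cod C f\<rbrakk>
     \<Longrightarrow> neg f \<boxplus> (x \<boxplus> (y \<boxplus> f)) = x \<boxplus> y"
  using assms
  by (simp_all add: typing add_left_comm[of x f] add_left_comm[of x "neg f"] add_left_comm[of y f]
      add_left_comm[of y "neg f"] add_comm[of x f] add_comm[of x "neg f"] add_comm[of y f]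
      add_comm[of y "neg f"] add_cancel sub_self add_Nul)

text \<open>Each typing condition on a compound arrow spawns several conditions on its parts, so that
  AC rewriting with \<open>arith\<close> is only affordable on short sums; \<open>dist\<close> distributes and cancels
  without it.\<close>

lemmas arith = typing Hom_iff comp_assoc' comp_Idt Idt_comp comp_add add_comp add_assoc add_comm
  add_left_comm add_Nul sub_self add_cancel add_cancel_gap neg_add neg_neg neg_Nul comp_Nul Nul_comp comp_neg
  neg_comp

lemmas dist = typing Hom_iff comp_assoc' comp_Idt Idt_comp comp_add add_comp add_Nul sub_self
  neg_neg neg_Nul comp_Nul Nul_comp comp_neg neg_comp simp_thms

lemma sub_eq_iff:
  assumes "f \<in> Hom C X Y" "g \<in> Hom C X Y" "h \<in> Hom C X Y"
  shows "f \<boxminus> g = h \<longleftrightarrow> f = g \<boxplus> h"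
proof
  assume "f \<boxminus> g = h"
  then have "f \<boxminus> g \<boxplus> g = h \<boxplus> g" by simp
  then show "f = g \<boxplus> h" using assms by (simp add: arith)
qed (use assms in \<open>auto simp: arith\<close>)

lemma Hom_closed:
  "\<lbrakk>f \<in> Hom C X Y; g \<in> Hom C X Y\<rbrakk> \<Longrightarrow> f \<boxplus> g \<in> Hom C X Y"
  "\<lbrakk>f \<in> Hom C X Y; g \<in> Hom C X Y\<rbrakk> \<Longrightarrow> f \<boxminus> g \<in> Hom C X Y"
  "f \<in> Hom C X Y \<Longrightarrow> neg f \<in> Hom C X Y"
  "\<lbrakk>X \<in> Obj C; Y \<in> Obj C\<rbrakk> \<Longrightarrow> Nul C X Y \<in> Hom C X Y"
  by (auto simp: arith)

lemma inv_hom_group: "f \<in> Hom C X Y \<Longrightarrow> inv\<^bsub>hom_group C X Y\<^esub> f = neg f"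
  by (auto simp: neg_def Hom_iff)

section \<open>Universal properties of short exact sequences\<close>

lemma short_exactD:
  assumes "short_exact C i p"
  shows "i \<in> Arr C" "p \<in> Arr C" "Dom C p = Cod C i" "p \<cdot> i = Nul C (Dom C i) (Cod C p)"
    "i \<in> Hom C (Dom C i) (Cod C i)" "p \<in> Hom C (Cod C i) (Cod C p)"
proof -
  show *: "i \<in> Arr C" "p \<in> Arr C" "Dom C p = Cod C i" "p \<cdot> i = Nul C (Dom C i) (Cod C p)"
    using assms unfolding short_exact_def is_kernel_def is_cokernel_def by blast+
  show "i \<in> Hom C (Dom C i) (Cod C i)" "p \<in> Hom C (Cod C i) (Cod C p)"
    using * by (simp_all add: Hom_iff)
qed

lemma short_exact_obj:
  assumes "short_exact C i p"
  shows "Dom C i \<in> Obj C" "Cod C i \<in> Obj C" "Cod C p \<in> Obj C"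
  using short_exactD(1,2)[OF assms] dom_obj cod_obj by auto

lemma short_exact_lift:
  assumes "short_exact C i p" "f \<in> Hom C X (Cod C i)" "p \<cdot> f = Nul C X (Cod C p)"
  obtains h where "h \<in> Hom C X (Dom C i)" "i \<cdot> h = f"
proof -
  have "f \<in> Hom C X (Dom C p)" using assms short_exactD[OF assms(1)] by simp
  then have "\<exists>!h. h \<in> Hom C X (Dom C i) \<and> i \<cdot> h = f"
    using assms(1,3) unfolding short_exact_def is_kernel_def by blast
  then show thesis using that by blast
qed

lemma short_exact_desc:
  assumes "short_exact C i p" "f \<in> Hom C (Cod C i) X" "f \<cdot> i = Nul C (Dom C i) X"
  obtains h where "h \<in> Hom C (Cod C p) X" "h \<cdot> p = f"
proof -
  have "\<exists>!h. h \<in> Hom C (Cod C p) X \<and> h \<cdot> p = f"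
    using assms unfolding short_exact_def is_cokernel_def by blast
  then show thesis using that by blast
qed

lemma short_exact_mono:
  assumes "short_exact C i p" "f \<in> Hom C X (Dom C i)" "g \<in> Hom C X (Dom C i)" "i \<cdot> f = i \<cdot> g"
  shows "f = g"
proof -
  have "i \<cdot> f \<in> Hom C X (Dom C p)"
    using assms short_exactD[OF assms(1)] by (simp add: typing Hom_iff)
  moreover have "p \<cdot> (i \<cdot> f) = Nul C X (Cod C p)"
    using assms short_exactD[OF assms(1)]
    by (subst comp_reduce[OF short_exactD(4)[OF assms(1)]]) (auto simp: Hom_iff Nul_comp typing)
  ultimately have "\<exists>!h. h \<in> Hom C X (Dom C i) \<and> i \<cdot> h = i \<cdot> f"
    using assms(1) unfolding short_exact_def is_kernel_def by blast
  then show ?thesis using assms(2-4) by metis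
qed

lemma short_exact_epi:
  assumes "short_exact C i p" "f \<in> Hom C (Cod C p) X" "g \<in> Hom C (Cod C p) X" "f \<cdot> p = g \<cdot> p"
  shows "f = g"
proof -
  have "f \<cdot> p \<in> Hom C (Cod C i) X"
    using assms short_exactD[OF assms(1)] by (simp add: arith)
  moreover have "(f \<cdot> p) \<cdot> i = Nul C (Dom C i) X"
    using assms short_exactD[OF assms(1)] by (auto simp: arith)
  ultimately have "\<exists>!h. h \<in> Hom C (Cod C p) X \<and> h \<cdot> p = f \<cdot> p"
    using assms(1) unfolding short_exact_def is_cokernel_def by blast
  then show ?thesis using assms(2-4) by metis
qed

lemma short_exact_epic: "short_exact C i p \<Longrightarrow> epic C p"
  unfolding epic_def using short_exact_epi short_exactD(2) by blast

lemma projective_lift: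
  assumes "projective C P" "short_exact C i p" "f \<in> Hom C P (Cod C p)"
  obtains g where "g \<in> Hom C P (Cod C i)" "p \<cdot> g = f"
  using assms short_exact_epic[OF assms(2)] short_exactD(3)[OF assms(2)]
  unfolding projective_def by metis

end

section \<open>Stable equality and syzygies\<close>

context abelian_category
begin

text \<open>The arrows that become zero in the stable category, with source and target taken from
  the arrow itself.\<close>

definition snull :: "'m \<Rightarrow> bool" where
  "snull f \<longleftrightarrow> f \<in> Arr C \<and> f \<in> factor_proj C (Dom C f) (Cod C f)"

lemma snullI:
  assumes "projective C P" "u \<in> Hom C X P" "v \<in> Hom C P Y"
  shows "snull (v \<cdot> u)"
proof -
  have "Dom C (v \<cdot> u) = X" "Cod C (v \<cdot> u) = Y" "v \<cdot> u \<in> Arr C"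
    using assms by (simp_all add: Hom_iff typing)
  then show ?thesis using assms unfolding snull_def factor_proj_def by blast
qed

lemma snullE:
  assumes "snull f" "f \<in> Hom C X Y"
  obtains P u v where "projective C P" "u \<in> Hom C X P" "v \<in> Hom C P Y" "f = v \<cdot> u"
  using assms unfolding snull_def factor_proj_def Hom_iff[of f] by blast

text \<open>A factorisation through some projective \<open>P\<close> can be moved to the given
  epimorphism \<open>p\<close>, because the arrow out of \<open>P\<close> lifts along
  \<open>p\<close>.\<close>

lemma snull_factor:
  assumes "short_exact C i p" "projective C (Cod C i)" "snull f" "f \<in> Hom C X (Cod C p)"
  obtains u where "u \<in> Hom C X (Cod C i)" "p \<cdot> u = f"
proof -
  obtain P u v where P: "projective C P" "u \<in> Hom C X P" "v \<in> Hom C P (Cod C p)" "f = v \<cdot> u"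
    using snullE[OF assms(3,4)] by blast
  obtain w where w: "w \<in> Hom C P (Cod C i)" "p \<cdot> w = v"
    using projective_lift[OF P(1) assms(1) P(3)] .
  have "p \<cdot> (w \<cdot> u) = f"
    using P w short_exactD[OF assms(1)] by (subst comp_reduce[OF w(2)]) (simp_all add: Hom_iff)
  then show thesis using that[of "w \<cdot> u"] w P by (simp add: Hom_iff typing)
qed

lemma snull_comp:
  assumes "snull f" "g \<in> Arr C"
  shows "Dom C g = Cod C f \<Longrightarrow> snull (g \<cdot> f)" "Cod C g = Dom C f \<Longrightarrow> snull (f \<cdot> g)"
proof -
  have f: "f \<in> Arr C" using assms(1) by (simp add: snull_def)
  obtain P u v where P: "projective C P" "u \<in> Hom C (Dom C f) P" "v \<in> Hom C P (Cod C f)" "f = v \<cdot> u"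
    using snullE[OF assms(1) HomI[OF f]] by blast
  have g: "g \<in> Hom C (Dom C g) (Cod C g)" using assms(2) HomI by blast
  show "snull (g \<cdot> f)" if "Dom C g = Cod C f"
    using snullI[OF P(1,2), of "g \<cdot> v"] comp[OF P(3), of g "Cod C g"]
      comp_assoc[OF P(2,3), of g "Cod C g"] that g P(4) by simp
  show "snull (f \<cdot> g)" if "Cod C g = Dom C f"
    using snullI[OF P(1) _ P(3), of "u \<cdot> g"] comp[of g "Dom C g" "Dom C f" u P]
      comp_assoc[of g "Dom C g" "Dom C f" u P v "Cod C f"] that g P(2-4) by metis
qed

definition stable_eq (infix "\<approx>" 50) where
  "f \<approx> g \<longleftrightarrow> f \<in> Arr C \<and> g \<in> Arr C \<and> Dom C f = Dom C g \<and> Cod C f = Cod C g \<and> snull (f \<boxminus> g)"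

lemma stable_eqI:
  "\<lbrakk>f \<in> Hom C X Y; g \<in> Hom C X Y; f \<boxminus> g = v \<cdot> u; projective C P; u \<in> Hom C X P; v \<in> Hom C P Y\<rbrakk>
   \<Longrightarrow> f \<approx> g"
  unfolding stable_eq_def using snullI by (simp add: Hom_iff)

lemma stable_eq_Hom: "f \<approx> g \<Longrightarrow> f \<in> Hom C X Y \<longleftrightarrow> g \<in> Hom C X Y"
  by (auto simp: stable_eq_def Hom_iff)

lemma stable_eq_typing:
  assumes "f \<approx> g" shows "f \<in> Arr C" "g \<in> Arr C" "Dom C f = Dom C g" "Cod C f = Cod C g"
  using assms by (auto simp: stable_eq_def)

lemma comp_stable_eq: "\<lbrakk>f \<approx> g; h \<in> Arr C; Dom C h = Cod C f\<rbrakk> \<Longrightarrow> h \<cdot> f \<approx> h \<cdot> g"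
  unfolding stable_eq_def using snull_comp(1)[of "f \<boxminus> g" h]
  by (simp add: typing comp_add comp_neg)

lemma stable_eq_comp: "\<lbrakk>f \<approx> g; h \<in> Arr C; Cod C h = Dom C f\<rbrakk> \<Longrightarrow> f \<cdot> h \<approx> g \<cdot> h"
  unfolding stable_eq_def using snull_comp(2)[of "f \<boxminus> g" h]
  by (simp add: typing add_comp neg_comp)

end

locale projective_abelian_category = abelian_category C
  for C :: "('o, 'm) abcat" (structure) +
  assumes enough: "enough_projectives C"
begin

text \<open>Both factorisations are moved to one epimorphism from a projective onto the common
  target, where they can be added; this takes the place of the direct sum of \<open>P\<close> and
  \<open>Q\<close>.\<close>

lemma snull_add:
  assumes "snull f" "snull g" "f \<in> Hom C X Y" "g \<in> Hom C X Y"
  shows "snull (f \<boxplus> g)"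
proof -
  obtain P u v where P: "projective C P" "u \<in> Hom C X P" "v \<in> Hom C P Y" "f = v \<cdot> u"
    using snullE[OF assms(1,3)] by blast
  obtain Q x y where Q: "projective C Q" "x \<in> Hom C X Q" "y \<in> Hom C Q Y" "g = y \<cdot> x"
    using snullE[OF assms(2,4)] by blast
  obtain e where e: "epic C e" "Cod C e = Y" "projective C (Dom C e)"
    using enough Hom_objs[OF P(3)] unfolding enough_projectives_def by blast
  obtain v' where v': "v' \<in> Hom C P (Dom C e)" "e \<cdot> v' = v"
    using P(1,3) e unfolding projective_def by metis
  obtain y' where y': "y' \<in> Hom C Q (Dom C e)" "e \<cdot> y' = y"
    using Q(1,3) e unfolding projective_def by metis
  have e': "e \<in> Hom C (Dom C e) Y" using e HomI unfolding epic_def by metis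
  have eq: "e \<cdot> (v' \<cdot> u \<boxplus> y' \<cdot> x) = v \<cdot> u \<boxplus> y \<cdot> x"
    using P(2,3) Q(2,3) v'(1) y'(1) e'
    by (simp add: Hom_iff typing comp_add comp_reduce[OF v'(2)] comp_reduce[OF y'(2)])
  have "v' \<cdot> u \<boxplus> y' \<cdot> x \<in> Hom C X (Dom C e)"
    using P(2) Q(2) v'(1) y'(1) by (simp add: Hom_iff typing)
  then show ?thesis
    using snullI[OF e(3) _ e'] eq P(4) Q(4) by metis
qed

lemma snull_Nul:
  assumes "X \<in> Obj C" "Y \<in> Obj C"
  shows "snull (Nul C X Y)"
proof -
  obtain e where e: "epic C e" "Cod C e = Y" "projective C (Dom C e)"
    using enough assms unfolding enough_projectives_def by blast
  then have "e \<in> Arr C" unfolding epic_def by simp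
  then have "Nul C X Y = e \<cdot> Nul C X (Dom C e)"
    using assms e by (simp add: comp_Nul)
  then show ?thesis using snullI[OF e(3), of "Nul C X (Dom C e)" X e Y] e \<open>e \<in> Arr C\<close> assms
    by (simp add: Hom_iff typing)
qed

lemma snull_neg: "snull f \<Longrightarrow> snull (neg f)"
proof -
  assume f: "snull f"
  then have "f \<in> Arr C" by (simp add: snull_def)
  then have "neg f = neg (Idt C (Cod C f)) \<cdot> f" by (simp add: typing neg_comp Idt_comp)
  then show ?thesis using snull_comp(1)[OF f, of "neg (Idt C (Cod C f))"] \<open>f \<in> Arr C\<close>
    by (simp add: typing)
qed

lemma stable_eq_refl: "f \<in> Arr C \<Longrightarrow> f \<approx> f"
  by (simp add: stable_eq_def sub_self snull_Nul typing)

lemma stable_eq_sym: "f \<approx> g \<Longrightarrow> g \<approx> f"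
  unfolding stable_eq_def using snull_neg[of "f \<boxminus> g"] by (simp add: arith)

lemma stable_eq_trans [trans]:
  assumes "f \<approx> g" "g \<approx> h" shows "f \<approx> h"
proof -
  have "f \<boxminus> h = (f \<boxminus> g) \<boxplus> (g \<boxminus> h)"
    using assms by (simp add: stable_eq_def arith)
  then show ?thesis
    using assms snull_add[of "f \<boxminus> g" "g \<boxminus> h" "Dom C f" "Cod C f"]
    by (simp add: stable_eq_def typing Hom_iff)
qed

lemma stable_eq_add:
  assumes "f \<approx> g" "f' \<approx> g'" "Dom C f = Dom C f'" "Cod C f = Cod C f'"
  shows "f \<boxplus> f' \<approx> g \<boxplus> g'"
proof -
  have "(f \<boxplus> f') \<boxminus> (g \<boxplus> g') = (f \<boxminus> g) \<boxplus> (f' \<boxminus> g')"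
    using assms by (simp add: stable_eq_def arith)
  then show ?thesis
    using assms snull_add[of "f \<boxminus> g" "f' \<boxminus> g'" "Dom C f" "Cod C f"]
    by (simp add: stable_eq_def typing Hom_iff)
qed

lemma stable_eq_neg:
  assumes "f \<approx> g" shows "neg f \<approx> neg g"
  using assms snull_neg[of "f \<boxminus> g"] by (simp add: stable_eq_def typing neg_add)

lemma stable_eq_mult:
  assumes "f \<approx> f'" "g \<approx> g'" "Dom C g = Cod C f"
  shows "g \<cdot> f \<approx> g' \<cdot> f'"
  using stable_eq_trans[OF stable_eq_comp[OF assms(2), of f] comp_stable_eq[OF assms(1), of g']]
    assms by (simp add: stable_eq_def)

lemma stable_eq_Nul_iff: "f \<in> Hom C X Y \<Longrightarrow> f \<approx> Nul C X Y \<longleftrightarrow> snull f"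
  using Hom_objs[of f X Y] by (auto simp: stable_eq_def Hom_iff neg_Nul add_Nul typing)

lemma stable_eq_Nul_factor:
  assumes "projective C P" "u \<in> Hom C X P" "v \<in> Hom C P Y"
  shows "v \<cdot> u \<approx> Nul C X Y"
  using assms snullI[OF assms] by (subst stable_eq_Nul_iff) (auto simp: Hom_iff typing)

section \<open>Projective resolutions and their lifting properties\<close>

abbreviation resn :: "('o, 'm) resolution \<Rightarrow> bool" where
  "resn R \<equiv> proj_resolution C (Syz R 0) R"

lemma proj_resolution_resn: "proj_resolution C M R \<Longrightarrow> resn R"
  by (simp add: proj_resolution_def)

lemma resn_typing:
  assumes "resn R"
  shows "prj R k \<in> Arr C" "Dom C (prj R k) = Pr R k" "Cod C (prj R k) = Syz R k"
    "inc R k \<in> Arr C" "Dom C (inc R k) = Syz R (Suc k)" "Cod C (inc R k) = Pr R k"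
    "Syz R k \<in> Obj C" "Pr R k \<in> Obj C"
  using assms dom_obj cod_obj unfolding proj_resolution_def Hom_iff by metis+

lemma resn_exact: "resn R \<Longrightarrow> short_exact C (inc R k) (prj R k)"
  by (simp add: proj_resolution_def)

lemma resn_projective: "resn R \<Longrightarrow> projective C (Pr R k)"
  by (simp add: proj_resolution_def)

lemma resn_zero: "resn R \<Longrightarrow> prj R k \<cdot> inc R k = Nul C (Syz R (Suc k)) (Syz R k)"
  using short_exactD(4)[OF resn_exact[of R k]] by (simp add: resn_typing)

lemma resn_lift:
  assumes "resn R" "projective C P" "f \<in> Hom C P (Syz R k)"
  obtains g where "g \<in> Hom C P (Pr R k)" "prj R k \<cdot> g = f"
  using projective_lift[OF assms(2) resn_exact[OF assms(1), of k]] assms by (auto simp: resn_typing)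

lemma resn_kernel:
  assumes "resn R" "f \<in> Hom C X (Pr R k)" "prj R k \<cdot> f = Nul C X (Syz R k)"
  obtains g where "g \<in> Hom C X (Syz R (Suc k))" "inc R k \<cdot> g = f"
  using short_exact_lift[OF resn_exact[OF assms(1), of k]] assms by (auto simp: resn_typing)

lemma resn_mono:
  assumes "resn R" "inc R k \<cdot> f = inc R k \<cdot> g"
    "f \<in> Hom C X (Syz R (Suc k))" "g \<in> Hom C X (Syz R (Suc k))"
  shows "f = g"
  using short_exact_mono[OF resn_exact[OF assms(1), of k]] assms by (auto simp: resn_typing)

lemma resn_factor:
  assumes "resn R" "snull f" "f \<in> Hom C X (Syz R k)"
  obtains u where "u \<in> Hom C X (Pr R k)" "prj R k \<cdot> u = f"
  using snull_factor[OF resn_exact[OF assms(1), of k] _ assms(2), of X] assms resn_projective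
  by (auto simp: resn_typing)

lemma resn_snull:
  assumes "resn R" "g \<in> Hom C (Pr R k) Y"
  shows "g \<cdot> inc R k \<approx> Nul C (Syz R (Suc k)) Y"
  by (rule stable_eq_Nul_factor[OF resn_projective[OF assms(1)] _ assms(2)])
     (use assms(1) in \<open>simp add: resn_typing Hom_iff\<close>)

section \<open>Arrows induced on syzygies\<close>

lemma syz_lift_exists:
  assumes "resn R" "resn S" "f \<in> Hom C (Syz R k) (Syz S l)"
  obtains h where "syz_lift C R k S l f h"
proof -
  note ty = resn_typing[OF assms(1)] resn_typing[OF assms(2)]
  have "f \<cdot> prj R k \<in> Hom C (Pr R k) (Syz S l)" using assms ty by (simp add: Hom_iff typing)
  then obtain g where g: "g \<in> Hom C (Pr R k) (Pr S l)" "prj S l \<cdot> g = f \<cdot> prj R k"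
    using resn_lift[OF assms(2) resn_projective[OF assms(1)]] by metis
  have "prj S l \<cdot> (g \<cdot> inc R k) = Nul C (Syz R (Suc k)) (Syz S l)"
    using g(1) assms(3) ty resn_zero[OF assms(1)]
    by (subst comp_reduce[OF g(2)]) (auto simp: Hom_iff typing comp_assoc' comp_Nul)
  then obtain h where h: "h \<in> Hom C (Syz R (Suc k)) (Syz S (Suc l))" "inc S l \<cdot> h = g \<cdot> inc R k"
    using resn_kernel[OF assms(2), of "g \<cdot> inc R k"] g ty by (auto simp: Hom_iff typing)
  show thesis using that[of h] g h assms(3) unfolding syz_lift_def by auto
qed

lemma syz_lift_Hom:
  assumes "syz_lift C R k S l f h"
  shows "f \<in> Hom C (Syz R k) (Syz S l)" "h \<in> Hom C (Syz R (Suc k)) (Syz S (Suc l))"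
  using assms unfolding syz_lift_def by auto

text \<open>This makes the passage to syzygies well defined on stable classes. A factorisation of
  \<open>f \<boxminus> f'\<close> through \<open>prj S l\<close> corrects the difference of the two
  lifts to \<open>?d\<close>, which \<open>prj S l\<close> kills. The correction
  \<open>u \<cdot> prj R k\<close> disappears on the next syzygy, so \<open>h \<boxminus> h'\<close>
  factors through \<open>Pr R k\<close>.\<close>

lemma syz_lift_cong:
  assumes R: "resn R" and S: "resn S"
    and L: "syz_lift C R k S l f h" "syz_lift C R k S l f' h'" and eq: "f \<approx> f'"
  shows "h \<approx> h'"
proof -
  note ty = resn_typing[OF R] resn_typing[OF S]
  note hom = syz_lift_Hom[OF L(1)] syz_lift_Hom[OF L(2)]
  obtain g where g: "g \<in> Hom C (Pr R k) (Pr S l)" "prj S l \<cdot> g = f \<cdot> prj R k" "inc S l \<cdot> h = g \<cdot> inc R k"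
    using L(1) unfolding syz_lift_def by auto
  obtain g' where g': "g' \<in> Hom C (Pr R k) (Pr S l)" "prj S l \<cdot> g' = f' \<cdot> prj R k"
    "inc S l \<cdot> h' = g' \<cdot> inc R k"
    using L(2) unfolding syz_lift_def by auto
  obtain u where u: "u \<in> Hom C (Syz R k) (Pr S l)" "prj S l \<cdot> u = f \<boxminus> f'"
    using resn_factor[OF S, of "f \<boxminus> f'"] eq hom by (auto simp: stable_eq_def Hom_iff typing)
  let ?d = "(g \<boxminus> g') \<boxminus> u \<cdot> prj R k"
  have "prj S l \<cdot> ?d = Nul C (Pr R k) (Syz S l)"
    using g(1) g'(1) u(1) hom ty
    by (simp only: dist g(2) g'(2) comp_reduce[OF u(2)])
  then obtain v where v: "v \<in> Hom C (Pr R k) (Syz S (Suc l))" "inc S l \<cdot> v = ?d"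
    using resn_kernel[OF S, of ?d] g(1) g'(1) u(1) ty by (auto simp: Hom_iff typing)
  have "inc S l \<cdot> (v \<cdot> inc R k) = ?d \<cdot> inc R k"
    using v(1) ty by (subst comp_reduce[OF v(2)]) (auto simp: Hom_iff)
  also have "\<dots> = inc S l \<cdot> (h \<boxminus> h')"
    using g(1) g'(1) u(1) hom ty by (simp only: dist g(3) g'(3) resn_zero[OF R])
  finally have "v \<cdot> inc R k = h \<boxminus> h'"
    by (rule resn_mono[OF S]) (use v(1) hom ty in \<open>auto simp: Hom_iff typing\<close>)
  then show ?thesis
    by (intro stable_eqI[OF hom(2,4) _ resn_projective[OF R] _ v(1), of "inc R k"])
       (use ty in \<open>simp_all add: Hom_iff\<close>)
qed

lemma syz_lift_add:
  assumes R: "resn R" and S: "resn S"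
    and L: "syz_lift C R k S l f h" "syz_lift C R k S l f' h'"
  shows "syz_lift C R k S l (f \<boxplus> f') (h \<boxplus> h')"
proof -
  note ty = resn_typing[OF R] resn_typing[OF S]
  note hom = syz_lift_Hom[OF L(1)] syz_lift_Hom[OF L(2)]
  obtain g where g: "g \<in> Hom C (Pr R k) (Pr S l)" "prj S l \<cdot> g = f \<cdot> prj R k" "inc S l \<cdot> h = g \<cdot> inc R k"
    using L(1) unfolding syz_lift_def by auto
  obtain g' where g': "g' \<in> Hom C (Pr R k) (Pr S l)" "prj S l \<cdot> g' = f' \<cdot> prj R k"
    "inc S l \<cdot> h' = g' \<cdot> inc R k"
    using L(2) unfolding syz_lift_def by auto
  have "prj S l \<cdot> (g \<boxplus> g') = (f \<boxplus> f') \<cdot> prj R k" "inc S l \<cdot> (h \<boxplus> h') = (g \<boxplus> g') \<cdot> inc R k"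
    using g g' hom ty by (simp_all add: Hom_iff typing comp_add add_comp)
  then show ?thesis
    unfolding syz_lift_def using g(1) g'(1) hom Hom_closed by blast
qed

lemma syz_lift_neg:
  assumes R: "resn R" and S: "resn S" and L: "syz_lift C R k S l f h"
  shows "syz_lift C R k S l (neg f) (neg h)"
proof -
  note ty = resn_typing[OF R] resn_typing[OF S]
  note hom = syz_lift_Hom[OF L(1)]
  obtain g where g: "g \<in> Hom C (Pr R k) (Pr S l)" "prj S l \<cdot> g = f \<cdot> prj R k" "inc S l \<cdot> h = g \<cdot> inc R k"
    using L unfolding syz_lift_def by auto
  have "prj S l \<cdot> neg g = neg f \<cdot> prj R k" "inc S l \<cdot> neg h = neg g \<cdot> inc R k"
    using g hom ty by (simp_all add: Hom_iff typing comp_neg neg_comp)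
  then show ?thesis
    unfolding syz_lift_def using g(1) hom Hom_closed by blast
qed

lemma syz_lift_Idt:
  assumes R: "resn R"
  shows "syz_lift C R k R k (Idt C (Syz R k)) (Idt C (Syz R (Suc k)))"
  unfolding syz_lift_def using resn_typing[OF R]
  by (auto simp: Hom_iff typing comp_Idt Idt_comp intro!: bexI[of _ "Idt C (Pr R k)"])

lemma syz_lift_comp:
  assumes R: "resn R" and S: "resn S" and T: "resn T"
    and L: "syz_lift C R k S l f h" "syz_lift C S l T m f' h'"
  shows "syz_lift C R k T m (f' \<cdot> f) (h' \<cdot> h)"
proof -
  note ty = resn_typing[OF R] resn_typing[OF S] resn_typing[OF T]
  note hom = syz_lift_Hom[OF L(1)] syz_lift_Hom[OF L(2)]
  obtain g where g: "g \<in> Hom C (Pr R k) (Pr S l)" "prj S l \<cdot> g = f \<cdot> prj R k" "inc S l \<cdot> h = g \<cdot> inc R k"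
    using L(1) unfolding syz_lift_def by auto
  obtain g' where g': "g' \<in> Hom C (Pr S l) (Pr T m)" "prj T m \<cdot> g' = f' \<cdot> prj S l"
    "inc T m \<cdot> h' = g' \<cdot> inc S l"
    using L(2) unfolding syz_lift_def by auto
  have "prj T m \<cdot> (g' \<cdot> g) = (f' \<cdot> f) \<cdot> prj R k"
    using g(1) g'(1) hom ty
    by (subst comp_reduce[OF g'(2)]) (simp_all add: Hom_iff typing comp_assoc' g(2))
  moreover have "inc T m \<cdot> (h' \<cdot> h) = (g' \<cdot> g) \<cdot> inc R k"
    using g(1) g'(1) hom ty
    by (subst comp_reduce[OF g'(3)]) (simp_all add: Hom_iff typing comp_assoc' g(3))
  ultimately show ?thesis
    unfolding syz_lift_def using g(1) g'(1) hom comp by blast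
qed

text \<open>A sequence of lifts up to stable equality, from the syzygies of \<open>R\<close> shifted by \<open>a\<close>: maps of
  objects have \<open>a = 0\<close>, connecting homomorphisms have \<open>a = 1\<close>.\<close>

definition slift :: "nat \<Rightarrow> ('o, 'm) resolution \<Rightarrow> ('o, 'm) resolution \<Rightarrow> (nat \<Rightarrow> 'm) \<Rightarrow> bool" where
  "slift a R S F \<longleftrightarrow> (\<forall>k. F k \<in> Hom C (Syz R (k + a)) (Syz S k) \<and>
     (\<exists>h. syz_lift C R (k + a) S k (F k) h \<and> h \<approx> F (Suc k)))"

lemma slift_Hom: "slift a R S F \<Longrightarrow> F k \<in> Hom C (Syz R (k + a)) (Syz S k)"
  by (simp add: slift_def)

lemma slift_step:
  assumes "resn R" "resn S" "slift a R S F" "syz_lift C R (k + a) S k f h" "f \<approx> F k"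
  shows "h \<approx> F (Suc k)"
proof -
  obtain h' where h': "syz_lift C R (k + a) S k (F k) h'" "h' \<approx> F (Suc k)"
    using assms(3) unfolding slift_def by blast
  show ?thesis using stable_eq_trans[OF syz_lift_cong[OF assms(1,2,4) h'(1) assms(5)] h'(2)] .
qed

text \<open>One step of lifting is determined up to stable equality by its input, so equality
  propagates from degree 0. Identities between sequences of lifts therefore have to be checked on
  their first terms alone.\<close>

lemma slift_unique:
  assumes "resn R" "resn S" "slift a R S F" "slift a R S G" "F 0 \<approx> G 0"
  shows "F k \<approx> G k"
proof (induction k)
  case (Suc k)
  obtain h where h: "syz_lift C R (k + a) S k (F k) h" "h \<approx> F (Suc k)"
    using assms(3) unfolding slift_def by blast
  show ?case
    using stable_eq_trans[OF stable_eq_sym[OF h(2)] slift_step[OF assms(1,2,4) h(1) Suc]] .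
qed (use assms in simp)

text \<open>\<open>F\<close> enters at index \<open>k + b\<close>, because \<open>G k\<close> starts
  at the syzygy of \<open>S\<close> with that index.\<close>

lemma slift_comp:
  assumes "resn R" "resn S" "resn T" "slift a R S F" "slift b S T G"
  shows "slift (b + a) R T (\<lambda>k. G k \<cdot> F (k + b))"
  unfolding slift_def
proof (intro allI conjI)
  fix k
  have *: "F (k + b) \<in> Hom C (Syz R (k + b + a)) (Syz S (k + b))" "G k \<in> Hom C (Syz S (k + b)) (Syz T k)"
    using slift_Hom assms by blast+
  then show "G k \<cdot> F (k + b) \<in> Hom C (Syz R (k + (b + a))) (Syz T k)"
    by (simp add: comp add.assoc)
  obtain h where h: "syz_lift C R (k + b + a) S (k + b) (F (k + b)) h" "h \<approx> F (Suc (k + b))"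
    using assms(4) unfolding slift_def by blast
  obtain g where g: "syz_lift C S (k + b) T k (G k) g" "g \<approx> G (Suc k)"
    using assms(5) unfolding slift_def by blast
  have "syz_lift C R (k + (b + a)) T k (G k \<cdot> F (k + b)) (g \<cdot> h)"
    using syz_lift_comp[OF assms(1-3) h(1) g(1)] by (simp add: add.assoc)
  moreover have "g \<cdot> h \<approx> G (Suc k) \<cdot> F (Suc k + b)"
    using stable_eq_mult[OF h(2) g(2)] syz_lift_Hom[OF h(1)] syz_lift_Hom[OF g(1)]
    by (simp add: Hom_iff)
  ultimately show "\<exists>h. syz_lift C R (k + (b + a)) T k (G k \<cdot> F (k + b)) h \<and> h \<approx> G (Suc k) \<cdot> F (Suc k + b)"
    by blast
qed

lemma slift_add:
  assumes "resn R" "resn S" "slift a R S F" "slift a R S G"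
  shows "slift a R S (\<lambda>k. F k \<boxplus> G k)"
  unfolding slift_def
proof (intro allI conjI)
  fix k
  show "F k \<boxplus> G k \<in> Hom C (Syz R (k + a)) (Syz S k)"
    using slift_Hom[OF assms(3), of k] slift_Hom[OF assms(4), of k] by (rule Hom_closed(1))
  obtain h where h: "syz_lift C R (k + a) S k (F k) h" "h \<approx> F (Suc k)"
    using assms(3) unfolding slift_def by blast
  obtain g where g: "syz_lift C R (k + a) S k (G k) g" "g \<approx> G (Suc k)"
    using assms(4) unfolding slift_def by blast
  show "\<exists>h. syz_lift C R (k + a) S k (F k \<boxplus> G k) h \<and> h \<approx> F (Suc k) \<boxplus> G (Suc k)"
    using syz_lift_add[OF assms(1,2) h(1) g(1)] stable_eq_add[OF h(2) g(2)]
      syz_lift_Hom[OF h(1)] syz_lift_Hom[OF g(1)] by (auto simp: Hom_iff)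
qed

lemma slift_Idt: "resn R \<Longrightarrow> slift 0 R R (\<lambda>k. Idt C (Syz R k))"
  unfolding slift_def using syz_lift_Idt[of R] syz_lift_Hom[OF syz_lift_Idt[of R]]
  by (metis Hom_iff add_0_right stable_eq_refl)

lemma slift_lifts:
  assumes "resn R" "resn S" "f \<in> Hom C (Syz R 0) (Syz S 0)"
  shows "lifts C R S f 0 = f" "slift 0 R S (lifts C R S f)"
    "syz_lift C R k S k (lifts C R S f k) (lifts C R S f (Suc k))"
proof -
  \<comment> \<open>A witness for the choice in \<open>lifts\<close>: each term is chosen as a lift
    of the preceding one.\<close>
  define F where "F = rec_nat f (\<lambda>k x. SOME h. syz_lift C R k S k x h)"
  have F: "syz_lift C R k S k (F k) (F (Suc k)) \<and> F k \<in> Hom C (Syz R k) (Syz S k)" for k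
  proof (induction k)
    case 0
    have "F 0 \<in> Hom C (Syz R 0) (Syz S 0)" using assms(3) by (simp add: F_def)
    then show ?case
      using syz_lift_exists[OF assms(1,2), of "F 0" 0 0]
      by (metis (mono_tags, lifting) F_def old.nat.simps(7) someI_ex)
  next
    case (Suc k)
    then have "F (Suc k) \<in> Hom C (Syz R (Suc k)) (Syz S (Suc k))" using syz_lift_Hom by blast
    then show ?case
      using syz_lift_exists[OF assms(1,2), of "F (Suc k)" "Suc k" "Suc k"]
      by (metis (mono_tags, lifting) F_def old.nat.simps(7) someI_ex)
  qed
  then have "lift_sequence C R S f F" by (simp add: lift_sequence_def F_def)
  then have *: "lift_sequence C R S f (lifts C R S f)"
    unfolding lifts_def by (metis someI_ex)
  then show "lifts C R S f 0 = f" "syz_lift C R k S k (lifts C R S f k) (lifts C R S f (Suc k))" for k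
    by (simp_all add: lift_sequence_def)
  then show "slift 0 R S (lifts C R S f)"
    unfolding slift_def using syz_lift_Hom by (metis Hom_iff add_0_right stable_eq_refl)
qed

end

section \<open>Horseshoes\<close>

context abelian_category
begin

lemma add_eq_swap:
  assumes "f \<in> Hom C X Y" "g \<in> Hom C X Y" "h \<in> Hom C X Y" "f \<boxminus> g = h"
  shows "f \<boxminus> h = g"
  using assms by (auto simp: sub_eq_iff arith)

end

context projective_abelian_category
begin

text \<open>Exactness of \<open>[X, Dom i] -> [X, Cod i] -> [X, Cod p]\<close> in the middle: the
  factorisation of \<open>p \<cdot> f\<close> through a projective lifts along \<open>p\<close>, and
  subtracting the lift from \<open>f\<close> leaves an arrow into the kernel.\<close>

lemma stable_exact:
  assumes E: "short_exact C i p" and f: "f \<in> Hom C X (Cod C i)" and n: "snull (p \<cdot> f)"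
  obtains e where "e \<in> Hom C X (Dom C i)" "f \<approx> i \<cdot> e"
proof -
  note ip = short_exactD[OF E]
  have pf: "p \<cdot> f \<in> Hom C X (Cod C p)" using f ip by (simp add: Hom_iff typing)
  obtain P u v where P: "projective C P" "u \<in> Hom C X P" "v \<in> Hom C P (Cod C p)" "p \<cdot> f = v \<cdot> u"
    using snullE[OF n pf] by blast
  obtain w where w: "w \<in> Hom C P (Cod C i)" "p \<cdot> w = v"
    using projective_lift[OF P(1) E P(3)] by blast
  have wu: "w \<cdot> u \<in> Hom C X (Cod C i)" using w(1) P(2) comp by blast
  have "p \<cdot> (f \<boxminus> w \<cdot> u) = p \<cdot> f \<boxminus> v \<cdot> u"
    using f w(1) P(2) ip by (simp only: dist comp_reduce[OF w(2)])
  also have "\<dots> = Nul C X (Cod C p)" using P(4) pf by (simp add: Hom_iff sub_self)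
  finally obtain e where e: "e \<in> Hom C X (Dom C i)" "i \<cdot> e = f \<boxminus> w \<cdot> u"
    using short_exact_lift[OF E Hom_closed(2)[OF f wu]] by metis
  have ie: "i \<cdot> e \<in> Hom C X (Cod C i)" using e(1) ip comp by blast
  have "f \<approx> i \<cdot> e"
    by (rule stable_eqI[OF f ie add_eq_swap[OF f wu ie e(2)[symmetric]] P(1,2) w(1)])
  then show thesis using that e(1) by blast
qed

end

locale horseshoe_setup = projective_abelian_category C
  for C :: "('o, 'm) abcat" (structure) +
  fixes R S :: "('o, 'm) resolution" and i p :: 'm and H :: "('o, 'm) horseshoe"
  assumes R: "resn R" and S: "resn S" and H: "is_horseshoe C R S i p H"
begin

abbreviation "M \<equiv> Mid H"

lemma M: "resn M" "Syz M 0 = Cod C i"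
  using H proj_resolution_resn unfolding is_horseshoe_def proj_resolution_def by blast+

lemma typing_horseshoe:
  "Pin H k \<in> Arr C" "Dom C (Pin H k) = Pr R k" "Cod C (Pin H k) = Pr M k"
  "Pout H k \<in> Arr C" "Dom C (Pout H k) = Pr M k" "Cod C (Pout H k) = Pr S k"
  "Sin H k \<in> Arr C" "Dom C (Sin H k) = Syz R k" "Cod C (Sin H k) = Syz M k"
  "Sout H k \<in> Arr C" "Dom C (Sout H k) = Syz M k" "Cod C (Sout H k) = Syz S k"
  using H unfolding is_horseshoe_def Hom_iff by metis+

lemmas ty = typing_horseshoe resn_typing[OF R] resn_typing[OF S] resn_typing[OF M(1)]

lemma exact_P: "short_exact C (Pin H k) (Pout H k)"
  and exact_S: "short_exact C (Sin H k) (Sout H k)"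
  and base: "Sin H 0 = i" "Sout H 0 = p"
  and square:
    "prj M k \<cdot> Pin H k = Sin H k \<cdot> prj R k"
    "prj S k \<cdot> Pout H k = Sout H k \<cdot> prj M k"
    "inc M k \<cdot> Sin H (Suc k) = Pin H k \<cdot> inc R k"
    "inc S k \<cdot> Sout H (Suc k) = Pout H k \<cdot> inc M k"
  using H unfolding is_horseshoe_def by blast+

lemma zero_S: "Sout H k \<cdot> Sin H k = Nul C (Syz R k) (Syz S k)"
  using short_exactD(4)[OF exact_S] ty by simp

lemma zero_P: "Pout H k \<cdot> Pin H k = Nul C (Pr R k) (Pr S k)"
  using short_exactD(4)[OF exact_P] ty by simp

lemma S_kernel:
  assumes "f \<in> Hom C X (Syz M k)" "Sout H k \<cdot> f = Nul C X (Syz S k)"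
  obtains g where "g \<in> Hom C X (Syz R k)" "Sin H k \<cdot> g = f"
  using short_exact_lift[OF exact_S, of f X k] assms ty by auto

lemma S_mono:
  "\<lbrakk>Sin H k \<cdot> f = Sin H k \<cdot> g; f \<in> Hom C X (Syz R k); g \<in> Hom C X (Syz R k)\<rbrakk> \<Longrightarrow> f = g"
  using short_exact_mono[OF exact_S, of f X k g] ty by simp

lemma S_lift:
  assumes "projective C P" "f \<in> Hom C P (Syz S k)"
  obtains g where "g \<in> Hom C P (Syz M k)" "Sout H k \<cdot> g = f"
  using projective_lift[OF assms(1) exact_S, of f k] assms ty by auto

lemma con_liftE:
  assumes "con_lift C R S H k h"
  obtains l where "h \<in> Hom C (Syz S (Suc k)) (Syz R k)" "l \<in> Hom C (Pr S k) (Syz M k)"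
    "Sout H k \<cdot> l = prj S k" "Sin H k \<cdot> h = l \<cdot> inc S k"
  using assms ty unfolding con_lift_def by (auto simp: Idt_comp)

lemma con_lift_exists:
  obtains h where "con_lift C R S H k h"
proof -
  obtain l where l: "l \<in> Hom C (Pr S k) (Syz M k)" "Sout H k \<cdot> l = prj S k"
    using S_lift[OF resn_projective[OF S], of "prj S k" k] ty by (auto simp: Hom_iff)
  have "Sout H k \<cdot> (l \<cdot> inc S k) = Nul C (Syz S (Suc k)) (Syz S k)"
    using l(1) ty by (subst comp_reduce[OF l(2)]) (auto simp: Hom_iff resn_zero[OF S])
  then obtain h where h: "h \<in> Hom C (Syz S (Suc k)) (Syz R k)" "Sin H k \<cdot> h = l \<cdot> inc S k"
    using S_kernel[of "l \<cdot> inc S k" _ k] l(1) ty by (auto simp: Hom_iff typing)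
  show thesis using that[of h] l h ty unfolding con_lift_def by (auto simp: Idt_comp)
qed

lemma con_lift_Hom: "con_lift C R S H k h \<Longrightarrow> h \<in> Hom C (Syz S (Suc k)) (Syz R k)"
  by (simp add: con_lift_def)

text \<open>Two lifts of the identity differ by an arrow from \<open>Pr S k\<close> into the kernel
  of \<open>Sout H k\<close>, and this arrow exhibits \<open>h \<boxminus> h'\<close> as stably
  null.\<close>

lemma con_lift_unique:
  assumes "con_lift C R S H k h" "con_lift C R S H k h'"
  shows "h \<approx> h'"
proof -
  obtain l where l: "h \<in> Hom C (Syz S (Suc k)) (Syz R k)" "l \<in> Hom C (Pr S k) (Syz M k)"
    "Sout H k \<cdot> l = prj S k" "Sin H k \<cdot> h = l \<cdot> inc S k"
    using con_liftE[OF assms(1)] .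
  obtain l' where l': "h' \<in> Hom C (Syz S (Suc k)) (Syz R k)" "l' \<in> Hom C (Pr S k) (Syz M k)"
    "Sout H k \<cdot> l' = prj S k" "Sin H k \<cdot> h' = l' \<cdot> inc S k"
    using con_liftE[OF assms(2)] .
  have "Sout H k \<cdot> (l \<boxminus> l') = Nul C (Pr S k) (Syz S k)"
    using l(2) l'(2) ty by (simp only: dist l(3) l'(3))
  then obtain z where z: "z \<in> Hom C (Pr S k) (Syz R k)" "Sin H k \<cdot> z = l \<boxminus> l'"
    using S_kernel[OF Hom_closed(2)[OF l(2) l'(2)]] by blast
  have "Sin H k \<cdot> (z \<cdot> inc S k) = (l \<boxminus> l') \<cdot> inc S k"
    using z(1) ty by (subst comp_reduce[OF z(2)]) (auto simp: Hom_iff)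
  also have "\<dots> = Sin H k \<cdot> (h \<boxminus> h')"
    using l(1,2) l'(1,2) ty by (simp only: dist l(4) l'(4))
  finally have "z \<cdot> inc S k = h \<boxminus> h'"
    by (rule S_mono) (use z(1) l(1) l'(1) ty in \<open>auto simp: Hom_iff typing\<close>)
  then show ?thesis
    by (intro stable_eqI[OF l(1) l'(1) _ resn_projective[OF S] _ z(1), of "inc S k"])
       (use ty in \<open>simp_all add: Hom_iff\<close>)
qed

text \<open>The anticommuting square of the \<open>3 \<times> 3\<close> lemma, and the source of the sign \<open>(-1)\<^sup>k\<close> in the
  connecting homomorphisms.\<close>

lemma con_lift_syz_lift:
  assumes C1: "con_lift C R S H k h" and C2: "con_lift C R S H (Suc k) h2"
    and L: "syz_lift C S (Suc k) R k h h'"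
  shows "neg h' \<approx> h2"
proof -
  obtain l where l: "h \<in> Hom C (Syz S (Suc k)) (Syz R k)" "l \<in> Hom C (Pr S k) (Syz M k)"
    "Sout H k \<cdot> l = prj S k" "Sin H k \<cdot> h = l \<cdot> inc S k"
    using con_liftE[OF C1] .
  obtain m where m: "h2 \<in> Hom C (Syz S (Suc (Suc k))) (Syz R (Suc k))"
    "m \<in> Hom C (Pr S (Suc k)) (Syz M (Suc k))"
    "Sout H (Suc k) \<cdot> m = prj S (Suc k)" "Sin H (Suc k) \<cdot> h2 = m \<cdot> inc S (Suc k)"
    using con_liftE[OF C2] .
  obtain g where g: "g \<in> Hom C (Pr S (Suc k)) (Pr R k)" "prj R k \<cdot> g = h \<cdot> prj S (Suc k)"
    "inc R k \<cdot> h' = g \<cdot> inc S (Suc k)" and h': "h' \<in> Hom C (Syz S (Suc (Suc k))) (Syz R (Suc k))"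
    using L unfolding syz_lift_def by auto
  obtain l' where l': "l' \<in> Hom C (Pr S k) (Pr M k)" "prj M k \<cdot> l' = l"
    using resn_lift[OF M(1) resn_projective[OF S] l(2)] .
  have 1: "prj S k \<cdot> (Pout H k \<cdot> l') = prj S k"
    using l'(1) ty by (subst comp_reduce[OF square(2)]) (simp_all only: dist l'(2) l(3))
  have "prj S k \<cdot> (Pout H k \<cdot> l' \<boxminus> Idt C (Pr S k)) = Nul C (Pr S k) (Syz S k)"
    using l'(1) ty by (simp only: dist 1)
  then obtain e where e: "e \<in> Hom C (Pr S k) (Syz S (Suc k))"
    "inc S k \<cdot> e = Pout H k \<cdot> l' \<boxminus> Idt C (Pr S k)"
    using resn_kernel[OF S, of "Pout H k \<cdot> l' \<boxminus> Idt C (Pr S k)" "Pr S k" k] l'(1) ty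
    by (auto simp: Hom_iff typing)
  \<comment> \<open>The arrow \<open>l'\<close> is a section of \<open>Pout H k\<close> only up to
    the defect \<open>inc S k \<cdot> e\<close>, since it is controlled only after composition with
    \<open>prj S k\<close>.\<close>
  have e': "Pout H k \<cdot> l' = Idt C (Pr S k) \<boxplus> inc S k \<cdot> e"
    using e l'(1) ty sub_eq_iff[of "Pout H k \<cdot> l'" _ _ "Idt C (Pr S k)" "inc S k \<cdot> e"]
    by (simp add: Hom_iff typing)
  obtain f where f: "f \<in> Hom C (Pr S k) (Syz M (Suc k))" "Sout H (Suc k) \<cdot> f = e"
    using S_lift[OF resn_projective[OF S] e(1)] .
  let ?q = "inc S k \<cdot> prj S (Suc k)"
  \<comment> \<open>A candidate for the lift in the next degree: \<open>prj M k\<close> kills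
    \<open>?y\<close>, which therefore comes from an arrow \<open>w\<close> into the next syzygy.
    \<open>Sout\<close> sends \<open>w\<close> to \<open>prj S (Suc k)\<close> plus the defect
    \<open>e \<cdot> ?q\<close>, for which \<open>f \<cdot> ?q\<close> compensates.\<close>
  let ?y = "l' \<cdot> ?q \<boxminus> Pin H k \<cdot> g"
  have "prj M k \<cdot> ?y = l \<cdot> ?q \<boxminus> (prj M k \<cdot> Pin H k) \<cdot> g"
    using l'(1) g(1) ty by (simp only: dist comp_reduce[OF l'(2)])
  also have "\<dots> = l \<cdot> ?q \<boxminus> (Sin H k \<cdot> h) \<cdot> prj S (Suc k)"
    using g(1) l(1) ty by (simp only: square(1) dist g(2))
  also have "\<dots> = Nul C (Pr S (Suc k)) (Syz M k)"
    using l(2) ty by (simp only: l(4) dist)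
  finally obtain w where w: "w \<in> Hom C (Pr S (Suc k)) (Syz M (Suc k))" "inc M k \<cdot> w = ?y"
    using resn_kernel[OF M(1), of ?y "Pr S (Suc k)" k] l'(1) g(1) ty by (auto simp: Hom_iff typing)
  have "inc S k \<cdot> (Sout H (Suc k) \<cdot> w) = Pout H k \<cdot> ?y"
    using w(1) ty by (subst comp_reduce[OF square(4)]) (simp_all only: dist w(2))
  also have "\<dots> = (Pout H k \<cdot> l') \<cdot> ?q"
    using l'(1) g(1) ty by (simp only: dist comp_reduce[OF zero_P])
  also have "\<dots> = inc S k \<cdot> (prj S (Suc k) \<boxplus> e \<cdot> ?q)"
    using e(1) ty unfolding e' by (simp only: dist)
  finally have w2: "Sout H (Suc k) \<cdot> w = prj S (Suc k) \<boxplus> e \<cdot> ?q"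
    by (rule resn_mono[OF S]) (use w(1) e(1) ty in \<open>auto simp: Hom_iff typing\<close>)
  let ?t = "w \<boxminus> (m \<boxplus> f \<cdot> ?q)"
  have "Sout H (Suc k) \<cdot> ?t = Nul C (Pr S (Suc k)) (Syz S (Suc k))"
    using w(1) m(2) f(1) e(1) ty by (simp only: dist w2 m(3) comp_reduce[OF f(2)])
  then obtain z where z: "z \<in> Hom C (Pr S (Suc k)) (Syz R (Suc k))" "Sin H (Suc k) \<cdot> z = ?t"
    using S_kernel[of ?t "Pr S (Suc k)" "Suc k"] w(1) m(2) f(1) ty by (auto simp: Hom_iff typing)
  have w3: "w = m \<boxplus> f \<cdot> ?q \<boxplus> Sin H (Suc k) \<cdot> z"
    using z w(1) m(2) f(1) ty
      sub_eq_iff[of w "Pr S (Suc k)" "Syz M (Suc k)" "m \<boxplus> f \<cdot> ?q" "Sin H (Suc k) \<cdot> z"]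
    by (simp add: Hom_iff typing)
  have q0: "?q \<cdot> inc S (Suc k) = Nul C (Syz S (Suc (Suc k))) (Pr S k)"
    using ty by (simp only: dist resn_zero[OF S])
  \<comment> \<open>After restriction to \<open>Syz S (Suc (Suc k))\<close> the factor
    \<open>?q\<close> vanishes, and only the subtracted term \<open>Pin H k \<cdot> g\<close> of
    \<open>?y\<close> survives. This is where the sign arises.\<close>
  have "inc M k \<cdot> (Sin H (Suc k) \<cdot> neg h') = neg (Pin H k \<cdot> (g \<cdot> inc S (Suc k)))"
    using h' g(1) ty by (subst comp_reduce[OF square(3)]) (simp_all only: dist g(3))
  also have "\<dots> = ?y \<cdot> inc S (Suc k)"
    using l'(1) g(1) ty by (simp only: dist resn_zero[OF S])
  also have "\<dots> = inc M k \<cdot> (w \<cdot> inc S (Suc k))"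
    using w(1) ty by (subst comp_reduce[OF w(2)]) (simp_all only: dist)
  finally have "Sin H (Suc k) \<cdot> neg h' = w \<cdot> inc S (Suc k)"
    by (rule resn_mono[OF M(1)]) (use w(1) h' ty in \<open>auto simp: Hom_iff typing\<close>)
  also have "\<dots> = m \<cdot> inc S (Suc k) \<boxplus> Sin H (Suc k) \<cdot> (z \<cdot> inc S (Suc k))"
    using m(2) f(1) z(1) ty unfolding w3 by (simp only: dist resn_zero[OF S])
  also have "\<dots> = Sin H (Suc k) \<cdot> (h2 \<boxplus> z \<cdot> inc S (Suc k))"
    using m(1) z(1) ty by (simp only: dist m(4))
  finally have "neg h' = h2 \<boxplus> z \<cdot> inc S (Suc k)"
    by (rule S_mono) (use m(1) h' z(1) ty in \<open>auto simp: Hom_iff typing\<close>)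
  then have "neg h' \<boxminus> h2 = z \<cdot> inc S (Suc k)"
    using m(1) h' z(1) ty sub_eq_iff[of "neg h'" "Syz S (Suc (Suc k))" "Syz R (Suc k)" h2]
    by (simp add: Hom_iff typing)
  then show ?thesis
    by (intro stable_eqI[OF Hom_closed(3)[OF h'] m(1) _ resn_projective[OF S] _ z(1), of "inc S (Suc k)"])
       (use ty in \<open>simp_all add: Hom_iff\<close>)
qed

text \<open>Twisting by \<open>(-1)^k\<close> turns the anticommuting arrows into a sequence of
  lifts in the sense of \<open>slift\<close>. The arbitrary choice of \<open>h\<close> is harmless,
  since all choices agree stably.\<close>

definition con_seq :: "nat \<Rightarrow> 'm" where
  "con_seq k = (let h = SOME h. con_lift C R S H k h in if even k then h else neg h)"

lemma con_seq:
  assumes "con_lift C R S H k h"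
  shows "con_seq k \<approx> (if even k then h else neg h)"
proof -
  have "con_lift C R S H k (SOME h. con_lift C R S H k h)" using assms by (rule someI)
  from con_lift_unique[OF this assms] show ?thesis
    using stable_eq_neg unfolding con_seq_def Let_def by auto
qed

lemma slift_con_seq: "slift 1 S R con_seq"
  unfolding slift_def
proof (intro allI conjI)
  fix k
  obtain h where h: "con_lift C R S H k h" using con_lift_exists .
  obtain h2 where h2: "con_lift C R S H (Suc k) h2" using con_lift_exists .
  have hh: "(if even k then h else neg h) \<in> Hom C (Syz S (Suc k)) (Syz R k)"
    using con_lift_Hom[OF h] Hom_closed by auto
  then show cs: "con_seq k \<in> Hom C (Syz S (k + 1)) (Syz R k)"
    using stable_eq_Hom[OF con_seq[OF h]] by simp
  obtain h' where h': "syz_lift C S (Suc k) R k h h'"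
    using syz_lift_exists[OF S R con_lift_Hom[OF h]] .
  obtain x where x: "syz_lift C S (Suc k) R k (con_seq k) x"
    using syz_lift_exists[OF S R, of "con_seq k" "Suc k" k] cs by auto
  have "syz_lift C S (Suc k) R k (if even k then h else neg h) (if even k then h' else neg h')"
    using h' syz_lift_neg[OF S R h'] by simp
  then have "x \<approx> (if even k then h' else neg h')"
    using syz_lift_cong[OF S R x] con_seq[OF h] by blast
  moreover have "h' \<approx> neg h2"
    using stable_eq_neg[OF con_lift_syz_lift[OF h h2 h']] syz_lift_Hom[OF h']
    by (simp add: neg_neg Hom_iff)
  ultimately have "x \<approx> (if even k then neg h2 else h2)"
    using con_lift_syz_lift[OF h h2 h'] stable_eq_trans[of x] by (auto split: if_splits)
  then have "x \<approx> con_seq (Suc k)"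
    using stable_eq_sym[OF con_seq[OF h2]] stable_eq_trans[of x _ "con_seq (Suc k)"]
    by (auto split: if_splits)
  then show "\<exists>h. syz_lift C S (k + 1) R k (con_seq k) h \<and> h \<approx> con_seq (Suc k)"
    using x by auto
qed

text \<open>Exactness of \<open>[X, \<Omega>D] -> [X, B] -> [X, C]\<close> at \<open>[X, B]\<close>.
  The factorisation \<open>v \<cdot> u\<close> of \<open>Sin H k \<cdot> f\<close> is split in two:
  \<open>q\<close> lifts \<open>Sout H k \<cdot> v\<close> to \<open>Pr S k\<close>, and
  \<open>v \<boxminus> l \<cdot> q\<close> comes from an arrow \<open>b\<close> into
  \<open>Syz R k\<close>. Then \<open>b \<cdot> u\<close> is stably null, while
  \<open>q \<cdot> u\<close> is killed by \<open>prj S k\<close> and so provides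
  \<open>w\<close>.\<close>

lemma stable_exact_con:
  assumes h: "con_lift C R S H k h" and f: "f \<in> Hom C X (Syz R k)" and n: "snull (Sin H k \<cdot> f)"
  obtains w where "w \<in> Hom C X (Syz S (Suc k))" "f \<approx> h \<cdot> w"
proof -
  obtain l where l: "h \<in> Hom C (Syz S (Suc k)) (Syz R k)" "l \<in> Hom C (Pr S k) (Syz M k)"
    "Sout H k \<cdot> l = prj S k" "Sin H k \<cdot> h = l \<cdot> inc S k"
    using con_liftE[OF h] .
  have "Sin H k \<cdot> f \<in> Hom C X (Syz M k)" using f ty by (simp add: Hom_iff typing)
  then obtain Q u v where Q: "projective C Q" "u \<in> Hom C X Q" "v \<in> Hom C Q (Syz M k)"
    "Sin H k \<cdot> f = v \<cdot> u"
    using snullE[OF n] by blast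
  have "Sout H k \<cdot> v \<in> Hom C Q (Syz S k)" using Q(3) ty by (simp add: Hom_iff typing)
  then obtain q where q: "q \<in> Hom C Q (Pr S k)" "prj S k \<cdot> q = Sout H k \<cdot> v"
    using resn_lift[OF S Q(1)] by blast
  have "Sout H k \<cdot> (v \<boxminus> l \<cdot> q) = Nul C Q (Syz S k)"
    using l(2) q(1) Q(3) ty by (simp only: dist comp_reduce[OF l(3)] q(2))
  then obtain b where b: "b \<in> Hom C Q (Syz R k)" "Sin H k \<cdot> b = v \<boxminus> l \<cdot> q"
    using S_kernel[of "v \<boxminus> l \<cdot> q" Q k] l(2) q(1) Q(3) by (auto simp: Hom_iff typing)
  have "prj S k \<cdot> (q \<cdot> u) = Sout H k \<cdot> (v \<cdot> u)"
    using q(1) Q(2,3) ty by (subst comp_reduce[OF q(2)]) (simp_all only: dist)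
  also have "\<dots> = Nul C X (Syz S k)"
    unfolding Q(4)[symmetric] using f ty
    by (subst comp_reduce[OF zero_S]) (auto simp: Hom_iff Nul_comp)
  finally obtain w where w: "w \<in> Hom C X (Syz S (Suc k))" "inc S k \<cdot> w = q \<cdot> u"
    using resn_kernel[OF S, of "q \<cdot> u" X k] q(1) Q(2) by (auto simp: Hom_iff typing)
  have "Sin H k \<cdot> (f \<boxminus> b \<cdot> u) = v \<cdot> u \<boxminus> (v \<boxminus> l \<cdot> q) \<cdot> u"
    using f b(1) Q(2) ty by (simp only: dist Q(4) comp_reduce[OF b(2)])
  also have "\<dots> = l \<cdot> (q \<cdot> u)"
    using l(2) q(1) Q(2,3) by (simp add: arith)
  also have "\<dots> = Sin H k \<cdot> (h \<cdot> w)"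
    unfolding w(2)[symmetric] using l(1,2) w(1) ty
    by (subst comp_reduce[OF l(4)]) (simp_all only: dist)
  finally have *: "f \<boxminus> b \<cdot> u = h \<cdot> w"
    by (rule S_mono) (use f b(1) l(1) w(1) Q(2) ty in \<open>auto simp: Hom_iff typing\<close>)
  have hw: "h \<cdot> w \<in> Hom C X (Syz R k)" and bu: "b \<cdot> u \<in> Hom C X (Syz R k)"
    using l(1) w(1) b(1) Q(2) comp by blast+
  have "f \<approx> h \<cdot> w"
    by (rule stable_eqI[OF f hw add_eq_swap[OF f bu hw *] Q(1,2) b(1)])
  then show thesis using that w(1) by blast
qed

text \<open>Exactness one place further left, at \<open>[X, \<Omega>D]\<close> in
  \<open>[X, \<Omega>C] -> [X, \<Omega>D] -> [X, B]\<close>. The arrow \<open>?y\<close> combines a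
  lift of \<open>l\<close> with a lift of the factorisation of \<open>h \<cdot> f\<close> so that
  \<open>prj M k\<close> kills it. The resulting \<open>w\<close> maps to \<open>f\<close> up to
  \<open>e \<cdot> ?q\<close>, which passes through \<open>Pr S k\<close>.\<close>

lemma stable_exact_Sout:
  assumes h: "con_lift C R S H k h" and f: "f \<in> Hom C X (Syz S (Suc k))" and n: "snull (h \<cdot> f)"
  obtains w where "w \<in> Hom C X (Syz M (Suc k))" "f \<approx> Sout H (Suc k) \<cdot> w"
proof -
  obtain l where l: "h \<in> Hom C (Syz S (Suc k)) (Syz R k)" "l \<in> Hom C (Pr S k) (Syz M k)"
    "Sout H k \<cdot> l = prj S k" "Sin H k \<cdot> h = l \<cdot> inc S k"
    using con_liftE[OF h] .
  obtain Q u v where Q: "projective C Q" "u \<in> Hom C X Q" "v \<in> Hom C Q (Syz R k)" "h \<cdot> f = v \<cdot> u"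
    using snullE[OF n comp[OF f l(1)]] by blast
  obtain v' where v': "v' \<in> Hom C Q (Pr R k)" "prj R k \<cdot> v' = v"
    using resn_lift[OF R Q(1,3)] .
  obtain l' where l': "l' \<in> Hom C (Pr S k) (Pr M k)" "prj M k \<cdot> l' = l"
    using resn_lift[OF M(1) resn_projective[OF S] l(2)] .
  have 1: "prj S k \<cdot> (Pout H k \<cdot> l') = prj S k"
    using l'(1) ty by (subst comp_reduce[OF square(2)]) (simp_all only: dist l'(2) l(3))
  have "prj S k \<cdot> (Pout H k \<cdot> l' \<boxminus> Idt C (Pr S k)) = Nul C (Pr S k) (Syz S k)"
    using l'(1) ty by (simp only: dist 1)
  then obtain e where e: "e \<in> Hom C (Pr S k) (Syz S (Suc k))"
    "inc S k \<cdot> e = Pout H k \<cdot> l' \<boxminus> Idt C (Pr S k)"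
    using resn_kernel[OF S, of "Pout H k \<cdot> l' \<boxminus> Idt C (Pr S k)" "Pr S k" k] l'(1) ty
    by (auto simp: Hom_iff typing)
  have e': "Pout H k \<cdot> l' = Idt C (Pr S k) \<boxplus> inc S k \<cdot> e"
    using e l'(1) ty sub_eq_iff[of "Pout H k \<cdot> l'" _ _ "Idt C (Pr S k)" "inc S k \<cdot> e"]
    by (simp add: Hom_iff typing)
  let ?q = "inc S k \<cdot> f"
  let ?y = "l' \<cdot> ?q \<boxminus> Pin H k \<cdot> (v' \<cdot> u)"
  have "prj M k \<cdot> ?y = l \<cdot> ?q \<boxminus> (prj M k \<cdot> Pin H k) \<cdot> (v' \<cdot> u)"
    using l'(1) v'(1) Q(2) f ty by (simp only: dist comp_reduce[OF l'(2)])
  also have "\<dots> = l \<cdot> ?q \<boxminus> Sin H k \<cdot> (v \<cdot> u)"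
    using Q(2) v'(1) ty by (simp only: square(1) dist comp_reduce[OF v'(2)])
  also have "\<dots> = l \<cdot> ?q \<boxminus> (Sin H k \<cdot> h) \<cdot> f"
    unfolding Q(4)[symmetric] using f l(1) ty by (simp only: dist)
  also have "\<dots> = Nul C X (Syz M k)"
    using l(2) f ty by (simp only: l(4) dist)
  finally obtain w where w: "w \<in> Hom C X (Syz M (Suc k))" "inc M k \<cdot> w = ?y"
    using resn_kernel[OF M(1), of ?y X k] l'(1) v'(1) Q(2) f ty by (auto simp: Hom_iff typing)
  have "inc S k \<cdot> (Sout H (Suc k) \<cdot> w) = Pout H k \<cdot> ?y"
    using w(1) ty by (subst comp_reduce[OF square(4)]) (simp_all only: dist w(2))
  also have "\<dots> = (Pout H k \<cdot> l') \<cdot> ?q"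
    using l'(1) v'(1) Q(2) f Hom_objs(1)[OF f] ty by (simp only: dist comp_reduce[OF zero_P])
  also have "\<dots> = inc S k \<cdot> (f \<boxplus> e \<cdot> ?q)"
    using e(1) f ty unfolding e' by (simp only: dist)
  finally have w2: "Sout H (Suc k) \<cdot> w = f \<boxplus> e \<cdot> ?q"
    by (rule resn_mono[OF S]) (use w(1) e(1) f ty in \<open>auto simp: Hom_iff typing\<close>)
  have sw: "Sout H (Suc k) \<cdot> w \<in> Hom C X (Syz S (Suc k))" and q: "?q \<in> Hom C X (Pr S k)"
    using w(1) f ty by (simp_all add: Hom_iff typing)
  have "Sout H (Suc k) \<cdot> w \<boxminus> f = e \<cdot> ?q"
    using w2 sub_eq_iff[OF sw f comp[OF q e(1)]] by simp
  then have "Sout H (Suc k) \<cdot> w \<approx> f"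
    by (rule stable_eqI[OF sw f _ resn_projective[OF S] q e(1)])
  then show thesis using that w(1) stable_eq_sym by blast
qed

lemma Sin_con_lift:
  assumes "con_lift C R S H k h"
  shows "Sin H k \<cdot> h \<approx> Nul C (Syz S (Suc k)) (Syz M k)"
  using con_liftE[OF assms] resn_snull[OF S] by metis

text \<open>The arrows \<open>prj M k\<close> and \<open>l \<cdot> Pout H k\<close> have the same
  composite with \<open>Sout H k\<close>, so they differ by an arrow \<open>z\<close> into
  \<open>Syz R k\<close>. Restricted to the next syzygy, the negative of \<open>z\<close> is the
  composite in question, which thus factors through \<open>Pr M k\<close>.\<close>

lemma con_lift_Sout:
  assumes "con_lift C R S H k h"
  shows "h \<cdot> Sout H (Suc k) \<approx> Nul C (Syz M (Suc k)) (Syz R k)"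
proof -
  obtain l where l: "h \<in> Hom C (Syz S (Suc k)) (Syz R k)" "l \<in> Hom C (Pr S k) (Syz M k)"
    "Sout H k \<cdot> l = prj S k" "Sin H k \<cdot> h = l \<cdot> inc S k"
    using con_liftE[OF assms] .
  have "Sout H k \<cdot> (prj M k \<boxminus> l \<cdot> Pout H k) = Nul C (Pr M k) (Syz S k)"
    using l(2) ty by (simp only: dist comp_reduce[OF l(3)] square(2))
  then obtain z where z: "z \<in> Hom C (Pr M k) (Syz R k)" "Sin H k \<cdot> z = prj M k \<boxminus> l \<cdot> Pout H k"
    using S_kernel[of "prj M k \<boxminus> l \<cdot> Pout H k" "Pr M k" k] l(2) ty by (auto simp: Hom_iff typing)
  have "Sin H k \<cdot> (neg z \<cdot> inc M k) = neg ((prj M k \<boxminus> l \<cdot> Pout H k) \<cdot> inc M k)"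
    using z(1) ty by (simp only: dist comp_reduce[OF z(2)])
  also have "\<dots> = l \<cdot> (Pout H k \<cdot> inc M k)"
    using l(2) ty by (simp only: dist resn_zero[OF M(1)])
  also have "\<dots> = Sin H k \<cdot> (h \<cdot> Sout H (Suc k))"
    unfolding square(4)[symmetric] using l(1,2) ty
    by (subst comp_reduce[OF l(4)]) (simp_all only: dist)
  finally have "neg z \<cdot> inc M k = h \<cdot> Sout H (Suc k)"
    by (rule S_mono) (use z(1) l(1) ty in \<open>auto simp: Hom_iff typing\<close>)
  then show ?thesis using resn_snull[OF M(1) Hom_closed(3)[OF z(1)]] by simp
qed

lemma slift_Sin: "slift 0 R M (Sin H)" and slift_Sout: "slift 0 M S (Sout H)"
proof -
  have "syz_lift C R k M k (Sin H k) (Sin H (Suc k))" for k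
    unfolding syz_lift_def using ty square(1,3) by (auto simp: Hom_iff intro!: bexI[of _ "Pin H k"])
  then show "slift 0 R M (Sin H)"
    unfolding slift_def using stable_eq_refl[OF typing_horseshoe(7)] syz_lift_Hom(1) by fastforce
  have "syz_lift C M k S k (Sout H k) (Sout H (Suc k))" for k
    unfolding syz_lift_def using ty square(2,4) by (auto simp: Hom_iff intro!: bexI[of _ "Pout H k"])
  then show "slift 0 M S (Sout H)"
    unfolding slift_def using stable_eq_refl[OF typing_horseshoe(10)] syz_lift_Hom(1) by fastforce
qed

end

context projective_abelian_category
begin

text \<open>The arrows \<open>b \<cdot> l\<close> and \<open>l' \<cdot> g\<close> both lift
  \<open>c \<cdot> prj S 0\<close> along \<open>p'\<close>, so they differ by an arrow
  \<open>e\<close> into the kernel, and \<open>e \<cdot> inc S 0\<close> is the difference of the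
  two sides. Only degree 0 is treated, since there \<open>b\<close> compares the middle terms, while
  no map between the two horseshoes is given.\<close>

lemma con_lift_natural:
  assumes H: "horseshoe_setup C R S i p H" and H': "horseshoe_setup C R' S' i' p' H'"
    and h: "con_lift C R S H 0 h" and h': "con_lift C R' S' H' 0 h'"
    and abc: "a \<in> Hom C (Dom C i) (Dom C i')" "b \<in> Hom C (Cod C i) (Cod C i')"
      "c \<in> Hom C (Cod C p) (Cod C p')" "b \<cdot> i = i' \<cdot> a" "c \<cdot> p = p' \<cdot> b"
    and c1: "syz_lift C S 0 S' 0 c c1"
  shows "a \<cdot> h \<approx> h' \<cdot> c1"
proof -
  interpret H: horseshoe_setup C R S i p H by fact
  interpret H': horseshoe_setup C R' S' i' p' H' by fact
  have ty: "Dom C i = Syz R 0" "Cod C i = Syz (Mid H) 0" "Dom C p = Syz (Mid H) 0" "Cod C p = Syz S 0"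
    "Dom C i' = Syz R' 0" "Cod C i' = Syz (Mid H') 0" "Dom C p' = Syz (Mid H') 0" "Cod C p' = Syz S' 0"
    "i \<in> Arr C" "p \<in> Arr C" "i' \<in> Arr C" "p' \<in> Arr C"
    using H.ty(7-12)[of 0] H'.ty(7-12)[of 0] unfolding H.base H'.base by simp_all
  note ty = ty resn_typing[OF H.S] resn_typing[OF H.R] resn_typing[OF H'.R] resn_typing[OF H'.S]
  note abc' = abc(1-3)[unfolded ty(1-8)]
  obtain l where l: "h \<in> Hom C (Syz S (Suc 0)) (Syz R 0)" "l \<in> Hom C (Pr S 0) (Syz (Mid H) 0)"
    "p \<cdot> l = prj S 0" "i \<cdot> h = l \<cdot> inc S 0"
    using H.con_liftE[OF h] unfolding H.base .
  obtain l' where l': "h' \<in> Hom C (Syz S' (Suc 0)) (Syz R' 0)" "l' \<in> Hom C (Pr S' 0) (Syz (Mid H') 0)"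
    "p' \<cdot> l' = prj S' 0" "i' \<cdot> h' = l' \<cdot> inc S' 0"
    using H'.con_liftE[OF h'] unfolding H'.base .
  obtain g where g: "g \<in> Hom C (Pr S 0) (Pr S' 0)" "prj S' 0 \<cdot> g = c \<cdot> prj S 0"
    "inc S' 0 \<cdot> c1 = g \<cdot> inc S 0" and c1': "c1 \<in> Hom C (Syz S (Suc 0)) (Syz S' (Suc 0))"
    using c1 unfolding syz_lift_def by auto
  have "p' \<cdot> (b \<cdot> l \<boxminus> l' \<cdot> g) = Nul C (Pr S 0) (Syz S' 0)"
    using l(2) l'(2) g(1) abc' ty
    by (simp only: dist comp_reduce[OF l'(3)] g(2) comp_reduce[OF abc(5)[symmetric]] l(3))
  then obtain e where e: "e \<in> Hom C (Pr S 0) (Syz R' 0)" "i' \<cdot> e = b \<cdot> l \<boxminus> l' \<cdot> g"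
    using H'.S_kernel[of "b \<cdot> l \<boxminus> l' \<cdot> g" "Pr S 0" 0] l(2) l'(2) g(1) abc'
    unfolding H'.base by (auto simp: Hom_iff typing)
  have "i' \<cdot> (e \<cdot> inc S 0) = (b \<cdot> l \<boxminus> l' \<cdot> g) \<cdot> inc S 0"
    using e(1) ty by (subst comp_reduce[OF e(2)]) (auto simp: Hom_iff)
  also have "\<dots> = b \<cdot> (i \<cdot> h) \<boxminus> l' \<cdot> (inc S' 0 \<cdot> c1)"
    using l(2) l'(2) g(1) abc'(2) ty unfolding l(4) g(3) by (simp only: dist)
  also have "\<dots> = i' \<cdot> (a \<cdot> h \<boxminus> h' \<cdot> c1)"
    using l(1) l'(1,2) c1' abc'(1,2) ty
    by (simp only: dist comp_reduce[OF abc(4)] comp_reduce[OF l'(4)])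
  finally have "e \<cdot> inc S 0 = a \<cdot> h \<boxminus> h' \<cdot> c1"
    using H'.S_mono[of 0 "e \<cdot> inc S 0" "a \<cdot> h \<boxminus> h' \<cdot> c1" "Syz S (Suc 0)"]
      e(1) l(1) l'(1) c1' abc'(1) ty unfolding H'.base by (simp add: Hom_iff typing)
  then show ?thesis
    by (intro stable_eqI[OF comp[OF l(1) abc'(1)] comp[OF c1' l'(1)] _ resn_projective[OF H.S] _ e(1),
          of "inc S 0"]) (use ty in \<open>simp_all add: Hom_iff\<close>)
qed

end

section \<open>Sequential direct limits\<close>

text \<open>Well-definedness collapses the union in \<open>class_map\<close> to a single set,
  provided that some representative has a value at all.\<close>

lemma class_map_eqI:
  assumes "x \<in> X" "r x Y" "\<And>x' Z. x' \<in> X \<Longrightarrow> r x' Z \<Longrightarrow> Z = Y"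
  shows "class_map r X = Y"
  unfolding class_map_def using assms by blast

lemma (in comm_group) rcos_eq_iff:
  assumes "subgroup N G" "x \<in> carrier G" "y \<in> carrier G"
  shows "N #> x = N #> y \<longleftrightarrow> x \<otimes> inv y \<in> N"
proof -
  have "x \<otimes> inv y \<in> N \<longleftrightarrow> x \<in> N #> y"
    using subgroup.rcos_module[OF assms(1) is_group assms(3,2)] by simp
  then show ?thesis
    using repr_independence[of x N y] rcos_self[OF assms(2,1)] assms by metis
qed

locale group_seq =
  fixes I :: "nat set" and G :: "nat \<Rightarrow> 'a monoid" and t :: "nat \<Rightarrow> 'a \<Rightarrow> 'a"
  assumes up: "k \<in> I \<Longrightarrow> Suc k \<in> I" and nonempty: "I \<noteq> {}"
    and groups: "k \<in> I \<Longrightarrow> comm_group (G k)"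
    and trans_hom: "k \<in> I \<Longrightarrow> t k \<in> hom (G k) (G (Suc k))"
begin

lemma up_add: "k \<in> I \<Longrightarrow> k + j \<in> I"
  using up by (induction j) auto

lemma trans_map_closed: "k \<in> I \<Longrightarrow> a \<in> carrier (G k) \<Longrightarrow> trans_map t k j a \<in> carrier (G (k + j))"
proof (induction j)
  case (Suc j)
  then show ?case using trans_hom[OF up_add, of k j] by (auto simp: hom_def Pi_iff)
qed simp

lemma trans_map_mult:
  "\<lbrakk>k \<in> I; a \<in> carrier (G k); b \<in> carrier (G k)\<rbrakk> \<Longrightarrow>
   trans_map t k j (a \<otimes>\<^bsub>G k\<^esub> b) = trans_map t k j a \<otimes>\<^bsub>G (k + j)\<^esub> trans_map t k j b"
proof (induction j)
  case (Suc j)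
  then show ?case
    using trans_hom[OF up_add, of k j] trans_map_closed[of k _ j] by (simp add: hom_def)
qed simp

lemma trans_map_hom: "k \<in> I \<Longrightarrow> trans_map t k j \<in> hom (G k) (G (k + j))"
  by (simp add: hom_def Pi_iff trans_map_closed trans_map_mult)

lemma trans_map_one: "k \<in> I \<Longrightarrow> trans_map t k j \<one>\<^bsub>G k\<^esub> = \<one>\<^bsub>G (k + j)\<^esub>"
  using trans_map_hom[of k j] groups[of k] groups[OF up_add, of k j] hom_one
  by (metis comm_group_def)

lemma trans_map_add: "trans_map t k (i + j) a = trans_map t (k + i) j (trans_map t k i a)"
  by (induction j) (simp_all add: add.assoc)

lemma trans_map_Suc: "trans_map t k (Suc j) a = trans_map t (Suc k) j (t k a)"
  using trans_map_add[of k 1 j a] by simp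

abbreviation "rel \<equiv> dirlim_rel I G t"

definition cls :: "nat \<Rightarrow> 'a \<Rightarrow> (nat \<times> 'a) set" where
  "cls k a = rel `` {(k, a)}"

lemma equiv_rel: "equiv (SIGMA k:I. carrier (G k)) rel"
proof (rule equivI)
  show "rel \<subseteq> (SIGMA k:I. carrier (G k)) \<times> (SIGMA k:I. carrier (G k))"
    by (auto simp: dirlim_rel_def)
  show "refl_on (SIGMA k:I. carrier (G k)) rel"
    by (auto simp: refl_on_def dirlim_rel_def)
  show "sym rel" unfolding sym_def dirlim_rel_def by (clarsimp, metis)
  show "trans rel"
  proof (rule transI)
    fix x y z assume xy: "(x, y) \<in> rel" and yz: "(y, z) \<in> rel"
    obtain k a l b m c where [simp]: "x = (k, a)" "y = (l, b)" "z = (m, c)" by (metis surj_pair)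
    from xy obtain j j' where 1: "k + j = l + j'" "trans_map t k j a = trans_map t l j' b"
      by (auto simp: dirlim_rel_def)
    from yz obtain i i' where 2: "l + i = m + i'" "trans_map t l i b = trans_map t m i' c"
      by (auto simp: dirlim_rel_def)
    have "trans_map t k (j + i) a = trans_map t l (j' + i) b"
      using 1 by (simp add: trans_map_add)
    also have "\<dots> = trans_map t m (i' + j') c"
      using 2 by (simp add: trans_map_add add.commute[of j'])
    finally have "\<exists>j j'. k + j = m + j' \<and> trans_map t k j a = trans_map t m j' c"
      using 1(1) 2(1) by (intro exI[of _ "j + i"] exI[of _ "i' + j'"]) simp
    then show "(x, z) \<in> rel"
      using xy yz unfolding dirlim_rel_def by simp
  qed
qed

lemma cls_eq_iff:
  assumes "k \<in> I" "a \<in> carrier (G k)" "l \<in> I" "b \<in> carrier (G l)"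
  shows "cls k a = cls l b \<longleftrightarrow> (\<exists>j j'. k + j = l + j' \<and> trans_map t k j a = trans_map t l j' b)"
  unfolding cls_def using eq_equiv_class_iff[OF equiv_rel, of "(k, a)" "(l, b)"] assms
  by (auto simp: dirlim_rel_def)

lemma cls_trans_map:
  assumes "k \<in> I" "a \<in> carrier (G k)"
  shows "cls (k + j) (trans_map t k j a) = cls k a"
proof -
  have "k + j + 0 = k + j \<and> trans_map t (k + j) 0 (trans_map t k j a) = trans_map t k j a" by simp
  then show ?thesis
    using cls_eq_iff[OF up_add[OF assms(1)] trans_map_closed[OF assms] assms] by blast
qed

lemma cls_trans: "k \<in> I \<Longrightarrow> a \<in> carrier (G k) \<Longrightarrow> cls (Suc k) (t k a) = cls k a"
  using cls_trans_map[of k a 1] by simp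

lemma cls_closed: "k \<in> I \<Longrightarrow> a \<in> carrier (G k) \<Longrightarrow> cls k a \<in> carrier (dirlim I G t)"
  by (auto simp: dirlim_def cls_def intro: quotientI)

text \<open>The bound \<open>N\<close> is free: a representative can be pushed along the transition
  maps as far as desired, for instance to the stages at which a connecting map is given.\<close>

lemma dirlim_cases:
  assumes "x \<in> carrier (dirlim I G t)"
  obtains k a where "k \<ge> N" "k \<in> I" "a \<in> carrier (G k)" "x = cls k a"
proof -
  obtain k a where ka: "k \<in> I" "a \<in> carrier (G k)" "x = cls k a"
    using assms by (auto simp: dirlim_def cls_def elim!: quotientE)
  show thesis
    using that[of "k + N" "trans_map t k N a"] ka up_add[of k N] trans_map_closed[of k a N]
      cls_trans_map[of k a N] by simp
qed

lemma mem_cls_iff: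
  assumes "k \<in> I" "a \<in> carrier (G k)"
  shows "(l, b) \<in> cls k a \<longleftrightarrow> l \<in> I \<and> b \<in> carrier (G l) \<and> cls l b = cls k a"
  using equiv_class_eq_iff[OF equiv_rel, of "(k, a)" "(l, b)"] assms unfolding cls_def by auto

text \<open>The product in \<open>dirlim\<close> is a union over all pairs of representatives at a
  common stage. It is a single class, because any two such pairs agree once they have been moved to
  one later stage.\<close>

lemma mult_cls:
  assumes k: "k \<in> I" "a \<in> carrier (G k)" "b \<in> carrier (G k)"
  shows "cls k a \<otimes>\<^bsub>dirlim I G t\<^esub> cls k b = cls k (a \<otimes>\<^bsub>G k\<^esub> b)"
proof -
  have *: "cls l (c \<otimes>\<^bsub>G l\<^esub> d) = cls k (a \<otimes>\<^bsub>G k\<^esub> b)" if "(l, c) \<in> cls k a" "(l, d) \<in> cls k b" for l c d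
  proof -
    have lc: "l \<in> I" "c \<in> carrier (G l)" "cls l c = cls k a" "d \<in> carrier (G l)" "cls l d = cls k b"
      using that mem_cls_iff k by auto
    interpret Gk: comm_group "G k" using groups k by blast
    interpret Gl: comm_group "G l" using groups lc by blast
    obtain j j' where j: "l + j = k + j'" "trans_map t l j c = trans_map t k j' a"
      using lc(3) cls_eq_iff[OF lc(1,2) k(1,2)] by blast
    obtain i i' where i: "l + i = k + i'" "trans_map t l i d = trans_map t k i' b"
      using lc(5) cls_eq_iff[OF lc(1,4) k(1,3)] by blast
    \<comment> \<open>The two comparisons end at different stages \<open>l + j\<close> and
      \<open>l + i\<close>; both are pushed on to \<open>l + (j + i)\<close>.\<close>
    have ji: "i + j' = j + i'" using i(1) j(1) by linarith
    have c': "trans_map t l (j + i) c = trans_map t k (j' + i) a"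
      using j by (simp add: trans_map_add)
    have "trans_map t l (i + j) d = trans_map t k (i' + j) b"
      using i by (simp add: trans_map_add)
    then have d': "trans_map t l (j + i) d = trans_map t k (j' + i) b"
      using ji by (simp add: add.commute)
    have e: "l + (j + i) = k + (j' + i)" using j by simp
    have "trans_map t l (j + i) (c \<otimes>\<^bsub>G l\<^esub> d) = trans_map t k (j' + i) (a \<otimes>\<^bsub>G k\<^esub> b)"
      using trans_map_mult[OF lc(1,2,4), of "j + i"] trans_map_mult[OF k, of "j' + i"] c' d' e by simp
    then show ?thesis
      using cls_eq_iff[OF lc(1) Gl.m_closed[OF lc(2,4)] k(1) Gk.m_closed[OF k(2,3)]] e by blast
  qed
  have "(k, a) \<in> cls k a" "(k, b) \<in> cls k b" using mem_cls_iff k by auto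
  with * have "{cls l (c \<otimes>\<^bsub>G l\<^esub> d) | l c d. (l, c) \<in> cls k a \<and> (l, d) \<in> cls k b} =
      {cls k (a \<otimes>\<^bsub>G k\<^esub> b)}"
    by blast
  then show ?thesis by (simp add: dirlim_def cls_def)
qed

lemma one_cls:
  assumes "k \<in> I" shows "\<one>\<^bsub>dirlim I G t\<^esub> = cls k \<one>\<^bsub>G k\<^esub>"
proof -
  have "cls l \<one>\<^bsub>G l\<^esub> = cls k \<one>\<^bsub>G k\<^esub>" if "l \<in> I" for l
  proof -
    have "trans_map t l k \<one>\<^bsub>G l\<^esub> = trans_map t k l \<one>\<^bsub>G k\<^esub>"
      using that assms by (simp add: trans_map_one add.commute)
    then show ?thesis
      using cls_eq_iff[of l "\<one>\<^bsub>G l\<^esub>" k "\<one>\<^bsub>G k\<^esub>"] that assms groups[of l] groups[of k]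
      by (metis add.commute comm_group_def group.is_monoid monoid.one_closed)
  qed
  then have "{cls l \<one>\<^bsub>G l\<^esub> | l. l \<in> I} = {cls k \<one>\<^bsub>G k\<^esub>}" using assms by blast
  then show ?thesis by (simp add: dirlim_def cls_def)
qed

lemma dirlim_cases2:
  assumes "x \<in> carrier (dirlim I G t)" "y \<in> carrier (dirlim I G t)"
  obtains k a b where "k \<ge> N" "k \<in> I" "a \<in> carrier (G k)" "x = cls k a"
    "b \<in> carrier (G k)" "y = cls k b"
proof -
  obtain k a where a: "k \<ge> N" "k \<in> I" "a \<in> carrier (G k)" "x = cls k a"
    using dirlim_cases[OF assms(1)] .
  obtain l b where b: "l \<ge> k" "l \<in> I" "b \<in> carrier (G l)" "y = cls l b"
    using dirlim_cases[OF assms(2)] .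
  show thesis
    using that[of l "trans_map t k (l - k) a" b] a b trans_map_closed[of k a "l - k"]
      cls_trans_map[of k a "l - k"] by simp
qed

lemma comm_group_dirlim: "comm_group (dirlim I G t)"
proof (rule comm_groupI)
  obtain k where k: "k \<in> I" using nonempty by blast
  show "\<one>\<^bsub>dirlim I G t\<^esub> \<in> carrier (dirlim I G t)"
    using k cls_closed one_cls groups[OF k] by (metis comm_group_def group.is_monoid monoid.one_closed)
  fix x y assume xy: "x \<in> carrier (dirlim I G t)" "y \<in> carrier (dirlim I G t)"
  obtain k a b where k: "k \<in> I" "a \<in> carrier (G k)" "x = cls k a" "b \<in> carrier (G k)" "y = cls k b"
    using dirlim_cases2[OF xy] by metis
  interpret comm_group "G k" using groups k by blast
  show "x \<otimes>\<^bsub>dirlim I G t\<^esub> y \<in> carrier (dirlim I G t)"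
    using k by (simp add: mult_cls cls_closed)
  show "x \<otimes>\<^bsub>dirlim I G t\<^esub> y = y \<otimes>\<^bsub>dirlim I G t\<^esub> x"
    using k by (simp add: mult_cls m_comm)
  show "\<one>\<^bsub>dirlim I G t\<^esub> \<otimes>\<^bsub>dirlim I G t\<^esub> x = x"
    using k by (simp add: mult_cls one_cls)
  have "inv\<^bsub>G k\<^esub> a \<otimes>\<^bsub>G k\<^esub> a = \<one>\<^bsub>G k\<^esub>" using k l_inv by blast
  then show "\<exists>y\<in>carrier (dirlim I G t). y \<otimes>\<^bsub>dirlim I G t\<^esub> x = \<one>\<^bsub>dirlim I G t\<^esub>"
    using k mult_cls[OF k(1) inv_closed[OF k(2)] k(2)] cls_closed[OF k(1) inv_closed[OF k(2)]] one_cls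
    by (metis)
  fix z assume z: "z \<in> carrier (dirlim I G t)"
  obtain l b' c where l: "k \<le> l" "l \<in> I" "b' \<in> carrier (G l)" "y = cls l b'" "c \<in> carrier (G l)" "z = cls l c"
    using dirlim_cases2[OF xy(2) z, of k] by metis
  define a' where "a' = trans_map t k (l - k) a"
  have a': "a' \<in> carrier (G l)" "x = cls l a'"
    using k(1-3) l(1) trans_map_closed[of k a "l - k"] cls_trans_map[of k a "l - k"]
    by (auto simp: a'_def)
  interpret L: comm_group "G l" using groups l by blast
  show "x \<otimes>\<^bsub>dirlim I G t\<^esub> y \<otimes>\<^bsub>dirlim I G t\<^esub> z = x \<otimes>\<^bsub>dirlim I G t\<^esub> (y \<otimes>\<^bsub>dirlim I G t\<^esub> z)"
    using l a' by (simp add: mult_cls L.m_assoc)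
qed

lemma cls_eq_one:
  assumes "k \<in> I" "a \<in> carrier (G k)"
  shows "cls k a = \<one>\<^bsub>dirlim I G t\<^esub> \<longleftrightarrow> (\<exists>j. trans_map t k j a = \<one>\<^bsub>G (k + j)\<^esub>)"
proof -
  have 1: "\<one>\<^bsub>G k\<^esub> \<in> carrier (G k)"
    using groups[OF assms(1)] by (metis comm_group_def group.is_monoid monoid.one_closed)
  have "cls k a = \<one>\<^bsub>dirlim I G t\<^esub> \<longleftrightarrow> (\<exists>j. trans_map t k j a = trans_map t k j \<one>\<^bsub>G k\<^esub>)"
    using one_cls[OF assms(1)] cls_eq_iff[OF assms(1,2) assms(1) 1] by auto
  then show ?thesis using trans_map_one[OF assms(1)] by simp
qed

lemma dirlim_map_eqI:
  assumes "k \<in> I" "a \<in> carrier (G k)" "k \<in> J"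
    and "\<And>l b. l \<in> I \<Longrightarrow> l \<in> J \<Longrightarrow> b \<in> carrier (G l) \<Longrightarrow> cls l b = cls k a \<Longrightarrow> r `` {(l, \<phi> l b)} = Y"
  shows "dirlim_map J r \<phi> (cls k a) = Y"
proof -
  have "{r `` {(l, \<phi> l b)} | l b. l \<in> J \<and> (l, b) \<in> cls k a} = {Y}"
  proof -
    have "r `` {(l, \<phi> l b)} = Y" if "l \<in> J" "(l, b) \<in> cls k a" for l b
      using that mem_cls_iff[OF assms(1,2)] assms(4) by blast
    moreover have "(k, a) \<in> cls k a" using mem_cls_iff[OF assms(1,2)] assms(1,2) by blast
    ultimately show ?thesis using assms(3) by blast
  qed
  then show ?thesis unfolding dirlim_map_def by simp
qed

end

text \<open>Commutation with single transitions on \<open>J\<close> is enough: \<open>J\<close> is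
  closed under successors, so two representatives in \<open>J\<close> of the same class become equal
  along transitions that stay inside \<open>J\<close>.\<close>

lemma dirlim_map_cls:
  assumes G: "group_seq I G t" and G': "group_seq I' G' t'"
    and J: "\<And>k. k \<in> J \<Longrightarrow> k \<in> I \<and> k \<in> I' \<and> Suc k \<in> J"
    and closed: "\<And>k a. k \<in> J \<Longrightarrow> a \<in> carrier (G k) \<Longrightarrow> \<phi> k a \<in> carrier (G' k)"
    and comm: "\<And>k a. k \<in> J \<Longrightarrow> a \<in> carrier (G k) \<Longrightarrow> \<phi> (Suc k) (t k a) = t' k (\<phi> k a)"
    and k: "k \<in> J" "a \<in> carrier (G k)"
  shows "dirlim_map J (dirlim_rel I' G' t') \<phi> (group_seq.cls I G t k a) =
    group_seq.cls I' G' t' k (\<phi> k a)"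
proof -
  interpret A: group_seq I G t by fact
  interpret B: group_seq I' G' t' by fact
  have *: "\<phi> (l + j) (trans_map t l j b) = trans_map t' l j (\<phi> l b) \<and> l + j \<in> J"
    if "l \<in> J" "b \<in> carrier (G l)" for l b j
  proof (induction j)
    case (Suc j)
    have "trans_map t l j b \<in> carrier (G (l + j))" using A.trans_map_closed that J by blast
    then show ?case using Suc comm[of "l + j"] J[of "l + j"] by simp
  qed (use that in simp)
  show ?thesis
  proof (rule A.dirlim_map_eqI)
    fix l b assume l: "l \<in> I" "l \<in> J" "b \<in> carrier (G l)" "A.cls l b = A.cls k a"
    obtain j j' where j: "l + j = k + j'" "trans_map t l j b = trans_map t k j' a"
      using l A.cls_eq_iff[OF l(1,3) _ k(2)] J[OF k(1)] by auto
    have "B.cls l (\<phi> l b) = B.cls k (\<phi> k a)"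
      using B.cls_eq_iff[OF _ closed[OF l(2,3)] _ closed[OF k]] J[OF k(1)] J[OF l(2)]
        *[OF l(2,3), of j] *[OF k, of j'] j by metis
    then show "dirlim_rel I' G' t' `` {(l, \<phi> l b)} = B.cls k (\<phi> k a)"
      by (simp add: B.cls_def)
  qed (use k J in auto)
qed

section \<open>The naive construction\<close>

context comm_group
begin

lemma mem_rcos_iff:
  assumes "subgroup N G" "x \<in> carrier G"
  shows "y \<in> N #> x \<longleftrightarrow> y \<in> carrier G \<and> y \<otimes> inv x \<in> N"
  using subgroup.rcos_module[OF assms(1) is_group assms(2)] r_coset_subset_G[of N x] assms
    subgroup.subset[OF assms(1)] by blast

lemma FactGroup_rcos:
  assumes "subgroup N G"
  shows "x \<in> carrier G \<Longrightarrow> N #> x \<in> carrier (G Mod N)"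
    and "X \<in> carrier (G Mod N) \<Longrightarrow> \<exists>x\<in>carrier G. X = N #> x"
    and "\<lbrakk>x \<in> carrier G; y \<in> carrier G\<rbrakk> \<Longrightarrow> (N #> x) \<otimes>\<^bsub>G Mod N\<^esub> (N #> y) = N #> (x \<otimes> y)"
    and "\<one>\<^bsub>G Mod N\<^esub> = N #> \<one>"
    and "x \<in> carrier G \<Longrightarrow> inv\<^bsub>G Mod N\<^esub> (N #> x) = N #> inv x"
proof -
  have N: "N \<lhd> G" using assms normal_iff_subgroup by simp
  show 1: "x \<in> carrier G \<Longrightarrow> N #> x \<in> carrier (G Mod N)" for x
    by (auto simp: FactGroup_def RCOSETS_def)
  show "X \<in> carrier (G Mod N) \<Longrightarrow> \<exists>x\<in>carrier G. X = N #> x"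
    by (auto simp: FactGroup_def RCOSETS_def)
  show 2: "\<lbrakk>x \<in> carrier G; y \<in> carrier G\<rbrakk> \<Longrightarrow> (N #> x) \<otimes>\<^bsub>G Mod N\<^esub> (N #> y) = N #> (x \<otimes> y)" for x y
    using normal.rcos_sum[OF N] by (simp add: FactGroup_def)
  show 3: "\<one>\<^bsub>G Mod N\<^esub> = N #> \<one>"
    using assms by (simp add: FactGroup_def coset_mult_one subgroup.subset)
  interpret Q: comm_group "G Mod N" using abelian_FactGroup[OF assms] .
  show "inv\<^bsub>G Mod N\<^esub> (N #> x) = N #> inv x" if "x \<in> carrier G"
  proof (rule Q.inv_equality)
    have "(N #> inv x) \<otimes>\<^bsub>G Mod N\<^esub> (N #> x) = N #> (inv x \<otimes> x)" using that by (intro 2) auto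
    then show "(N #> inv x) \<otimes>\<^bsub>G Mod N\<^esub> (N #> x) = \<one>\<^bsub>G Mod N\<^esub>" using that 3 by simp
  qed (use that 1 in auto)
qed

end

context projective_abelian_category
begin

section \<open>Stable Hom groups and classes of arrows\<close>

lemma factor_proj_iff: "f \<in> factor_proj C X Y \<longleftrightarrow> f \<in> Hom C X Y \<and> snull f"
proof
  assume f: "f \<in> factor_proj C X Y"
  then have "f \<in> Hom C X Y" unfolding factor_proj_def using comp by blast
  with f show "f \<in> Hom C X Y \<and> snull f" by (auto simp: snull_def Hom_iff)
next
  assume "f \<in> Hom C X Y \<and> snull f"
  then show "f \<in> factor_proj C X Y" unfolding snull_def Hom_iff by metis
qed

lemma subgroup_factor_proj:
  assumes "X \<in> Obj C" "Y \<in> Obj C"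
  shows "subgroup (factor_proj C X Y) (hom_group C X Y)"
proof -
  interpret comm_group "hom_group C X Y" using assms by (rule hom_comm_group)
  show ?thesis
  proof (rule subgroup.intro)
    show "factor_proj C X Y \<subseteq> carrier (hom_group C X Y)"
      by (auto simp: factor_proj_iff)
    show "\<one>\<^bsub>hom_group C X Y\<^esub> \<in> factor_proj C X Y"
      using assms by (simp add: factor_proj_iff Hom_closed snull_Nul)
    show "x \<otimes>\<^bsub>hom_group C X Y\<^esub> y \<in> factor_proj C X Y"
      if "x \<in> factor_proj C X Y" "y \<in> factor_proj C X Y" for x y
      using that Hom_closed snull_add by (auto simp: factor_proj_iff)
    show "inv\<^bsub>hom_group C X Y\<^esub> x \<in> factor_proj C X Y" if "x \<in> factor_proj C X Y" for x
      using that Hom_closed snull_neg by (simp add: factor_proj_iff inv_hom_group)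
  qed
qed

lemma comm_group_stable_hom: "X \<in> Obj C \<Longrightarrow> Y \<in> Obj C \<Longrightarrow> comm_group (stable_hom C X Y)"
  unfolding stable_hom_def
  by (rule comm_group.abelian_FactGroup[OF hom_comm_group subgroup_factor_proj])

lemma stable_class_eq_iff:
  assumes "f \<in> Hom C X Y" "g \<in> Hom C X Y"
  shows "stable_class C X Y f = stable_class C X Y g \<longleftrightarrow> f \<approx> g"
proof -
  note obj = Hom_objs[OF assms(1)]
  interpret comm_group "hom_group C X Y" by (rule hom_comm_group[OF obj])
  show ?thesis
    unfolding stable_class_def using rcos_eq_iff[OF subgroup_factor_proj[OF obj], of f g] assms
    by (simp add: inv_hom_group factor_proj_iff Hom_closed stable_eq_def) (auto simp: Hom_iff)
qed

lemma mem_stable_class_iff: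
  assumes "f \<in> Hom C X Y"
  shows "g \<in> stable_class C X Y f \<longleftrightarrow> g \<in> Hom C X Y \<and> g \<approx> f"
proof -
  note obj = Hom_objs[OF assms(1)]
  interpret comm_group "hom_group C X Y" by (rule hom_comm_group[OF obj])
  show ?thesis
    unfolding stable_class_def using mem_rcos_iff[OF subgroup_factor_proj[OF obj], of f g] assms
    by (simp add: inv_hom_group factor_proj_iff) (auto simp: Hom_iff stable_eq_def typing)
qed

lemma
  assumes obj: "X \<in> Obj C" "Y \<in> Obj C"
  shows stable_class_Nul: "\<one>\<^bsub>stable_hom C X Y\<^esub> = stable_class C X Y (Nul C X Y)"
    and stable_hom_cases': "x \<in> carrier (stable_hom C X Y) \<Longrightarrow> \<exists>f\<in>Hom C X Y. x = stable_class C X Y f"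
    and stable_class_closed': "f \<in> Hom C X Y \<Longrightarrow> stable_class C X Y f \<in> carrier (stable_hom C X Y)"
    and stable_class_mult': "\<lbrakk>f \<in> Hom C X Y; g \<in> Hom C X Y\<rbrakk> \<Longrightarrow>
      stable_class C X Y f \<otimes>\<^bsub>stable_hom C X Y\<^esub> stable_class C X Y g = stable_class C X Y (f \<boxplus> g)"
    and stable_class_neg': "f \<in> Hom C X Y \<Longrightarrow>
      inv\<^bsub>stable_hom C X Y\<^esub> stable_class C X Y f = stable_class C X Y (neg f)"
proof -
  interpret comm_group "hom_group C X Y" by (rule hom_comm_group[OF obj])
  note F = FactGroup_rcos[OF subgroup_factor_proj[OF obj], folded stable_hom_def stable_class_def,
      unfolded hom_group_simps]
  show "\<one>\<^bsub>stable_hom C X Y\<^esub> = stable_class C X Y (Nul C X Y)" by (rule F(4))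
  show "x \<in> carrier (stable_hom C X Y) \<Longrightarrow> \<exists>f\<in>Hom C X Y. x = stable_class C X Y f" by (rule F(2))
  show "f \<in> Hom C X Y \<Longrightarrow> stable_class C X Y f \<in> carrier (stable_hom C X Y)" by (rule F(1))
  show "\<lbrakk>f \<in> Hom C X Y; g \<in> Hom C X Y\<rbrakk> \<Longrightarrow>
      stable_class C X Y f \<otimes>\<^bsub>stable_hom C X Y\<^esub> stable_class C X Y g = stable_class C X Y (f \<boxplus> g)"
    by (rule F(3))
  show "f \<in> Hom C X Y \<Longrightarrow>
      inv\<^bsub>stable_hom C X Y\<^esub> stable_class C X Y f = stable_class C X Y (neg f)"
    using F(5)[of f] inv_hom_group[of f X Y] by simp
qed

lemma stable_class_closed: "f \<in> Hom C X Y \<Longrightarrow> stable_class C X Y f \<in> carrier (stable_hom C X Y)"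
  using stable_class_closed' Hom_objs by blast

lemma stable_class_mult:
  "\<lbrakk>f \<in> Hom C X Y; g \<in> Hom C X Y\<rbrakk> \<Longrightarrow>
   stable_class C X Y f \<otimes>\<^bsub>stable_hom C X Y\<^esub> stable_class C X Y g = stable_class C X Y (f \<boxplus> g)"
  using stable_class_mult' Hom_objs by blast

lemma stable_class_neg:
  "f \<in> Hom C X Y \<Longrightarrow> inv\<^bsub>stable_hom C X Y\<^esub> stable_class C X Y f = stable_class C X Y (neg f)"
  using stable_class_neg' Hom_objs by blast

lemma stable_hom_cases:
  assumes "x \<in> carrier (stable_hom C X Y)" "X \<in> Obj C" "Y \<in> Obj C"
  obtains f where "f \<in> Hom C X Y" "x = stable_class C X Y f"
  using stable_hom_cases' assms by blast

lemma signed_stable_class: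
  "f \<in> Hom C X Y \<Longrightarrow> signed (stable_hom C X Y) k (stable_class C X Y f) =
    stable_class C X Y (if even k then f else neg f)"
  by (simp add: signed_def stable_class_neg)

lemma class_map_comp:
  assumes "f \<in> Hom C X Y" "g \<in> Hom C Y Z"
  shows "class_map (\<lambda>f U. U = stable_class C X Z (g \<cdot> f)) (stable_class C X Y f) =
    stable_class C X Z (g \<cdot> f)"
proof (rule class_map_eqI)
  show "f \<in> stable_class C X Y f"
    using assms mem_stable_class_iff stable_eq_refl by (auto simp: Hom_iff)
  fix f' U assume f': "f' \<in> stable_class C X Y f" "U = stable_class C X Z (g \<cdot> f')"
  then have *: "f' \<in> Hom C X Y" "f' \<approx> f" using mem_stable_class_iff[OF assms(1)] by auto
  have "g \<cdot> f' \<approx> g \<cdot> f" using comp_stable_eq[OF *(2)] assms *(1) by (simp add: Hom_iff)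
  then show "U = stable_class C X Z (g \<cdot> f)"
    using f'(2) stable_class_eq_iff[OF comp[OF *(1) assms(2)] comp[OF assms]] by simp
qed simp

text \<open>Changing the representative or the lift alters \<open>h\<close> only within its stable
  class, by \<open>syz_lift_cong\<close>; this is the well-definedness of the transition
  maps.\<close>

lemma class_map_syz_lift:
  assumes "resn R" "resn S" "syz_lift C R k S l f h"
  shows "class_map (\<lambda>f Y. \<exists>h. syz_lift C R k S l f h \<and>
      Y = stable_class C (Syz R (Suc k)) (Syz S (Suc l)) h) (stable_class C (Syz R k) (Syz S l) f) =
    stable_class C (Syz R (Suc k)) (Syz S (Suc l)) h"
proof (rule class_map_eqI)
  note hom = syz_lift_Hom[OF assms(3)]
  show "f \<in> stable_class C (Syz R k) (Syz S l) f"
    using mem_stable_class_iff[OF hom(1)] hom(1) stable_eq_refl by (simp add: Hom_iff)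
  show "\<exists>h'. syz_lift C R k S l f h' \<and> stable_class C (Syz R (Suc k)) (Syz S (Suc l)) h =
    stable_class C (Syz R (Suc k)) (Syz S (Suc l)) h'"
    using assms(3) by blast
  fix f' Y assume "f' \<in> stable_class C (Syz R k) (Syz S l) f"
    "\<exists>h'. syz_lift C R k S l f' h' \<and> Y = stable_class C (Syz R (Suc k)) (Syz S (Suc l)) h'"
  then obtain h' where h': "f' \<approx> f" "syz_lift C R k S l f' h'"
    "Y = stable_class C (Syz R (Suc k)) (Syz S (Suc l)) h'"
    using mem_stable_class_iff[OF hom(1)] by auto
  have "h' \<approx> h" using syz_lift_cong[OF assms(1,2) h'(2) assms(3) h'(1)] .
  then show "Y = stable_class C (Syz R (Suc k)) (Syz S (Suc l)) h"
    using h'(3) stable_class_eq_iff[OF syz_lift_Hom(2)[OF h'(2)] hom(2)] by simp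
qed

lemma syz_lift_Nul:
  assumes "resn R" "resn S"
  shows "syz_lift C R k S l (Nul C (Syz R k) (Syz S l)) (Nul C (Syz R (Suc k)) (Syz S (Suc l)))"
  unfolding syz_lift_def using resn_typing[OF assms(1)] resn_typing[OF assms(2)]
  by (auto simp: Hom_iff typing comp_Nul Nul_comp intro!: bexI[of _ "Nul C (Pr R k) (Pr S l)"])

lemma slift_Nul:
  assumes "resn R" "resn S"
  shows "slift a R S (\<lambda>k. Nul C (Syz R (k + a)) (Syz S k))"
  unfolding slift_def using syz_lift_Nul[OF assms, of "_ + a"] syz_lift_Hom(1)[OF syz_lift_Nul[OF assms, of "_ + a"]]
    stable_eq_refl typing_Nul(1) resn_typing(7)[OF assms(1)] resn_typing(7)[OF assms(2)]
  by (metis add_Suc)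

end

locale naive_setting = projective_abelian_category C
  for C :: "('o, 'm) abcat" (structure) +
  fixes res :: "'o \<Rightarrow> ('o, 'm) resolution"
    and hs :: "'m \<Rightarrow> 'm \<Rightarrow> ('o, 'm) horseshoe"
    and A :: 'o
  assumes res: "M \<in> Obj C \<Longrightarrow> proj_resolution C M (res M)"
    and hs: "short_exact C i p \<Longrightarrow> is_horseshoe C (res (Dom C i)) (res (Cod C p)) i p (hs i p)"
    and A: "A \<in> Obj C"
begin

lemma resn_res: "M \<in> Obj C \<Longrightarrow> resn (res M)"
  using res proj_resolution_resn by blast

lemma Syz_res_0: "M \<in> Obj C \<Longrightarrow> Syz (res M) 0 = M"
  using res by (simp add: proj_resolution_def)

lemma resn_A: "resn (res A)"
  using resn_res A .

lemma horseshoe: "short_exact C i p \<Longrightarrow> horseshoe_setup C (res (Dom C i)) (res (Cod C p)) i p (hs i p)"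
  using resn_res hs short_exactD(1,2) dom_obj cod_obj
  by (intro horseshoe_setup.intro horseshoe_setup_axioms.intro projective_abelian_category_axioms) blast+

text \<open>Since \<open>nat\<close> truncates, this is the intended syzygy only for
  \<open>n + int k \<ge> 0\<close>, which is the range recorded by \<open>index\<close>.\<close>

abbreviation syzA :: "int \<Rightarrow> nat \<Rightarrow> 'o" where
  "syzA n k \<equiv> Syz (res A) (nat (n + int k))"

abbreviation "BC \<equiv> bc_group C res A"
abbreviation "BC_stage \<equiv> bc_stage C res A"
abbreviation "BC_trans \<equiv> bc_trans C res A"
abbreviation "BC_map \<equiv> bc_map C res A"
abbreviation "BC_con \<equiv> bc_con C res hs A"
abbreviation "HE \<equiv> hatext_group C res A"
abbreviation "HE_stage \<equiv> hatext_stage C res A"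
abbreviation "HE_trans \<equiv> hatext_trans C res A"
abbreviation "HE_rel \<equiv> hatext_rel C res A"
abbreviation "\<beta> \<equiv> beta_map C res A"
abbreviation "syzHom n B k \<equiv> Hom C (syzA n k) (Syz (res B) k)"
abbreviation "sclass n B k \<equiv> stable_class C (syzA n k) (Syz (res B) k)"

abbreviation index :: "int \<Rightarrow> nat set" where
  "index n \<equiv> {k. n + int k \<ge> 0}"

lemma nat_index_Suc: "n + int k \<ge> 0 \<Longrightarrow> nat (n + int (Suc k)) = Suc (nat (n + int k))"
  by simp

definition bc_class :: "int \<Rightarrow> 'o \<Rightarrow> nat \<Rightarrow> 'm \<Rightarrow> (nat \<times> 'm set) set" where
  "bc_class n B k f = bc_rel C res A n B `` {(k, sclass n B k f)}"

lemma syz_obj: "B \<in> Obj C \<Longrightarrow> Syz (res B) k \<in> Obj C"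
  using resn_typing(7) resn_res by blast

lemma bc_trans_class:
  assumes "B \<in> Obj C" "n + int k \<ge> 0" "syz_lift C (res A) (nat (n + int k)) (res B) k f h"
  shows "BC_trans n B k (sclass n B k f) =
    sclass n B (Suc k) h"
  unfolding bc_trans_def nat_index_Suc[OF assms(2)]
  by (rule class_map_syz_lift[OF resn_A resn_res[OF assms(1)] assms(3)])

lemma bc_stage_cases:
  assumes "x \<in> carrier (BC_stage n B k)" "B \<in> Obj C"
  obtains f where "f \<in> syzHom n B k" "x = sclass n B k f"
  using stable_hom_cases assms syz_obj[OF assms(2)] syz_obj[OF A] unfolding bc_stage_def by metis

lemma syz_lift_A:
  assumes "B \<in> Obj C" "n + int k \<ge> 0" "f \<in> syzHom n B k"
  obtains h where "syz_lift C (res A) (nat (n + int k)) (res B) k f h"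
    "h \<in> syzHom n B (Suc k)"
  using syz_lift_exists[OF resn_A resn_res[OF assms(1)] assms(3)] syz_lift_Hom(2)
  unfolding nat_index_Suc[OF assms(2)] by metis

lemma group_seq_bc:
  assumes B: "B \<in> Obj C"
  shows "group_seq (index n) (BC_stage n B) (BC_trans n B)"
proof (rule group_seq.intro)
  show "Suc k \<in> index n" if "k \<in> index n" for k using that by simp
  have "nat (- n) \<in> index n" by simp
  then show "index n \<noteq> {}" by blast
  show "comm_group (BC_stage n B k)" for k
    unfolding bc_stage_def using comm_group_stable_hom syz_obj[OF B] syz_obj[OF A] by blast
  fix k assume "k \<in> index n"
  then have k: "n + int k \<ge> 0" by simp
  show "BC_trans n B k \<in> hom (BC_stage n B k) (BC_stage n B (Suc k))"
  proof (rule homI)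
    fix x assume "x \<in> carrier (BC_stage n B k)"
    then obtain f where f: "f \<in> syzHom n B k"
      "x = sclass n B k f"
      using bc_stage_cases B by metis
    obtain h where h: "syz_lift C (res A) (nat (n + int k)) (res B) k f h"
      "h \<in> syzHom n B (Suc k)"
      using syz_lift_A[OF B k f(1)] .
    show "BC_trans n B k x \<in> carrier (BC_stage n B (Suc k))"
      unfolding f(2) bc_trans_class[OF B k h(1)] bc_stage_def using stable_class_closed h(2) by blast
    fix y assume "y \<in> carrier (BC_stage n B k)"
    then obtain g where g: "g \<in> syzHom n B k"
      "y = sclass n B k g"
      using bc_stage_cases B by metis
    obtain h' where h': "syz_lift C (res A) (nat (n + int k)) (res B) k g h'"
      "h' \<in> syzHom n B (Suc k)"
      using syz_lift_A[OF B k g(1)] .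
    have "x \<otimes>\<^bsub>BC_stage n B k\<^esub> y = sclass n B k (f \<boxplus> g)"
      unfolding f(2) g(2) bc_stage_def by (rule stable_class_mult[OF f(1) g(1)])
    then show "BC_trans n B k (x \<otimes>\<^bsub>BC_stage n B k\<^esub> y) =
      BC_trans n B k x \<otimes>\<^bsub>BC_stage n B (Suc k)\<^esub> BC_trans n B k y"
      unfolding f(2) g(2) bc_trans_class[OF B k h(1)] bc_trans_class[OF B k h'(1)]
      using bc_trans_class[OF B k syz_lift_add[OF resn_A resn_res[OF B] h(1) h'(1)]]
        stable_class_mult[OF h(2) h'(2)] by (simp add: bc_stage_def)
  qed
qed

lemma bc_class_cls:
  assumes "B \<in> Obj C"
  shows "bc_class n B k f = group_seq.cls (index n) (BC_stage n B) (BC_trans n B) k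
    (sclass n B k f)"
  by (simp add: group_seq.cls_def[OF group_seq_bc[OF assms]] bc_class_def bc_rel_def)

lemma comm_group_bc: "B \<in> Obj C \<Longrightarrow> comm_group (BC n B)"
  unfolding bc_group_def by (rule group_seq.comm_group_dirlim[OF group_seq_bc])

section \<open>Elements of BC in terms of representing arrows\<close>

context
  fixes B :: 'o assumes B: "B \<in> Obj C"
begin

interpretation D: group_seq "index n" "BC_stage n B" "BC_trans n B" for n
  by (rule group_seq_bc[OF B])

lemma sc_closed:
  "f \<in> syzHom n B k \<Longrightarrow>
   sclass n B k f \<in> carrier (BC_stage n B k)"
  unfolding bc_stage_def by (rule stable_class_closed)

lemma bc_class_closed:
  "\<lbrakk>n + int k \<ge> 0; f \<in> syzHom n B k\<rbrakk> \<Longrightarrow>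
   bc_class n B k f \<in> carrier (BC n B)"
  unfolding bc_class_cls[OF B] bc_group_def using D.cls_closed sc_closed by simp

lemma bc_class_cases:
  assumes "x \<in> carrier (BC n B)"
  obtains k f where "k \<ge> N" "n + int k \<ge> 0" "f \<in> syzHom n B k" "x = bc_class n B k f"
proof -
  obtain k a where k: "k \<ge> N" "k \<in> index n" "a \<in> carrier (BC_stage n B k)" "x = D.cls n k a"
    using D.dirlim_cases assms unfolding bc_group_def by metis
  obtain f where "f \<in> syzHom n B k" "a = sclass n B k f"
    using bc_stage_cases[OF k(3) B] .
  then show thesis using that[of k f] k by (simp add: bc_class_cls[OF B])
qed

lemma bc_class_cases2:
  assumes "x \<in> carrier (BC n B)" "y \<in> carrier (BC n B)"
  obtains k f g where "k \<ge> N" "n + int k \<ge> 0" "f \<in> syzHom n B k" "x = bc_class n B k f"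
    "g \<in> syzHom n B k" "y = bc_class n B k g"
proof -
  obtain k a b where k: "k \<ge> N" "k \<in> index n" "a \<in> carrier (BC_stage n B k)" "x = D.cls n k a"
    "b \<in> carrier (BC_stage n B k)" "y = D.cls n k b"
    using D.dirlim_cases2 assms unfolding bc_group_def by metis
  obtain f where "f \<in> syzHom n B k" "a = sclass n B k f"
    using bc_stage_cases[OF k(3) B] .
  moreover obtain g where "g \<in> syzHom n B k" "b = sclass n B k g"
    using bc_stage_cases[OF k(5) B] .
  ultimately show thesis using that[of k f g] k by (simp add: bc_class_cls[OF B])
qed

lemma bc_class_cong:
  "\<lbrakk>f \<approx> g; f \<in> syzHom n B k\<rbrakk> \<Longrightarrow> bc_class n B k f = bc_class n B k g"
  unfolding bc_class_def using stable_class_eq_iff stable_eq_Hom by metis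

lemma bc_class_mult:
  assumes "n + int k \<ge> 0" "f \<in> syzHom n B k" "g \<in> syzHom n B k"
  shows "bc_class n B k f \<otimes>\<^bsub>BC n B\<^esub> bc_class n B k g = bc_class n B k (f \<boxplus> g)"
  using D.mult_cls[OF _ sc_closed[OF assms(2)] sc_closed[OF assms(3)]] assms(1)
  by (simp add: bc_class_cls[OF B] bc_group_def bc_stage_def[of _ _ _ _ _ k] stable_class_mult[OF assms(2,3)])

lemma bc_class_one:
  assumes "n + int k \<ge> 0"
  shows "\<one>\<^bsub>BC n B\<^esub> = bc_class n B k (Nul C (syzA n k) (Syz (res B) k))"
  using D.one_cls[of k n] assms syz_obj[OF A] syz_obj[OF B]
  by (simp add: bc_class_cls[OF B] bc_group_def bc_stage_def[of _ _ _ _ _ k] stable_class_Nul)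

lemma bc_class_lift:
  assumes "n + int k \<ge> 0" "syz_lift C (res A) (nat (n + int k)) (res B) k f h"
  shows "bc_class n B (Suc k) h = bc_class n B k f"
  using D.cls_trans[OF _ sc_closed[OF syz_lift_Hom(1)[OF assms(2)]]] assms(1)
    bc_trans_class[OF B assms] by (simp add: bc_class_cls[OF B])

lemma bc_class_snull:
  assumes "n + int k \<ge> 0" "f \<in> syzHom n B k" "snull f"
  shows "bc_class n B k f = \<one>\<^bsub>BC n B\<^esub>"
  using bc_class_one[OF assms(1)] bc_class_cong[OF _ assms(2)] stable_eq_Nul_iff[OF assms(2)] assms(3)
  by simp

text \<open>A class is trivial exactly when some iterated lift of a representative is stably null.
  The induction runs backwards from that stage, so that its users never meet iterated transition
  maps.\<close>

lemma bc_class_eq_one_induct: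
  assumes "bc_class n B k f = \<one>\<^bsub>BC n B\<^esub>" "n + int k \<ge> 0"
    "f \<in> syzHom n B k"
    and "\<And>k f. n + int k \<ge> 0 \<Longrightarrow> f \<in> syzHom n B k \<Longrightarrow> snull f \<Longrightarrow> P k f"
    and "\<And>k f h. n + int k \<ge> 0 \<Longrightarrow> f \<in> syzHom n B k \<Longrightarrow>
      syz_lift C (res A) (nat (n + int k)) (res B) k f h \<Longrightarrow> P (Suc k) h \<Longrightarrow> P k f"
  shows "P k f"
proof -
  let ?sc = "\<lambda>k. sclass n B k"
  have "\<exists>j. trans_map (BC_trans n B) k j (?sc k f) = \<one>\<^bsub>BC_stage n B (k + j)\<^esub>"
    using D.cls_eq_one[OF _ sc_closed[OF assms(3)]] assms(1,2) by (simp add: bc_class_cls[OF B] bc_group_def)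
  then obtain j where "trans_map (BC_trans n B) k j (?sc k f) = \<one>\<^bsub>BC_stage n B (k + j)\<^esub>" ..
  then show ?thesis using assms(2,3)
  proof (induction j arbitrary: k f)
    case 0
    then have "?sc k f = ?sc k (Nul C (syzA n k) (Syz (res B) k))"
      using stable_class_Nul syz_obj[OF A] syz_obj[OF B] by (simp add: bc_stage_def)
    then have "snull f"
      using stable_class_eq_iff[OF 0(3) Hom_closed(4)] stable_eq_Nul_iff[OF 0(3)]
        syz_obj[OF A] syz_obj[OF B] by simp
    then show ?case using assms(4) 0 by blast
  next
    case (Suc j)
    obtain h where h: "syz_lift C (res A) (nat (n + int k)) (res B) k f h"
      "h \<in> syzHom n B (Suc k)"
      using syz_lift_A[OF B Suc.prems(2,3)] .
    have "trans_map (BC_trans n B) (Suc k) j (?sc (Suc k) h) = \<one>\<^bsub>BC_stage n B (Suc k + j)\<^esub>"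
      using Suc.prems(1) bc_trans_class[OF B Suc.prems(2) h(1)]
        D.trans_map_Suc[of n k j] by (simp del: trans_map.simps(2))
    then have "P (Suc k) h" using Suc.IH[of "Suc k" h] h(2) Suc.prems(2) by simp
    then show ?case using assms(5) Suc.prems h(1) by blast
  qed
qed

end
end

section \<open>Its maps and connecting homomorphisms\<close>

lemma exact_seqI:
  assumes "group G4" "group G3" "group G2" "group G1" "group G0"
    and "f3 \<in> hom G3 G4" "f2 \<in> hom G2 G3" "f1 \<in> hom G1 G2" "f0 \<in> hom G0 G1"
    and "\<And>y. y \<in> carrier G3 \<Longrightarrow> f3 y = \<one>\<^bsub>G4\<^esub> \<longleftrightarrow> (\<exists>x\<in>carrier G2. y = f2 x)"
    and "\<And>y. y \<in> carrier G2 \<Longrightarrow> f2 y = \<one>\<^bsub>G3\<^esub> \<longleftrightarrow> (\<exists>x\<in>carrier G1. y = f1 x)"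
    and "\<And>y. y \<in> carrier G1 \<Longrightarrow> f1 y = \<one>\<^bsub>G2\<^esub> \<longleftrightarrow> (\<exists>x\<in>carrier G0. y = f0 x)"
  shows "exact_seq ([G4, G3, G2, G1, G0], [f3, f2, f1, f0])"
proof -
  have "kernel G3 G4 f3 = f2 ` carrier G2" "kernel G2 G3 f2 = f1 ` carrier G1"
    "kernel G1 G2 f1 = f0 ` carrier G0"
    using assms(10-12) assms(7-9) by (auto simp: kernel_def hom_def Pi_iff)
  then show ?thesis
    using assms(1-9) by (auto intro!: group_hom.intro group_hom_axioms.intro)
qed

context naive_setting
begin

lemmas bc_one_induct [consumes 4, case_names null lift] = bc_class_eq_one_induct

text \<open>An arrow of shift \<open>a\<close> raises the cohomological degree by \<open>a\<close>
  and lowers the stage by \<open>a\<close>, so the syzygy of \<open>A\<close> stays the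
  same.\<close>

lemma syzA_shift: "syzA (n + int a) k = syzA n (k + a)"
  by (simp add: add_ac)

lemma syzA_Suc: "syzA (n + 1) k = syzA n (Suc k)"
  using syzA_shift[of n 1 k] by simp

text \<open>A lift of \<open>F k\<close> composed with \<open>g'\<close> is a lift of
  \<open>F k \<cdot> g\<close>, and that lift of \<open>F k\<close> agrees stably with
  \<open>F (Suc k)\<close>. Hence the action of a sequence of lifts on \<open>BC\<close> can be read
  off at any stage.\<close>

lemma bc_class_slift_step:
  assumes B: "B \<in> Obj C" and D: "D \<in> Obj C" and F: "slift a (res B) (res D) F"
    and n: "n + int (k + a) \<ge> 0" and g: "syz_lift C (res A) (nat (n + int (k + a))) (res B) (k + a) g g'"
  shows "bc_class (n + int a) D (Suc k) (F (Suc k) \<cdot> g') = bc_class (n + int a) D k (F k \<cdot> g)"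
proof -
  obtain h where h: "syz_lift C (res B) (k + a) (res D) k (F k) h" "h \<approx> F (Suc k)"
    using F unfolding slift_def by blast
  have n': "n + int a + int k \<ge> 0" "nat (n + int a + int k) = nat (n + int (k + a))"
    using n by (simp_all add: add_ac)
  have L: "syz_lift C (res A) (nat (n + int a + int k)) (res D) k (F k \<cdot> g) (h \<cdot> g')"
    unfolding n'(2) by (rule syz_lift_comp[OF resn_A resn_res[OF B] resn_res[OF D] g h(1)])
  have "h \<cdot> g' \<approx> F (Suc k) \<cdot> g'"
    using stable_eq_comp[OF h(2)] syz_lift_Hom(2)[OF g] syz_lift_Hom(2)[OF h(1)] by (simp add: Hom_iff)
  moreover have "h \<cdot> g' \<in> syzHom (n + int a) D (Suc k)"
    using syz_lift_Hom(2)[OF L] unfolding nat_index_Suc[OF n'(1)] .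
  ultimately show ?thesis
    using bc_class_lift[OF D n'(1) L] bc_class_cong[OF D] by metis
qed

lemma slift_comp_Hom:
  assumes "slift a (res B) (res D) F" "g \<in> syzHom n B (k + a)"
  shows "F k \<cdot> g \<in> syzHom (n + int a) D k"
  unfolding syzA_shift by (rule comp[OF assms(2) slift_Hom[OF assms(1)]])

text \<open>This transfers exactness from the stages to the limit: a class with trivial image is
  given a new representative whose image is already stably null, to which the stable exactness
  lemmas apply.\<close>

lemma bc_class_slift_one:
  assumes B: "B \<in> Obj C" and D: "D \<in> Obj C" and F: "slift a (res B) (res D) F"
    and n: "n + int (k + a) \<ge> 0" and g: "g \<in> syzHom n B (k + a)"
    and one: "bc_class (n + int a) D k (F k \<cdot> g) = \<one>\<^bsub>BC (n + int a) D\<^esub>"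
  obtains l g' where "n + int (l + a) \<ge> 0" "g' \<in> syzHom n B (l + a)"
    "bc_class n B (l + a) g' = bc_class n B (k + a) g" "snull (F l \<cdot> g')"
proof -
  have n': "n + int a + int k \<ge> 0" using n by (simp add: add_ac)
  \<comment> \<open>The arrow \<open>f\<close> is tied to \<open>F k \<cdot> g\<close> only by
    stable equality: the lift of \<open>F k \<cdot> g\<close> supplied by the induction and the
    product \<open>F (Suc k) \<cdot> g'\<close> need not be equal.\<close>
  let ?P = "\<lambda>k f. \<forall>g. g \<in> syzHom n B (k + a) \<and> F k \<cdot> g \<approx> f \<longrightarrow>
    (\<exists>l g'. n + int (l + a) \<ge> 0 \<and> g' \<in> syzHom n B (l + a) \<and>
     bc_class n B (l + a) g' = bc_class n B (k + a) g \<and> snull (F l \<cdot> g'))"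
  have "?P k (F k \<cdot> g)"
    using D one n' slift_comp_Hom[OF F g]
  proof (induction rule: bc_one_induct)
    case (null k f)
    show ?case
    proof (intro allI impI)
      fix g assume g: "g \<in> syzHom n B (k + a) \<and> F k \<cdot> g \<approx> f"
      have "f \<approx> Nul C (syzA (n + int a) k) (Syz (res D) k)"
        using stable_eq_Nul_iff[OF null(2)] null(3) by blast
      then have "F k \<cdot> g \<approx> Nul C (syzA (n + int a) k) (Syz (res D) k)"
        using g stable_eq_trans by blast
      then have "snull (F k \<cdot> g)" using stable_eq_Nul_iff slift_comp_Hom[OF F] g by blast
      then show "\<exists>l g'. n + int (l + a) \<ge> 0 \<and> g' \<in> syzHom n B (l + a) \<and>
        bc_class n B (l + a) g' = bc_class n B (k + a) g \<and> snull (F l \<cdot> g')"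
        using g null(1) by (intro exI[of _ k] exI[of _ g]) (simp add: add_ac)
    qed
  next
    case (lift k f h)
    show ?case
    proof (intro allI impI)
      fix g assume g: "g \<in> syzHom n B (k + a) \<and> F k \<cdot> g \<approx> f"
      have nk: "n + int (k + a) \<ge> 0" "nat (n + int a + int k) = nat (n + int (k + a))"
        using lift(1) by (simp_all add: add_ac)
      obtain g' where g': "syz_lift C (res A) (nat (n + int (k + a))) (res B) (k + a) g g'"
        "g' \<in> syzHom n B (Suc (k + a))"
        using syz_lift_A[OF B nk(1)] g by blast
      obtain x where x: "syz_lift C (res B) (k + a) (res D) k (F k) x" "x \<approx> F (Suc k)"
        using F unfolding slift_def by blast
      have "syz_lift C (res A) (nat (n + int (k + a))) (res D) k (F k \<cdot> g) (x \<cdot> g')"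
        by (rule syz_lift_comp[OF resn_A resn_res[OF B] resn_res[OF D] g'(1) x(1)])
      then have "x \<cdot> g' \<approx> h"
        using syz_lift_cong[OF resn_A resn_res[OF D] _ lift(3)[unfolded nk(2)]] g by blast
      moreover have "x \<cdot> g' \<approx> F (Suc k) \<cdot> g'"
        using stable_eq_comp[OF x(2)] syz_lift_Hom(2)[OF x(1)] g'(2) by (simp add: Hom_iff)
      ultimately have "F (Suc k) \<cdot> g' \<approx> h" using stable_eq_sym stable_eq_trans by blast
      with lift(4) g'(2) obtain l g'' where
        "n + int (l + a) \<ge> 0 \<and> g'' \<in> syzHom n B (l + a) \<and>
        bc_class n B (l + a) g'' = bc_class n B (Suc k + a) g' \<and> snull (F l \<cdot> g'')"
        by (metis add_Suc)
      moreover have "bc_class n B (Suc k + a) g' = bc_class n B (k + a) g"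
        using bc_class_lift[OF B nk(1) g'(1)] by simp
      ultimately show "\<exists>l g'. n + int (l + a) \<ge> 0 \<and> g' \<in> syzHom n B (l + a) \<and>
        bc_class n B (l + a) g' = bc_class n B (k + a) g \<and> snull (F l \<cdot> g')"
        by auto
    qed
  qed
  moreover have "F k \<cdot> g \<approx> F k \<cdot> g"
    using stable_eq_refl slift_comp_Hom[OF F g] by (simp add: Hom_iff)
  ultimately show thesis using that g by blast
qed

lemma bc_map_class:
  assumes f: "f \<in> Hom C B D" and n: "n + int k \<ge> 0" and g: "g \<in> syzHom n B k"
  shows "BC_map n f (bc_class n B k g) = bc_class n D k (lifts C (res B) (res D) f k \<cdot> g)"
proof -
  note obj = Hom_objs[OF f]
  have f': "f \<in> Hom C (Syz (res B) 0) (Syz (res D) 0)" "Dom C f = B" "Cod C f = D"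
    using f Syz_res_0 obj by (auto simp: Hom_iff)
  define F where "F = lifts C (res B) (res D) f"
  note F = slift_lifts(2,3)[OF resn_res[OF obj(1)] resn_res[OF obj(2)] f'(1), folded F_def]
  define \<phi> where "\<phi> k = class_map (\<lambda>g Y. Y = sclass n D k (F k \<cdot> g))" for k
  have \<phi>: "\<phi> k (sclass n B k g) = sclass n D k (F k \<cdot> g)"
    if "g \<in> syzHom n B k" for k g
    unfolding \<phi>_def using class_map_comp[OF that] slift_Hom[OF F(1)] by simp
  have Fg: "F k \<cdot> g \<in> syzHom n D k" if "g \<in> syzHom n B k" for k g
    using slift_comp_Hom[OF F(1), of g n k] that by simp
  have "dirlim_map (index n) (dirlim_rel (index n) (BC_stage n D) (BC_trans n D)) \<phi>
      (group_seq.cls (index n) (BC_stage n B) (BC_trans n B) k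
        (sclass n B k g)) =
    group_seq.cls (index n) (BC_stage n D) (BC_trans n D) k
      (\<phi> k (sclass n B k g))"
  proof (rule dirlim_map_cls[OF group_seq_bc[OF obj(1)] group_seq_bc[OF obj(2)]])
    fix k x assume k: "k \<in> index n" and x: "x \<in> carrier (BC_stage n B k)"
    obtain g where g: "g \<in> syzHom n B k" "x = sclass n B k g"
      using bc_stage_cases[OF x obj(1)] .
    have nk: "n + int k \<ge> 0" using k by simp
    show "\<phi> k x \<in> carrier (BC_stage n D k)"
      unfolding g(2) \<phi>[OF g(1)] using sc_closed[OF obj(2) Fg[OF g(1)]] .
    obtain g' where g': "syz_lift C (res A) (nat (n + int k)) (res B) k g g'"
      "g' \<in> syzHom n B (Suc k)"
      using syz_lift_A[OF obj(1) nk g(1)] .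
    show "\<phi> (Suc k) (BC_trans n B k x) = BC_trans n D k (\<phi> k x)"
      unfolding g(2) \<phi>[OF g(1)] bc_trans_class[OF obj(1) nk g'(1)] \<phi>[OF g'(2)]
      using bc_trans_class[OF obj(2) nk syz_lift_comp[OF resn_A resn_res[OF obj(1)] resn_res[OF obj(2)] g'(1) F(2)]]
      by simp
  qed (use n sc_closed[OF obj(1) g] in auto)
  then show ?thesis
    unfolding bc_map_def bc_rel_def bc_class_cls[OF obj(1)] bc_class_cls[OF obj(2)] \<phi>[OF g] f'(2,3)
      F_def[symmetric] \<phi>_def[abs_def, symmetric] .
qed

abbreviation con_seq' :: "'m \<Rightarrow> 'm \<Rightarrow> nat \<Rightarrow> 'm" where
  "con_seq' i p \<equiv> horseshoe_setup.con_seq C (res (Dom C i)) (res (Cod C p)) (hs i p)"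

section \<open>The connecting homomorphism on representatives\<close>

lemma bc_con_stage_class:
  assumes E: "short_exact C i p" and g: "syz_lift C (res A) m (res (Cod C p)) k g g'"
    and h: "con_lift C (res (Dom C i)) (res (Cod C p)) (hs i p) k h"
  shows "bc_con_stage C res hs A i p m k (stable_class C (Syz (res A) m) (Syz (res (Cod C p)) k) g) =
    stable_class C (Syz (res A) (Suc m)) (Syz (res (Dom C i)) k) (h \<cdot> g')"
proof -
  interpret H: horseshoe_setup C "res (Dom C i)" "res (Cod C p)" i p "hs i p" by (rule horseshoe[OF E])
  note hom = syz_lift_Hom[OF g] H.con_lift_Hom[OF h]
  show ?thesis
    unfolding bc_con_stage_def
  proof (rule class_map_eqI)
    show "g \<in> stable_class C (Syz (res A) m) (Syz (res (Cod C p)) k) g"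
      using mem_stable_class_iff[OF hom(1)] hom(1) stable_eq_refl by (simp add: Hom_iff)
    show "\<exists>ga ha. syz_lift C (res A) m (res (Cod C p)) k g ga \<and>
       con_lift C (res (Dom C i)) (res (Cod C p)) (hs i p) k ha \<and>
       stable_class C (Syz (res A) (Suc m)) (Syz (res (Dom C i)) k) (h \<cdot> g') =
       stable_class C (Syz (res A) (Suc m)) (Syz (res (Dom C i)) k) (ha \<cdot> ga)"
      using g h by blast
    fix x Z assume x: "x \<in> stable_class C (Syz (res A) m) (Syz (res (Cod C p)) k) g"
      "\<exists>g h. syz_lift C (res A) m (res (Cod C p)) k x g \<and>
       con_lift C (res (Dom C i)) (res (Cod C p)) (hs i p) k h \<and>
       Z = stable_class C (Syz (res A) (Suc m)) (Syz (res (Dom C i)) k) (h \<cdot> g)"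
    then obtain y w where yw: "syz_lift C (res A) m (res (Cod C p)) k x y"
      "con_lift C (res (Dom C i)) (res (Cod C p)) (hs i p) k w"
      "Z = stable_class C (Syz (res A) (Suc m)) (Syz (res (Dom C i)) k) (w \<cdot> y)" by blast
    have "x \<approx> g" using x(1) mem_stable_class_iff[OF hom(1)] by blast
    then have "y \<approx> g'" using syz_lift_cong[OF resn_A H.S yw(1) g] by blast
    moreover have "w \<approx> h" using H.con_lift_unique[OF yw(2) h] .
    ultimately have "w \<cdot> y \<approx> h \<cdot> g'"
      using stable_eq_mult[of y g' w h] syz_lift_Hom(2)[OF yw(1)] H.con_lift_Hom[OF yw(2)]
      by (simp add: Hom_iff)
    then show "Z = stable_class C (Syz (res A) (Suc m)) (Syz (res (Dom C i)) k) (h \<cdot> g')"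
      using yw(3) stable_class_eq_iff[OF comp[OF syz_lift_Hom(2)[OF yw(1)] H.con_lift_Hom[OF yw(2)]]
          comp[OF hom(2,3)]] by simp
  qed
qed

text \<open>The sign in \<open>bc_con\<close> is the one built into \<open>con_seq\<close>.
  Compatibility with the transition maps is then the \<open>slift\<close> property of that sequence,
  and no sign is left to be tracked.\<close>

lemma bc_con_class_aux:
  assumes E: "short_exact C i p" and n: "n + int k \<ge> 1"
    and g: "syz_lift C (res A) (nat (n + int k)) (res (Cod C p)) k g g'"
  shows "BC_con n i p (bc_class n (Cod C p) k g) =
    bc_class (n + 1) (Dom C i) k (con_seq' i p k \<cdot> g')"
proof -
  interpret H: horseshoe_setup C "res (Dom C i)" "res (Cod C p)" i p "hs i p" by (rule horseshoe[OF E])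
  let ?B = "Dom C i" and ?D = "Cod C p"
  note obj = short_exact_obj(1,3)[OF E]
  define \<phi> where "\<phi> k x = signed (BC_stage (n + 1) ?B k) k
    (bc_con_stage C res hs A i p (nat (n + int k)) k x)" for k x
  have cg: "con_seq' i p k \<cdot> g' \<in> Hom C (syzA (n + 1) k) (Syz (res ?B) k)"
    if "g' \<in> Hom C (syzA n (Suc k)) (Syz (res ?D) (Suc k))" for k g'
    using slift_comp_Hom[OF H.slift_con_seq, of g' n k] that by simp
  have \<phi>: "\<phi> k (stable_class C (syzA n k) (Syz (res ?D) k) g) =
      stable_class C (syzA (n + 1) k) (Syz (res ?B) k) (con_seq' i p k \<cdot> g')"
    if k: "n + int k \<ge> 1" and g: "syz_lift C (res A) (nat (n + int k)) (res ?D) k g g'" for k g g'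
  proof -
    obtain h where h: "con_lift C (res ?B) (res ?D) (hs i p) k h" using H.con_lift_exists .
    have s: "syzA (n + 1) k = Syz (res A) (Suc (nat (n + int k)))"
      using k syzA_Suc[of n k] nat_index_Suc[of n k] by simp
    note hom = comp[OF syz_lift_Hom(2)[OF g] H.con_lift_Hom[OF h]]
    have eq: "(if even k then h \<cdot> g' else neg (h \<cdot> g')) = (if even k then h else neg h) \<cdot> g'"
      using syz_lift_Hom(2)[OF g] H.con_lift_Hom[OF h] by (simp add: neg_comp Hom_iff)
    have hk: "(if even k then h else neg h) \<in> Hom C (Syz (res ?D) (Suc k)) (Syz (res ?B) k)"
      using H.con_lift_Hom[OF h] Hom_closed by simp
    have "(if even k then h else neg h) \<cdot> g' \<approx> con_seq' i p k \<cdot> g'"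
      using stable_eq_comp[OF stable_eq_sym[OF H.con_seq[OF h]]] syz_lift_Hom(2)[OF g]
        hk by (simp add: Hom_iff)
    then show ?thesis
      unfolding \<phi>_def bc_con_stage_class[OF E g h] bc_stage_def s signed_stable_class[OF hom] eq
      using stable_class_eq_iff[OF comp[OF syz_lift_Hom(2)[OF g] hk]] stable_eq_Hom
        comp[OF syz_lift_Hom(2)[OF g] hk] by blast
  qed
  have g1: "g \<in> Hom C (syzA n k) (Syz (res ?D) k)" using syz_lift_Hom(1)[OF g] .
  have "dirlim_map {k. n + int k \<ge> 1} (dirlim_rel (index (n + 1)) (BC_stage (n + 1) ?B) (BC_trans (n + 1) ?B)) \<phi>
      (group_seq.cls (index n) (BC_stage n ?D) (BC_trans n ?D) k
        (stable_class C (syzA n k) (Syz (res ?D) k) g)) =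
    group_seq.cls (index (n + 1)) (BC_stage (n + 1) ?B) (BC_trans (n + 1) ?B) k
      (\<phi> k (stable_class C (syzA n k) (Syz (res ?D) k) g))"
  proof (rule dirlim_map_cls[OF group_seq_bc[OF obj(2)] group_seq_bc[OF obj(1)]])
    fix k x assume k: "k \<in> {k. n + int k \<ge> 1}" and x: "x \<in> carrier (BC_stage n ?D k)"
    obtain g where g: "g \<in> Hom C (syzA n k) (Syz (res ?D) k)" "x = stable_class C (syzA n k) (Syz (res ?D) k) g"
      using bc_stage_cases[OF x obj(2)] .
    have nk: "n + int k \<ge> 1" "n + int k \<ge> 0" "n + int (Suc k) \<ge> 1" "n + int (Suc k) \<ge> 0" "n + 1 + int k \<ge> 0"
      using k by simp_all
    obtain g' where g': "syz_lift C (res A) (nat (n + int k)) (res ?D) k g g'"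
      "g' \<in> Hom C (syzA n (Suc k)) (Syz (res ?D) (Suc k))"
      using syz_lift_A[OF obj(2) nk(2) g(1)] .
    show "\<phi> k x \<in> carrier (BC_stage (n + 1) ?B k)"
      unfolding g(2) \<phi>[OF nk(1) g'(1)] using sc_closed[OF obj(1) cg[OF g'(2)]] .
    obtain g'' where g'': "syz_lift C (res A) (nat (n + int (Suc k))) (res ?D) (Suc k) g' g''"
      "g'' \<in> Hom C (syzA n (Suc (Suc k))) (Syz (res ?D) (Suc (Suc k)))"
      using syz_lift_A[OF obj(2) nk(4) g'(2)] .
    obtain y where y: "syz_lift C (res ?D) (k + 1) (res ?B) k (con_seq' i p k) y"
       "y \<approx> con_seq' i p (Suc k)"
      using H.slift_con_seq unfolding slift_def by blast
    have e: "nat (n + 1 + int k) = nat (n + int (Suc k))" by simp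
    have L: "syz_lift C (res A) (nat (n + 1 + int k)) (res ?B) k (con_seq' i p k \<cdot> g') (y \<cdot> g'')"
      unfolding e by (rule syz_lift_comp[OF resn_A H.S H.R _ y(1)]) (use g''(1) in simp)
    have "y \<cdot> g'' \<approx> con_seq' i p (Suc k) \<cdot> g''"
      using stable_eq_comp[OF y(2)] syz_lift_Hom(2)[OF y(1)] g''(2) by (simp add: Hom_iff)
    then show "\<phi> (Suc k) (BC_trans n ?D k x) = BC_trans (n + 1) ?B k (\<phi> k x)"
      unfolding g(2) \<phi>[OF nk(1) g'(1)] bc_trans_class[OF obj(2) nk(2) g'(1)] \<phi>[OF nk(3) g''(1)]
        bc_trans_class[OF obj(1) nk(5) L]
      using stable_class_eq_iff[OF cg[OF g''(2)]] stable_eq_Hom[of "y \<cdot> g''"] cg[OF g''(2)]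
        stable_eq_sym by blast
  qed (use n sc_closed[OF obj(2) g1] in auto)
  then show ?thesis
    unfolding bc_con_def bc_rel_def bc_class_cls[OF obj(1)] bc_class_cls[OF obj(2)] \<phi>[OF n g]
      \<phi>_def[abs_def, symmetric] .
qed

text \<open>With the representative given at stage \<open>Suc k\<close> the connecting homomorphism
  is plain composition with one arrow of the sequence, and \<open>g\<close> itself need not be
  lifted.\<close>

lemma bc_con_class:
  assumes E: "short_exact C i p" and n: "n + int (Suc k) \<ge> 0"
    and g: "g \<in> syzHom n (Cod C p) (Suc k)"
  shows "BC_con n i p (bc_class n (Cod C p) (Suc k) g) =
    bc_class (n + 1) (Dom C i) k (con_seq' i p k \<cdot> g)"
proof -
  interpret H: horseshoe_setup C "res (Dom C i)" "res (Cod C p)" i p "hs i p" by (rule horseshoe[OF E])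
  let ?B = "Dom C i" and ?D = "Cod C p"
  note obj = short_exact_obj(1,3)[OF E]
  have step: "bc_class (n + 1) ?B (Suc k) (con_seq' i p (Suc k) \<cdot> g') = bc_class (n + 1) ?B k (con_seq' i p k \<cdot> g)"
    if "syz_lift C (res A) (nat (n + int (Suc k))) (res ?D) (Suc k) g g'" "n + int (Suc k) \<ge> 0" for k g g'
    using bc_class_slift_step[OF obj(2,1) H.slift_con_seq, of n k g g'] that by simp
  obtain g' where g': "syz_lift C (res A) (nat (n + int (Suc k))) (res ?D) (Suc k) g g'"
    "g' \<in> Hom C (syzA n (Suc (Suc k))) (Syz (res ?D) (Suc (Suc k)))"
    using syz_lift_A[OF obj(2) n g] .
  \<comment> \<open>Two lifts rather than one: at stage \<open>Suc k\<close> the syzygy of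
    \<open>A\<close> may still have index 0, whereas \<open>bc_con\<close> is assembled from indices
    at least 1.\<close>
  have n': "n + int (Suc (Suc k)) \<ge> 0" "n + int (Suc (Suc k)) \<ge> 1" using n by auto
  obtain g'' where g'': "syz_lift C (res A) (nat (n + int (Suc (Suc k)))) (res ?D) (Suc (Suc k)) g' g''"
    using syz_lift_A[OF obj(2) n'(1) g'(2)] .
  have "BC_con n i p (bc_class n ?D (Suc k) g) = BC_con n i p (bc_class n ?D (Suc (Suc k)) g')"
    using bc_class_lift[OF obj(2) n g'(1)] by simp
  also have "\<dots> = bc_class (n + 1) ?B (Suc (Suc k)) (con_seq' i p (Suc (Suc k)) \<cdot> g'')"
    by (rule bc_con_class_aux[OF E n'(2) g''])
  also have "\<dots> = bc_class (n + 1) ?B (Suc k) (con_seq' i p (Suc k) \<cdot> g')"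
    by (rule step[OF g'' n'(1)])
  also have "\<dots> = bc_class (n + 1) ?B k (con_seq' i p k \<cdot> g)"
    by (rule step[OF g'(1) n])
  finally show ?thesis .
qed

end

section \<open>The long exact sequence of the naive construction\<close>

context projective_abelian_category
begin

lemma slift_comp0:
  "\<lbrakk>resn R; resn S; resn T; slift 0 R S F; slift 0 S T G\<rbrakk> \<Longrightarrow> slift 0 R T (\<lambda>k. G k \<cdot> F k)"
  using slift_comp[of R S T 0 F 0 G] by simp

end

context naive_setting
begin

abbreviation lft :: "'m \<Rightarrow> nat \<Rightarrow> 'm" where
  "lft f \<equiv> lifts C (res (Dom C f)) (res (Cod C f)) f"

lemma lft:
  assumes "f \<in> Hom C B D"
  shows "lft f 0 = f" "slift 0 (res B) (res D) (lft f)" "lft f k \<in> Hom C (Syz (res B) k) (Syz (res D) k)"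
    "syz_lift C (res B) k (res D) k (lft f k) (lft f (Suc k))"
proof -
  have f: "f \<in> Hom C (Syz (res B) 0) (Syz (res D) 0)" "Dom C f = B" "Cod C f = D"
    using assms Syz_res_0 Hom_objs[OF assms] by (auto simp: Hom_iff)
  note * = slift_lifts[OF resn_res[OF Hom_objs(1)[OF assms]] resn_res[OF Hom_objs(2)[OF assms]] f(1)]
  show "lft f 0 = f" "slift 0 (res B) (res D) (lft f)"
    "syz_lift C (res B) k (res D) k (lft f k) (lft f (Suc k))"
    using * f(2,3) by simp_all
  then show "lft f k \<in> Hom C (Syz (res B) k) (Syz (res D) k)"
    using slift_Hom[of 0 _ _ _ k] by simp
qed

lemma bc_map_lft:
  assumes "f \<in> Hom C B D" "n + int k \<ge> 0" "g \<in> syzHom n B k"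
  shows "BC_map n f (bc_class n B k g) = bc_class n D k (lft f k \<cdot> g)"
    "lft f k \<cdot> g \<in> syzHom n D k"
  using bc_map_class[OF assms] assms(1) comp[OF assms(3) lft(3)[OF assms(1)]] by (auto simp: Hom_iff)

section \<open>Additivity and functoriality\<close>

lemma bc_map_hom:
  assumes f: "f \<in> Hom C B D"
  shows "BC_map n f \<in> hom (BC n B) (BC n D)"
proof (rule homI)
  note obj = Hom_objs[OF f]
  show "BC_map n f x \<in> carrier (BC n D)" if "x \<in> carrier (BC n B)" for x
    using bc_class_cases[OF obj(1) that] bc_map_lft[OF f] bc_class_closed[OF obj(2)] by metis
  fix x y assume "x \<in> carrier (BC n B)" "y \<in> carrier (BC n B)"
  then obtain k g h where k: "n + int k \<ge> 0" "g \<in> syzHom n B k" "x = bc_class n B k g"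
    "h \<in> syzHom n B k" "y = bc_class n B k h"
    using bc_class_cases2[OF obj(1)] by metis
  have "lft f k \<cdot> (g \<boxplus> h) = lft f k \<cdot> g \<boxplus> lft f k \<cdot> h"
    using k(2,4) lft(3)[OF f, of k] by (simp add: Hom_iff comp_add)
  then show "BC_map n f (x \<otimes>\<^bsub>BC n B\<^esub> y) =
      BC_map n f x \<otimes>\<^bsub>BC n D\<^esub> BC_map n f y"
    using k Hom_closed(1)[OF k(2,4)]
    by (simp add: bc_class_mult[OF obj(1)] bc_class_mult[OF obj(2)] bc_map_lft[OF f])
qed

text \<open>The chosen lifts of an identity need not be identities, but the identities of the
  syzygies form another sequence of lifts with the same first term, so the two agree stably by
  \<open>slift_unique\<close>. Composites and sums are treated below in the same way.\<close>

lemma bc_map_ident: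
  assumes B: "B \<in> Obj C" and x: "x \<in> carrier (BC n B)"
  shows "BC_map n (Idt C B) x = x"
proof -
  obtain k g where k: "n + int k \<ge> 0" "g \<in> syzHom n B k" "x = bc_class n B k g"
    using bc_class_cases[OF B x] by metis
  have "lft (Idt C B) k \<approx> Idt C (Syz (res B) k)"
    using slift_unique[OF resn_res resn_res lft(2)[OF ident] slift_Idt, OF B B B resn_res, OF B]
      lft(1)[OF ident[OF B]] Syz_res_0[OF B] stable_eq_refl ident[OF B] by (simp add: Hom_iff)
  then have "lft (Idt C B) k \<cdot> g \<approx> Idt C (Syz (res B) k) \<cdot> g"
    using stable_eq_comp k(2) lft(3)[OF ident[OF B], of k] by (simp add: Hom_iff)
  also have "Idt C (Syz (res B) k) \<cdot> g = g" using k(2) by (simp add: Hom_iff Idt_comp)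
  finally show ?thesis
    using bc_map_lft[OF ident[OF B] k(1,2)] k(3) bc_class_cong[OF B] by metis
qed

lemma bc_map_comp:
  assumes f: "f \<in> Hom C X Y" and g: "g \<in> Hom C Y Z" and x: "x \<in> carrier (BC n X)"
  shows "BC_map n (g \<cdot> f) x = BC_map n g (BC_map n f x)"
proof -
  note obj = Hom_objs[OF f] Hom_objs[OF g]
  note gf = comp[OF f g]
  obtain k u where k: "n + int k \<ge> 0" "u \<in> syzHom n X k" "x = bc_class n X k u"
    using bc_class_cases[OF obj(1) x] by metis
  have "lft (g \<cdot> f) k \<approx> lft g k \<cdot> lft f k"
    using slift_unique[OF resn_res resn_res lft(2)[OF gf] slift_comp0[OF _ _ _ lft(2)[OF f] lft(2)[OF g]]]
      resn_res obj lft(1)[OF f] lft(1)[OF g] lft(1)[OF gf] stable_eq_refl gf by (simp add: Hom_iff)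
  then have "lft (g \<cdot> f) k \<cdot> u \<approx> (lft g k \<cdot> lft f k) \<cdot> u"
    using stable_eq_comp k(2) lft(3)[OF gf, of k] by (simp add: Hom_iff)
  also have "(lft g k \<cdot> lft f k) \<cdot> u = lft g k \<cdot> (lft f k \<cdot> u)"
    using k(2) lft(3)[OF f, of k] lft(3)[OF g, of k] by (simp add: Hom_iff comp_assoc')
  finally show ?thesis
    using bc_map_lft[OF gf k(1,2)] bc_map_lft[OF f k(1,2)] bc_map_lft[OF g k(1)] k(3)
      bc_class_cong[OF obj(4)] by metis
qed

lemma bc_map_plus:
  assumes f: "f \<in> Hom C X Y" and g: "g \<in> Hom C X Y" and x: "x \<in> carrier (BC n X)"
  shows "BC_map n (f \<boxplus> g) x = BC_map n f x \<otimes>\<^bsub>BC n Y\<^esub> BC_map n g x"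
proof -
  note obj = Hom_objs[OF f]
  note fg = Hom_closed(1)[OF f g]
  obtain k u where k: "n + int k \<ge> 0" "u \<in> syzHom n X k" "x = bc_class n X k u"
    using bc_class_cases[OF obj(1) x] by metis
  have "lft (f \<boxplus> g) k \<approx> lft f k \<boxplus> lft g k"
    using slift_unique[OF resn_res resn_res lft(2)[OF fg] slift_add[OF _ _ lft(2)[OF f] lft(2)[OF g]]]
      resn_res obj lft(1)[OF f] lft(1)[OF g] lft(1)[OF fg] stable_eq_refl fg by (simp add: Hom_iff)
  then have "lft (f \<boxplus> g) k \<cdot> u \<approx> (lft f k \<boxplus> lft g k) \<cdot> u"
    using stable_eq_comp k(2) lft(3)[OF fg, of k] by (simp add: Hom_iff)
  also have "(lft f k \<boxplus> lft g k) \<cdot> u = lft f k \<cdot> u \<boxplus> lft g k \<cdot> u"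
    using k(2) lft(3)[OF f, of k] lft(3)[OF g, of k] by (simp add: Hom_iff add_comp)
  finally show ?thesis
    using bc_map_lft[OF fg k(1,2)] bc_map_lft[OF f k(1,2)] bc_map_lft[OF g k(1,2)] k
      bc_class_mult[OF obj(2) k(1)] bc_class_cong[OF obj(2)] by metis
qed

section \<open>Additivity and naturality of the connecting homomorphisms\<close>

lemma con_seq_Hom:
  assumes "short_exact C i p"
  shows "con_seq' i p k \<in> Hom C (Syz (res (Cod C p)) (Suc k)) (Syz (res (Dom C i)) k)"
  using slift_Hom[OF horseshoe_setup.slift_con_seq[OF horseshoe[OF assms]], of k] by simp

lemma bc_con_cases:
  assumes E: "short_exact C i p" and x: "x \<in> carrier (BC n (Cod C p))"
  obtains k g where "n + int (Suc k) \<ge> 0" "g \<in> syzHom n (Cod C p) (Suc k)"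
    "x = bc_class n (Cod C p) (Suc k) g"
proof -
  have D: "Cod C p \<in> Obj C" using short_exactD(2)[OF E] cod_obj by blast
  obtain k g where "1 \<le> k" "n + int k \<ge> 0" "g \<in> syzHom n (Cod C p) k"
    "x = bc_class n (Cod C p) k g"
    using bc_class_cases[OF D x, of 1] by metis
  then show thesis using that[of "k - 1" g] by simp
qed

lemma bc_con_val:
  assumes E: "short_exact C i p" and n: "n + int (Suc k) \<ge> 0"
    and g: "g \<in> syzHom n (Cod C p) (Suc k)"
  shows "BC_con n i p (bc_class n (Cod C p) (Suc k) g) =
    bc_class (n + 1) (Dom C i) k (con_seq' i p k \<cdot> g)"
    "con_seq' i p k \<cdot> g \<in> syzHom (n + 1) (Dom C i) k" "n + 1 + int k \<ge> 0"
  using bc_con_class[OF assms] comp[OF g con_seq_Hom[OF E]] n syzA_Suc by auto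

lemma bc_con_hom:
  assumes E: "short_exact C i p"
  shows "BC_con n i p \<in> hom (BC n (Cod C p)) (BC (n + 1) (Dom C i))"
proof (rule homI)
  let ?B = "Dom C i" and ?D = "Cod C p"
  note obj = short_exact_obj(1,3)[OF E]
  show "BC_con n i p x \<in> carrier (BC (n + 1) ?B)"
    if "x \<in> carrier (BC n ?D)" for x
    using bc_con_cases[OF E that] bc_con_val[OF E] bc_class_closed[OF obj(1)] by metis
  fix x y assume xy: "x \<in> carrier (BC n ?D)" "y \<in> carrier (BC n ?D)"
  then obtain l g h where l: "1 \<le> l" "n + int l \<ge> 0" "g \<in> Hom C (syzA n l) (Syz (res ?D) l)" "x = bc_class n ?D l g"
    "h \<in> Hom C (syzA n l) (Syz (res ?D) l)" "y = bc_class n ?D l h"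
    using bc_class_cases2[OF obj(2) xy, of 1] by metis
  then obtain k where k: "l = Suc k" by (cases l) auto
  note l = l[unfolded k]
  have "con_seq' i p k \<cdot> (g \<boxplus> h) = con_seq' i p k \<cdot> g \<boxplus> con_seq' i p k \<cdot> h"
    using l(3,5) con_seq_Hom[OF E, of k] by (simp add: Hom_iff comp_add)
  then show "BC_con n i p (x \<otimes>\<^bsub>BC n ?D\<^esub> y) =
      BC_con n i p x \<otimes>\<^bsub>BC (n + 1) ?B\<^esub> BC_con n i p y"
    using bc_class_mult[OF obj(2) l(2,3,5)] bc_con_val[OF E l(2,3)] bc_con_val[OF E l(2,5)]
      bc_con_val[OF E l(2) Hom_closed(1)[OF l(3,5)]] bc_class_mult[OF obj(1)] l(4,6) by simp
qed

text \<open>Both sides are sequences of lifts of shift 1, so they agree as soon as they do in degree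
  0. There \<open>con_lift_natural\<close> applies, whatever the two horseshoes look like in higher
  degrees.\<close>

lemma con_seq_natural:
  assumes E: "short_exact C i p" and E': "short_exact C i' p'"
    and abc: "a \<in> Hom C (Dom C i) (Dom C i')" "b \<in> Hom C (Cod C i) (Cod C i')"
      "c \<in> Hom C (Cod C p) (Cod C p')" "b \<cdot> i = i' \<cdot> a" "c \<cdot> p = p' \<cdot> b"
  shows "lft a k \<cdot> con_seq' i p k \<approx> con_seq' i' p' k \<cdot> lft c (Suc k)"
proof -
  let ?R = "res (Dom C i)" and ?S = "res (Cod C p)" and ?R' = "res (Dom C i')" and ?S' = "res (Cod C p')"
  interpret H: horseshoe_setup C ?R ?S i p "hs i p" by (rule horseshoe[OF E])
  interpret H': horseshoe_setup C ?R' ?S' i' p' "hs i' p'" by (rule horseshoe[OF E'])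
  have 1: "slift 1 ?S ?R' (\<lambda>k. lft a k \<cdot> con_seq' i p k)"
    using slift_comp[OF H.S H.R H'.R H.slift_con_seq lft(2)[OF abc(1)]] by simp
  have 2: "slift 1 ?S ?R' (\<lambda>k. con_seq' i' p' k \<cdot> lft c (k + 1))"
    using slift_comp[OF H.S H'.S H'.R lft(2)[OF abc(3)] H'.slift_con_seq] by simp
  obtain h where h: "con_lift C ?R ?S (hs i p) 0 h" using H.con_lift_exists .
  obtain h' where h': "con_lift C ?R' ?S' (hs i' p') 0 h'" using H'.con_lift_exists .
  have c: "syz_lift C ?S 0 ?S' 0 c (lft c (Suc 0))"
    using lft(4)[OF abc(3), of 0] lft(1)[OF abc(3)] by simp
  have A: "lft a 0 \<cdot> con_seq' i p 0 \<approx> a \<cdot> h"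
    using comp_stable_eq[OF H.con_seq[OF h], of a] con_seq_Hom[OF E, of 0] abc(1) lft(1)[OF abc(1)]
      Syz_res_0[OF Hom_objs(1)[OF abc(1)]] by (simp add: Hom_iff)
  have B: "con_seq' i' p' 0 \<cdot> lft c (Suc 0) \<approx> h' \<cdot> lft c (Suc 0)"
    using stable_eq_comp[OF H'.con_seq[OF h'], of "lft c (Suc 0)"] con_seq_Hom[OF E', of 0]
      lft(3)[OF abc(3), of "Suc 0"] by (simp add: Hom_iff)
  have "a \<cdot> h \<approx> h' \<cdot> lft c (Suc 0)"
    by (rule con_lift_natural[OF horseshoe[OF E] horseshoe[OF E'] h h' abc c])
  then have "lft a 0 \<cdot> con_seq' i p 0 \<approx> con_seq' i' p' 0 \<cdot> lft c (0 + 1)"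
    using stable_eq_trans[OF stable_eq_trans[OF A] stable_eq_sym[OF B]] by simp
  from slift_unique[OF H.S H'.R 1 2 this] show ?thesis by simp
qed

lemma bc_con_natural:
  assumes E: "short_exact C i p" and E': "short_exact C i' p'"
    and abc: "a \<in> Hom C (Dom C i) (Dom C i')" "b \<in> Hom C (Cod C i) (Cod C i')"
      "c \<in> Hom C (Cod C p) (Cod C p')" "b \<cdot> i = i' \<cdot> a" "c \<cdot> p = p' \<cdot> b"
    and x: "x \<in> carrier (BC n (Cod C p))"
  shows "BC_map (n + 1) a (BC_con n i p x) =
    BC_con n i' p' (BC_map n c x)"
proof -
  obtain k g where k: "n + int (Suc k) \<ge> 0" "g \<in> syzHom n (Cod C p) (Suc k)"
    "x = bc_class n (Cod C p) (Suc k) g"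
    using bc_con_cases[OF E x] .
  note v = bc_con_val[OF E k(1,2)]
  note c = bc_map_lft[OF abc(3) k(1,2)]
  note hom = k(2) con_seq_Hom[OF E, of k] con_seq_Hom[OF E', of k] lft(3)[OF abc(1), of k] lft(3)[OF abc(3), of "Suc k"]
  have "lft a k \<cdot> (con_seq' i p k \<cdot> g) = (lft a k \<cdot> con_seq' i p k) \<cdot> g"
    using hom by (simp add: Hom_iff comp_assoc')
  also have "\<dots> \<approx> (con_seq' i' p' k \<cdot> lft c (Suc k)) \<cdot> g"
    using stable_eq_comp[OF con_seq_natural[OF E E' abc, of k], of g] hom by (simp add: Hom_iff typing)
  also have "\<dots> = con_seq' i' p' k \<cdot> (lft c (Suc k) \<cdot> g)"
    using hom by (simp add: Hom_iff comp_assoc')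
  finally show ?thesis
    using bc_map_lft[OF abc(1) v(3,2)] bc_con_val[OF E' k(1) c(2)] v(1) c(1) k(3)
      bc_class_cong[OF Hom_objs(2)[OF abc(1)]] by metis
qed

text \<open>The horseshoe resolves the middle term by \<open>Mid (hs i p)\<close>, while
  \<open>BC\<close> uses the assigned resolution. This sequence of lifts of the identity and
  \<open>from_mid\<close> translate between the two.\<close>

definition to_mid :: "'m \<Rightarrow> 'm \<Rightarrow> nat \<Rightarrow> 'm" where
  "to_mid i p = lifts C (res (Cod C i)) (Mid (hs i p)) (Idt C (Cod C i))"

definition from_mid :: "'m \<Rightarrow> 'm \<Rightarrow> nat \<Rightarrow> 'm" where
  "from_mid i p = lifts C (Mid (hs i p)) (res (Cod C i)) (Idt C (Cod C i))"

text \<open>Each stable equation compares two sequences of lifts with the same first term: an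
  identity, \<open>i\<close> or \<open>p\<close>.\<close>

lemma middle_comparison:
  assumes E: "short_exact C i p"
  shows "to_mid i p k \<in> Hom C (Syz (res (Cod C i)) k) (Syz (Mid (hs i p)) k)"
    "from_mid i p k \<in> Hom C (Syz (Mid (hs i p)) k) (Syz (res (Cod C i)) k)"
    "from_mid i p k \<cdot> to_mid i p k \<approx> Idt C (Syz (res (Cod C i)) k)"
    "lft i k \<approx> from_mid i p k \<cdot> Sin (hs i p) k" "to_mid i p k \<cdot> lft i k \<approx> Sin (hs i p) k"
    "lft p k \<approx> Sout (hs i p) k \<cdot> to_mid i p k" "lft p k \<cdot> from_mid i p k \<approx> Sout (hs i p) k"
proof -
  interpret H: horseshoe_setup C "res (Dom C i)" "res (Cod C p)" i p "hs i p" by (rule horseshoe[OF E])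
  note ip = short_exactD[OF E] and X = short_exact_obj(2)[OF E]
  let ?X = "Cod C i"
  have M0: "Syz H.M 0 = ?X" "Syz (res ?X) 0 = ?X" using H.M Syz_res_0[OF X] by auto
  have id: "Idt C ?X \<in> Hom C (Syz (res ?X) 0) (Syz H.M 0)" "Idt C ?X \<in> Hom C (Syz H.M 0) (Syz (res ?X) 0)"
    using M0 ident[OF X] by simp_all
  note t = slift_lifts(1,2)[OF resn_res[OF X] H.M(1) id(1), folded to_mid_def]
  note t' = slift_lifts(1,2)[OF H.M(1) resn_res[OF X] id(2), folded from_mid_def]
  note li = lft(1,2)[OF ip(5)] and lp = lft(1,2)[OF ip(6)]
  note rs = H.M(1) H.M(1)[unfolded H.M(2)] res[OF X] H.R H.S resn_res[OF X] t(1) t'(1) li(1) lp(1) lp(1)[unfolded ip(3)] M0 H.base ip(1-3) typing_Idt[OF X]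
    Idt_comp comp_Idt stable_eq_refl
  show "to_mid i p k \<in> Hom C (Syz (res ?X) k) (Syz H.M k)" "from_mid i p k \<in> Hom C (Syz H.M k) (Syz (res ?X) k)"
    using slift_Hom[OF t(2), of k] slift_Hom[OF t'(2), of k] by simp_all
  show "from_mid i p k \<cdot> to_mid i p k \<approx> Idt C (Syz (res ?X) k)"
    by (rule slift_unique[OF resn_res[OF X] resn_res[OF X] slift_comp0[OF _ _ _ t(2) t'(2)] slift_Idt])
      (simp_all add: rs)
  show "lft i k \<approx> from_mid i p k \<cdot> Sin (hs i p) k"
    by (rule slift_unique[OF H.R resn_res[OF X] li(2) slift_comp0[OF _ _ _ H.slift_Sin t'(2)]]) (simp_all add: rs)
  show "to_mid i p k \<cdot> lft i k \<approx> Sin (hs i p) k"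
    by (rule slift_unique[OF H.R H.M(1) slift_comp0[OF _ _ _ li(2) t(2)] H.slift_Sin]) (simp_all add: rs)
  show "lft p k \<approx> Sout (hs i p) k \<cdot> to_mid i p k"
    by (rule slift_unique[OF resn_res[OF X] H.S lp(2) slift_comp0[OF _ _ _ t(2) H.slift_Sout]]) (simp_all add: rs)
  show "lft p k \<cdot> from_mid i p k \<approx> Sout (hs i p) k"
    by (rule slift_unique[OF H.M(1) H.S slift_comp0[OF _ _ _ t'(2) lp(2)] H.slift_Sout]) (simp_all add: rs)
qed

section \<open>Exactness of BC at the three terms\<close>

lemma stable_eq_Nul_snull:
  assumes "f \<approx> Nul C X Y" "X \<in> Obj C" "Y \<in> Obj C"
  shows "snull f"
  using assms stable_eq_Nul_iff[of f X Y] stable_eq_Hom[OF assms(1)] Hom_closed(4) by blast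

lemma snull_cong: "f \<approx> g \<Longrightarrow> snull f \<longleftrightarrow> snull g"
  using stable_eq_Nul_iff[of f "Dom C f" "Cod C f"] stable_eq_Nul_iff[of g "Dom C f" "Cod C f"]
    stable_eq_trans stable_eq_sym stable_eq_typing[of f g] unfolding Hom_iff by metis

text \<open>A representative with stably null image is carried by \<open>to_mid\<close> to the
  resolution of the horseshoe, where \<open>stable_exact\<close> applies, and
  \<open>from_mid\<close> carries the outcome back. The converse holds because the lifts of a zero
  arrow are stably null.\<close>

lemma bc_exact_middle:
  assumes E: "short_exact C i p" and y: "y \<in> carrier (BC n (Cod C i))"
  shows "BC_map n p y = \<one>\<^bsub>BC n (Cod C p)\<^esub> \<longleftrightarrow>
    (\<exists>x\<in>carrier (BC n (Dom C i)). y = BC_map n i x)" (is "?L \<longleftrightarrow> ?R")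
proof
  interpret H: horseshoe_setup C "res (Dom C i)" "res (Cod C p)" i p "hs i p" by (rule horseshoe[OF E])
  note ip = short_exactD[OF E]
  note obj = short_exact_obj[OF E]
  note t = middle_comparison[OF E]
  assume ?L
  obtain k0 g0 where k0: "n + int k0 \<ge> 0" "g0 \<in> syzHom n (Cod C i) k0" "y = bc_class n (Cod C i) k0 g0"
    using bc_class_cases[OF obj(2) y] by metis
  have "bc_class (n + int 0) (Cod C p) k0 (lft p k0 \<cdot> g0) = \<one>\<^bsub>BC (n + int 0) (Cod C p)\<^esub>"
    using \<open>?L\<close> bc_map_lft(1)[OF ip(6) k0(1,2)] k0(3) by simp
  then obtain k g where k: "n + int k \<ge> 0" "g \<in> syzHom n (Cod C i) k"
    "bc_class n (Cod C i) k g = y" "snull (lft p k \<cdot> g)"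
    using bc_class_slift_one[OF obj(2,3) lft(2)[OF ip(6)], of n k0 g0] k0 by auto
  note hom = k(2) t(1,2)[of k] lft(3)[OF ip(5), of k] lft(3)[OF ip(6), of k] H.ty(7-12)[of k]
  have "lft p k \<cdot> g \<approx> (Sout (hs i p) k \<cdot> to_mid i p k) \<cdot> g"
    using stable_eq_comp[OF t(6)[of k], of g] hom by (simp add: Hom_iff)
  then have "snull (Sout (hs i p) k \<cdot> (to_mid i p k \<cdot> g))"
    using k(4) snull_cong hom by (simp add: Hom_iff comp_assoc')
  then obtain e where e: "e \<in> syzHom n (Dom C i) k" "to_mid i p k \<cdot> g \<approx> Sin (hs i p) k \<cdot> e"
    using stable_exact[OF H.exact_S[of k], of "to_mid i p k \<cdot> g" "syzA n k"] hom by (auto simp: Hom_iff typing)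
  have "g = Idt C (Syz (res (Cod C i)) k) \<cdot> g" using hom by (simp add: Hom_iff Idt_comp)
  also have "\<dots> \<approx> (from_mid i p k \<cdot> to_mid i p k) \<cdot> g"
    using stable_eq_comp[OF stable_eq_sym[OF t(3)[of k]], of g] hom typing_Idt syz_obj[OF obj(2)]
    by (simp add: Hom_iff)
  also have "\<dots> = from_mid i p k \<cdot> (to_mid i p k \<cdot> g)" using hom by (simp add: Hom_iff comp_assoc')
  also have "\<dots> \<approx> from_mid i p k \<cdot> (Sin (hs i p) k \<cdot> e)"
    using comp_stable_eq[OF e(2), of "from_mid i p k"] hom by (simp add: Hom_iff typing)
  also have "\<dots> = (from_mid i p k \<cdot> Sin (hs i p) k) \<cdot> e" using hom e(1) by (simp add: Hom_iff comp_assoc')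
  also have "\<dots> \<approx> lft i k \<cdot> e"
    using stable_eq_comp[OF stable_eq_sym[OF t(4)[of k]], of e] hom e(1) by (simp add: Hom_iff typing)
  finally have "g \<approx> lft i k \<cdot> e" .
  then have "y = BC_map n i (bc_class n (Dom C i) k e)"
    using bc_map_lft(1)[OF ip(5) k(1) e(1)] k(2,3) bc_class_cong[OF obj(2)] by simp
  then show ?R using bc_class_closed[OF obj(1) k(1) e(1)] by blast
next
  note ip = short_exactD[OF E]
  note obj = short_exact_obj[OF E]
  assume ?R
  then obtain x where x: "x \<in> carrier (BC n (Dom C i))" "y = BC_map n i x" by blast
  obtain k e where k: "n + int k \<ge> 0" "e \<in> syzHom n (Dom C i) k" "x = bc_class n (Dom C i) k e"
    using bc_class_cases[OF obj(1) x(1)] by metis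
  have "BC_map n p y = BC_map n (p \<cdot> i) x"
    using x bc_map_comp[OF ip(5,6) x(1)] by simp
  also have "\<dots> = BC_map n (Nul C (Dom C i) (Cod C p)) x" using ip by simp
  also have "\<dots> = bc_class n (Cod C p) k (lft (Nul C (Dom C i) (Cod C p)) k \<cdot> e)"
    using bc_map_lft(1)[OF Hom_closed(4) k(1,2)] obj k(3) by simp
  also have "\<dots> = \<one>\<^bsub>BC n (Cod C p)\<^esub>"
  proof -
    note z = lft[OF Hom_closed(4)[OF obj(1,3)]]
    have "lft (Nul C (Dom C i) (Cod C p)) k \<approx> Nul C (Syz (res (Dom C i)) k) (Syz (res (Cod C p)) k)"
      using slift_unique[OF resn_res resn_res z(2) slift_Nul, of k] resn_res obj z(1) Syz_res_0
        stable_eq_refl typing_Nul(1)[OF obj(1,3)] by simp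
    then have "snull (lft (Nul C (Dom C i) (Cod C p)) k)" using stable_eq_Nul_iff[OF z(3)] by blast
    then have "snull (lft (Nul C (Dom C i) (Cod C p)) k \<cdot> e)"
      using snull_comp(2) k(2) z(3)[of k] by (simp add: Hom_iff)
    then show ?thesis using bc_class_snull[OF obj(3) k(1) comp[OF k(2) z(3)]] by blast
  qed
  finally show ?L .
qed

lemma bc_exact_right:
  assumes E: "short_exact C i p" and y: "y \<in> carrier (BC n (Cod C p))"
  shows "BC_con n i p y = \<one>\<^bsub>BC (n + 1) (Dom C i)\<^esub> \<longleftrightarrow>
    (\<exists>x\<in>carrier (BC n (Cod C i)). y = BC_map n p x)" (is "?L \<longleftrightarrow> ?R")
proof
  interpret H: horseshoe_setup C "res (Dom C i)" "res (Cod C p)" i p "hs i p" by (rule horseshoe[OF E])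
  note ip = short_exactD[OF E]
  note obj = short_exact_obj[OF E]
  note t = middle_comparison[OF E]
  \<comment> \<open>The arrow \<open>con_seq' i p k\<close> agrees stably with \<open>h\<close> up
    to sign, and the exactness lemmas of the horseshoe speak about \<open>h\<close>.\<close>
  have sn: "snull (con_seq' i p k \<cdot> f) \<longleftrightarrow> snull (h \<cdot> f)"
    if h: "con_lift C (res (Dom C i)) (res (Cod C p)) (hs i p) k h"
      and f: "f \<in> Hom C X (Syz (res (Cod C p)) (Suc k))" for k f h X
  proof -
    have "con_seq' i p k \<cdot> f \<approx> (if even k then h else neg h) \<cdot> f"
      using stable_eq_comp[OF H.con_seq[OF h], of f] con_seq_Hom[OF E, of k] f by (simp add: Hom_iff)
    moreover have "(if even k then h else neg h) \<cdot> f = (if even k then h \<cdot> f else neg (h \<cdot> f))"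
      using H.con_lift_Hom[OF h] f by (simp add: Hom_iff neg_comp)
    moreover have "snull (neg (h \<cdot> f)) \<longleftrightarrow> snull (h \<cdot> f)"
      using snull_neg[of "h \<cdot> f"] snull_neg[of "neg (h \<cdot> f)"] neg_neg comp[OF f H.con_lift_Hom[OF h]]
      by (auto simp: Hom_iff)
    ultimately show ?thesis using snull_cong by (auto split: if_splits)
  qed
  {
    assume ?L
    obtain k0 g0 where k0: "n + int (Suc k0) \<ge> 0" "g0 \<in> syzHom n (Cod C p) (Suc k0)"
      "y = bc_class n (Cod C p) (Suc k0) g0"
      using bc_con_cases[OF E y] .
    have "bc_class (n + int 1) (Dom C i) k0 (con_seq' i p k0 \<cdot> g0) = \<one>\<^bsub>BC (n + int 1) (Dom C i)\<^esub>"
      using \<open>?L\<close> bc_con_val(1)[OF E k0(1,2)] k0(3) by simp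
    then obtain k g where k: "n + int (Suc k) \<ge> 0" "g \<in> syzHom n (Cod C p) (Suc k)"
      "bc_class n (Cod C p) (Suc k) g = y" "snull (con_seq' i p k \<cdot> g)"
      using bc_class_slift_one[OF obj(3,1) H.slift_con_seq, of n k0 g0] k0 by auto
    obtain h where h: "con_lift C (res (Dom C i)) (res (Cod C p)) (hs i p) k h" using H.con_lift_exists .
    have "snull (h \<cdot> g)" using k(4) sn[OF h k(2)] by blast
    then obtain w where w: "w \<in> Hom C (syzA n (Suc k)) (Syz H.M (Suc k))" "g \<approx> Sout (hs i p) (Suc k) \<cdot> w"
      using H.stable_exact_Sout[OF h k(2)] by blast
    note hom = k(2) w(1) t(1,2)[of "Suc k"] lft(3)[OF ip(6), of "Suc k"] H.ty(7-12)[of "Suc k"]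
    have "Sout (hs i p) (Suc k) \<cdot> w \<approx> (lft p (Suc k) \<cdot> from_mid i p (Suc k)) \<cdot> w"
      using stable_eq_comp[OF stable_eq_sym[OF t(7)[of "Suc k"]], of w] hom by (simp add: Hom_iff)
    also have "\<dots> = lft p (Suc k) \<cdot> (from_mid i p (Suc k) \<cdot> w)" using hom by (simp add: Hom_iff comp_assoc')
    finally have "g \<approx> lft p (Suc k) \<cdot> (from_mid i p (Suc k) \<cdot> w)" using w(2) stable_eq_trans by blast
    moreover have tw: "from_mid i p (Suc k) \<cdot> w \<in> syzHom n (Cod C i) (Suc k)"
      using hom by (simp add: Hom_iff typing)
    ultimately have "y = BC_map n p (bc_class n (Cod C i) (Suc k) (from_mid i p (Suc k) \<cdot> w))"
      using bc_map_lft(1)[OF ip(6) k(1) tw] k(2,3) bc_class_cong[OF obj(3)] by simp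
    then show ?R using bc_class_closed[OF obj(2) k(1) tw] by blast
  }
  assume ?R
  then obtain x where x: "x \<in> carrier (BC n (Cod C i))" "y = BC_map n p x" by blast
  \<comment> \<open>A positive stage is required, because the value of the connecting homomorphism
    is read off one stage lower.\<close>
  obtain l w where l: "1 \<le> l" "n + int l \<ge> 0" "w \<in> syzHom n (Cod C i) l" "x = bc_class n (Cod C i) l w"
    using bc_class_cases[OF obj(2) x(1), of 1] by metis
  then obtain k where k: "l = Suc k" by (cases l) auto
  note l = l[unfolded k]
  obtain h where h: "con_lift C (res (Dom C i)) (res (Cod C p)) (hs i p) k h" using H.con_lift_exists .
  note pw = bc_map_lft[OF ip(6) l(2,3)]
  note hom = l(3) t(1,2)[of "Suc k"] lft(3)[OF ip(6), of "Suc k"] H.ty(7-12)[of "Suc k"] H.con_lift_Hom[OF h]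
  have "h \<cdot> (lft p (Suc k) \<cdot> w) = (h \<cdot> lft p (Suc k)) \<cdot> w" using hom by (simp add: Hom_iff comp_assoc')
  also have "\<dots> \<approx> (h \<cdot> (Sout (hs i p) (Suc k) \<cdot> to_mid i p (Suc k))) \<cdot> w"
    using stable_eq_comp[OF comp_stable_eq[OF t(6)[of "Suc k"], of h], of w] hom by (simp add: Hom_iff typing)
  also have "\<dots> = (h \<cdot> Sout (hs i p) (Suc k)) \<cdot> (to_mid i p (Suc k) \<cdot> w)"
    using hom by (simp add: Hom_iff typing comp_assoc')
  finally have *: "h \<cdot> (lft p (Suc k) \<cdot> w) \<approx> (h \<cdot> Sout (hs i p) (Suc k)) \<cdot> (to_mid i p (Suc k) \<cdot> w)" .
  have "snull (h \<cdot> Sout (hs i p) (Suc k))"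
    using stable_eq_Nul_snull[OF H.con_lift_Sout[OF h]] resn_typing(7)[OF H.M(1)] syz_obj obj by blast
  then have "snull ((h \<cdot> Sout (hs i p) (Suc k)) \<cdot> (to_mid i p (Suc k) \<cdot> w))"
    using snull_comp(2) hom by (simp add: Hom_iff typing)
  then have "snull (con_seq' i p k \<cdot> (lft p (Suc k) \<cdot> w))"
    using sn[OF h pw(2)] snull_cong[OF *] by blast
  then show ?L
    using bc_con_val[OF E l(2) pw(2)] x(2) l(4) pw(1) bc_class_snull[OF obj(1)] by simp
qed

lemma bc_exact_left:
  assumes E: "short_exact C i p" and y: "y \<in> carrier (BC (n + 1) (Dom C i))"
  shows "BC_map (n + 1) i y = \<one>\<^bsub>BC (n + 1) (Cod C i)\<^esub> \<longleftrightarrow>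
    (\<exists>x\<in>carrier (BC n (Cod C p)). y = BC_con n i p x)" (is "?L \<longleftrightarrow> ?R")
proof
  interpret H: horseshoe_setup C "res (Dom C i)" "res (Cod C p)" i p "hs i p" by (rule horseshoe[OF E])
  note ip = short_exactD[OF E]
  note obj = short_exact_obj[OF E]
  note t = middle_comparison[OF E]
  {
    assume ?L
    obtain k0 g0 where k0: "n + 1 + int k0 \<ge> 0" "g0 \<in> syzHom (n + 1) (Dom C i) k0"
      "y = bc_class (n + 1) (Dom C i) k0 g0"
      using bc_class_cases[OF obj(1) y] by metis
    have "bc_class (n + 1 + int 0) (Cod C i) k0 (lft i k0 \<cdot> g0) = \<one>\<^bsub>BC (n + 1 + int 0) (Cod C i)\<^esub>"
      using \<open>?L\<close> bc_map_lft(1)[OF ip(5) k0(1,2)] k0(3) by simp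
    then obtain k g where k: "n + 1 + int k \<ge> 0" "g \<in> syzHom (n + 1) (Dom C i) k"
      "bc_class (n + 1) (Dom C i) k g = y" "snull (lft i k \<cdot> g)"
      using bc_class_slift_one[OF obj(1,2) lft(2)[OF ip(5)], of "n + 1" k0 g0] k0 by auto
    obtain h where h: "con_lift C (res (Dom C i)) (res (Cod C p)) (hs i p) k h" using H.con_lift_exists .
    note hom = k(2) t(1,2)[of k] lft(3)[OF ip(5), of k] H.ty(7-12)[of k]
    have "Sin (hs i p) k \<cdot> g \<approx> (to_mid i p k \<cdot> lft i k) \<cdot> g"
      using stable_eq_comp[OF stable_eq_sym[OF t(5)[of k]], of g] hom by (simp add: Hom_iff)
    moreover have "snull ((to_mid i p k \<cdot> lft i k) \<cdot> g)"
      using snull_comp(1)[OF k(4), of "to_mid i p k"] hom by (simp add: Hom_iff typing comp_assoc')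
    ultimately have "snull (Sin (hs i p) k \<cdot> g)" using snull_cong by blast
    then obtain w where w: "w \<in> Hom C (syzA (n + 1) k) (Syz (res (Cod C p)) (Suc k))" "g \<approx> h \<cdot> w"
      using H.stable_exact_con[OF h k(2)] by blast
    \<comment> \<open>\<open>con_seq' i p k\<close> carries the sign \<open>(-1)^k\<close> and
      \<open>h\<close> does not; the sign is moved into the preimage.\<close>
    define w' where "w' = (if even k then w else neg w)"
    have w': "w' \<in> syzHom n (Cod C p) (Suc k)"
      using w(1) Hom_closed unfolding w'_def syzA_Suc by simp
    have "con_seq' i p k \<cdot> w' \<approx> (if even k then h else neg h) \<cdot> w'"
      using stable_eq_comp[OF H.con_seq[OF h], of w'] con_seq_Hom[OF E, of k] w' by (simp add: Hom_iff)
    also have "(if even k then h else neg h) \<cdot> w' = h \<cdot> w"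
      using w(1) H.con_lift_Hom[OF h] unfolding w'_def by (simp add: Hom_iff typing neg_comp comp_neg neg_neg)
    finally have "g \<approx> con_seq' i p k \<cdot> w'" using w(2) stable_eq_trans stable_eq_sym by blast
    moreover have nk: "n + int (Suc k) \<ge> 0" using k(1) by simp
    ultimately have "y = BC_con n i p (bc_class n (Cod C p) (Suc k) w')"
      using bc_con_val(1)[OF E nk w'] k(2,3) bc_class_cong[OF obj(1)] by simp
    then show ?R using bc_class_closed[OF obj(3) nk w'] by blast
  }
  assume ?R
  then obtain x where x: "x \<in> carrier (BC n (Cod C p))" "y = BC_con n i p x" by blast
  obtain k w where k: "n + int (Suc k) \<ge> 0" "w \<in> syzHom n (Cod C p) (Suc k)"
    "x = bc_class n (Cod C p) (Suc k) w"
    using bc_con_cases[OF E x(1)] .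
  obtain h where h: "con_lift C (res (Dom C i)) (res (Cod C p)) (hs i p) k h" using H.con_lift_exists .
  note v = bc_con_val[OF E k(1,2)]
  note hom = k(2) t(1,2)[of k] lft(3)[OF ip(5), of k] H.ty(7-12)[of k] H.con_lift_Hom[OF h] con_seq_Hom[OF E, of k]
  have s0: "snull (Sin (hs i p) k \<cdot> h)"
    using stable_eq_Nul_snull[OF H.Sin_con_lift[OF h]] resn_typing(7)[OF H.M(1)] syz_obj obj by blast
  have "Sin (hs i p) k \<cdot> con_seq' i p k \<approx> Sin (hs i p) k \<cdot> (if even k then h else neg h)"
    using comp_stable_eq[OF H.con_seq[OF h], of "Sin (hs i p) k"] hom by (simp add: Hom_iff)
  moreover have "snull (Sin (hs i p) k \<cdot> (if even k then h else neg h))"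
    using s0 snull_neg[OF s0] hom by (simp add: Hom_iff comp_neg)
  ultimately have s: "snull (Sin (hs i p) k \<cdot> con_seq' i p k)" using snull_cong by blast
  have "lft i k \<cdot> (con_seq' i p k \<cdot> w) = (lft i k \<cdot> con_seq' i p k) \<cdot> w"
    using hom by (simp add: Hom_iff comp_assoc')
  also have "\<dots> \<approx> ((from_mid i p k \<cdot> Sin (hs i p) k) \<cdot> con_seq' i p k) \<cdot> w"
    using stable_eq_comp[OF stable_eq_comp[OF t(4)[of k], of "con_seq' i p k"], of w] hom
    by (simp add: Hom_iff typing)
  also have "\<dots> = from_mid i p k \<cdot> ((Sin (hs i p) k \<cdot> con_seq' i p k) \<cdot> w)"
    using hom by (simp add: Hom_iff typing comp_assoc')
  finally have *: "lft i k \<cdot> (con_seq' i p k \<cdot> w) \<approx> from_mid i p k \<cdot> ((Sin (hs i p) k \<cdot> con_seq' i p k) \<cdot> w)" .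
  have "snull (from_mid i p k \<cdot> ((Sin (hs i p) k \<cdot> con_seq' i p k) \<cdot> w))"
    using snull_comp(1)[OF snull_comp(2)[OF s, of w], of "from_mid i p k"] hom by (simp add: Hom_iff typing)
  then have "snull (lft i k \<cdot> (con_seq' i p k \<cdot> w))" using snull_cong[OF *] by blast
  then show ?L
    using bc_map_lft[OF ip(5) v(3,2)] x(2) k(3) v(1) bc_class_snull[OF obj(2) v(3)] by simp
qed

lemma BC_functor_simps [simp]:
  "Fobj (BC_functor C res hs A) = BC"
  "Fmor (BC_functor C res hs A) = BC_map"
  "Fcon (BC_functor C res hs A) = BC_con"
  by (simp_all add: BC_functor_def)

theorem cohomological_functor_BC: "cohomological_functor C (BC_functor C res hs A)"
proof (rule cohomological_functor.intro, unfold BC_functor_simps)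
  show "exact_seq
        ([BC (n + 1) (Cod C i), BC (n + 1) (Dom C i), BC n (Cod C p),
          BC n (Cod C i), BC n (Dom C i)],
         [BC_map (n + 1) i, BC_con n i p, BC_map n p, BC_map n i])"
    if E: "short_exact C i p" for n i p
  proof -
    note ip = short_exactD[OF E]
    note obj = short_exact_obj[OF E]
    show ?thesis
      by (rule exact_seqI)
        (use obj comm_group_bc bc_map_hom[OF ip(5)] bc_map_hom[OF ip(6)] bc_con_hom[OF E]
           bc_exact_middle[OF E] bc_exact_right[OF E] bc_exact_left[OF E] in \<open>auto simp: comm_group_def\<close>)
  qed
qed ((rule comm_group_bc bc_map_hom bc_map_ident bc_map_comp bc_map_plus bc_con_hom bc_con_natural;
    assumption)+)

text \<open>The identity of \<open>P\<close> is stably zero. Identities and zero arrows both form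
  sequences of lifts, so by uniqueness the identity of every syzygy of \<open>P\<close> is stably
  zero as well, whatever resolution is assigned to \<open>P\<close>.\<close>

lemma vanishes_BC: "vanishes_on_projectives C (BC_functor C res hs A)"
  unfolding vanishes_on_projectives_def BC_functor_simps
proof (intro allI impI)
  fix n P assume P: "projective C P"
  then have obj: "P \<in> Obj C" by (simp add: projective_def)
  interpret G: comm_group "BC n P" by (rule comm_group_bc[OF obj])
  have "x = \<one>\<^bsub>BC n P\<^esub>" if x: "x \<in> carrier (BC n P)" for x
  proof -
    obtain k g where k: "n + int k \<ge> 0" "g \<in> syzHom n P k" "x = bc_class n P k g"
      using bc_class_cases[OF obj x] by metis
    have "Idt C P = Idt C P \<cdot> Idt C P" using typing_Idt[OF obj] by (simp add: comp_Idt)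
    then have "Idt C P \<approx> Nul C P P" using stable_eq_Nul_factor[OF P ident[OF obj] ident[OF obj]] by simp
    then have "Idt C (Syz (res P) k) \<approx> Nul C (Syz (res P) k) (Syz (res P) k)"
      using slift_unique[OF resn_res resn_res slift_Idt slift_Nul, OF obj obj resn_res resn_res resn_res,
          OF obj obj obj, of k] Syz_res_0[OF obj] by simp
    then have "snull (Idt C (Syz (res P) k))" using stable_eq_Nul_iff ident syz_obj[OF obj] by blast
    then have "snull (Idt C (Syz (res P) k) \<cdot> g)"
      using snull_comp(2) k(2) typing_Idt[OF syz_obj[OF obj, of k]] by (simp add: Hom_iff)
    then have "snull g" using k(2) by (simp add: Hom_iff Idt_comp)
    then show ?thesis using bc_class_snull[OF obj k(1,2)] k(3) by simp
  qed
  then show "carrier (BC n P) = {\<one>\<^bsub>BC n P\<^esub>}" by auto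
qed

end

section \<open>Cocycles modulo coboundaries\<close>

locale ext_setting = projective_abelian_category C
  for C :: "('o, 'm) abcat" (structure) +
  fixes R :: "('o, 'm) resolution"
  assumes R: "resn R"
begin

lemmas tyR = resn_typing[OF R]

text \<open>Cocycles are the arrows \<open>f \<cdot> prj R m\<close> with \<open>f : Syz R m \<rightarrow> Y\<close>. Such a cocycle is a
  coboundary iff \<open>f\<close> extends along \<open>inc R (m - 1)\<close>, or is zero if \<open>m = 0\<close>.\<close>

definition enull :: "nat \<Rightarrow> 'm \<Rightarrow> bool" where
  "enull m f \<longleftrightarrow> (case m of 0 \<Rightarrow> f = Nul C (Dom C f) (Cod C f)
     | Suc k \<Rightarrow> \<exists>g\<in>Hom C (Pr R k) (Cod C f). f = g \<cdot> inc R k)"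

lemma enull_0: "f \<in> Hom C X Y \<Longrightarrow> enull 0 f \<longleftrightarrow> f = Nul C X Y"
  by (auto simp: enull_def Hom_iff)

lemma enull_Suc: "f \<in> Hom C X Y \<Longrightarrow> enull (Suc k) f \<longleftrightarrow> (\<exists>g\<in>Hom C (Pr R k) Y. f = g \<cdot> inc R k)"
  by (auto simp: enull_def Hom_iff)

section \<open>Cocycles as arrows out of syzygies\<close>

lemma prj_epi: "\<lbrakk>f \<cdot> prj R m = g \<cdot> prj R m; f \<in> Hom C (Syz R m) Y; g \<in> Hom C (Syz R m) Y\<rbrakk> \<Longrightarrow> f = g"
  using short_exact_epi[OF resn_exact[OF R, of m], of f Y g] tyR by simp

lemma prj_Hom: "f \<in> Hom C (Syz R m) Y \<Longrightarrow> f \<cdot> prj R m \<in> Hom C (Pr R m) Y"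
  using tyR by (simp add: Hom_iff typing)

lemma inc_desc:
  assumes "f \<in> Hom C (Pr R m) Y" "f \<cdot> inc R m = Nul C (Syz R (Suc m)) Y"
  obtains f' where "f' \<in> Hom C (Syz R m) Y" "f = f' \<cdot> prj R m"
  using short_exact_desc[OF resn_exact[OF R, of m], of f Y] assms tyR by auto

lemma cocycles_iff: "f \<in> cocycles C R m Y \<longleftrightarrow> (\<exists>f'\<in>Hom C (Syz R m) Y. f = f' \<cdot> prj R m)"
proof
  assume "f \<in> cocycles C R m Y"
  then have f: "f \<in> Hom C (Pr R m) Y" "f \<cdot> (inc R m \<cdot> prj R (Suc m)) = Nul C (Pr R (Suc m)) Y"
    by (auto simp: cocycles_def diff_def)
  note Y = Hom_objs(2)[OF f(1)]
  have "(f \<cdot> inc R m) \<cdot> prj R (Suc m) = Nul C (Syz R (Suc m)) Y \<cdot> prj R (Suc m)"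
    using f tyR Y by (simp add: Hom_iff comp_assoc' Nul_comp)
  then have "f \<cdot> inc R m = Nul C (Syz R (Suc m)) Y"
    by (rule prj_epi) (use f tyR Y in \<open>simp_all add: Hom_iff typing\<close>)
  then show "\<exists>f'\<in>Hom C (Syz R m) Y. f = f' \<cdot> prj R m" using inc_desc[OF f(1)] by blast
next
  assume "\<exists>f'\<in>Hom C (Syz R m) Y. f = f' \<cdot> prj R m"
  then obtain f' where f: "f' \<in> Hom C (Syz R m) Y" "f = f' \<cdot> prj R m" by blast
  have "f' \<cdot> (prj R m \<cdot> (inc R m \<cdot> prj R (Suc m))) = Nul C (Pr R (Suc m)) Y"
    using f(1) tyR by (simp add: Hom_iff comp_reduce[OF resn_zero[OF R]] Nul_comp comp_Nul)
  then show "f \<in> cocycles C R m Y"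
    using f tyR by (simp add: cocycles_def diff_def Hom_iff typing comp_assoc')
qed

lemma coboundaries_iff:
  assumes Y: "Y \<in> Obj C"
  shows "f \<in> coboundaries C R m Y \<longleftrightarrow> (\<exists>f'\<in>Hom C (Syz R m) Y. f = f' \<cdot> prj R m \<and> enull m f')"
proof (cases m)
  case 0
  have "(\<exists>f'\<in>Hom C (Syz R 0) Y. f = f' \<cdot> prj R 0 \<and> enull 0 f') \<longleftrightarrow> f = Nul C (Syz R 0) Y \<cdot> prj R 0"
    using enull_0 Hom_closed(4)[OF tyR(7) Y] by auto
  then show ?thesis using 0 tyR Y by (simp add: Nul_comp)
next
  case (Suc k)
  have "f = g \<cdot> diff C R k \<longleftrightarrow> f = (g \<cdot> inc R k) \<cdot> prj R (Suc k)" if "g \<in> Hom C (Pr R k) Y" for g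
    using that tyR by (simp add: diff_def Hom_iff comp_assoc')
  moreover have "g \<cdot> inc R k \<in> Hom C (Syz R (Suc k)) Y" if "g \<in> Hom C (Pr R k) Y" for g
    using that tyR by (simp add: Hom_iff typing)
  ultimately show ?thesis
    using enull_Suc unfolding Suc by (auto simp: image_iff)
qed

lemma coboundary_iff:
  assumes "f \<in> Hom C (Syz R m) Y"
  shows "f \<cdot> prj R m \<in> coboundaries C R m Y \<longleftrightarrow> enull m f"
  unfolding coboundaries_iff[OF Hom_objs(2)[OF assms]] using assms prj_epi by blast

lemma enull_Nul:
  assumes "Y \<in> Obj C" shows "enull m (Nul C (Syz R m) Y)"
proof (cases m)
  case (Suc k)
  have "Nul C (Syz R m) Y = Nul C (Pr R k) Y \<cdot> inc R k"
    using tyR assms Suc by (simp add: Nul_comp)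
  then show ?thesis
    using enull_Suc[OF Hom_closed(4)[OF tyR(7)[of "Suc k"] assms]] Hom_closed(4)[OF tyR(8)[of k] assms] Suc by auto
qed (use enull_0[OF Hom_closed(4)[OF tyR(7) assms]] in simp)

lemma enull_add:
  assumes "f \<in> Hom C (Syz R m) Y" "g \<in> Hom C (Syz R m) Y" "enull m f" "enull m g"
  shows "enull m (f \<boxplus> g)"
proof (cases m)
  case 0
  then show ?thesis
    using assms enull_0[of f] enull_0[of g] enull_0[OF Hom_closed(1)[OF assms(1,2)]] Hom_objs[OF assms(1)]
    by (auto simp: add_Nul typing)
next
  case (Suc k)
  obtain u v where uv: "u \<in> Hom C (Pr R k) Y" "f = u \<cdot> inc R k" "v \<in> Hom C (Pr R k) Y" "g = v \<cdot> inc R k"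
    using assms enull_Suc Suc by blast
  then have "f \<boxplus> g = (u \<boxplus> v) \<cdot> inc R k" using tyR by (simp add: Hom_iff add_comp)
  then show ?thesis
    using enull_Suc[OF Hom_closed(1)[OF assms(1,2)[unfolded Suc]]] Hom_closed(1)[OF uv(1,3)] Suc by blast
qed

lemma enull_comp:
  assumes "f \<in> Hom C (Syz R m) Y" "enull m f" "a \<in> Hom C Y Z"
  shows "enull m (a \<cdot> f)"
proof (cases m)
  case 0
  then have "f = Nul C (Syz R 0) Y" using assms enull_0 by blast
  then show ?thesis
    using enull_0[OF comp[OF assms(1,3)]] assms tyR 0 by (simp add: Hom_iff comp_Nul)
next
  case (Suc k)
  obtain u where u: "u \<in> Hom C (Pr R k) Y" "f = u \<cdot> inc R k"
    using assms enull_Suc Suc by blast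
  then have "a \<cdot> f = (a \<cdot> u) \<cdot> inc R k" using tyR assms(3) by (simp add: Hom_iff comp_assoc')
  then show ?thesis
    using enull_Suc[OF comp[OF assms(1)[unfolded Suc] assms(3)]] comp[OF u(1) assms(3)] Suc by blast
qed

lemma enull_neg:
  assumes "f \<in> Hom C (Syz R m) Y" "enull m f"
  shows "enull m (neg f)"
proof -
  have "neg f = neg (Idt C Y) \<cdot> f"
    using assms(1) Hom_objs(2)[OF assms(1)] by (simp add: Hom_iff neg_comp typing Idt_comp)
  then show ?thesis
    using enull_comp[OF assms Hom_closed(3)[OF ident[OF Hom_objs(2)[OF assms(1)]]]] by simp
qed

section \<open>Groups of cocycles and their quotients\<close>

lemma cocycle_group_simps [simp]:
  "carrier (cocycle_group C R m Y) = cocycles C R m Y"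
  "x \<otimes>\<^bsub>cocycle_group C R m Y\<^esub> y = x \<boxplus> y"
  "\<one>\<^bsub>cocycle_group C R m Y\<^esub> = Nul C (Pr R m) Y"
  by (simp_all add: cocycle_group_def hom_group_def)

lemma cocycles_Hom: "f \<in> cocycles C R m Y \<Longrightarrow> f \<in> Hom C (Pr R m) Y"
  by (simp add: cocycles_def)

lemma cocycles_Nul: "Y \<in> Obj C \<Longrightarrow> Nul C (Pr R m) Y \<in> cocycles C R m Y"
  using tyR by (simp add: cocycles_def Hom_iff typing diff_def Nul_comp)

lemma cocycles_add:
  assumes "f \<in> cocycles C R m Y" "g \<in> cocycles C R m Y"
  shows "f \<boxplus> g \<in> cocycles C R m Y"
proof -
  obtain f' g' where "f' \<in> Hom C (Syz R m) Y" "f = f' \<cdot> prj R m" "g' \<in> Hom C (Syz R m) Y" "g = g' \<cdot> prj R m"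
    using assms cocycles_iff by blast
  then have "f' \<boxplus> g' \<in> Hom C (Syz R m) Y" "f \<boxplus> g = (f' \<boxplus> g') \<cdot> prj R m"
    using tyR by (simp_all add: Hom_iff typing add_comp)
  then show ?thesis using cocycles_iff by blast
qed

lemma cocycles_neg:
  assumes "f \<in> cocycles C R m Y"
  shows "neg f \<in> cocycles C R m Y"
proof -
  obtain f' where "f' \<in> Hom C (Syz R m) Y" "f = f' \<cdot> prj R m"
    using assms cocycles_iff by blast
  then have "neg f' \<in> Hom C (Syz R m) Y" "neg f = neg f' \<cdot> prj R m"
    using tyR by (simp_all add: Hom_iff typing neg_comp)
  then show ?thesis using cocycles_iff by blast
qed

lemma comm_group_cocycles:
  assumes "Y \<in> Obj C" shows "comm_group (cocycle_group C R m Y)"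
proof (rule comm_groupI)
  fix x y z assume "x \<in> carrier (cocycle_group C R m Y)" "y \<in> carrier (cocycle_group C R m Y)"
    "z \<in> carrier (cocycle_group C R m Y)"
  then have "x \<in> Hom C (Pr R m) Y" "y \<in> Hom C (Pr R m) Y" "z \<in> Hom C (Pr R m) Y"
    by (auto intro: cocycles_Hom)
  then show "x \<otimes>\<^bsub>cocycle_group C R m Y\<^esub> y \<otimes>\<^bsub>cocycle_group C R m Y\<^esub> z =
    x \<otimes>\<^bsub>cocycle_group C R m Y\<^esub> (y \<otimes>\<^bsub>cocycle_group C R m Y\<^esub> z)"
    by (simp add: Hom_iff add_assoc)
next
  fix x y assume "x \<in> carrier (cocycle_group C R m Y)" "y \<in> carrier (cocycle_group C R m Y)"
  then have "x \<in> Hom C (Pr R m) Y" "y \<in> Hom C (Pr R m) Y" by (auto intro: cocycles_Hom)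
  then show "x \<otimes>\<^bsub>cocycle_group C R m Y\<^esub> y = y \<otimes>\<^bsub>cocycle_group C R m Y\<^esub> x"
    by (simp add: Hom_iff add_comm)
next
  fix x assume x: "x \<in> carrier (cocycle_group C R m Y)"
  then have "x \<in> Hom C (Pr R m) Y" by (auto intro: cocycles_Hom)
  then show "\<one>\<^bsub>cocycle_group C R m Y\<^esub> \<otimes>\<^bsub>cocycle_group C R m Y\<^esub> x = x"
    "\<exists>y\<in>carrier (cocycle_group C R m Y). y \<otimes>\<^bsub>cocycle_group C R m Y\<^esub> x = \<one>\<^bsub>cocycle_group C R m Y\<^esub>"
    using cocycles_neg[of x] x by (auto simp add: Hom_iff add_Nul sub_self intro!: bexI[of _ "neg x"])
qed (use assms in \<open>simp_all add: cocycles_add cocycles_Nul\<close>)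

lemma inv_cocycles:
  assumes "f \<in> cocycles C R m Y"
  shows "inv\<^bsub>cocycle_group C R m Y\<^esub> f = neg f"
proof -
  note f = cocycles_Hom[OF assms]
  interpret comm_group "cocycle_group C R m Y" by (rule comm_group_cocycles[OF Hom_objs(2)[OF f]])
  show ?thesis
    by (rule inv_equality) (use assms f cocycles_neg in \<open>auto simp: Hom_iff sub_self\<close>)
qed

lemma subgroup_coboundaries:
  assumes "Y \<in> Obj C"
  shows "subgroup (coboundaries C R m Y) (cocycle_group C R m Y)"
proof -
  interpret comm_group "cocycle_group C R m Y" by (rule comm_group_cocycles[OF assms])
  have sub: "coboundaries C R m Y \<subseteq> cocycles C R m Y"
    using coboundaries_iff[OF assms] cocycles_iff by blast
  show ?thesis
  proof (rule subgroup.intro)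
    show "coboundaries C R m Y \<subseteq> carrier (cocycle_group C R m Y)" using sub by simp
    show "\<one>\<^bsub>cocycle_group C R m Y\<^esub> \<in> coboundaries C R m Y"
      using coboundary_iff[OF Hom_closed(4)[OF tyR(7) assms]] enull_Nul[OF assms] tyR assms
      by (simp add: Nul_comp)
  next
    fix x y assume "x \<in> coboundaries C R m Y" "y \<in> coboundaries C R m Y"
    then obtain f g where f: "f \<in> Hom C (Syz R m) Y" "x = f \<cdot> prj R m" "enull m f"
      and g: "g \<in> Hom C (Syz R m) Y" "y = g \<cdot> prj R m" "enull m g"
      using coboundaries_iff[OF assms] by blast
    have "x \<boxplus> y = (f \<boxplus> g) \<cdot> prj R m" using f g tyR by (simp add: Hom_iff add_comp)
    then show "x \<otimes>\<^bsub>cocycle_group C R m Y\<^esub> y \<in> coboundaries C R m Y"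
      using coboundary_iff[OF Hom_closed(1)[OF f(1) g(1)]] enull_add f g by simp
  next
    fix x assume x: "x \<in> coboundaries C R m Y"
    then obtain f where f: "f \<in> Hom C (Syz R m) Y" "x = f \<cdot> prj R m" "enull m f"
      using coboundaries_iff[OF assms] by blast
    have "neg x = neg f \<cdot> prj R m" using f tyR by (simp add: Hom_iff neg_comp)
    moreover have "inv\<^bsub>cocycle_group C R m Y\<^esub> x = neg x" using inv_cocycles x sub by blast
    ultimately show "inv\<^bsub>cocycle_group C R m Y\<^esub> x \<in> coboundaries C R m Y"
      using coboundary_iff[OF Hom_closed(3)[OF f(1)]] enull_neg f by simp
  qed
qed

text \<open>Ext classes are named by arrows out of the \<open>m\<close>-th syzygy, the same data
  that name stable classes. In these terms the comparison map is the identity on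
  representatives.\<close>

definition ecl :: "nat \<Rightarrow> 'o \<Rightarrow> 'm \<Rightarrow> 'm set" where
  "ecl m Y f = ext_class C R m Y (f \<cdot> prj R m)"

lemma cocycle: "f \<in> Hom C (Syz R m) Y \<Longrightarrow> f \<cdot> prj R m \<in> cocycles C R m Y"
  using cocycles_iff by blast

lemma
  assumes Y: "Y \<in> Obj C"
  shows ecl_Nul: "\<one>\<^bsub>ext_group C R (int m) Y\<^esub> = ecl m Y (Nul C (Syz R m) Y)"
    and ext_cases': "x \<in> carrier (ext_group C R (int m) Y) \<Longrightarrow> \<exists>f\<in>Hom C (Syz R m) Y. x = ecl m Y f"
    and comm_group_ext': "comm_group (ext_group C R (int m) Y)"
    and ecl_closed': "f \<in> Hom C (Syz R m) Y \<Longrightarrow> ecl m Y f \<in> carrier (ext_group C R (int m) Y)"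
    and ecl_mult': "\<lbrakk>f \<in> Hom C (Syz R m) Y; g \<in> Hom C (Syz R m) Y\<rbrakk> \<Longrightarrow>
      ecl m Y f \<otimes>\<^bsub>ext_group C R (int m) Y\<^esub> ecl m Y g = ecl m Y (f \<boxplus> g)"
    and ecl_neg': "f \<in> Hom C (Syz R m) Y \<Longrightarrow> inv\<^bsub>ext_group C R (int m) Y\<^esub> ecl m Y f = ecl m Y (neg f)"
    and ecl_eq_iff': "\<lbrakk>f \<in> Hom C (Syz R m) Y; g \<in> Hom C (Syz R m) Y\<rbrakk> \<Longrightarrow>
      ecl m Y f = ecl m Y g \<longleftrightarrow> enull m (f \<boxminus> g)"
    and mem_ecl_iff': "f \<in> Hom C (Syz R m) Y \<Longrightarrow>
      u \<in> ecl m Y f \<longleftrightarrow> (\<exists>f'\<in>Hom C (Syz R m) Y. u = f' \<cdot> prj R m \<and> enull m (f' \<boxminus> f))"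
proof -
  interpret comm_group "cocycle_group C R m Y" by (rule comm_group_cocycles[OF Y])
  note sg = subgroup_coboundaries[OF Y, of m]
  note F = FactGroup_rcos[OF sg, folded ext_class_def, unfolded cocycle_group_simps]
  have G: "ext_group C R (int m) Y = cocycle_group C R m Y Mod coboundaries C R m Y"
    by (simp add: ext_group_def)
  have sub: "f \<cdot> prj R m \<boxminus> g \<cdot> prj R m = (f \<boxminus> g) \<cdot> prj R m"
    if "f \<in> Hom C (Syz R m) Y" "g \<in> Hom C (Syz R m) Y" for f g
    using that tyR by (simp add: Hom_iff add_comp neg_comp typing)
  show "comm_group (ext_group C R (int m) Y)" unfolding G by (rule abelian_FactGroup[OF sg])
  show "\<one>\<^bsub>ext_group C R (int m) Y\<^esub> = ecl m Y (Nul C (Syz R m) Y)"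
    unfolding G F(4) ecl_def using tyR Y by (simp add: Nul_comp)
  show "x \<in> carrier (ext_group C R (int m) Y) \<Longrightarrow> \<exists>f\<in>Hom C (Syz R m) Y. x = ecl m Y f"
    unfolding G ecl_def using F(2)[of x] cocycles_iff by auto
  show "f \<in> Hom C (Syz R m) Y \<Longrightarrow> ecl m Y f \<in> carrier (ext_group C R (int m) Y)"
    unfolding G ecl_def using F(1) cocycle by blast
  show "\<lbrakk>f \<in> Hom C (Syz R m) Y; g \<in> Hom C (Syz R m) Y\<rbrakk> \<Longrightarrow>
      ecl m Y f \<otimes>\<^bsub>ext_group C R (int m) Y\<^esub> ecl m Y g = ecl m Y (f \<boxplus> g)"
    unfolding G ecl_def using F(3)[OF cocycle cocycle, of f g] tyR by (simp add: Hom_iff add_comp)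
  show "f \<in> Hom C (Syz R m) Y \<Longrightarrow> inv\<^bsub>ext_group C R (int m) Y\<^esub> ecl m Y f = ecl m Y (neg f)"
    unfolding G ecl_def using F(5)[OF cocycle, of f] inv_cocycles[OF cocycle, of f] tyR
    by (simp add: Hom_iff neg_comp)
  show "\<lbrakk>f \<in> Hom C (Syz R m) Y; g \<in> Hom C (Syz R m) Y\<rbrakk> \<Longrightarrow>
      ecl m Y f = ecl m Y g \<longleftrightarrow> enull m (f \<boxminus> g)"
    unfolding ecl_def ext_class_def
    using rcos_eq_iff[OF sg, of "f \<cdot> prj R m" "g \<cdot> prj R m"] cocycle[of f m Y] cocycle[of g m Y]
      inv_cocycles[OF cocycle, of g] sub[of f g] coboundary_iff[OF Hom_closed(2)[of f _ _ g]] by simp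
  show "u \<in> ecl m Y f \<longleftrightarrow> (\<exists>f'\<in>Hom C (Syz R m) Y. u = f' \<cdot> prj R m \<and> enull m (f' \<boxminus> f))"
    if f: "f \<in> Hom C (Syz R m) Y"
  proof -
    have "u \<in> ecl m Y f \<longleftrightarrow> u \<in> cocycles C R m Y \<and> u \<boxminus> f \<cdot> prj R m \<in> coboundaries C R m Y"
      unfolding ecl_def ext_class_def
      using mem_rcos_iff[OF sg, of "f \<cdot> prj R m" u] cocycle[OF f] inv_cocycles[OF cocycle[OF f]] by simp
    also have "\<dots> \<longleftrightarrow> (\<exists>f'\<in>Hom C (Syz R m) Y. u = f' \<cdot> prj R m \<and> enull m (f' \<boxminus> f))"
      using cocycles_iff sub[OF _ f] coboundary_iff[OF Hom_closed(2)[OF _ f]] by auto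
    finally show ?thesis .
  qed
qed

lemma ecl_closed: "f \<in> Hom C (Syz R m) Y \<Longrightarrow> ecl m Y f \<in> carrier (ext_group C R (int m) Y)"
  using ecl_closed' Hom_objs by blast

lemma ecl_mult: "\<lbrakk>f \<in> Hom C (Syz R m) Y; g \<in> Hom C (Syz R m) Y\<rbrakk> \<Longrightarrow>
    ecl m Y f \<otimes>\<^bsub>ext_group C R (int m) Y\<^esub> ecl m Y g = ecl m Y (f \<boxplus> g)"
  using ecl_mult' Hom_objs by blast

lemma ecl_neg: "f \<in> Hom C (Syz R m) Y \<Longrightarrow> inv\<^bsub>ext_group C R (int m) Y\<^esub> ecl m Y f = ecl m Y (neg f)"
  using ecl_neg' Hom_objs by blast

lemma ecl_eq_iff: "\<lbrakk>f \<in> Hom C (Syz R m) Y; g \<in> Hom C (Syz R m) Y\<rbrakk> \<Longrightarrow>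
    ecl m Y f = ecl m Y g \<longleftrightarrow> enull m (f \<boxminus> g)"
  using ecl_eq_iff' Hom_objs by blast

lemma mem_ecl_iff: "f \<in> Hom C (Syz R m) Y \<Longrightarrow>
    x \<in> ecl m Y f \<longleftrightarrow> (\<exists>f'\<in>Hom C (Syz R m) Y. x = f' \<cdot> prj R m \<and> enull m (f' \<boxminus> f))"
  using mem_ecl_iff' Hom_objs by blast

lemma enull_self: "f \<in> Hom C (Syz R m) Y \<Longrightarrow> enull m (f \<boxminus> f)"
  using enull_Nul[OF Hom_objs(2)] by (auto simp: sub_self Hom_iff cod_obj)

lemma ecl_eq_one_iff:
  assumes "f \<in> Hom C (Syz R m) Y"
  shows "ecl m Y f = \<one>\<^bsub>ext_group C R (int m) Y\<^esub> \<longleftrightarrow> enull m f"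
proof -
  note Y = Hom_objs(2)[OF assms]
  have "f \<boxminus> Nul C (Syz R m) Y = f" using assms tyR Y by (simp add: Hom_iff neg_Nul add_Nul)
  then show ?thesis using ecl_eq_iff[OF assms Hom_closed(4)[OF tyR(7) Y]] ecl_Nul[OF Y] by simp
qed

section \<open>Induced maps and connecting homomorphisms on Ext classes\<close>

lemma ext_map_ecl:
  assumes a: "a \<in> Hom C Y Z" and f: "f \<in> Hom C (Syz R m) Y"
  shows "ext_map C R (int m) a (ecl m Y f) = ecl m Z (a \<cdot> f)"
proof -
  have a': "Cod C a = Z" using a by (simp add: Hom_iff)
  have "class_map (\<lambda>x U. U = ext_class C R m Z (a \<cdot> x)) (ecl m Y f) = ecl m Z (a \<cdot> f)"
  proof (rule class_map_eqI)
    show "f \<cdot> prj R m \<in> ecl m Y f" using mem_ecl_iff[OF f] f enull_self[OF f] by blast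
    show "ecl m Z (a \<cdot> f) = ext_class C R m Z (a \<cdot> (f \<cdot> prj R m))"
      using a f tyR by (simp add: ecl_def Hom_iff comp_assoc')
    fix x U assume x: "x \<in> ecl m Y f" "U = ext_class C R m Z (a \<cdot> x)"
    then obtain g where g: "g \<in> Hom C (Syz R m) Y" "x = g \<cdot> prj R m" "enull m (g \<boxminus> f)"
      using mem_ecl_iff[OF f] by blast
    have "U = ecl m Z (a \<cdot> g)" using x(2) g(1,2) a tyR by (simp add: ecl_def Hom_iff comp_assoc')
    moreover have "enull m (a \<cdot> g \<boxminus> a \<cdot> f)"
      using enull_comp[OF Hom_closed(2)[OF g(1) f] g(3) a] a f g(1)
      by (simp add: Hom_iff comp_add comp_neg typing)
    ultimately show "U = ecl m Z (a \<cdot> f)"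
      using ecl_eq_iff[OF comp[OF g(1) a] comp[OF f a]] by simp
  qed
  then show ?thesis by (simp add: ext_map_def a')
qed

text \<open>The connecting homomorphism read on arrows out of syzygies. For the sequences of a
  resolution it is \<open>syz_lift\<close>, and for those of a horseshoe it is realised by
  composition with a \<open>con_lift\<close>.\<close>

definition elift :: "nat \<Rightarrow> 'm \<Rightarrow> 'm \<Rightarrow> 'm \<Rightarrow> 'm \<Rightarrow> bool" where
  "elift m i p f h \<longleftrightarrow> f \<in> Hom C (Syz R m) (Cod C p) \<and> h \<in> Hom C (Syz R (Suc m)) (Dom C i) \<and>
    (\<exists>g\<in>Hom C (Pr R m) (Cod C i). p \<cdot> g = f \<cdot> prj R m \<and> i \<cdot> h = g \<cdot> inc R m)"

lemma elift_inc:
  assumes E: "short_exact C i p" and f: "f \<in> Hom C (Syz R m) (Cod C p)"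
    and g: "g \<in> Hom C (Pr R m) (Cod C i)" "p \<cdot> g = f \<cdot> prj R m"
  obtains h where "h \<in> Hom C (Syz R (Suc m)) (Dom C i)" "i \<cdot> h = g \<cdot> inc R m"
proof -
  note ip = short_exactD[OF E]
  have "p \<cdot> (g \<cdot> inc R m) = Nul C (Syz R (Suc m)) (Cod C p)"
    using g(1) f ip tyR by (subst comp_reduce[OF g(2)]) (auto simp: Hom_iff typing comp_assoc' resn_zero[OF R] comp_Nul)
  then show thesis using short_exact_lift[OF E, of "g \<cdot> inc R m"] that g(1) tyR by (auto simp: Hom_iff typing)
qed

lemma elift_exists:
  assumes E: "short_exact C i p" and f: "f \<in> Hom C (Syz R m) (Cod C p)"
  obtains h where "elift m i p f h"
proof -
  obtain g where g: "g \<in> Hom C (Pr R m) (Cod C i)" "p \<cdot> g = f \<cdot> prj R m"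
    using projective_lift[OF resn_projective[OF R] E prj_Hom[OF f]] .
  obtain h where "h \<in> Hom C (Syz R (Suc m)) (Dom C i)" "i \<cdot> h = g \<cdot> inc R m" using elift_inc[OF E f g] .
  then show thesis using that[of h] g f unfolding elift_def by blast
qed

lemma elift_cong:
  assumes E: "short_exact C i p" and L: "elift m i p f h" "elift m i p f' h'" and n: "enull m (f \<boxminus> f')"
  shows "enull (Suc m) (h \<boxminus> h')"
proof -
  note ip = short_exactD[OF E]
  obtain g where g: "g \<in> Hom C (Pr R m) (Cod C i)" "p \<cdot> g = f \<cdot> prj R m" "i \<cdot> h = g \<cdot> inc R m"
    using L(1) unfolding elift_def by blast
  obtain g' where g': "g' \<in> Hom C (Pr R m) (Cod C i)" "p \<cdot> g' = f' \<cdot> prj R m" "i \<cdot> h' = g' \<cdot> inc R m"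
    using L(2) unfolding elift_def by blast
  have hom: "f \<in> Hom C (Syz R m) (Cod C p)" "f' \<in> Hom C (Syz R m) (Cod C p)"
    "h \<in> Hom C (Syz R (Suc m)) (Dom C i)" "h' \<in> Hom C (Syz R (Suc m)) (Dom C i)"
    using L unfolding elift_def by auto
  \<comment> \<open>The difference has to lift along \<open>p\<close>. For \<open>m = 0\<close> it
    is zero; otherwise it extends along \<open>inc R k\<close> to the projective
    \<open>Pr R k\<close>, on which a lift exists.\<close>
  obtain w where w: "w \<in> Hom C (Syz R m) (Cod C i)" "p \<cdot> w = f \<boxminus> f'"
  proof (cases m)
    case 0
    then have "f \<boxminus> f' = Nul C (Syz R m) (Cod C p)"
      using n enull_0[OF Hom_closed(2)[OF hom(1,2)]] by simp
    then show thesis using that[of "Nul C (Syz R m) (Cod C i)"] ip tyR cod_obj[OF ip(1)]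
      by (simp add: Hom_iff typing comp_Nul)
  next
    case (Suc k)
    then obtain u where u: "u \<in> Hom C (Pr R k) (Cod C p)" "f \<boxminus> f' = u \<cdot> inc R k"
      using n enull_Suc[OF Hom_closed(2)[OF hom(1,2)]] by blast
    obtain u' where u': "u' \<in> Hom C (Pr R k) (Cod C i)" "p \<cdot> u' = u"
      using projective_lift[OF resn_projective[OF R] E u(1)] .
    have "p \<cdot> (u' \<cdot> inc R k) = f \<boxminus> f'"
      using u u'(1) ip tyR by (subst comp_reduce[OF u'(2)]) (auto simp: Hom_iff)
    then show thesis using that[of "u' \<cdot> inc R k"] u'(1) tyR Suc by (simp add: Hom_iff typing)
  qed
  let ?d = "(g \<boxminus> g') \<boxminus> w \<cdot> prj R m"
  have "p \<cdot> ?d = Nul C (Pr R m) (Cod C p)"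
    using g(1) g'(1) w(1) hom ip tyR by (simp only: dist g(2) g'(2) comp_reduce[OF w(2)])
  then obtain e where e: "e \<in> Hom C (Pr R m) (Dom C i)" "i \<cdot> e = ?d"
    using short_exact_lift[OF E, of ?d "Pr R m"] g(1) g'(1) w(1) tyR by (auto simp: Hom_iff typing)
  have "i \<cdot> (e \<cdot> inc R m) = ?d \<cdot> inc R m"
    using e(1) ip tyR by (subst comp_reduce[OF e(2)]) (auto simp: Hom_iff)
  also have "\<dots> = i \<cdot> (h \<boxminus> h')"
    using g(1) g'(1) w(1) hom ip tyR by (simp only: dist g(3) g'(3) resn_zero[OF R])
  finally have "e \<cdot> inc R m = h \<boxminus> h'"
    by (rule short_exact_mono[OF E, rotated 2]) (use e(1) hom tyR in \<open>auto simp: Hom_iff typing\<close>)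
  then show ?thesis unfolding enull_Suc[OF Hom_closed(2)[OF hom(3,4)]] using e(1) by metis
qed

lemma ext_con_ecl:
  assumes E: "short_exact C i p" and L: "elift m i p f h"
  shows "ext_con C R (int m) i p (ecl m (Cod C p) f) = ecl (Suc m) (Dom C i) h"
proof -
  note ip = short_exactD[OF E]
  obtain g where g: "g \<in> Hom C (Pr R m) (Cod C i)" "p \<cdot> g = f \<cdot> prj R m" "i \<cdot> h = g \<cdot> inc R m"
    using L unfolding elift_def by blast
  have hom: "f \<in> Hom C (Syz R m) (Cod C p)" "h \<in> Hom C (Syz R (Suc m)) (Dom C i)"
    using L unfolding elift_def by auto
  have "class_map (\<lambda>x Y. \<exists>g \<in> Hom C (Pr R m) (Cod C i). \<exists>h \<in> Hom C (Pr R (Suc m)) (Dom C i).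
             p \<cdot> g = x \<and> i \<cdot> h = g \<cdot> diff C R m \<and>
             Y = ext_class C R (Suc m) (Dom C i) h) (ecl m (Cod C p) f) = ecl (Suc m) (Dom C i) h"
  proof (rule class_map_eqI)
    show "f \<cdot> prj R m \<in> ecl m (Cod C p) f" using mem_ecl_iff[OF hom(1)] hom(1) enull_self[OF hom(1)] by blast
    have "i \<cdot> (h \<cdot> prj R (Suc m)) = g \<cdot> diff C R m"
      using hom(2) g(1) ip tyR by (subst comp_reduce[OF g(3)]) (auto simp: Hom_iff diff_def comp_assoc')
    then show "\<exists>ga \<in> Hom C (Pr R m) (Cod C i). \<exists>ha \<in> Hom C (Pr R (Suc m)) (Dom C i).
             p \<cdot> ga = f \<cdot> prj R m \<and> i \<cdot> ha = ga \<cdot> diff C R m \<and>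
             ecl (Suc m) (Dom C i) h = ext_class C R (Suc m) (Dom C i) ha"
      using g(1,2) prj_Hom[OF hom(2)] unfolding ecl_def by blast
    fix x Z assume x: "x \<in> ecl m (Cod C p) f"
      "\<exists>g \<in> Hom C (Pr R m) (Cod C i). \<exists>h \<in> Hom C (Pr R (Suc m)) (Dom C i).
             p \<cdot> g = x \<and> i \<cdot> h = g \<cdot> diff C R m \<and>
             Z = ext_class C R (Suc m) (Dom C i) h"
    then obtain g' h' where g': "g' \<in> Hom C (Pr R m) (Cod C i)" "h' \<in> Hom C (Pr R (Suc m)) (Dom C i)"
      "p \<cdot> g' = x" "i \<cdot> h' = g' \<cdot> diff C R m" "Z = ext_class C R (Suc m) (Dom C i) h'" by blast
    obtain f' where f': "f' \<in> Hom C (Syz R m) (Cod C p)" "x = f' \<cdot> prj R m" "enull m (f' \<boxminus> f)"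
      using mem_ecl_iff[OF hom(1)] x(1) by blast
    \<comment> \<open>The arrow \<open>h'\<close> of the definition starts at
      \<open>Pr R (Suc m)\<close>. It descends to an arrow \<open>k\<close> on the syzygy, which
      brings the comparison back to \<open>elift_cong\<close>.\<close>
    obtain k where k: "k \<in> Hom C (Syz R (Suc m)) (Dom C i)" "i \<cdot> k = g' \<cdot> inc R m"
      using elift_inc[OF E f'(1) g'(1)] g'(3) f'(2) by auto
    have "i \<cdot> (k \<cdot> prj R (Suc m)) = i \<cdot> h'"
      unfolding g'(4) using k(1) g'(1) ip tyR
      by (subst comp_reduce[OF k(2)]) (auto simp: Hom_iff diff_def comp_assoc')
    then have "k \<cdot> prj R (Suc m) = h'"
      by (rule short_exact_mono[OF E prj_Hom[OF k(1)] g'(2)])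
    then have "Z = ecl (Suc m) (Dom C i) k" using g'(5) by (simp add: ecl_def)
    moreover have "elift m i p f' k" unfolding elift_def using f' k g' by blast
    ultimately show "Z = ecl (Suc m) (Dom C i) h"
      using elift_cong[OF E _ L f'(3)] ecl_eq_iff[OF k(1) hom(2)] by simp
  qed
  then show ?thesis by (simp add: ext_con_def)
qed

lemma ext_neg_trivial:
  assumes "n < 0"
  shows "carrier (ext_group C R n Y) = {\<one>\<^bsub>ext_group C R n Y\<^esub>}" "comm_group (ext_group C R n Y)"
  using assms by (simp_all add: ext_group_def) (simp add: singleton_group_def)
end

section \<open>Dimension shifting and Mislin completions\<close>

lemma (in cohomological_functor) exactness:
  assumes E: "short_exact C i p"
  shows "y \<in> carrier (Fobj T n (Cod C i)) \<Longrightarrow> Fmor T n p y = \<one>\<^bsub>Fobj T n (Cod C p)\<^esub> \<longleftrightarrow>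
      (\<exists>x\<in>carrier (Fobj T n (Dom C i)). y = Fmor T n i x)"
    and "y \<in> carrier (Fobj T n (Cod C p)) \<Longrightarrow> Fcon T n i p y = \<one>\<^bsub>Fobj T (n + 1) (Dom C i)\<^esub> \<longleftrightarrow>
      (\<exists>x\<in>carrier (Fobj T n (Cod C i)). y = Fmor T n p x)"
    and "y \<in> carrier (Fobj T (n + 1) (Dom C i)) \<Longrightarrow> Fmor T (n + 1) i y = \<one>\<^bsub>Fobj T (n + 1) (Cod C i)\<^esub> \<longleftrightarrow>
      (\<exists>x\<in>carrier (Fobj T n (Cod C p)). y = Fcon T n i p x)"
  using long_exact[OF E, of n] unfolding exact_seq_cons_iff exact_seq_end_iff
  by (auto simp: kernel_def image_iff set_eq_iff)

locale cohomological_functor_ab = abelian_category C + cohomological_functor C T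
  for C :: "('o, 'm) abcat" (structure) and T :: "('o, 'm, 'g) cohfun"
begin

section \<open>Homomorphism properties and dimension shifting\<close>

lemma group_obj: "X \<in> Obj C \<Longrightarrow> group (Fobj T n X)"
  using obj_group by (simp add: comm_group_def)

lemma mor_group_hom: "f \<in> Hom C X Y \<Longrightarrow> group_hom (Fobj T n X) (Fobj T n Y) (Fmor T n f)"
  using group_obj mor_hom Hom_objs by (intro group_hom.intro group_hom_axioms.intro) blast+

lemma con_group_hom:
  "short_exact C i p \<Longrightarrow> group_hom (Fobj T n (Cod C p)) (Fobj T (n + 1) (Dom C i)) (Fcon T n i p)"
  using group_obj con_hom short_exactD(1,2) dom_obj cod_obj
  by (intro group_hom.intro group_hom_axioms.intro) blast+

lemma mor_closed: "f \<in> Hom C X Y \<Longrightarrow> x \<in> carrier (Fobj T n X) \<Longrightarrow> Fmor T n f x \<in> carrier (Fobj T n Y)"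
  using mor_hom[of f X Y n] by (auto simp: hom_def)

lemma con_closed:
  "short_exact C i p \<Longrightarrow> x \<in> carrier (Fobj T n (Cod C p)) \<Longrightarrow> Fcon T n i p x \<in> carrier (Fobj T (n + 1) (Dom C i))"
  using con_hom by (auto simp: hom_def)

text \<open>Both neighbours of the connecting homomorphism in the long exact sequence are groups of
  the projective middle term, hence trivial.\<close>

lemma con_bij:
  assumes v: "vanishes_on_projectives C T" and E: "short_exact C i p" and P: "projective C (Cod C i)"
  shows "inj_on (Fcon T n i p) (carrier (Fobj T n (Cod C p)))"
    and "Fcon T n i p ` carrier (Fobj T n (Cod C p)) = carrier (Fobj T (n + 1) (Dom C i))"
proof -
  note ip = short_exactD[OF E]
  have triv: "carrier (Fobj T m (Cod C i)) = {\<one>\<^bsub>Fobj T m (Cod C i)\<^esub>}" for m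
    using v P unfolding vanishes_on_projectives_def by blast
  have "Fmor T n p \<one>\<^bsub>Fobj T n (Cod C i)\<^esub> = \<one>\<^bsub>Fobj T n (Cod C p)\<^esub>"
    using group_hom.hom_one[OF mor_group_hom[OF ip(6)]] .
  then have "y = \<one>\<^bsub>Fobj T n (Cod C p)\<^esub>"
    if "y \<in> carrier (Fobj T n (Cod C p))" "Fcon T n i p y = \<one>\<^bsub>Fobj T (n + 1) (Dom C i)\<^esub>" for y
    using exactness(2)[OF E that(1)] that(2) triv by auto
  then show "inj_on (Fcon T n i p) (carrier (Fobj T n (Cod C p)))"
    using group_hom.inj_on_one_iff[OF con_group_hom[OF E]] by blast
  have "\<exists>x\<in>carrier (Fobj T n (Cod C p)). y = Fcon T n i p x" if "y \<in> carrier (Fobj T (n + 1) (Dom C i))" for y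
    using exactness(3)[OF E that] mor_closed[OF ip(5) that] triv by auto
  then show "Fcon T n i p ` carrier (Fobj T n (Cod C p)) = carrier (Fobj T (n + 1) (Dom C i))"
    using con_closed[OF E] by blast
qed

end

lemma coh_morphismD:
  assumes "coh_morphism C T U \<mu>"
  shows "cohomological_functor C T" "cohomological_functor C U"
    "X \<in> Obj C \<Longrightarrow> \<mu> n X \<in> hom (Fobj T n X) (Fobj U n X)"
    "f \<in> Hom C X Y \<Longrightarrow> x \<in> carrier (Fobj T n X) \<Longrightarrow> \<mu> n Y (Fmor T n f x) = Fmor U n f (\<mu> n X x)"
    "short_exact C i p \<Longrightarrow> x \<in> carrier (Fobj T n (Cod C p)) \<Longrightarrow>
      \<mu> (n + 1) (Dom C i) (Fcon T n i p x) = Fcon U n i p (\<mu> n (Cod C p) x)"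
  using assms unfolding coh_morphism_def by blast+

text \<open>The elements that finitely many dimension shifts turn into the neutral one. An inductive
  predicate suits this, because every shift changes both the degree and the object, and the short
  exact sequences may be chosen anew at each step.\<close>

inductive killed :: "('o, 'm) abcat \<Rightarrow> ('o, 'm, 'g) cohfun \<Rightarrow> int \<Rightarrow> 'o \<Rightarrow> 'g \<Rightarrow> bool"
  for C :: "('o, 'm) abcat" and T :: "('o, 'm, 'g) cohfun" where
  one: "killed C T n X \<one>\<^bsub>Fobj T n X\<^esub>"
| shift: "short_exact C i p \<Longrightarrow> projective C (Cod C i) \<Longrightarrow> x \<in> carrier (Fobj T n (Cod C p)) \<Longrightarrow>
    killed C T (n + 1) (Dom C i) (Fcon T n i p x) \<Longrightarrow> killed C T n (Cod C p) x"

context abelian_category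
begin

text \<open>The morphism commutes with the shifts, and in \<open>U\<close> each shift is injective,
  so triviality after the shifts pulls back to triviality before them.\<close>

lemma killed_morphism:
  assumes "killed C T n X x" "coh_morphism C T U \<phi>" "vanishes_on_projectives C U" "X \<in> Obj C"
  shows "\<phi> n X x = \<one>\<^bsub>Fobj U n X\<^esub>"
  using assms(1,4)
proof (induction rule: killed.induct)
  case (one n X)
  interpret T: cohomological_functor_ab C T
    using coh_morphismD[OF assms(2)] abelian_category_axioms by (simp add: cohomological_functor_ab_def)
  interpret U: cohomological_functor_ab C U
    using coh_morphismD[OF assms(2)] abelian_category_axioms by (simp add: cohomological_functor_ab_def)
  show ?case
    using coh_morphismD(3)[OF assms(2) one] hom_one T.group_obj[OF one] U.group_obj[OF one] by blast
next
  case (shift i p x n)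
  interpret U: cohomological_functor_ab C U
    using coh_morphismD[OF assms(2)] abelian_category_axioms by (simp add: cohomological_functor_ab_def)
  note ip = short_exactD[OF shift(1)]
  have "Fcon U n i p (\<phi> n (Cod C p) x) = \<one>\<^bsub>Fobj U (n + 1) (Dom C i)\<^esub>"
    using shift.IH dom_obj[OF ip(1)] coh_morphismD(5)[OF assms(2) shift(1,3)] by simp
  moreover have "\<phi> n (Cod C p) x \<in> carrier (Fobj U n (Cod C p))"
    using coh_morphismD(3)[OF assms(2) cod_obj[OF ip(2)]] shift(3) by (auto simp: hom_def)
  ultimately show ?case
    using U.con_bij(1)[OF assms(3) shift(1,2), of n]
      group_hom.inj_on_one_iff[OF U.con_group_hom[OF shift(1)], of n] by blast
qed

end

text \<open>The assumption \<open>reach\<close> says that finitely many dimension shifts along \<open>(\<iota> X, \<pi> X)\<close> move \<open>y\<close>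
  into the range of \<open>\<nu>\<close>, in the form of an induction rule.\<close>

locale mislin_criterion = abelian_category C
  for C :: "('o, 'm) abcat" (structure) +
  fixes T :: "('o, 'm, 'g) cohfun" and T' :: "('o, 'm, 'k) cohfun" and \<nu> :: "int \<Rightarrow> 'o \<Rightarrow> 'g \<Rightarrow> 'k"
    and \<iota> \<pi> :: "'o \<Rightarrow> 'm"
  assumes \<nu>: "coh_morphism C T T' \<nu>" and T': "vanishes_on_projectives C T'"
    and shift: "X \<in> Obj C \<Longrightarrow> short_exact C (\<iota> X) (\<pi> X)" "X \<in> Obj C \<Longrightarrow> projective C (Cod C (\<iota> X))"
      "X \<in> Obj C \<Longrightarrow> Cod C (\<pi> X) = X"
    and reach: "X \<in> Obj C \<Longrightarrow> y \<in> carrier (Fobj T' n X) \<Longrightarrow>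
      (\<And>n X x. X \<in> Obj C \<Longrightarrow> x \<in> carrier (Fobj T n X) \<Longrightarrow> Q n X (\<nu> n X x)) \<Longrightarrow>
      (\<And>n X y. X \<in> Obj C \<Longrightarrow> y \<in> carrier (Fobj T' n X) \<Longrightarrow>
         Q (n + 1) (Dom C (\<iota> X)) (Fcon T' n (\<iota> X) (\<pi> X) y) \<Longrightarrow> Q n X y) \<Longrightarrow> Q n X y"
    and kill: "X \<in> Obj C \<Longrightarrow> x \<in> carrier (Fobj T n X) \<Longrightarrow> \<nu> n X x = \<one>\<^bsub>Fobj T' n X\<^esub> \<Longrightarrow> killed C T n X x"
begin

sublocale T: cohomological_functor_ab C T
  using coh_morphismD(1)[OF \<nu>] abelian_category_axioms by (simp add: cohomological_functor_ab_def)

sublocale T': cohomological_functor_ab C T'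
  using coh_morphismD(2)[OF \<nu>] abelian_category_axioms by (simp add: cohomological_functor_ab_def)

abbreviation \<Omega> :: "'o \<Rightarrow> 'o" where "\<Omega> X \<equiv> Dom C (\<iota> X)"

lemma \<Omega>_obj: "X \<in> Obj C \<Longrightarrow> \<Omega> X \<in> Obj C"
  using short_exactD(1)[OF shift(1)] dom_obj by blast

text \<open>Projectivity of the middle term lets \<open>c \<cdot> \<pi> X\<close> lift along
  \<open>p\<close>, and the lift restricts to the kernels. Thus the fixed sequence of
  \<open>X\<close> maps to every short exact sequence whose last term receives an arrow from
  \<open>X\<close>.\<close>

lemma shift_map:
  assumes X: "X \<in> Obj C" and E: "short_exact C i p" and c: "c \<in> Hom C X (Cod C p)"
  obtains a b where "a \<in> Hom C (\<Omega> X) (Dom C i)" "b \<in> Hom C (Cod C (\<iota> X)) (Cod C i)"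
    "b \<cdot> \<iota> X = i \<cdot> a" "c \<cdot> \<pi> X = p \<cdot> b" "c \<in> Hom C (Cod C (\<pi> X)) (Cod C p)"
proof -
  note ip = short_exactD[OF E] and s = short_exactD[OF shift(1)[OF X]]
  note s = s[unfolded shift(3)[OF X]]
  have "c \<cdot> \<pi> X \<in> Hom C (Cod C (\<iota> X)) (Cod C p)" using comp[OF s(6) c] .
  then obtain b where b: "b \<in> Hom C (Cod C (\<iota> X)) (Cod C i)" "p \<cdot> b = c \<cdot> \<pi> X"
    using projective_lift[OF shift(2)[OF X] E] by blast
  have "p \<cdot> (b \<cdot> \<iota> X) = (c \<cdot> \<pi> X) \<cdot> \<iota> X"
    using b(1) s ip by (subst comp_reduce[OF b(2)]) (auto simp: Hom_iff)
  also have "\<dots> = c \<cdot> (\<pi> X \<cdot> \<iota> X)" using comp_assoc[OF s(5,6) c] .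
  also have "\<dots> = Nul C (\<Omega> X) (Cod C p)" using s(4) c \<Omega>_obj[OF X] by (simp add: Hom_iff comp_Nul)
  finally obtain a where a: "a \<in> Hom C (\<Omega> X) (Dom C i)" "i \<cdot> a = b \<cdot> \<iota> X"
    using short_exact_lift[OF E comp[OF s(5) b(1)]] by blast
  show thesis using that[OF a(1) b(1)] a(2) b(2) c shift(3)[OF X] by simp
qed

context
  fixes U :: "('o, 'm, 'h) cohfun" and \<phi> :: "int \<Rightarrow> 'o \<Rightarrow> 'g \<Rightarrow> 'h"
  assumes U: "vanishes_on_projectives C U" and \<phi>: "coh_morphism C T U \<phi>"
begin

interpretation U: cohomological_functor_ab C U
  using coh_morphismD(2)[OF \<phi>] abelian_category_axioms by (simp add: cohomological_functor_ab_def)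

text \<open>\<open>u\<close> is the value on \<open>y\<close> that \<open>\<phi>\<close> forces upon a factorisation, read off after \<open>k\<close> shifts.\<close>

fun extension :: "nat \<Rightarrow> int \<Rightarrow> 'o \<Rightarrow> 'k \<Rightarrow> 'h \<Rightarrow> bool" where
  "extension 0 n X y u \<longleftrightarrow> (\<exists>x\<in>carrier (Fobj T n X). y = \<nu> n X x \<and> u = \<phi> n X x)"
| "extension (Suc k) n X y u \<longleftrightarrow> y \<in> carrier (Fobj T' n X) \<and> u \<in> carrier (Fobj U n X) \<and>
    extension k (n + 1) (\<Omega> X) (Fcon T' n (\<iota> X) (\<pi> X) y) (Fcon U n (\<iota> X) (\<pi> X) u)"

lemma \<nu>_closed: "X \<in> Obj C \<Longrightarrow> x \<in> carrier (Fobj T n X) \<Longrightarrow> \<nu> n X x \<in> carrier (Fobj T' n X)"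
  using coh_morphismD(3)[OF \<nu>] by (auto simp: hom_def)

lemma \<phi>_closed: "X \<in> Obj C \<Longrightarrow> x \<in> carrier (Fobj T n X) \<Longrightarrow> \<phi> n X x \<in> carrier (Fobj U n X)"
  using coh_morphismD(3)[OF \<phi>] by (auto simp: hom_def)

lemma extension_closed:
  "X \<in> Obj C \<Longrightarrow> extension k n X y u \<Longrightarrow> y \<in> carrier (Fobj T' n X) \<and> u \<in> carrier (Fobj U n X)"
  by (cases k) (auto simp: \<nu>_closed \<phi>_closed)

text \<open>Both \<open>\<nu>\<close> and \<open>\<phi>\<close> commute with connecting
  homomorphisms. Values found after different numbers of shifts can therefore be compared after a
  common number.\<close>

lemma extension_Suc: "X \<in> Obj C \<Longrightarrow> extension k n X y u \<Longrightarrow> extension (Suc k) n X y u"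
proof (induction k arbitrary: n X y u)
  case 0
  then obtain x where x: "x \<in> carrier (Fobj T n X)" "y = \<nu> n X x" "u = \<phi> n X x" by auto
  have x': "x \<in> carrier (Fobj T n (Cod C (\<pi> X)))" using x(1) shift(3)[OF 0(1)] by simp
  have "Fcon T n (\<iota> X) (\<pi> X) x \<in> carrier (Fobj T (n + 1) (\<Omega> X))"
    using T.con_closed[OF shift(1)[OF 0(1)] x'] .
  then show ?case
    using extension_closed[OF 0] x shift(3)[OF 0(1)] coh_morphismD(5)[OF \<nu> shift(1)[OF 0(1)] x']
      coh_morphismD(5)[OF \<phi> shift(1)[OF 0(1)] x']
    by (auto intro!: bexI[of _ "Fcon T n (\<iota> X) (\<pi> X) x"])
next
  case (Suc k)
  have "extension (Suc k) (n + 1) (\<Omega> X) (Fcon T' n (\<iota> X) (\<pi> X) y) (Fcon U n (\<iota> X) (\<pi> X) u)"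
    by (rule Suc.IH[OF \<Omega>_obj[OF Suc.prems(1)]]) (use Suc.prems(2) in simp)
  with Suc.prems(2) show ?case
    unfolding extension.simps(2)[of "Suc k"] by (simp only: extension.simps(2)[of k] simp_thms)
qed

lemma extension_le: "X \<in> Obj C \<Longrightarrow> extension k n X y u \<Longrightarrow> extension (k + j) n X y u"
  using extension_Suc by (induction j) simp_all

text \<open>Naturality and uniqueness of the value are proved together: for an identity arrow the
  claim is \<open>u = v\<close>. Without shifts, the two preimages differ by an element that
  \<open>\<nu>\<close> sends to the neutral one; it is killed in \<open>T\<close>, so
  \<open>\<phi>\<close> cannot see it. Each shift is then undone by injectivity of the connecting
  homomorphism in \<open>U\<close>.\<close>

lemma extension_mor:
  "f \<in> Hom C X Y \<Longrightarrow> extension k n X y u \<Longrightarrow> extension k n Y (Fmor T' n f y) v \<Longrightarrow> Fmor U n f u = v"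
proof (induction k arbitrary: n X Y f y u v)
  case 0
  note obj = Hom_objs[OF 0(1)]
  obtain x where x: "x \<in> carrier (Fobj T n X)" "y = \<nu> n X x" "u = \<phi> n X x" using 0(2) by auto
  obtain z where z: "z \<in> carrier (Fobj T n Y)" "Fmor T' n f y = \<nu> n Y z" "v = \<phi> n Y z" using 0(3) by auto
  let ?w = "Fmor T n f x"
  have w: "?w \<in> carrier (Fobj T n Y)" using T.mor_closed[OF 0(1) x(1)] .
  have eq: "\<nu> n Y ?w = \<nu> n Y z" using coh_morphismD(4)[OF \<nu> 0(1) x(1)] x(2) z(2) by simp
  interpret TY: group "Fobj T n Y" by (rule T.group_obj[OF obj(2)])
  interpret \<nu>: group_hom "Fobj T n Y" "Fobj T' n Y" "\<nu> n Y"
    by (intro group_hom.intro group_hom_axioms.intro T.group_obj T'.group_obj coh_morphismD(3)[OF \<nu>] obj)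
  interpret \<phi>: group_hom "Fobj T n Y" "Fobj U n Y" "\<phi> n Y"
    by (intro group_hom.intro group_hom_axioms.intro T.group_obj U.group_obj coh_morphismD(3)[OF \<phi>] obj)
  let ?d = "?w \<otimes>\<^bsub>Fobj T n Y\<^esub> inv\<^bsub>Fobj T n Y\<^esub> z"
  have "\<nu> n Y ?d = \<one>\<^bsub>Fobj T' n Y\<^esub>" using w z(1) eq by simp
  then have "killed C T n Y ?d" using kill obj(2) w z(1) by simp
  then have "\<phi> n Y ?d = \<one>\<^bsub>Fobj U n Y\<^esub>" using killed_morphism[OF _ \<phi> U obj(2)] by blast
  then have "\<phi> n Y ?w \<otimes>\<^bsub>Fobj U n Y\<^esub> inv\<^bsub>Fobj U n Y\<^esub> \<phi> n Y z = \<one>\<^bsub>Fobj U n Y\<^esub>"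
    using w z(1) by simp
  then have "\<phi> n Y ?w = \<phi> n Y z"
    using w z(1) \<phi>.H.right_cancel[of "inv\<^bsub>Fobj U n Y\<^esub> \<phi> n Y z" "\<phi> n Y ?w" "\<phi> n Y z"] by simp
  then show ?case using coh_morphismD(4)[OF \<phi> 0(1) x(1)] x(3) z(3) by simp
next
  case (Suc k)
  note obj = Hom_objs[OF Suc.prems(1)]
  have f: "f \<in> Hom C X (Cod C (\<pi> Y))" using Suc.prems(1) shift(3)[OF obj(2)] by simp
  obtain a b where ab: "a \<in> Hom C (\<Omega> X) (\<Omega> Y)" "b \<in> Hom C (Cod C (\<iota> X)) (Cod C (\<iota> Y))"
    "b \<cdot> \<iota> X = \<iota> Y \<cdot> a" "f \<cdot> \<pi> X = \<pi> Y \<cdot> b" "f \<in> Hom C (Cod C (\<pi> X)) (Cod C (\<pi> Y))"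
    using shift_map[OF obj(1) shift(1)[OF obj(2)] f] .
  have y: "y \<in> carrier (Fobj T' n (Cod C (\<pi> X)))" and u: "u \<in> carrier (Fobj U n (Cod C (\<pi> X)))"
    and v: "v \<in> carrier (Fobj U n Y)"
    using Suc.prems(2,3) shift(3)[OF obj(1)] by auto
  have n1: "Fmor T' (n + 1) a (Fcon T' n (\<iota> X) (\<pi> X) y) = Fcon T' n (\<iota> Y) (\<pi> Y) (Fmor T' n f y)"
    by (rule T'.con_natural[OF shift(1)[OF obj(1)] shift(1)[OF obj(2)] ab(1,2,5,3,4) y])
  have n2: "Fmor U (n + 1) a (Fcon U n (\<iota> X) (\<pi> X) u) = Fcon U n (\<iota> Y) (\<pi> Y) (Fmor U n f u)"
    by (rule U.con_natural[OF shift(1)[OF obj(1)] shift(1)[OF obj(2)] ab(1,2,5,3,4) u])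
  have "Fcon U n (\<iota> Y) (\<pi> Y) (Fmor U n f u) = Fcon U n (\<iota> Y) (\<pi> Y) v"
    using Suc.IH[OF ab(1), of "n + 1" "Fcon T' n (\<iota> X) (\<pi> X) y" "Fcon U n (\<iota> X) (\<pi> X) u"
        "Fcon U n (\<iota> Y) (\<pi> Y) v"] Suc.prems(2,3) n1 n2 by simp
  moreover have "Fmor U n f u \<in> carrier (Fobj U n Y)"
    using U.mor_closed[OF Suc.prems(1)] u shift(3)[OF obj(1)] by simp
  ultimately show ?case
    using U.con_bij(1)[OF U shift(1,2)[OF obj(2)], of n] v shift(3)[OF obj(2)] by (simp add: inj_on_def)
qed

lemma extension_mult:
  assumes "X \<in> Obj C" "extension k n X y u" "extension k n X z v"
  shows "extension k n X (y \<otimes>\<^bsub>Fobj T' n X\<^esub> z) (u \<otimes>\<^bsub>Fobj U n X\<^esub> v)"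
  using assms
proof (induction k arbitrary: n X y z u v)
  case 0
  obtain a where a: "a \<in> carrier (Fobj T n X)" "y = \<nu> n X a" "u = \<phi> n X a" using 0(2) by auto
  obtain b where b: "b \<in> carrier (Fobj T n X)" "z = \<nu> n X b" "v = \<phi> n X b" using 0(3) by auto
  interpret TX: group "Fobj T n X" by (rule T.group_obj[OF 0(1)])
  show ?case
    using a b coh_morphismD(3)[OF \<nu> 0(1), of n] coh_morphismD(3)[OF \<phi> 0(1), of n]
    by (auto simp: hom_def intro!: bexI[of _ "a \<otimes>\<^bsub>Fobj T n X\<^esub> b"])
next
  case (Suc k)
  interpret TX: group "Fobj T' n X" by (rule T'.group_obj[OF Suc.prems(1)])
  interpret UX: group "Fobj U n X" by (rule U.group_obj[OF Suc.prems(1)])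
  have c: "y \<in> carrier (Fobj T' n X)" "z \<in> carrier (Fobj T' n X)" "u \<in> carrier (Fobj U n X)" "v \<in> carrier (Fobj U n X)"
    using Suc.prems by auto
  note s = shift[OF Suc.prems(1)]
  have "Fcon T' n (\<iota> X) (\<pi> X) (y \<otimes>\<^bsub>Fobj T' n X\<^esub> z) =
      Fcon T' n (\<iota> X) (\<pi> X) y \<otimes>\<^bsub>Fobj T' (n + 1) (\<Omega> X)\<^esub> Fcon T' n (\<iota> X) (\<pi> X) z"
    "Fcon U n (\<iota> X) (\<pi> X) (u \<otimes>\<^bsub>Fobj U n X\<^esub> v) =
      Fcon U n (\<iota> X) (\<pi> X) u \<otimes>\<^bsub>Fobj U (n + 1) (\<Omega> X)\<^esub> Fcon U n (\<iota> X) (\<pi> X) v"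
    using T'.con_hom[OF s(1), of n] U.con_hom[OF s(1), of n] c unfolding s(3) by (simp_all add: hom_def)
  then show ?case
    using Suc.IH[OF \<Omega>_obj[OF Suc.prems(1)]] Suc.prems c by simp
qed

text \<open>A value in the shifted degree is pulled back through the connecting homomorphism of
  \<open>U\<close>, which is surjective.\<close>

lemma extension_exists:
  assumes "X \<in> Obj C" "y \<in> carrier (Fobj T' n X)"
  shows "\<exists>k u. extension k n X y u"
proof (rule reach[OF assms])
  fix n X x assume "X \<in> Obj C" "x \<in> carrier (Fobj T n X)"
  then have "extension 0 n X (\<nu> n X x) (\<phi> n X x)" by auto
  then show "\<exists>k u. extension k n X (\<nu> n X x) u" by blast
next
  fix n X y assume X: "X \<in> Obj C" and y: "y \<in> carrier (Fobj T' n X)"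
    and "\<exists>k u. extension k (n + 1) (\<Omega> X) (Fcon T' n (\<iota> X) (\<pi> X) y) u"
  then obtain k u where k: "extension k (n + 1) (\<Omega> X) (Fcon T' n (\<iota> X) (\<pi> X) y) u" by blast
  have "u \<in> carrier (Fobj U (n + 1) (\<Omega> X))" using extension_closed[OF \<Omega>_obj[OF X] k] by blast
  then obtain v where "v \<in> carrier (Fobj U n X)" "u = Fcon U n (\<iota> X) (\<pi> X) v"
    using U.con_bij(2)[OF U shift(1,2)[OF X], of n] unfolding shift(3)[OF X] by blast
  then have "extension (Suc k) n X y v" using y k by simp
  then show "\<exists>k u. extension k n X y u" by blast
qed

definition extend :: "int \<Rightarrow> 'o \<Rightarrow> 'k \<Rightarrow> 'h" where
  "extend n X y = (SOME u. \<exists>k. extension k n X y u)"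

lemma extend_mor:
  assumes f: "f \<in> Hom C X Y" and "extension k n X y u" "extension l n Y (Fmor T' n f y) v"
  shows "Fmor U n f u = v"
  using extension_mor[OF f, of "k + l"] extension_le[OF Hom_objs(1)[OF f] assms(2), of l]
    extension_le[OF Hom_objs(2)[OF f] assms(3), of k] by (simp add: add.commute)

lemma extend_eq:
  assumes X: "X \<in> Obj C" and E: "extension k n X y u"
  shows "extend n X y = u"
proof -
  have "\<exists>l. extension l n X y (extend n X y)" unfolding extend_def
    using E by (intro someI_ex[of "\<lambda>u. \<exists>k. extension k n X y u"]) blast
  then obtain l where l: "extension l n X y (extend n X y)" ..
  have "Fmor T' n (Idt C X) y = y" using T'.mor_ident[OF X] extension_closed[OF X E] by blast
  then have "Fmor U n (Idt C X) u = extend n X y" using extend_mor[OF ident[OF X] E] l by simp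
  then show ?thesis using U.mor_ident[OF X] extension_closed[OF X E] by simp
qed

lemma extend_extension:
  assumes X: "X \<in> Obj C" and y: "y \<in> carrier (Fobj T' n X)"
  obtains k where "extension k n X y (extend n X y)"
  using extension_exists[OF assms] extend_eq[OF X] by metis

lemma coh_morphism_extend: "coh_morphism C T' U extend"
  unfolding coh_morphism_def
proof (intro conjI allI ballI impI)
  show "cohomological_functor C T'" by (rule coh_morphismD(2)[OF \<nu>])
  show "cohomological_functor C U" by (rule coh_morphismD(2)[OF \<phi>])
  show nat: "extend n Y (Fmor T' n f y) = Fmor U n f (extend n X y)"
    if f: "f \<in> Hom C X Y" and y: "y \<in> carrier (Fobj T' n X)" for n X Y f y
  proof -
    obtain k where k: "extension k n X y (extend n X y)" using extend_extension[OF Hom_objs(1)[OF f] y] .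
    obtain l where l: "extension l n Y (Fmor T' n f y) (extend n Y (Fmor T' n f y))"
      using extend_extension[OF Hom_objs(2)[OF f] T'.mor_closed[OF f y]] .
    show ?thesis using extend_mor[OF f k l] by simp
  qed
  show "extend n X \<in> hom (Fobj T' n X) (Fobj U n X)" if X: "X \<in> Obj C" for n X
  proof (rule homI)
    fix y assume y: "y \<in> carrier (Fobj T' n X)"
    obtain k where k: "extension k n X y (extend n X y)" using extend_extension[OF X y] .
    then show "extend n X y \<in> carrier (Fobj U n X)" using extension_closed[OF X] by blast
    fix z assume z: "z \<in> carrier (Fobj T' n X)"
    obtain l where l: "extension l n X z (extend n X z)" using extend_extension[OF X z] .
    show "extend n X (y \<otimes>\<^bsub>Fobj T' n X\<^esub> z) = extend n X y \<otimes>\<^bsub>Fobj U n X\<^esub> extend n X z"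
      using extend_eq[OF X extension_mult[OF X extension_le[OF X k, of l]]]
        extension_le[OF X l, of k] by (simp add: add.commute)
  qed
  fix n i p y assume E: "short_exact C i p" and y: "y \<in> carrier (Fobj T' n (Cod C p))"
  let ?X = "Cod C p"
  note ip = short_exactD[OF E]
  have X: "?X \<in> Obj C" using cod_obj[OF ip(2)] .
  \<comment> \<open>For the fixed sequence of \<open>?X\<close> compatibility is built into
    \<open>extension\<close>, since one more shift leaves the value valid.\<close>
  have shift_con: "extend (n + 1) (\<Omega> ?X) (Fcon T' n (\<iota> ?X) (\<pi> ?X) y) = Fcon U n (\<iota> ?X) (\<pi> ?X) (extend n ?X y)"
  proof -
    obtain k where k: "extension k n ?X y (extend n ?X y)" using extend_extension[OF X y] .
    show ?thesis
      by (rule extend_eq[OF \<Omega>_obj[OF X], of k]) (use extension_Suc[OF X k] in simp)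
  qed
  \<comment> \<open>An arbitrary sequence ending at \<open>?X\<close> receives a map from the fixed
    one over the identity of \<open>?X\<close>; naturality of the connecting homomorphisms transfers
    the claim.\<close>
  obtain a b where ab: "a \<in> Hom C (\<Omega> ?X) (Dom C i)" "b \<in> Hom C (Cod C (\<iota> ?X)) (Cod C i)"
    "b \<cdot> \<iota> ?X = i \<cdot> a" "Idt C ?X \<cdot> \<pi> ?X = p \<cdot> b" "Idt C ?X \<in> Hom C (Cod C (\<pi> ?X)) ?X"
    using shift_map[OF X E ident[OF X]] .
  have y': "y \<in> carrier (Fobj T' n (Cod C (\<pi> ?X)))" using y shift(3)[OF X] by simp
  have u: "extend n ?X y \<in> carrier (Fobj U n ?X)"
    using extend_extension[OF X y] extension_closed[OF X] by metis
  then have u': "extend n ?X y \<in> carrier (Fobj U n (Cod C (\<pi> ?X)))" using shift(3)[OF X] by simp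
  have "Fcon T' n i p y = Fmor T' (n + 1) a (Fcon T' n (\<iota> ?X) (\<pi> ?X) y)"
    using T'.con_natural[OF shift(1)[OF X] E ab(1,2,5,3,4) y'] T'.mor_ident[OF X y] by simp
  then have "extend (n + 1) (Dom C i) (Fcon T' n i p y) =
      Fmor U (n + 1) a (Fcon U n (\<iota> ?X) (\<pi> ?X) (extend n ?X y))"
    using nat[OF ab(1) T'.con_closed[OF shift(1)[OF X] y']] shift_con by simp
  also have "\<dots> = Fcon U n i p (extend n ?X y)"
    using U.con_natural[OF shift(1)[OF X] E ab(1,2,5,3,4) u'] U.mor_ident[OF X u] by simp
  finally show "extend (n + 1) (Dom C i) (Fcon T' n i p y) = Fcon U n i p (extend n ?X y)" .
qed

lemma extend_\<nu>: "X \<in> Obj C \<Longrightarrow> x \<in> carrier (Fobj T n X) \<Longrightarrow> extend n X (\<nu> n X x) = \<phi> n X x"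
  using extend_eq[of X 0] by auto

lemma extend_unique:
  assumes m: "coh_morphism C T' U \<mu>"
    and eq: "\<And>n X x. X \<in> Obj C \<Longrightarrow> x \<in> carrier (Fobj T n X) \<Longrightarrow> \<mu> n X (\<nu> n X x) = \<phi> n X x"
    and X: "X \<in> Obj C" and y: "y \<in> carrier (Fobj T' n X)"
  shows "\<mu> n X y = extend n X y"
proof (rule reach[OF X y])
  fix n X x assume "X \<in> Obj C" "x \<in> carrier (Fobj T n X)"
  then show "\<mu> n X (\<nu> n X x) = extend n X (\<nu> n X x)" using eq extend_\<nu> by simp
next
  fix n X y assume X: "X \<in> Obj C" and y: "y \<in> carrier (Fobj T' n X)"
    and IH: "\<mu> (n + 1) (\<Omega> X) (Fcon T' n (\<iota> X) (\<pi> X) y) = extend (n + 1) (\<Omega> X) (Fcon T' n (\<iota> X) (\<pi> X) y)"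
  have y': "y \<in> carrier (Fobj T' n (Cod C (\<pi> X)))" using y shift(3)[OF X] by simp
  have "Fcon U n (\<iota> X) (\<pi> X) (\<mu> n X y) = Fcon U n (\<iota> X) (\<pi> X) (extend n X y)"
    using coh_morphismD(5)[OF m shift(1)[OF X] y'] coh_morphismD(5)[OF coh_morphism_extend shift(1)[OF X] y']
      IH shift(3)[OF X] by simp
  moreover have "\<mu> n X y \<in> carrier (Fobj U n X)" "extend n X y \<in> carrier (Fobj U n X)"
    using coh_morphismD(3)[OF m X, of n] coh_morphismD(3)[OF coh_morphism_extend X, of n] y
    by (auto simp: hom_def)
  ultimately show "\<mu> n X y = extend n X y"
    using U.con_bij(1)[OF U shift(1,2)[OF X], of n] unfolding shift(3)[OF X] by (auto simp: inj_on_def)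
qed

end

theorem mislin_completion: "mislin_completion TYPE('h) C T T' \<nu>"
  unfolding mislin_completion_def
proof (intro conjI \<nu> T' allI impI)
  fix U :: "('o, 'm, 'h) cohfun" and \<phi>
  assume A: "vanishes_on_projectives C U \<and> coh_morphism C T U \<phi>"
  note m = coh_morphism_extend[OF conjunct1[OF A] conjunct2[OF A]]
    extend_\<nu>[OF conjunct1[OF A] conjunct2[OF A]] extend_unique[OF conjunct1[OF A] conjunct2[OF A]]
  show "\<exists>\<mu>. coh_morphism C T' U \<mu> \<and>
           (\<forall>n. \<forall>X \<in> Obj C. \<forall>x \<in> carrier (Fobj T n X). \<mu> n X (\<nu> n X x) = \<phi> n X x) \<and>
           (\<forall>\<mu>'. coh_morphism C T' U \<mu>' \<and>
              (\<forall>n. \<forall>X \<in> Obj C. \<forall>x \<in> carrier (Fobj T n X). \<mu>' n X (\<nu> n X x) = \<phi> n X x) \<longrightarrow>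
              (\<forall>n. \<forall>X \<in> Obj C. \<forall>y \<in> carrier (Fobj T' n X). \<mu>' n X y = \<mu> n X y))"
    by (rule exI[of _ "extend U \<phi>"]) (use m in blast)
qed

end

section \<open>Isomorphisms of cohomological functors and transport of structure\<close>

lemma coh_isomorphismI:
  assumes m: "coh_morphism C T U \<mu>"
    and b: "\<And>n X. X \<in> Obj C \<Longrightarrow> bij_betw (\<mu> n X) (carrier (Fobj T n X)) (carrier (Fobj U n X))"
    and C: "abelian_category C"
  shows "coh_isomorphism C T U \<mu>"
proof -
  interpret abelian_category C by fact
  interpret T: cohomological_functor_ab C T
    using coh_morphismD(1)[OF m] C by (simp add: cohomological_functor_ab_def)
  interpret U: cohomological_functor_ab C U
    using coh_morphismD(2)[OF m] C by (simp add: cohomological_functor_ab_def)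
  define \<kappa> where "\<kappa> n X = inv_into (carrier (Fobj T n X)) (\<mu> n X)" for n X
  have k1: "\<kappa> n X (\<mu> n X x) = x" if "X \<in> Obj C" "x \<in> carrier (Fobj T n X)" for n X x
    unfolding \<kappa>_def using b[OF that(1), of n] that(2) by (meson bij_betw_inv_into_left)
  have k2: "\<mu> n X (\<kappa> n X y) = y" "\<kappa> n X y \<in> carrier (Fobj T n X)" if "X \<in> Obj C" "y \<in> carrier (Fobj U n X)" for n X y
    unfolding \<kappa>_def using b[OF that(1), of n] that(2)
    by (meson bij_betw_inv_into_right, metis bij_betw_def inv_into_into)
  have "coh_morphism C U T \<kappa>"
    unfolding coh_morphism_def
  proof (intro conjI allI ballI impI coh_morphismD(1,2)[OF m])
    fix n X assume X: "X \<in> Obj C"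
    interpret T: group "Fobj T n X" by (rule T.group_obj[OF X])
    show "\<kappa> n X \<in> hom (Fobj U n X) (Fobj T n X)"
    proof (rule homI)
      fix x y assume x: "x \<in> carrier (Fobj U n X)" and y: "y \<in> carrier (Fobj U n X)"
      have "x \<otimes>\<^bsub>Fobj U n X\<^esub> y = \<mu> n X (\<kappa> n X x \<otimes>\<^bsub>Fobj T n X\<^esub> \<kappa> n X y)"
        using coh_morphismD(3)[OF m X, of n] k2[OF X x] k2[OF X y] by (simp add: hom_def)
      then show "\<kappa> n X (x \<otimes>\<^bsub>Fobj U n X\<^esub> y) = \<kappa> n X x \<otimes>\<^bsub>Fobj T n X\<^esub> \<kappa> n X y"
        using k1[OF X] k2[OF X x] k2[OF X y] by simp
    qed (rule k2(2)[OF X])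
  next
    fix n X Y f x assume f: "f \<in> Hom C X Y" and x: "x \<in> carrier (Fobj U n X)"
    note obj = Hom_objs[OF f]
    show "\<kappa> n Y (Fmor U n f x) = Fmor T n f (\<kappa> n X x)"
      using coh_morphismD(4)[OF m f k2(2)[OF obj(1) x]] k2(1)[OF obj(1) x]
        k1[OF obj(2) T.mor_closed[OF f k2(2)[OF obj(1) x]]] by simp
  next
    fix n i p x assume E: "short_exact C i p" and x: "x \<in> carrier (Fobj U n (Cod C p))"
    note obj = short_exact_obj(1,3)[OF E]
    show "\<kappa> (n + 1) (Dom C i) (Fcon U n i p x) = Fcon T n i p (\<kappa> n (Cod C p) x)"
      using coh_morphismD(5)[OF m E k2(2)[OF obj(2) x]] k2(1)[OF obj(2) x]
        k1[OF obj(1) T.con_closed[OF E k2(2)[OF obj(2) x]]] by simp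
  qed
  then show ?thesis unfolding coh_isomorphism_def using m k1 k2 by blast
qed

text \<open>The equations required of \<open>T\<close> may be tested after the injective
  \<open>\<mu>\<close>, where they become those of \<open>U\<close>. Exactness also asks for
  preimages, and these are carried over by surjectivity. The point is that \<open>T\<close> is not
  assumed to be cohomological.\<close>

lemma cohomological_functor_transport:
  assumes C: "abelian_category C" and U: "cohomological_functor C U"
    and grp: "\<And>n X. X \<in> Obj C \<Longrightarrow> comm_group (Fobj T n X)"
    and hom: "\<And>n X. X \<in> Obj C \<Longrightarrow> \<mu> n X \<in> hom (Fobj T n X) (Fobj U n X)"
    and bij: "\<And>n X. X \<in> Obj C \<Longrightarrow> bij_betw (\<mu> n X) (carrier (Fobj T n X)) (carrier (Fobj U n X))"
    and mor: "\<And>n X Y f x. f \<in> Hom C X Y \<Longrightarrow> x \<in> carrier (Fobj T n X) \<Longrightarrow>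
      Fmor T n f x \<in> carrier (Fobj T n Y) \<and> \<mu> n Y (Fmor T n f x) = Fmor U n f (\<mu> n X x)"
    and con: "\<And>n i p x. short_exact C i p \<Longrightarrow> x \<in> carrier (Fobj T n (Cod C p)) \<Longrightarrow>
      Fcon T n i p x \<in> carrier (Fobj T (n + 1) (Dom C i)) \<and>
      \<mu> (n + 1) (Dom C i) (Fcon T n i p x) = Fcon U n i p (\<mu> n (Cod C p) x)"
  shows "coh_morphism C T U \<mu>"
proof -
  interpret abelian_category C by fact
  interpret U: cohomological_functor_ab C U using U C by (simp add: cohomological_functor_ab_def)
  have cl: "\<mu> n X x \<in> carrier (Fobj U n X)" if "X \<in> Obj C" "x \<in> carrier (Fobj T n X)" for n X x
    using hom[OF that(1), of n] that(2) by (auto simp: hom_def)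
  have inj: "x = y" if "\<mu> n X x = \<mu> n X y" "X \<in> Obj C" "x \<in> carrier (Fobj T n X)" "y \<in> carrier (Fobj T n X)" for n X x y
    using bij[OF that(2), of n] that by (auto simp: bij_betw_def inj_on_def)
  have surj: "\<exists>x\<in>carrier (Fobj T n X). y = \<mu> n X x" if "X \<in> Obj C" "y \<in> carrier (Fobj U n X)" for n X y
    using bij[OF that(1), of n] that(2) by (auto simp: bij_betw_def)
  have g: "group (Fobj T n X)" if "X \<in> Obj C" for n X using grp[OF that] by (simp add: comm_group_def)
  have mult: "\<mu> n X (x \<otimes>\<^bsub>Fobj T n X\<^esub> y) = \<mu> n X x \<otimes>\<^bsub>Fobj U n X\<^esub> \<mu> n X y"
    "x \<otimes>\<^bsub>Fobj T n X\<^esub> y \<in> carrier (Fobj T n X)"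
    if "X \<in> Obj C" "x \<in> carrier (Fobj T n X)" "y \<in> carrier (Fobj T n X)" for n X x y
    using hom[OF that(1), of n] that(2,3) monoid.m_closed[OF group.is_monoid[OF g[OF that(1)]] that(2,3)]
    by (auto simp: hom_def)
  have one: "\<mu> n X \<one>\<^bsub>Fobj T n X\<^esub> = \<one>\<^bsub>Fobj U n X\<^esub>" "\<one>\<^bsub>Fobj T n X\<^esub> \<in> carrier (Fobj T n X)"
    if "X \<in> Obj C" for n X
    using hom_one[OF hom[OF that]] g[OF that] U.group_obj[OF that] group.is_monoid monoid.one_closed by blast+
  have one_iff: "x = \<one>\<^bsub>Fobj T n X\<^esub> \<longleftrightarrow> \<mu> n X x = \<one>\<^bsub>Fobj U n X\<^esub>"
    if "X \<in> Obj C" "x \<in> carrier (Fobj T n X)" for n X x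
    using one[OF that(1)] inj[OF _ that(1)] that(2) by metis
  \<comment> \<open>Membership in the range of a map, the existential half of every exactness
    statement, corresponds under \<open>\<mu>\<close> on both sides.\<close>
  have image: "(\<exists>x\<in>carrier (Fobj T n X). y = F x) \<longleftrightarrow> (\<exists>x\<in>carrier (Fobj U n X). \<mu> m Y y = F' x)"
    if "X \<in> Obj C" "Y \<in> Obj C" and "\<And>x. x \<in> carrier (Fobj T n X) \<Longrightarrow>
      F x \<in> carrier (Fobj T m Y) \<and> \<mu> m Y (F x) = F' (\<mu> n X x)" and "y \<in> carrier (Fobj T m Y)"
    for n m X Y F F' y
  proof -
    have "(\<exists>x\<in>carrier (Fobj T n X). y = F x) \<longleftrightarrow> (\<exists>x\<in>carrier (Fobj T n X). \<mu> m Y y = F' (\<mu> n X x))"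
      using that(3) inj[OF _ that(2) that(4)] by metis
    also have "\<dots> \<longleftrightarrow> (\<exists>x\<in>carrier (Fobj U n X). \<mu> m Y y = F' x)"
      using surj[OF that(1)] cl[OF that(1)] by metis
    finally show ?thesis .
  qed
  have mor_hom: "Fmor T n f \<in> hom (Fobj T n X) (Fobj T n Y)" if f: "f \<in> Hom C X Y" for n f X Y
  proof (rule homI)
    fix x y assume x: "x \<in> carrier (Fobj T n X)" and y: "y \<in> carrier (Fobj T n X)"
    note obj = Hom_objs[OF f]
    show "Fmor T n f (x \<otimes>\<^bsub>Fobj T n X\<^esub> y) = Fmor T n f x \<otimes>\<^bsub>Fobj T n Y\<^esub> Fmor T n f y"
      using mor[OF f] mult[OF obj(1) x y] mult[OF obj(2)] x y U.mor_hom[OF f, of n] cl[OF obj(1)]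
      by (intro inj[OF _ obj(2)]) (auto simp: hom_def)
  qed (use mor[OF f] in blast)
  have con_hom: "Fcon T n i p \<in> hom (Fobj T n (Cod C p)) (Fobj T (n + 1) (Dom C i))" if E: "short_exact C i p" for n i p
  proof (rule homI)
    fix x y assume x: "x \<in> carrier (Fobj T n (Cod C p))" and y: "y \<in> carrier (Fobj T n (Cod C p))"
    note obj = short_exact_obj(1,3)[OF E]
    show "Fcon T n i p (x \<otimes>\<^bsub>Fobj T n (Cod C p)\<^esub> y) = Fcon T n i p x \<otimes>\<^bsub>Fobj T (n + 1) (Dom C i)\<^esub> Fcon T n i p y"
      using con[OF E] mult[OF obj(2) x y] mult[OF obj(1)] x y U.con_hom[OF E, of n] cl[OF obj(2)]
      by (intro inj[OF _ obj(1)]) (auto simp: hom_def)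
  qed (use con[OF E] in blast)
  have "cohomological_functor C T"
  proof (rule cohomological_functor.intro)
    show "Fmor T n (Idt C X) x = x" if "X \<in> Obj C" "x \<in> carrier (Fobj T n X)" for X x n
      by (rule inj[OF _ that(1)]) (use mor[OF ident] U.mor_ident cl that in auto)
    show "Fmor T n (g \<cdot>\<^bsub>C\<^esub> f) x = Fmor T n g (Fmor T n f x)"
      if f: "f \<in> Hom C X Y" and h: "g \<in> Hom C Y Z" and x: "x \<in> carrier (Fobj T n X)" for f g X Y Z x n
      by (rule inj[OF _ Hom_objs(2)[OF h]])
        (use mor[OF comp[OF f h] x] mor[OF h] mor[OF f x] U.mor_comp[OF f h cl[OF Hom_objs(1)[OF f] x]] in auto)
    show "Fmor T n (Plus C f g) x = Fmor T n f x \<otimes>\<^bsub>Fobj T n Y\<^esub> Fmor T n g x"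
      if f: "f \<in> Hom C X Y" and h: "g \<in> Hom C X Y" and x: "x \<in> carrier (Fobj T n X)" for f g X Y x n
      by (rule inj[OF _ Hom_objs(2)[OF f]])
        (use mor[OF Hom_closed(1)[OF f h] x] mor[OF h x] mor[OF f x] mult[OF Hom_objs(2)[OF f]]
          U.mor_plus[OF f h cl[OF Hom_objs(1)[OF f] x]] in auto)
    show "Fmor T (n + 1) a (Fcon T n i p x) = Fcon T n i' p' (Fmor T n c x)"
      if E: "short_exact C i p" and E': "short_exact C i' p'" and
        abc: "a \<in> Hom C (Dom C i) (Dom C i')" "b \<in> Hom C (Cod C i) (Cod C i')"
        "c \<in> Hom C (Cod C p) (Cod C p')" "b \<cdot>\<^bsub>C\<^esub> i = i' \<cdot>\<^bsub>C\<^esub> a" "c \<cdot>\<^bsub>C\<^esub> p = p' \<cdot>\<^bsub>C\<^esub> b"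
        and x: "x \<in> carrier (Fobj T n (Cod C p))" for i p i' p' a b c x n
      by (rule inj[OF _ Hom_objs(2)[OF abc(1)]])
        (use mor[OF abc(1)] con[OF E x] mor[OF abc(3) x] con[OF E']
          U.con_natural[OF E E' abc cl[OF Hom_objs(1)[OF abc(3)] x]] in auto)
    show "exact_seq
        ([Fobj T (n + 1) (Cod C i), Fobj T (n + 1) (Dom C i), Fobj T n (Cod C p),
          Fobj T n (Cod C i), Fobj T n (Dom C i)],
         [Fmor T (n + 1) i, Fcon T n i p, Fmor T n p, Fmor T n i])"
      if E: "short_exact C i p" for i p n
    proof (rule exact_seqI)
      note ip = short_exactD[OF E]
      note obj = short_exact_obj[OF E]
      show "group (Fobj T (n + 1) (Cod C i))" "group (Fobj T (n + 1) (Dom C i))" "group (Fobj T n (Cod C p))"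
        "group (Fobj T n (Cod C i))" "group (Fobj T n (Dom C i))" using g obj by blast+
      show "Fmor T (n + 1) i \<in> hom (Fobj T (n + 1) (Dom C i)) (Fobj T (n + 1) (Cod C i))"
        "Fcon T n i p \<in> hom (Fobj T n (Cod C p)) (Fobj T (n + 1) (Dom C i))"
        "Fmor T n p \<in> hom (Fobj T n (Cod C i)) (Fobj T n (Cod C p))"
        "Fmor T n i \<in> hom (Fobj T n (Dom C i)) (Fobj T n (Cod C i))"
        using mor_hom ip con_hom[OF E] by blast+
      show "Fmor T (n + 1) i y = \<one>\<^bsub>Fobj T (n + 1) (Cod C i)\<^esub> \<longleftrightarrow> (\<exists>x\<in>carrier (Fobj T n (Cod C p)). y = Fcon T n i p x)"
        if y: "y \<in> carrier (Fobj T (n + 1) (Dom C i))" for y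
        using U.exactness(3)[OF E cl[OF obj(1) y]] mor[OF ip(5) y] one_iff[OF obj(2)]
          image[where F = "Fcon T n i p" and F' = "Fcon U n i p", OF obj(3,1) con[OF E] y] by metis
      show "Fcon T n i p y = \<one>\<^bsub>Fobj T (n + 1) (Dom C i)\<^esub> \<longleftrightarrow> (\<exists>x\<in>carrier (Fobj T n (Cod C i)). y = Fmor T n p x)"
        if y: "y \<in> carrier (Fobj T n (Cod C p))" for y
        using U.exactness(2)[OF E cl[OF obj(3) y]] con[OF E y] one_iff[OF obj(1)]
          image[where F = "Fmor T n p" and F' = "Fmor U n p", OF obj(2,3) mor[OF ip(6)] y] by metis
      show "Fmor T n p y = \<one>\<^bsub>Fobj T n (Cod C p)\<^esub> \<longleftrightarrow> (\<exists>x\<in>carrier (Fobj T n (Dom C i)). y = Fmor T n i x)"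
        if y: "y \<in> carrier (Fobj T n (Cod C i))" for y
        using U.exactness(1)[OF E cl[OF obj(2) y]] mor[OF ip(6) y] one_iff[OF obj(3)]
          image[where F = "Fmor T n i" and F' = "Fmor U n i", OF obj(1,2) mor[OF ip(5)] y] by metis
    qed
  qed (use grp mor_hom con_hom in blast)+
  then show ?thesis unfolding coh_morphism_def using U hom mor con by blast
qed

section \<open>The long exact sequence of Ext\<close>

context ext_setting
begin

lemma comm_group_ext: "Y \<in> Obj C \<Longrightarrow> comm_group (ext_group C R n Y)"
  using comm_group_ext'[of Y "nat n"] ext_neg_trivial(2)[of n Y] by (cases "n < 0") auto

lemma ext_cases:
  assumes "x \<in> carrier (ext_group C R n Y)" "Y \<in> Obj C"
  obtains "n < 0" "x = \<one>\<^bsub>ext_group C R n Y\<^esub>"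
  | m f where "n = int m" "f \<in> Hom C (Syz R m) Y" "x = ecl m Y f"
proof (cases "n < 0")
  case True
  then show thesis using that(1) ext_neg_trivial(1) assms(1) by blast
next
  case False
  then have n: "n = int (nat n)" by simp
  then obtain f where "f \<in> Hom C (Syz R (nat n)) Y" "x = ecl (nat n) Y f"
    using ext_cases'[OF assms(2), of x "nat n"] assms(1) by auto
  then show thesis using that(2)[OF n] by blast
qed

lemma ext_map_neg: "n < 0 \<Longrightarrow> f \<in> Hom C X Y \<Longrightarrow> ext_map C R n f x = \<one>\<^bsub>ext_group C R n Y\<^esub>"
  by (simp add: ext_map_def Hom_iff)

lemma ext_con_neg: "n < 0 \<Longrightarrow> ext_con C R n i p x = \<one>\<^bsub>ext_group C R (n + 1) (Dom C i)\<^esub>"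
  by (simp add: ext_con_def)

lemma ext_one_closed: "Y \<in> Obj C \<Longrightarrow> \<one>\<^bsub>ext_group C R n Y\<^esub> \<in> carrier (ext_group C R n Y)"
  using comm_group_ext by (simp add: comm_group_def group.is_monoid monoid.one_closed)

lemma ext_one_mult: "Y \<in> Obj C \<Longrightarrow>
    \<one>\<^bsub>ext_group C R n Y\<^esub> \<otimes>\<^bsub>ext_group C R n Y\<^esub> \<one>\<^bsub>ext_group C R n Y\<^esub> = \<one>\<^bsub>ext_group C R n Y\<^esub>"
  using comm_group_ext by (simp add: comm_group_def group.is_monoid monoid.one_closed monoid.l_one)

lemma ext_map_hom:
  assumes f: "f \<in> Hom C X Y"
  shows "ext_map C R n f \<in> hom (ext_group C R n X) (ext_group C R n Y)"
proof (rule homI)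
  note obj = Hom_objs[OF f]
  show "ext_map C R n f x \<in> carrier (ext_group C R n Y)" if x: "x \<in> carrier (ext_group C R n X)" for x
    using x obj(1)
  proof (cases rule: ext_cases)
    case (2 m g)
    then show ?thesis using ext_map_ecl[OF f] ecl_closed comp[OF _ f] by simp
  qed (use ext_map_neg[OF _ f] ext_one_closed[OF obj(2)] in simp)
  fix x y assume x: "x \<in> carrier (ext_group C R n X)" and y: "y \<in> carrier (ext_group C R n X)"
  show "ext_map C R n f (x \<otimes>\<^bsub>ext_group C R n X\<^esub> y) = ext_map C R n f x \<otimes>\<^bsub>ext_group C R n Y\<^esub> ext_map C R n f y"
    using x obj(1)
  proof (cases rule: ext_cases)
    case 1
    then show ?thesis using ext_map_neg[OF _ f] ext_one_mult[OF obj(2)] by simp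
  next
    case (2 m g)
    obtain h where h: "h \<in> Hom C (Syz R m) X" "y = ecl m X h"
      using ext_cases'[OF obj(1), of y m] y 2(1) by auto
    have "f \<cdot> (g \<boxplus> h) = f \<cdot> g \<boxplus> f \<cdot> h" using 2(2) h(1) f by (simp add: Hom_iff comp_add)
    then show ?thesis
      using 2 h ecl_mult[OF 2(2) h(1)] ext_map_ecl[OF f 2(2)] ext_map_ecl[OF f h(1)]
        ext_map_ecl[OF f Hom_closed(1)[OF 2(2) h(1)]] ecl_mult[OF comp[OF 2(2) f] comp[OF h(1) f]] by simp
  qed
qed

lemma elift_add:
  assumes E: "short_exact C i p" and L: "elift m i p f h" "elift m i p f' h'"
  shows "elift m i p (f \<boxplus> f') (h \<boxplus> h')"
proof -
  note ip = short_exactD[OF E]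
  obtain g where g: "g \<in> Hom C (Pr R m) (Cod C i)" "p \<cdot> g = f \<cdot> prj R m" "i \<cdot> h = g \<cdot> inc R m"
    using L(1) unfolding elift_def by blast
  obtain g' where g': "g' \<in> Hom C (Pr R m) (Cod C i)" "p \<cdot> g' = f' \<cdot> prj R m" "i \<cdot> h' = g' \<cdot> inc R m"
    using L(2) unfolding elift_def by blast
  have hom: "f \<in> Hom C (Syz R m) (Cod C p)" "f' \<in> Hom C (Syz R m) (Cod C p)"
    "h \<in> Hom C (Syz R (Suc m)) (Dom C i)" "h' \<in> Hom C (Syz R (Suc m)) (Dom C i)"
    using L unfolding elift_def by auto
  have "p \<cdot> (g \<boxplus> g') = (f \<boxplus> f') \<cdot> prj R m" "i \<cdot> (h \<boxplus> h') = (g \<boxplus> g') \<cdot> inc R m"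
    using g g' hom ip tyR by (simp_all add: Hom_iff comp_add add_comp)
  then show ?thesis
    unfolding elift_def using Hom_closed(1)[OF hom(1,2)] Hom_closed(1)[OF hom(3,4)] Hom_closed(1)[OF g(1) g'(1)]
    by blast
qed

lemma elift_natural:
  assumes E: "short_exact C i p" and E': "short_exact C i' p'"
    and abc: "a \<in> Hom C (Dom C i) (Dom C i')" "b \<in> Hom C (Cod C i) (Cod C i')"
      "c \<in> Hom C (Cod C p) (Cod C p')" "b \<cdot> i = i' \<cdot> a" "c \<cdot> p = p' \<cdot> b"
    and L: "elift m i p f h"
  shows "elift m i' p' (c \<cdot> f) (a \<cdot> h)"
proof -
  note ip = short_exactD[OF E] short_exactD[OF E']
  obtain g where g: "g \<in> Hom C (Pr R m) (Cod C i)" "p \<cdot> g = f \<cdot> prj R m" "i \<cdot> h = g \<cdot> inc R m"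
    using L unfolding elift_def by blast
  have hom: "f \<in> Hom C (Syz R m) (Cod C p)" "h \<in> Hom C (Syz R (Suc m)) (Dom C i)"
    using L unfolding elift_def by auto
  have "p' \<cdot> (b \<cdot> g) = (c \<cdot> p) \<cdot> g"
    using g(1) abc ip by (subst comp_reduce[OF abc(5)[symmetric]]) (simp_all add: Hom_iff)
  also have "\<dots> = (c \<cdot> f) \<cdot> prj R m"
    using g(1) hom abc(3) ip tyR by (simp add: Hom_iff comp_assoc' g(2))
  finally have 1: "p' \<cdot> (b \<cdot> g) = (c \<cdot> f) \<cdot> prj R m" .
  have "i' \<cdot> (a \<cdot> h) = (b \<cdot> i) \<cdot> h"
    using hom abc ip by (subst comp_reduce[OF abc(4)[symmetric]]) (simp_all add: Hom_iff)
  also have "\<dots> = (b \<cdot> g) \<cdot> inc R m"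
    using g(1) hom abc(2) ip tyR by (simp add: Hom_iff comp_assoc' g(3))
  finally show ?thesis
    unfolding elift_def using 1 comp[OF hom(1) abc(3)] comp[OF hom(2) abc(1)] comp[OF g(1) abc(2)] by blast
qed

lemma elift_Hom:
  assumes "elift m i p f h"
  shows "f \<in> Hom C (Syz R m) (Cod C p)" "h \<in> Hom C (Syz R (Suc m)) (Dom C i)"
  using assms unfolding elift_def by auto

lemma int_Suc': "int m + 1 = int (Suc m)" by simp

lemma ext_con_hom:
  assumes E: "short_exact C i p"
  shows "ext_con C R n i p \<in> hom (ext_group C R n (Cod C p)) (ext_group C R (n + 1) (Dom C i))"
proof (rule homI)
  note obj = short_exact_obj(1,3)[OF E]
  show "ext_con C R n i p x \<in> carrier (ext_group C R (n + 1) (Dom C i))"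
    if x: "x \<in> carrier (ext_group C R n (Cod C p))" for x
    using x obj(2)
  proof (cases rule: ext_cases)
    case (2 m f)
    obtain h where h: "elift m i p f h" using elift_exists[OF E 2(2)] .
    show ?thesis
      unfolding 2(1,3) ext_con_ecl[OF E h] int_Suc' by (rule ecl_closed[OF elift_Hom(2)[OF h]])
  qed (use ext_con_neg ext_one_closed[OF obj(1)] in simp)
  fix x y assume x: "x \<in> carrier (ext_group C R n (Cod C p))" and y: "y \<in> carrier (ext_group C R n (Cod C p))"
  show "ext_con C R n i p (x \<otimes>\<^bsub>ext_group C R n (Cod C p)\<^esub> y) =
      ext_con C R n i p x \<otimes>\<^bsub>ext_group C R (n + 1) (Dom C i)\<^esub> ext_con C R n i p y"
    using x obj(2)
  proof (cases rule: ext_cases)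
    case 1
    then show ?thesis using ext_con_neg ext_one_mult[OF obj(1)] by simp
  next
    case (2 m f)
    obtain g where g: "g \<in> Hom C (Syz R m) (Cod C p)" "y = ecl m (Cod C p) g"
      using ext_cases'[OF obj(2), of y m] y 2(1) by auto
    obtain h where h: "elift m i p f h" using elift_exists[OF E 2(2)] .
    obtain h' where h': "elift m i p g h'" using elift_exists[OF E g(1)] .
    show ?thesis
      unfolding 2(1,3) g(2) ecl_mult[OF 2(2) g(1)] ext_con_ecl[OF E h] ext_con_ecl[OF E h']
        ext_con_ecl[OF E elift_add[OF E h h']] int_Suc'
      using ecl_mult[OF elift_Hom(2)[OF h] elift_Hom(2)[OF h']] by simp
  qed
qed

lemma ext_map_one: "f \<in> Hom C X Y \<Longrightarrow> ext_map C R n f \<one>\<^bsub>ext_group C R n X\<^esub> = \<one>\<^bsub>ext_group C R n Y\<^esub>"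
  using hom_one[OF ext_map_hom] comm_group_ext Hom_objs by (simp add: comm_group_def)

section \<open>Exactness of Ext at the three terms\<close>

lemma ext_exact_middle:
  assumes E: "short_exact C i p" and y: "y \<in> carrier (ext_group C R n (Cod C i))"
  shows "ext_map C R n p y = \<one>\<^bsub>ext_group C R n (Cod C p)\<^esub> \<longleftrightarrow>
    (\<exists>x\<in>carrier (ext_group C R n (Dom C i)). y = ext_map C R n i x)" (is "?L \<longleftrightarrow> ?R")
proof -
  note ip = short_exactD[OF E]
  note obj = short_exact_obj[OF E]
  show ?thesis
    using y obj(2)
  proof (cases rule: ext_cases)
    case 1
    then show ?thesis using ext_map_neg[OF _ ip(5)] ext_map_neg[OF _ ip(6)] ext_one_closed[OF obj(1), of n] by auto
  next
    case (2 m f)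
    note pf = comp[OF 2(2) ip(6)]
    have L: "?L \<longleftrightarrow> enull m (p \<cdot> f)"
      unfolding 2(1,3) ext_map_ecl[OF ip(6) 2(2)] ecl_eq_one_iff[OF pf] ..
    show ?thesis
    proof
      assume ?L
      then have n: "enull m (p \<cdot> f)" using L by simp
      \<comment> \<open>The condition \<open>enull m (p \<cdot> f)\<close> is lifted along
        \<open>p\<close>: \<open>w\<close> represents the trivial class and has the same image as
        \<open>f\<close>, so \<open>f \<boxminus> w\<close> lands in the kernel of
        \<open>p\<close>.\<close>
      obtain w where w: "w \<in> Hom C (Syz R m) (Cod C i)" "p \<cdot> w = p \<cdot> f" "enull m w"
      proof (cases m)
        case 0
        then have "p \<cdot> f = Nul C (Syz R m) (Cod C p)" using n enull_0[OF pf] by simp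
        then show thesis
          using that[of "Nul C (Syz R m) (Cod C i)"] ip tyR obj enull_Nul[OF obj(2)]
          by (simp add: Hom_iff typing comp_Nul)
      next
        case (Suc k)
        then obtain u where u: "u \<in> Hom C (Pr R k) (Cod C p)" "p \<cdot> f = u \<cdot> inc R k"
          using n enull_Suc[OF pf] by blast
        obtain u' where u': "u' \<in> Hom C (Pr R k) (Cod C i)" "p \<cdot> u' = u"
          using projective_lift[OF resn_projective[OF R] E u(1)] .
        have w: "u' \<cdot> inc R k \<in> Hom C (Syz R m) (Cod C i)" using u'(1) tyR Suc by (simp add: Hom_iff typing)
        have "p \<cdot> (u' \<cdot> inc R k) = p \<cdot> f"
          using u u'(1) ip tyR by (subst comp_reduce[OF u'(2)]) (auto simp: Hom_iff)
        moreover have "enull m (u' \<cdot> inc R k)" using w u'(1) enull_Suc Suc by blast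
        ultimately show thesis using that w by blast
      qed
      have "p \<cdot> (f \<boxminus> w) = Nul C (Syz R m) (Cod C p)"
        using 2(2) w(1,2) ip by (simp add: Hom_iff comp_add comp_neg typing sub_self)
      then obtain e where e: "e \<in> Hom C (Syz R m) (Dom C i)" "i \<cdot> e = f \<boxminus> w"
        using short_exact_lift[OF E Hom_closed(2)[OF 2(2) w(1)]] by blast
      have "f \<boxminus> i \<cdot> e = w" by (rule add_eq_swap[OF 2(2) w(1) comp[OF e(1) ip(5)] e(2)[symmetric]])
      then have "y = ext_map C R n i (ecl m (Dom C i) e)"
        using ecl_eq_iff[OF 2(2) comp[OF e(1) ip(5)]] w(3) ext_map_ecl[OF ip(5) e(1)] 2(1,3) by simp
      then show ?R using ecl_closed[OF e(1)] 2(1) by blast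
    next
      assume ?R
      then obtain e where e: "e \<in> Hom C (Syz R m) (Dom C i)" "y = ext_map C R n i (ecl m (Dom C i) e)"
        using ext_cases'[OF obj(1)] 2(1) by blast
      have "p \<cdot> (i \<cdot> e) = Nul C (Syz R m) (Cod C p)"
        using e(1) ip obj by (subst comp_reduce[OF ip(4)]) (auto simp: Hom_iff Nul_comp)
      then show ?L
        unfolding e(2) 2(1) ext_map_ecl[OF ip(5) e(1)] ext_map_ecl[OF ip(6) comp[OF e(1) ip(5)]]
        using ecl_Nul[OF obj(3)] by simp
    qed
  qed
qed

lemma ext_exact_right:
  assumes E: "short_exact C i p" and y: "y \<in> carrier (ext_group C R n (Cod C p))"
  shows "ext_con C R n i p y = \<one>\<^bsub>ext_group C R (n + 1) (Dom C i)\<^esub> \<longleftrightarrow>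
    (\<exists>x\<in>carrier (ext_group C R n (Cod C i)). y = ext_map C R n p x)" (is "?L \<longleftrightarrow> ?R")
proof -
  note ip = short_exactD[OF E]
  note obj = short_exact_obj[OF E]
  show ?thesis
    using y obj(3)
  proof (cases rule: ext_cases)
    case 1
    then show ?thesis using ext_con_neg ext_map_neg[OF _ ip(6)] ext_one_closed[OF obj(2), of n] by auto
  next
    case (2 m f)
    obtain h where h: "elift m i p f h" using elift_exists[OF E 2(2)] .
    have L: "?L \<longleftrightarrow> (\<exists>e\<in>Hom C (Pr R m) (Dom C i). h = e \<cdot> inc R m)"
      unfolding 2(1,3) ext_con_ecl[OF E h] int_Suc' ecl_eq_one_iff[OF elift_Hom(2)[OF h]]
        enull_Suc[OF elift_Hom(2)[OF h]] ..
    show ?thesis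
    proof
      assume ?L
      then obtain e where e: "e \<in> Hom C (Pr R m) (Dom C i)" "h = e \<cdot> inc R m" using L by blast
      obtain g where g: "g \<in> Hom C (Pr R m) (Cod C i)" "p \<cdot> g = f \<cdot> prj R m" "i \<cdot> h = g \<cdot> inc R m"
        using h unfolding elift_def by blast
      \<comment> \<open>The triviality of \<open>h\<close> corrects the Snake Lemma lift
        \<open>g\<close> to an arrow that vanishes on the next syzygy and so descends to the
        required \<open>f'\<close>.\<close>
      have "(g \<boxminus> i \<cdot> e) \<cdot> inc R m = g \<cdot> inc R m \<boxminus> i \<cdot> h"
        unfolding e(2) using g(1) e(1) ip tyR by (simp only: dist)
      also have "\<dots> = Nul C (Syz R (Suc m)) (Cod C i)"
        unfolding g(3) using g(1) tyR by (simp add: Hom_iff typing sub_self)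
      finally obtain f' where f': "f' \<in> Hom C (Syz R m) (Cod C i)" "g \<boxminus> i \<cdot> e = f' \<cdot> prj R m"
        using inc_desc[OF Hom_closed(2)[OF g(1) comp[OF e(1) ip(5)]]] by blast
      have "(p \<cdot> f') \<cdot> prj R m = p \<cdot> (g \<boxminus> i \<cdot> e)"
        unfolding f'(2) using f'(1) ip tyR by (simp add: Hom_iff comp_assoc')
      also have "\<dots> = f \<cdot> prj R m \<boxminus> (p \<cdot> i) \<cdot> e"
        using g(1) e(1) ip(1-3,5,6) by (simp only: dist g(2))
      also have "\<dots> = f \<cdot> prj R m"
        unfolding ip(4) using e(1) 2(2) tyR obj by (simp add: Hom_iff Nul_comp neg_Nul add_Nul typing)
      finally have "p \<cdot> f' = f" by (rule prj_epi[OF _ comp[OF f'(1) ip(6)] 2(2)])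
      then have "y = ext_map C R n p (ecl m (Cod C i) f')"
        using ext_map_ecl[OF ip(6) f'(1)] 2(1,3) by simp
      then show ?R using ecl_closed[OF f'(1)] 2(1) by blast
    next
      assume ?R
      then obtain f' where f': "f' \<in> Hom C (Syz R m) (Cod C i)" "y = ext_map C R n p (ecl m (Cod C i) f')"
        using ext_cases'[OF obj(2)] 2(1) by blast
      have "p \<cdot> (f' \<cdot> prj R m) = (p \<cdot> f') \<cdot> prj R m" "(f' \<cdot> prj R m) \<cdot> inc R m = Nul C (Syz R (Suc m)) (Cod C i)"
        "i \<cdot> Nul C (Syz R (Suc m)) (Dom C i) = Nul C (Syz R (Suc m)) (Cod C i)"
        using f'(1) ip tyR by (simp_all add: Hom_iff comp_assoc' resn_zero[OF R] comp_Nul)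
      then have L': "elift m i p (p \<cdot> f') (Nul C (Syz R (Suc m)) (Dom C i))"
        unfolding elift_def using comp[OF f'(1) ip(6)] Hom_closed(4)[OF tyR(7) obj(1)] prj_Hom[OF f'(1)]
        by (intro conjI bexI[of _ "f' \<cdot> prj R m"]) auto
      show ?L
        unfolding f'(2) 2(1) ext_map_ecl[OF ip(6) f'(1)] ext_con_ecl[OF E L'] int_Suc' ecl_Nul[OF obj(1)] ..
    qed
  qed
qed

lemma ext_exact_left:
  assumes E: "short_exact C i p" and y: "y \<in> carrier (ext_group C R (n + 1) (Dom C i))"
  shows "ext_map C R (n + 1) i y = \<one>\<^bsub>ext_group C R (n + 1) (Cod C i)\<^esub> \<longleftrightarrow>
    (\<exists>x\<in>carrier (ext_group C R n (Cod C p)). y = ext_con C R n i p x)" (is "?L \<longleftrightarrow> ?R")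
proof -
  note ip = short_exactD[OF E]
  note obj = short_exact_obj[OF E]
  show ?thesis
  proof (cases "n < 0")
    case True
    have R: "?R \<longleftrightarrow> y = \<one>\<^bsub>ext_group C R (n + 1) (Dom C i)\<^esub>"
      using ext_con_neg[OF True] ext_one_closed[OF obj(3), of n] by auto
    show ?thesis
      using y obj(1)
    proof (cases rule: ext_cases)
      case 1
      then show ?thesis using R ext_map_one[OF ip(5), of "n + 1"] by simp
    next
      case (2 m h)
      \<comment> \<open>Here \<open>n\<close> is negative and \<open>n + 1\<close> is not, so
        \<open>n = -1\<close>: exactness is left exactness of Hom, that is, cancellation of
        \<open>i\<close>.\<close>
      then have m: "m = 0" using True by simp
      note ih = comp[OF 2(2) ip(5)]
      have "?L \<longleftrightarrow> i \<cdot> h = Nul C (Syz R 0) (Cod C i)"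
        unfolding 2(1,3) ext_map_ecl[OF ip(5) 2(2)] ecl_eq_one_iff[OF ih] using enull_0[OF ih] m by simp
      also have "Nul C (Syz R 0) (Cod C i) = i \<cdot> Nul C (Syz R 0) (Dom C i)"
        using ip tyR by (simp add: comp_Nul)
      also have "i \<cdot> h = i \<cdot> Nul C (Syz R 0) (Dom C i) \<longleftrightarrow> h = Nul C (Syz R 0) (Dom C i)"
        using short_exact_mono[OF E 2(2)[unfolded m] Hom_closed(4)[OF tyR(7) obj(1)]] by blast
      also have "\<dots> \<longleftrightarrow> y = \<one>\<^bsub>ext_group C R (n + 1) (Dom C i)\<^esub>"
        unfolding 2(1,3) ecl_eq_one_iff[OF 2(2)] using enull_0[OF 2(2)] m by simp
      finally show ?thesis using R by simp
    qed
  next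
    case False
    define m where "m = nat n"
    have n: "n = int m" using False by (simp add: m_def)
    obtain h where h: "h \<in> Hom C (Syz R (Suc m)) (Dom C i)" "y = ecl (Suc m) (Dom C i) h"
      using ext_cases'[OF obj(1), of y "Suc m"] y unfolding n int_Suc' by blast
    note ih = comp[OF h(1) ip(5)]
    have L: "?L \<longleftrightarrow> (\<exists>g\<in>Hom C (Pr R m) (Cod C i). i \<cdot> h = g \<cdot> inc R m)"
      unfolding n int_Suc' h(2) ext_map_ecl[OF ip(5) h(1)] ecl_eq_one_iff[OF ih] enull_Suc[OF ih] ..
    show ?thesis
    proof
      assume ?L
      then obtain g where g: "g \<in> Hom C (Pr R m) (Cod C i)" "i \<cdot> h = g \<cdot> inc R m" using L by blast
      have "(p \<cdot> g) \<cdot> inc R m = p \<cdot> (i \<cdot> h)"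
        unfolding g(2) using g(1) ip tyR by (simp add: Hom_iff comp_assoc')
      also have "\<dots> = Nul C (Syz R (Suc m)) (Cod C p)"
        using h(1) ip obj by (subst comp_reduce[OF ip(4)]) (auto simp: Hom_iff Nul_comp)
      finally obtain f where f: "f \<in> Hom C (Syz R m) (Cod C p)" "p \<cdot> g = f \<cdot> prj R m"
        using inc_desc[OF comp[OF g(1) ip(6)]] by blast
      have "elift m i p f h" unfolding elift_def using f g h(1) by blast
      then have "y = ext_con C R n i p (ecl m (Cod C p) f)" using ext_con_ecl[OF E] h(2) n by simp
      then show ?R using ecl_closed[OF f(1)] n by blast
    next
      assume ?R
      then obtain f where f: "f \<in> Hom C (Syz R m) (Cod C p)" "y = ext_con C R n i p (ecl m (Cod C p) f)"
        using ext_cases'[OF obj(3)] n by blast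
      obtain k where k: "elift m i p f k" using elift_exists[OF E f(1)] .
      then obtain g where g: "g \<in> Hom C (Pr R m) (Cod C i)" "i \<cdot> k = g \<cdot> inc R m"
        unfolding elift_def by blast
      note ik = comp[OF elift_Hom(2)[OF k] ip(5)]
      have y': "y = ecl (Suc m) (Dom C i) k" using f(2) ext_con_ecl[OF E k] n by simp
      show ?L
        unfolding n int_Suc' y' ext_map_ecl[OF ip(5) elift_Hom(2)[OF k]] ecl_eq_one_iff[OF ik] enull_Suc[OF ik]
        using g by blast
    qed
  qed
qed

lemma Ext_functor_simps [simp]:
  "Fobj (Ext_functor C R) = ext_group C R" "Fmor (Ext_functor C R) = ext_map C R"
  "Fcon (Ext_functor C R) = ext_con C R"
  by (simp_all add: Ext_functor_def)

theorem cohomological_functor_Ext: "cohomological_functor C (Ext_functor C R)"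
proof (rule cohomological_functor.intro, unfold Ext_functor_simps)
  show "exact_seq
        ([ext_group C R (n + 1) (Cod C i), ext_group C R (n + 1) (Dom C i), ext_group C R n (Cod C p),
          ext_group C R n (Cod C i), ext_group C R n (Dom C i)],
         [ext_map C R (n + 1) i, ext_con C R n i p, ext_map C R n p, ext_map C R n i])"
    if E: "short_exact C i p" for n i p
  proof -
    note ip = short_exactD[OF E]
    note obj = short_exact_obj[OF E]
    show ?thesis
      by (rule exact_seqI)
        (use obj comm_group_ext ext_map_hom[OF ip(5)] ext_map_hom[OF ip(6)] ext_con_hom[OF E]
           ext_exact_middle[OF E] ext_exact_right[OF E] ext_exact_left[OF E] in \<open>auto simp: comm_group_def\<close>)
  qed
  show "ext_map C R n (Idt C X) x = x" if X: "X \<in> Obj C" and x: "x \<in> carrier (ext_group C R n X)" for n X x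
    using x X
  proof (cases rule: ext_cases)
    case (2 m f)
    then show ?thesis using ext_map_ecl[OF ident[OF X] 2(2)] by (simp add: Hom_iff Idt_comp)
  qed (use ext_map_neg[OF _ ident[OF X]] in simp)
  show "ext_map C R n (g \<cdot> f) x = ext_map C R n g (ext_map C R n f x)"
    if f: "f \<in> Hom C X Y" and g: "g \<in> Hom C Y Z" and x: "x \<in> carrier (ext_group C R n X)" for n X Y Z f g x
    using x Hom_objs(1)[OF f]
  proof (cases rule: ext_cases)
    case (2 m u)
    have "(g \<cdot> f) \<cdot> u = g \<cdot> (f \<cdot> u)" using comp_assoc[OF 2(2) f g] .
    then show ?thesis
      using ext_map_ecl[OF comp[OF f g] 2(2)] ext_map_ecl[OF f 2(2)] ext_map_ecl[OF g comp[OF 2(2) f]] 2(1,3) by simp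
  qed (use ext_map_neg[OF _ comp[OF f g]] ext_map_neg[OF _ g] in simp)
  show "ext_map C R n (f \<boxplus> g) x = ext_map C R n f x \<otimes>\<^bsub>ext_group C R n Y\<^esub> ext_map C R n g x"
    if f: "f \<in> Hom C X Y" and g: "g \<in> Hom C X Y" and x: "x \<in> carrier (ext_group C R n X)" for n X Y f g x
    using x Hom_objs(1)[OF f]
  proof (cases rule: ext_cases)
    case (2 m u)
    have "(f \<boxplus> g) \<cdot> u = f \<cdot> u \<boxplus> g \<cdot> u" using comp_plus_left[OF 2(2) f g] .
    then show ?thesis
      using ext_map_ecl[OF Hom_closed(1)[OF f g] 2(2)] ext_map_ecl[OF f 2(2)] ext_map_ecl[OF g 2(2)]
        ecl_mult[OF comp[OF 2(2) f] comp[OF 2(2) g]] 2(1,3) by simp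
  qed (use ext_map_neg[OF _ Hom_closed(1)[OF f g]] ext_map_neg[OF _ g] ext_map_neg[OF _ f]
        ext_one_mult[OF Hom_objs(2)[OF f]] in simp)
  show "ext_map C R (n + 1) a (ext_con C R n i p x) = ext_con C R n i' p' (ext_map C R n c x)"
    if E: "short_exact C i p" and E': "short_exact C i' p'"
    and abc: "a \<in> Hom C (Dom C i) (Dom C i')" "b \<in> Hom C (Cod C i) (Cod C i')"
      "c \<in> Hom C (Cod C p) (Cod C p')" "b \<cdot> i = i' \<cdot> a" "c \<cdot> p = p' \<cdot> b"
    and x: "x \<in> carrier (ext_group C R n (Cod C p))" for n i p i' p' a b c x
    using x Hom_objs(1)[OF abc(3)]
  proof (cases rule: ext_cases)
    case 1
    then show ?thesis using ext_con_neg ext_map_one[OF abc(1), of "n + 1"] by simp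
  next
    case (2 m f)
    obtain h where h: "elift m i p f h" using elift_exists[OF E 2(2)] .
    show ?thesis
      unfolding 2(1,3) ext_con_ecl[OF E h] ext_map_ecl[OF abc(3) 2(2)]
        ext_con_ecl[OF E' elift_natural[OF E E' abc h]] int_Suc' ext_map_ecl[OF abc(1) elift_Hom(2)[OF h]] ..
  qed
qed ((rule comm_group_ext ext_map_hom ext_con_hom; assumption)+)

text \<open>Two representatives of one Ext class differ by an arrow that extends along
  \<open>inc R m\<close>, hence factors through the projective \<open>Pr R m\<close>. Index
  \<open>Suc m\<close> matters, because in degree 0 there is no preceding projective.\<close>

lemma beta_stage_ecl:
  assumes f: "f \<in> Hom C (Syz R (Suc m)) Y"
  shows "beta_stage C R (Suc m) Y (ecl (Suc m) Y f) = stable_class C (Syz R (Suc m)) Y f"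
  unfolding beta_stage_def
proof (rule class_map_eqI)
  show "f \<cdot> prj R (Suc m) \<in> ecl (Suc m) Y f" using mem_ecl_iff[OF f] f enull_self[OF f] by blast
  show "\<exists>f'\<in>Hom C (Syz R (Suc m)) Y. f \<cdot> prj R (Suc m) = f' \<cdot> prj R (Suc m) \<and>
     stable_class C (Syz R (Suc m)) Y f = stable_class C (Syz R (Suc m)) Y f'" using f by blast
  fix x Z assume x: "x \<in> ecl (Suc m) Y f"
    "\<exists>f'\<in>Hom C (Syz R (Suc m)) Y. x = f' \<cdot> prj R (Suc m) \<and> Z = stable_class C (Syz R (Suc m)) Y f'"
  then obtain g where g: "g \<in> Hom C (Syz R (Suc m)) Y" "x = g \<cdot> prj R (Suc m)" "Z = stable_class C (Syz R (Suc m)) Y g"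
    by blast
  obtain g' where g': "g' \<in> Hom C (Syz R (Suc m)) Y" "x = g' \<cdot> prj R (Suc m)" "enull (Suc m) (g' \<boxminus> f)"
    using x(1) mem_ecl_iff[OF f] by blast
  have "g' = g" using prj_epi[of g' "Suc m" g Y] g g' by simp
  then obtain u where u: "u \<in> Hom C (Pr R m) Y" "g \<boxminus> f = u \<cdot> inc R m"
    using g'(3) enull_Suc[OF Hom_closed(2)[OF g(1) f]] by blast
  have "inc R m \<in> Hom C (Syz R (Suc m)) (Pr R m)" using tyR by (simp add: Hom_iff)
  then have "g \<approx> f" using stable_eqI[OF g(1) f u(2) resn_projective[OF R] _ u(1)] by blast
  then show "Z = stable_class C (Syz R (Suc m)) Y f" using g(3) stable_class_eq_iff[OF g(1) f] by simp
qed

end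

section \<open>The comparison map\<close>

context naive_setting
begin

sublocale E: ext_setting C "res A"
  by unfold_locales (rule resn_A)

lemma res_exact: "B \<in> Obj C \<Longrightarrow> short_exact C (inc (res B) k) (prj (res B) k)"
  using resn_exact resn_res by blast

lemmas res_typing = resn_typing[OF resn_res]

text \<open>Identifies the transition maps of the resolution construction with those of the naive
  one at the level of representing arrows.\<close>

lemma elift_syz_lift:
  assumes "B \<in> Obj C"
  shows "E.elift m (inc (res B) k) (prj (res B) k) f h \<longleftrightarrow> syz_lift C (res A) m (res B) k f h"
  unfolding E.elift_def syz_lift_def using res_typing[OF assms] by simp

lemma group_seq_hatext:
  assumes B: "B \<in> Obj C"
  shows "group_seq UNIV (HE_stage n B) (HE_trans n B)"
proof (rule group_seq.intro)
  show "comm_group (HE_stage n B k)" for k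
    unfolding hatext_stage_def using E.comm_group_ext syz_obj[OF B] by blast
  show "HE_trans n B k \<in> hom (HE_stage n B k) (HE_stage n B (Suc k))" for k
    using E.ext_con_hom[OF res_exact[OF B, of k], of "n + int k"] res_typing[OF B]
    unfolding hatext_trans_def hatext_stage_def by (simp add: add_ac)
qed auto

definition hat_class :: "int \<Rightarrow> 'o \<Rightarrow> nat \<Rightarrow> 'm set \<Rightarrow> (nat \<times> 'm set) set" where
  "hat_class n B k x = HE_rel n B `` {(k, x)}"

abbreviation secl :: "int \<Rightarrow> 'o \<Rightarrow> nat \<Rightarrow> 'm \<Rightarrow> 'm set" where
  "secl n B k f \<equiv> E.ecl (nat (n + int k)) (Syz (res B) k) f"

lemma hat_class_cls:
  assumes "B \<in> Obj C"
  shows "hat_class n B k x = group_seq.cls UNIV (HE_stage n B) (HE_trans n B) k x"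
  by (simp add: group_seq.cls_def[OF group_seq_hatext[OF assms]] hat_class_def hatext_rel_def)

lemma comm_group_hatext: "B \<in> Obj C \<Longrightarrow> comm_group (HE n B)"
  unfolding hatext_group_def by (rule group_seq.comm_group_dirlim[OF group_seq_hatext])

lemma secl_closed:
  assumes "n + int k \<ge> 0" "f \<in> syzHom n B k"
  shows "secl n B k f \<in> carrier (HE_stage n B k)"
  using E.ecl_closed[OF assms(2)] assms(1) by (simp add: hatext_stage_def)

lemma hatext_stage_cases:
  assumes "x \<in> carrier (HE_stage n B k)" "B \<in> Obj C"
  obtains "n + int k < 0" "x = \<one>\<^bsub>HE_stage n B k\<^esub>"
  | f where "n + int k \<ge> 0" "f \<in> syzHom n B k" "x = secl n B k f"
  using assms(1)[unfolded hatext_stage_def] syz_obj[OF assms(2)]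
proof (cases rule: E.ext_cases)
  case 1
  then show thesis using that(1) by (simp add: hatext_stage_def)
next
  case (2 m f)
  then have "nat (n + int k) = m" "n + int k \<ge> 0" by simp_all
  then show thesis using that(2)[of f] 2 by simp
qed

lemma hatext_trans_secl:
  assumes B: "B \<in> Obj C" and n: "n + int k \<ge> 0"
    and L: "syz_lift C (res A) (nat (n + int k)) (res B) k f h"
  shows "HE_trans n B k (secl n B k f) = secl n B (Suc k) h"
proof -
  have "HE_trans n B k (secl n B k f) =
      ext_con C (res A) (int (nat (n + int k))) (inc (res B) k) (prj (res B) k) (secl n B k f)"
    using n by (simp add: hatext_trans_def)
  also have "\<dots> = E.ecl (Suc (nat (n + int k))) (Syz (res B) (Suc k)) h"
    using E.ext_con_ecl[OF res_exact[OF B] iffD2[OF elift_syz_lift[OF B] L]] res_typing[OF B] by simp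
  finally show ?thesis unfolding nat_index_Suc[OF n] .
qed

context
  fixes B :: 'o assumes B: "B \<in> Obj C"
begin

interpretation D: group_seq UNIV "HE_stage n B" "HE_trans n B" for n
  by (rule group_seq_hatext[OF B])

lemma hat_class_closed:
  "x \<in> carrier (HE_stage n B k) \<Longrightarrow> hat_class n B k x \<in> carrier (HE n B)"
  unfolding hat_class_cls[OF B] hatext_group_def using D.cls_closed by simp

lemma hat_class_cases2:
  assumes "x \<in> carrier (HE n B)" "y \<in> carrier (HE n B)"
  obtains k f g where "k \<ge> N" "n + int k \<ge> 0" "f \<in> syzHom n B k" "x = hat_class n B k (secl n B k f)"
    "g \<in> syzHom n B k" "y = hat_class n B k (secl n B k g)"
proof -
  \<comment> \<open>The bound \<open>nat (- n)\<close> skips the stages of negative degree, whose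
    groups are trivial and have no representing arrows.\<close>
  obtain k a b where k: "k \<ge> max N (nat (- n))" "a \<in> carrier (HE_stage n B k)" "x = D.cls n k a"
    "b \<in> carrier (HE_stage n B k)" "y = D.cls n k b"
    using D.dirlim_cases2 assms unfolding hatext_group_def by metis
  have n: "n + int k \<ge> 0" using k(1) by auto
  obtain f where "f \<in> syzHom n B k" "a = secl n B k f"
    using hatext_stage_cases[OF k(2) B] n by (metis not_le)
  moreover obtain g where "g \<in> syzHom n B k" "b = secl n B k g"
    using hatext_stage_cases[OF k(4) B] n by (metis not_le)
  ultimately show thesis using that[of k f g] k n by (simp add: hat_class_cls[OF B])
qed

lemma hat_class_cases:
  assumes "x \<in> carrier (HE n B)"
  obtains k f where "k \<ge> N" "n + int k \<ge> 0" "f \<in> syzHom n B k" "x = hat_class n B k (secl n B k f)"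
  using hat_class_cases2[OF assms assms] by metis

lemma hat_class_mult:
  assumes "x \<in> carrier (HE_stage n B k)" "y \<in> carrier (HE_stage n B k)"
  shows "hat_class n B k x \<otimes>\<^bsub>HE n B\<^esub> hat_class n B k y =
    hat_class n B k (x \<otimes>\<^bsub>HE_stage n B k\<^esub> y)"
  unfolding hat_class_cls[OF B] hatext_group_def using D.mult_cls assms by simp

lemma hat_class_one: "hat_class n B k \<one>\<^bsub>HE_stage n B k\<^esub> = \<one>\<^bsub>HE n B\<^esub>"
  unfolding hat_class_cls[OF B] hatext_group_def using D.one_cls by simp

lemma hat_class_secl_mult:
  assumes "n + int k \<ge> 0" "f \<in> syzHom n B k" "g \<in> syzHom n B k"
  shows "hat_class n B k (secl n B k f) \<otimes>\<^bsub>HE n B\<^esub> hat_class n B k (secl n B k g) =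
    hat_class n B k (secl n B k (f \<boxplus> g))"
  using hat_class_mult[OF secl_closed[OF assms(1,2)] secl_closed[OF assms(1,3)]] E.ecl_mult[OF assms(2,3)] assms(1)
  by (simp add: hatext_stage_def)

lemma hat_class_lift:
  assumes "n + int k \<ge> 0" "syz_lift C (res A) (nat (n + int k)) (res B) k f h"
  shows "hat_class n B (Suc k) (secl n B (Suc k) h) = hat_class n B k (secl n B k f)"
  using D.cls_trans[OF _ secl_closed[OF assms(1) syz_lift_Hom(1)[OF assms(2)]]]
    hatext_trans_secl[OF B assms] by (simp add: hat_class_cls[OF B])

lemma beta_map_aux:
  assumes n: "n + int k \<ge> 1" and f: "f \<in> syzHom n B k"
  shows "\<beta> n B (hat_class n B k (secl n B k f)) = bc_class n B k f"
proof -
  define \<phi> where "\<phi> k = beta_stage C (res A) (nat (n + int k)) (Syz (res B) k)" for k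
  have \<phi>: "\<phi> k (secl n B k f) = sclass n B k f"
    if "n + int k \<ge> 1" "f \<in> syzHom n B k" for k f
  proof -
    have "nat (n + int k) = Suc (nat (n + int k) - 1)" using that(1) by simp
    then obtain m where "nat (n + int k) = Suc m" ..
    then show ?thesis unfolding \<phi>_def using E.beta_stage_ecl[of f m] that(2) by simp
  qed
  have "dirlim_map {k. n + int k \<ge> 1} (dirlim_rel (index n) (BC_stage n B) (BC_trans n B)) \<phi>
      (D.cls n k (secl n B k f)) =
    group_seq.cls (index n) (BC_stage n B) (BC_trans n B) k (\<phi> k (secl n B k f))"
  proof (rule dirlim_map_cls[OF group_seq_hatext[OF B] group_seq_bc[OF B]])
    fix k x assume k: "k \<in> {k. n + int k \<ge> 1}" and x: "x \<in> carrier (HE_stage n B k)"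
    have nk: "n + int k \<ge> 1" "n + int k \<ge> 0" "n + int (Suc k) \<ge> 1" using k by auto
    obtain f where f: "f \<in> syzHom n B k" "x = secl n B k f"
      using hatext_stage_cases[OF x B] nk(2) by (metis not_le)
    obtain h where h: "syz_lift C (res A) (nat (n + int k)) (res B) k f h"
      "h \<in> syzHom n B (Suc k)"
      using syz_lift_A[OF B nk(2) f(1)] .
    show "\<phi> k x \<in> carrier (BC_stage n B k)"
      unfolding f(2) \<phi>[OF nk(1) f(1)] by (rule sc_closed[OF B f(1)])
    show "\<phi> (Suc k) (HE_trans n B k x) = BC_trans n B k (\<phi> k x)"
      unfolding f(2) \<phi>[OF nk(1) f(1)] hatext_trans_secl[OF B nk(2) h(1)] \<phi>[OF nk(3) h(2)]
        bc_trans_class[OF B nk(2) h(1)] ..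
  qed (use n secl_closed[OF _ f] in auto)
  then show ?thesis
    unfolding beta_map_def bc_rel_def hat_class_cls[OF B] bc_class_cls[OF B] \<phi>[OF n f] \<phi>_def[abs_def, symmetric] .
qed

text \<open>The comparison is assembled from stages with \<open>n + k \<ge> 1\<close>. A
  representative of degree 0 is moved along one transition first, and both constructions move it by
  the same lift.\<close>

lemma beta_map_class:
  assumes n: "n + int k \<ge> 0" and f: "f \<in> syzHom n B k"
  shows "\<beta> n B (hat_class n B k (secl n B k f)) = bc_class n B k f"
proof -
  obtain h where h: "syz_lift C (res A) (nat (n + int k)) (res B) k f h"
    "h \<in> syzHom n B (Suc k)"
    using syz_lift_A[OF B n f] .
  have "n + int (Suc k) \<ge> 1" using n by simp
  then show ?thesis
    using beta_map_aux[OF _ h(2)] hat_class_lift[OF n h(1)] bc_class_lift[OF B n h(1)] by simp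
qed

lemma beta_map_hom: "\<beta> n B \<in> hom (HE n B) (BC n B)"
proof (rule homI)
  show "\<beta> n B x \<in> carrier (BC n B)"
    if "x \<in> carrier (HE n B)" for x
    using hat_class_cases[OF that] beta_map_class bc_class_closed[OF B] by metis
  fix x y assume "x \<in> carrier (HE n B)" "y \<in> carrier (HE n B)"
  then obtain k f g where k: "n + int k \<ge> 0" "f \<in> syzHom n B k" "x = hat_class n B k (secl n B k f)"
    "g \<in> syzHom n B k" "y = hat_class n B k (secl n B k g)"
    using hat_class_cases2 by metis
  show "\<beta> n B (x \<otimes>\<^bsub>HE n B\<^esub> y) =
      \<beta> n B x \<otimes>\<^bsub>BC n B\<^esub> \<beta> n B y"
    unfolding k(3,5) hat_class_secl_mult[OF k(1,2,4)] beta_map_class[OF k(1) Hom_closed(1)[OF k(2,4)]]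
      beta_map_class[OF k(1,2)] beta_map_class[OF k(1,4)] bc_class_mult[OF B k(1,2,4)] ..
qed

text \<open>If \<open>f\<close> is \<open>prj (res B) k \<cdot> u\<close>, then
  \<open>u \<cdot> prj (res A) m\<close> is an admissible lift, and it vanishes on the next syzygy.
  The induced arrow is thus zero on the nose and not only stably, which is why one transition
  suffices to annihilate the Ext class.\<close>

lemma snull_syz_lift:
  assumes f: "f \<in> Hom C (Syz (res A) m) (Syz (res B) k)" "snull f"
  shows "syz_lift C (res A) m (res B) k f (Nul C (Syz (res A) (Suc m)) (Syz (res B) (Suc k)))"
proof -
  note ty = E.tyR res_typing[OF B]
  obtain u where u: "u \<in> Hom C (Syz (res A) m) (Pr (res B) k)" "prj (res B) k \<cdot> u = f"
    using resn_factor[OF resn_res[OF B] f(2,1)] .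
  let ?g = "u \<cdot> prj (res A) m"
  have "?g \<in> Hom C (Pr (res A) m) (Pr (res B) k)" "prj (res B) k \<cdot> ?g = f \<cdot> prj (res A) m"
    using u(1) ty by (simp_all add: Hom_iff typing comp_reduce[OF u(2)])
  moreover have "inc (res B) k \<cdot> Nul C (Syz (res A) (Suc m)) (Syz (res B) (Suc k)) = ?g \<cdot> inc (res A) m"
    using u(1) ty by (simp add: Hom_iff comp_Nul comp_assoc' resn_zero[OF resn_A])
  ultimately show ?thesis
    unfolding syz_lift_def using f(1) Hom_closed(4) ty by blast
qed

lemma beta_map_eq_one:
  assumes "x \<in> carrier (HE n B)" "\<beta> n B x = \<one>\<^bsub>BC n B\<^esub>"
  shows "x = \<one>\<^bsub>HE n B\<^esub>"
proof -
  obtain k f where k: "n + int k \<ge> 0" "f \<in> syzHom n B k" "x = hat_class n B k (secl n B k f)"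
    using hat_class_cases[OF assms(1)] by metis
  have "bc_class n B k f = \<one>\<^bsub>BC n B\<^esub>" using assms(2) beta_map_class[OF k(1,2)] k(3) by simp
  with B have "hat_class n B k (secl n B k f) = \<one>\<^bsub>HE n B\<^esub>"
    using k(1,2)
  proof (induction rule: bc_one_induct)
    case (null k f)
    note L = snull_syz_lift[OF null(2,3)]
    have "secl n B (Suc k) (Nul C (Syz (res A) (Suc (nat (n + int k)))) (Syz (res B) (Suc k))) =
        \<one>\<^bsub>HE_stage n B (Suc k)\<^esub>"
      using E.ecl_Nul[OF syz_obj[OF B, of "Suc k"], of "Suc (nat (n + int k))"] null(1)
        nat_index_Suc[OF null(1)] by (simp add: hatext_stage_def add_ac)
    then show ?case using hat_class_lift[OF null(1) L] hat_class_one by metis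
  next
    case (lift k f h)
    then show ?case using hat_class_lift[OF lift(1,3)] by simp
  qed
  then show ?thesis using k(3) by simp
qed

lemma beta_map_bij: "bij_betw (\<beta> n B) (carrier (HE n B)) (carrier (BC n B))"
proof -
  interpret group_hom "HE n B" "BC n B" "\<beta> n B"
    using comm_group_hatext[OF B] comm_group_bc[OF B] beta_map_hom
    by (intro group_hom.intro group_hom_axioms.intro) (auto simp: comm_group_def)
  have "inj_on (\<beta> n B) (carrier (HE n B))"
    using inj_on_one_iff beta_map_eq_one by blast
  moreover have "\<exists>x\<in>carrier (HE n B). y = \<beta> n B x"
    if y: "y \<in> carrier (BC n B)" for y
  proof -
    obtain k f where k: "n + int k \<ge> 0" "f \<in> syzHom n B k" "y = bc_class n B k f"
      using bc_class_cases[OF B y] by metis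
    then show ?thesis using beta_map_class[OF k(1,2)] hat_class_closed[OF secl_closed[OF k(1,2)]] by metis
  qed
  ultimately show ?thesis unfolding bij_betw_def using hom_closed by blast
qed

end

text \<open>Since \<open>\<beta>\<close> is injective, well-definedness of a map of direct limits need not be checked on
  transition maps.\<close>

lemma hat_map_transport:
  assumes B: "B \<in> Obj C" and D: "D \<in> Obj C"
    and \<phi>: "\<And>l b. b \<in> carrier (HE_stage n B l) \<Longrightarrow> \<phi> l b \<in> carrier (HE_stage n' D l) \<and>
      \<beta> n' D (hat_class n' D l (\<phi> l b)) = \<Phi> (\<beta> n B (hat_class n B l b))"
    and x: "x \<in> carrier (HE n B)"
  shows "dirlim_map UNIV (HE_rel n' D) \<phi> x \<in> carrier (HE n' D) \<and>
    \<beta> n' D (dirlim_map UNIV (HE_rel n' D) \<phi> x) = \<Phi> (\<beta> n B x)"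
proof -
  interpret G: group_seq UNIV "HE_stage n B" "HE_trans n B"
    by (rule group_seq_hatext[OF B])
  obtain k f where k: "n + int k \<ge> 0" "f \<in> syzHom n B k" "x = hat_class n B k (secl n B k f)"
    using hat_class_cases[OF B x] by metis
  let ?a = "secl n B k f"
  have a: "?a \<in> carrier (HE_stage n B k)" by (rule secl_closed[OF k(1,2)])
  have "dirlim_map UNIV (HE_rel n' D) \<phi> (G.cls k ?a) = hat_class n' D k (\<phi> k ?a)"
  proof (rule G.dirlim_map_eqI)
    fix l b assume b: "b \<in> carrier (HE_stage n B l)" and eq: "G.cls l b = G.cls k ?a"
    have "\<beta> n' D (hat_class n' D l (\<phi> l b)) = \<beta> n' D (hat_class n' D k (\<phi> k ?a))"
      using \<phi>[OF b] \<phi>[OF a] eq by (simp add: hat_class_cls[OF B])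
    then have "hat_class n' D l (\<phi> l b) = hat_class n' D k (\<phi> k ?a)"
      by (rule inj_onD[OF bij_betw_imp_inj_on[OF beta_map_bij[OF D]]])
        (use hat_class_closed[OF D] \<phi>[OF b] \<phi>[OF a] in blast)+
    then show "HE_rel n' D `` {(l, \<phi> l b)} = hat_class n' D k (\<phi> k ?a)"
      by (simp add: hat_class_def)
  qed (use a in simp_all)
  then show ?thesis
    using \<phi>[OF a] hat_class_closed[OF D] k(3) by (simp add: hat_class_cls[OF B])
qed

lemma beta_one:
  assumes "B \<in> Obj C"
  shows "\<beta> n B \<one>\<^bsub>HE n B\<^esub> = \<one>\<^bsub>BC n B\<^esub>"
  using hom_one[OF beta_map_hom[OF assms]] comm_group_hatext[OF assms] comm_group_bc[OF assms]
  by (simp add: comm_group_def)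

lemma bc_map_one: "f \<in> Hom C B D \<Longrightarrow> BC_map n f \<one>\<^bsub>BC n B\<^esub> = \<one>\<^bsub>BC n D\<^esub>"
  using hom_one[OF bc_map_hom] comm_group_bc Hom_objs by (simp add: comm_group_def)

lemma bc_con_one:
  assumes "short_exact C i p"
  shows "BC_con n i p \<one>\<^bsub>BC n (Cod C p)\<^esub> = \<one>\<^bsub>BC (n + 1) (Dom C i)\<^esub>"
  using hom_one[OF bc_con_hom[OF assms]] comm_group_bc short_exactD(1,2)[OF assms] dom_obj cod_obj
  by (simp add: comm_group_def)

lemma hatext_map_beta:
  assumes f: "f \<in> Hom C B D" and x: "x \<in> carrier (HE n B)"
  shows "hatext_map C res A n f x \<in> carrier (HE n D) \<and>
    \<beta> n D (hatext_map C res A n f x) = BC_map n f (\<beta> n B x)"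
proof -
  note obj = Hom_objs[OF f]
  have f': "Dom C f = B" "Cod C f = D" using f by (auto simp: Hom_iff)
  show ?thesis
    unfolding hatext_map_def f'
  proof (rule hat_map_transport[OF obj _ x])
    fix l b assume b: "b \<in> carrier (HE_stage n B l)"
    let ?F = "lifts C (res B) (res D) f l"
    have F: "?F \<in> Hom C (Syz (res B) l) (Syz (res D) l)" using lft(3)[OF f, of l] f' by simp
    have c: "ext_map C (res A) (n + int l) ?F b \<in> carrier (HE_stage n D l)"
      using E.ext_map_hom[OF F, of "n + int l"] b unfolding hatext_stage_def hom_def by auto
    show "ext_map C (res A) (n + int l) ?F b \<in> carrier (HE_stage n D l) \<and>
      \<beta> n D (hat_class n D l (ext_map C (res A) (n + int l) ?F b)) =
      BC_map n f (\<beta> n B (hat_class n B l b))"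
      using b obj(1)
    proof (cases rule: hatext_stage_cases)
      case 1
      have "ext_map C (res A) (n + int l) ?F b = \<one>\<^bsub>HE_stage n D l\<^esub>"
        using E.ext_map_neg[OF 1(1) F] by (simp add: hatext_stage_def)
      then show ?thesis
        using c 1(2) hat_class_one[OF obj(1)] hat_class_one[OF obj(2)] beta_one obj bc_map_one[OF f] by simp
    next
      case (2 g)
      note Fg = comp[OF 2(2) F]
      have "ext_map C (res A) (n + int l) ?F b = secl n D l (?F \<cdot> g)"
        using E.ext_map_ecl[OF F 2(2)] 2(1,3) by simp
      then show ?thesis
        using c beta_map_class[OF obj(2) 2(1) Fg] beta_map_class[OF obj(1) 2(1,2)] bc_map_class[OF f 2(1,2)] 2(3)
        by simp
    qed
  qed
qed

text \<open>The composite \<open>l \<cdot> G\<close> of the lifts behind \<open>h\<close> and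
  \<open>g'\<close> is a lift as in the Snake Lemma for the horseshoe sequence. Hence the connecting
  homomorphism of Ext is composition with \<open>h\<close> after passing to syzygies, which is the
  formula for \<open>\<tau>\<close>.\<close>

lemma con_elift:
  assumes E: "short_exact C i p" and h: "con_lift C (res (Dom C i)) (res (Cod C p)) (hs i p) k h"
    and g: "syz_lift C (res A) m (res (Cod C p)) k g g'"
  shows "E.elift m (Sin (hs i p) k) (Sout (hs i p) k) g (h \<cdot> g')"
proof -
  interpret H: horseshoe_setup C "res (Dom C i)" "res (Cod C p)" i p "hs i p" by (rule horseshoe[OF E])
  note ty = H.ty E.tyR
  note hom = syz_lift_Hom[OF g] H.con_lift_Hom[OF h]
  obtain l where l: "l \<in> Hom C (Pr (res (Cod C p)) k) (Syz H.M k)"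
    "Sout (hs i p) k \<cdot> l = prj (res (Cod C p)) k" "Sin (hs i p) k \<cdot> h = l \<cdot> inc (res (Cod C p)) k"
    using H.con_liftE[OF h] .
  obtain G where G: "G \<in> Hom C (Pr (res A) m) (Pr (res (Cod C p)) k)"
    "prj (res (Cod C p)) k \<cdot> G = g \<cdot> prj (res A) m" "inc (res (Cod C p)) k \<cdot> g' = G \<cdot> inc (res A) m"
    using g unfolding syz_lift_def by blast
  have "Sout (hs i p) k \<cdot> (l \<cdot> G) = g \<cdot> prj (res A) m"
    using l(1) G(1) ty by (subst comp_reduce[OF l(2)]) (simp_all add: Hom_iff G(2))
  moreover have "Sin (hs i p) k \<cdot> (h \<cdot> g') = (l \<cdot> G) \<cdot> inc (res A) m"
    using l(1) G(1) hom ty by (subst comp_reduce[OF l(3)]) (simp_all add: Hom_iff comp_assoc' G(3))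
  ultimately show ?thesis
    unfolding E.elift_def using hom comp[OF G(1) l(1)] comp[OF hom(2,3)] ty by auto
qed

text \<open>The second claim, on single stages, gives the first by \<open>hat_map_transport\<close>.
  Its case \<open>l = 0\<close> later gives the compatibility of the completion map with connecting
  homomorphisms, as stage 0 is Ext itself and carries no sign.\<close>

lemma hatext_con_beta:
  assumes E: "short_exact C i p" and x: "x \<in> carrier (HE n (Cod C p))"
  shows "hatext_con C res hs A n i p x \<in> carrier (HE (n + 1) (Dom C i)) \<and>
    \<beta> (n + 1) (Dom C i) (hatext_con C res hs A n i p x) =
      BC_con n i p (\<beta> n (Cod C p) x)" (is ?A)
    and "b \<in> carrier (HE_stage n (Cod C p) l) \<Longrightarrow>
      signed (HE_stage (n + 1) (Dom C i) l) l
        (ext_con C (res A) (n + int l) (Sin (hs i p) l) (Sout (hs i p) l) b) \<in> carrier (HE_stage (n + 1) (Dom C i) l) \<and>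
      \<beta> (n + 1) (Dom C i) (hat_class (n + 1) (Dom C i) l
        (signed (HE_stage (n + 1) (Dom C i) l) l
          (ext_con C (res A) (n + int l) (Sin (hs i p) l) (Sout (hs i p) l) b))) =
      BC_con n i p (\<beta> n (Cod C p) (hat_class n (Cod C p) l b))" (is "?b \<Longrightarrow> ?B l b")
proof -
  interpret H: horseshoe_setup C "res (Dom C i)" "res (Cod C p)" i p "hs i p" by (rule horseshoe[OF E])
  note obj = short_exact_obj(1,3)[OF E]
  have stage: "?B l b" if b: "b \<in> carrier (HE_stage n (Cod C p) l)" for l b
    using b obj(2)
  proof (cases rule: hatext_stage_cases)
    case 1
    let ?S = "HE_stage (n + 1) (Dom C i) l"
    interpret S: comm_group ?S
      unfolding hatext_stage_def using E.comm_group_ext syz_obj[OF obj(1)] by blast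
    have "ext_con C (res A) (n + int l) (Sin (hs i p) l) (Sout (hs i p) l) b = \<one>\<^bsub>?S\<^esub>"
      using E.ext_con_neg[OF 1(1)] H.ty by (simp add: hatext_stage_def add_ac)
    then have "signed ?S l (ext_con C (res A) (n + int l) (Sin (hs i p) l) (Sout (hs i p) l) b) = \<one>\<^bsub>?S\<^esub>"
      by (simp add: signed_def)
    then show ?thesis
      using 1(2) hat_class_one[OF obj(1)] hat_class_one[OF obj(2)] beta_one obj bc_con_one[OF E] by simp
  next
    case (2 g)
    define m where "m = nat (n + int l)"
    have m: "int m = n + int l" "nat (n + 1 + int l) = Suc m" "n + 1 + int l = int (Suc m)"
      "nat (n + int (Suc l)) = Suc m"
      using 2(1) by (simp_all add: m_def)
    have m': "syzA n l = Syz (res A) m" "syzA (n + 1) l = Syz (res A) (Suc m)" "syzA n (Suc l) = Syz (res A) (Suc m)"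
      by (simp_all only: m(2,4) m_def[symmetric])
    note g = 2(2)[unfolded m'(1)]
    obtain h where h: "con_lift C (res (Dom C i)) (res (Cod C p)) (hs i p) l h" using H.con_lift_exists .
    obtain g' where g': "syz_lift C (res A) m (res (Cod C p)) l g g'"
      using syz_lift_exists[OF resn_A H.S g] .
    note L = con_elift[OF E h g']
    have hg: "h \<cdot> g' \<in> Hom C (Syz (res A) (Suc m)) (Syz (res (Dom C i)) l)"
      using comp[OF syz_lift_Hom(2)[OF g'] H.con_lift_Hom[OF h]] .
    define s where "s = (if even l then h \<cdot> g' else neg (h \<cdot> g'))"
    have s: "s \<in> syzHom (n + 1) (Dom C i) l"
      using hg Hom_closed(3)[OF hg] unfolding s_def m' by simp
    have "ext_con C (res A) (n + int l) (Sin (hs i p) l) (Sout (hs i p) l) b =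
        E.ecl (Suc m) (Syz (res (Dom C i)) l) (h \<cdot> g')"
      using E.ext_con_ecl[OF H.exact_S L] H.ty(8,12) 2(3) by (simp add: m_def[symmetric] m(1))
    then have v: "signed (HE_stage (n + 1) (Dom C i) l) l
        (ext_con C (res A) (n + int l) (Sin (hs i p) l) (Sout (hs i p) l) b) = secl (n + 1) (Dom C i) l s"
      unfolding signed_def s_def hatext_stage_def m(2) unfolding m(3) using E.ecl_neg[OF hg] by simp
    have "con_seq' i p l \<cdot> g' \<approx> (if even l then h else neg h) \<cdot> g'"
      using stable_eq_comp[OF H.con_seq[OF h], of g'] con_seq_Hom[OF E, of l] syz_lift_Hom(2)[OF g']
      by (simp add: Hom_iff)
    also have "(if even l then h else neg h) \<cdot> g' = s"
      using H.con_lift_Hom[OF h] syz_lift_Hom(2)[OF g'] unfolding s_def by (simp add: Hom_iff neg_comp)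
    finally have "s \<approx> con_seq' i p l \<cdot> g'" using stable_eq_sym by blast
    moreover have "BC_con n i p (bc_class n (Cod C p) l g) = bc_class (n + 1) (Dom C i) l (con_seq' i p l \<cdot> g')"
      using bc_con_class[OF E, of n l g'] syz_lift_Hom(2)[OF g'] 2(1) m'(3)
        bc_class_lift[OF obj(2) 2(1) g'[unfolded m_def]] by simp
    moreover have n1: "n + 1 + int l \<ge> 0" using 2(1) by simp
    ultimately show ?thesis
      unfolding v using beta_map_class[OF obj(1) n1 s] bc_class_cong[OF obj(1) _ s] secl_closed[OF n1 s]
        beta_map_class[OF obj(2) 2(1,2)] 2(3) by simp
  qed
  then show "?b \<Longrightarrow> ?B l b" .
  show ?A
    unfolding hatext_con_def by (rule hat_map_transport[OF obj(2,1) stage x])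
qed

lemma HatExt_functor_simps [simp]:
  "Fobj (HatExt_functor C res hs A) = HE"
  "Fmor (HatExt_functor C res hs A) = hatext_map C res A"
  "Fcon (HatExt_functor C res hs A) = hatext_con C res hs A"
  by (simp_all add: HatExt_functor_def)

theorem coh_isomorphism_beta:
  "coh_isomorphism C (HatExt_functor C res hs A) (BC_functor C res hs A) (\<beta>)"
proof (rule coh_isomorphismI)
  show "coh_morphism C (HatExt_functor C res hs A) (BC_functor C res hs A) (\<beta>)"
    by (rule cohomological_functor_transport)
      (simp_all add: abelian_category_axioms cohomological_functor_BC comm_group_hatext beta_map_hom
        beta_map_bij hatext_map_beta hatext_con_beta(1))
qed (simp_all add: abelian_category_axioms beta_map_bij)

section \<open>The completion map and its universal property\<close>

abbreviation completion_map :: "int \<Rightarrow> 'o \<Rightarrow> 'm set \<Rightarrow> (nat \<times> 'm set) set" where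
  "completion_map \<equiv> \<lambda>n B. \<beta> n B \<circ> canonical_map C res A n B"

lemma canonical_map_class: "canonical_map C res A n B x = hat_class n B 0 x"
  by (simp add: canonical_map_def hat_class_def)

lemma stage_0: "B \<in> Obj C \<Longrightarrow> HE_stage n B 0 = ext_group C (res A) n B"
  by (simp add: hatext_stage_def Syz_res_0)

lemma completion_map_ecl:
  assumes B: "B \<in> Obj C" and f: "f \<in> Hom C (Syz (res A) m) B"
  shows "completion_map (int m) B (E.ecl m B f) = bc_class (int m) B 0 f"
  using beta_map_class[OF B, of "int m" 0 f] f Syz_res_0[OF B] by (simp add: canonical_map_class)

lemma completion_map_one:
  assumes B: "B \<in> Obj C"
  shows "completion_map n B \<one>\<^bsub>ext_group C (res A) n B\<^esub> = \<one>\<^bsub>BC n B\<^esub>"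
  using hat_class_one[OF B, of n 0] beta_one[OF B] by (simp add: canonical_map_class stage_0[OF B])

lemma coh_morphism_completion:
  "coh_morphism C (Ext_functor C (res A)) (BC_functor C res hs A) completion_map"
  unfolding coh_morphism_def E.Ext_functor_simps BC_functor_simps
proof (intro conjI allI ballI impI E.cohomological_functor_Ext cohomological_functor_BC)
  fix n X assume X: "X \<in> Obj C"
  have "canonical_map C res A n X \<in> hom (ext_group C (res A) n X) (HE n X)"
    unfolding canonical_map_class stage_0[OF X, symmetric]
    by (rule homI) (simp_all add: hat_class_closed[OF X] hat_class_mult[OF X])
  then show "completion_map n X \<in> hom (ext_group C (res A) n X) (BC n X)"
    using hom_compose beta_map_hom[OF X] by blast
next
  fix n X Y f x assume f: "f \<in> Hom C X Y" and x: "x \<in> carrier (ext_group C (res A) n X)"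
  note obj = Hom_objs[OF f]
  show "completion_map n Y (ext_map C (res A) n f x) = BC_map n f (completion_map n X x)"
    using x obj(1)
  proof (cases rule: E.ext_cases)
    case 1
    then show ?thesis
      using E.ext_map_neg[OF 1(1) f] completion_map_one[OF obj(1)] completion_map_one[OF obj(2)] bc_map_one[OF f] by metis
  next
    case (2 m g)
    have g: "g \<in> syzHom (int m) X 0" using 2(2) Syz_res_0[OF obj(1)] by simp
    show ?thesis
      unfolding 2(1,3) E.ext_map_ecl[OF f 2(2)] completion_map_ecl[OF obj(1) 2(2)]
        completion_map_ecl[OF obj(2) comp[OF 2(2) f]]
      using bc_map_lft(1)[OF f _ g] lft(1)[OF f] by simp
  qed
next
  fix n i p x assume E: "short_exact C i p" and x: "x \<in> carrier (ext_group C (res A) n (Cod C p))"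
  note obj = short_exact_obj(1,3)[OF E]
  interpret H: horseshoe_setup C "res (Dom C i)" "res (Cod C p)" i p "hs i p" by (rule horseshoe[OF E])
  have one: "\<one>\<^bsub>HE n (Cod C p)\<^esub> \<in> carrier (HE n (Cod C p))"
    using comm_group_hatext[OF obj(2)] by (simp add: comm_group_def group.is_monoid monoid.one_closed)
  have "x \<in> carrier (HE_stage n (Cod C p) 0)" using x stage_0[OF obj(2)] by simp
  from hatext_con_beta(2)[OF E one this]
  show "completion_map (n + 1) (Dom C i) (ext_con C (res A) n i p x) =
      BC_con n i p (completion_map n (Cod C p) x)"
    by (simp add: signed_def H.base canonical_map_class)
qed

lemma canonical_shift:
  assumes X: "X \<in> Obj C"
  shows "Cod C (prj (res X) 0) = X" "short_exact C (inc (res X) 0) (prj (res X) 0)"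
    "projective C (Cod C (inc (res X) 0))"
  using res_typing[OF X] Syz_res_0[OF X] res_exact[OF X] resn_projective[OF resn_res[OF X]] by simp_all

text \<open>The connecting homomorphism of the first sequence of \<open>res X\<close> lowers the
  stage of a representative by one and raises the degree by one, and at stage 0 a class comes from
  Ext. After a shift the first syzygy is resolved by its own assigned resolution, which need not be
  the tail of \<open>res X\<close>; hence \<open>n\<close>, \<open>X\<close> and \<open>f\<close>
  vary in the induction.\<close>

lemma bc_reach:
  assumes base: "\<And>n X x. X \<in> Obj C \<Longrightarrow> x \<in> carrier (ext_group C (res A) n X) \<Longrightarrow> Q n X (completion_map n X x)"
    and step: "\<And>n X y. X \<in> Obj C \<Longrightarrow> y \<in> carrier (BC n X) \<Longrightarrow>
       Q (n + 1) (Dom C (inc (res X) 0)) (BC_con n (inc (res X) 0) (prj (res X) 0) y) \<Longrightarrow> Q n X y"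
  shows "X \<in> Obj C \<Longrightarrow> n + int k \<ge> 0 \<Longrightarrow> f \<in> syzHom n X k \<Longrightarrow> Q n X (bc_class n X k f)"
proof (induction k arbitrary: n X f)
  case 0
  then have n: "n = int (nat n)" and f: "f \<in> Hom C (Syz (res A) (nat n)) X"
    using Syz_res_0[OF 0(1)] by auto
  have "Q (int (nat n)) X (completion_map (int (nat n)) X (E.ecl (nat n) X f))"
    by (rule base[OF 0(1) E.ecl_closed[OF f]])
  then show ?case using completion_map_ecl[OF 0(1) f] n by simp
next
  case (Suc k)
  note S = canonical_shift[OF Suc.prems(1)]
  have f: "f \<in> Hom C (syzA n (Suc k)) (Syz (res (Cod C (prj (res X) 0))) (Suc k))"
    using Suc.prems(3) S(1) by simp
  note v = bc_con_val[OF S(2) Suc.prems(2) f]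
  have "Dom C (inc (res X) 0) \<in> Obj C" using short_exactD(1)[OF S(2)] dom_obj by blast
  then have "Q (n + 1) (Dom C (inc (res X) 0)) (bc_class (n + 1) (Dom C (inc (res X) 0)) k
      (con_seq' (inc (res X) 0) (prj (res X) 0) k \<cdot> f))"
    using Suc.IH v(2,3) by blast
  then show ?case
    using step[OF Suc.prems(1) bc_class_closed[OF Suc.prems]] v(1) S(1) by simp
qed

text \<open>The shifts run along the sequences of \<open>res X\<close>, whose connecting
  homomorphisms are the transition maps of the resolution construction. A representative that
  becomes stably null after finitely many of them is annihilated by the next one.\<close>

lemma ext_killed:
  assumes X: "X \<in> Obj C" and x: "x \<in> carrier (ext_group C (res A) n X)"
    and one: "completion_map n X x = \<one>\<^bsub>BC n X\<^esub>"
  shows "killed C (Ext_functor C (res A)) n X x"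
  using x X
proof (cases rule: E.ext_cases)
  case 1
  then show ?thesis using killed.one[of C "Ext_functor C (res A)" n X] by simp
next
  case (2 m f)
  let ?T = "Ext_functor C (res A)"
  have step: "killed C ?T (n + int k) (Syz (res X) k) (secl n X k f)"
    if n: "n + int k \<ge> 0" and f: "f \<in> syzHom n X k"
      and L: "syz_lift C (res A) (nat (n + int k)) (res X) k f h"
      and K: "killed C ?T (n + int (Suc k)) (Syz (res X) (Suc k)) (secl n X (Suc k) h)" for k f h
  proof -
    have D: "Cod C (prj (res X) k) = Syz (res X) k" "Dom C (inc (res X) k) = Syz (res X) (Suc k)"
      using res_typing[OF X] by simp_all
    have "killed C ?T (n + int k) (Cod C (prj (res X) k)) (secl n X k f)"
    proof (rule killed.shift[OF res_exact[OF X]])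
      show "projective C (Cod C (inc (res X) k))"
        using resn_projective[OF resn_res[OF X]] res_typing[OF X] by simp
      show "secl n X k f \<in> carrier (Fobj ?T (n + int k) (Cod C (prj (res X) k)))"
        using secl_closed[OF n f] D by (simp add: hatext_stage_def)
      have "Fcon ?T (n + int k) (inc (res X) k) (prj (res X) k) (secl n X k f) = secl n X (Suc k) h"
        using hatext_trans_secl[OF X n L] by (simp add: hatext_trans_def)
      then show "killed C ?T (n + int k + 1) (Dom C (inc (res X) k))
          (Fcon ?T (n + int k) (inc (res X) k) (prj (res X) k) (secl n X k f))"
        using K D by (simp add: add_ac)
    qed
    then show ?thesis using D by simp
  qed
  have f: "f \<in> syzHom n X 0" using 2(1,2) Syz_res_0[OF X] by simp
  have f0: "bc_class n X 0 f = \<one>\<^bsub>BC n X\<^esub>"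
    using one completion_map_ecl[OF X 2(2)] 2(1,3) by simp
  have n0: "n + int 0 \<ge> 0" using 2(1) by simp
  have "killed C ?T (n + int 0) (Syz (res X) 0) (secl n X 0 f)"
    using X f0 n0 f
  proof (induction rule: bc_one_induct)
    case (null k f)
    let ?h = "Nul C (Syz (res A) (Suc (nat (n + int k)))) (Syz (res X) (Suc k))"
    have "secl n X (Suc k) ?h = \<one>\<^bsub>Fobj ?T (n + int (Suc k)) (Syz (res X) (Suc k))\<^esub>"
      using E.ecl_Nul[OF syz_obj[OF X, of "Suc k"], of "Suc (nat (n + int k))"] null(1)
        nat_index_Suc[OF null(1)] by (simp add: add_ac)
    then have "killed C ?T (n + int (Suc k)) (Syz (res X) (Suc k)) (secl n X (Suc k) ?h)"
      using killed.one by metis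
    then show ?case using step[OF null(1,2) snull_syz_lift[OF X null(2,3)]] by blast
  next
    case (lift k f h)
    then show ?case using step by blast
  qed
  then show ?thesis using 2(1,3) Syz_res_0[OF X] by simp
qed

theorem mislin_completion_BC:
  "mislin_completion TYPE('h) C (Ext_functor C (res A)) (BC_functor C res hs A) completion_map"
proof -
  interpret mislin_criterion C "Ext_functor C (res A)" "BC_functor C res hs A" completion_map
    "\<lambda>X. inc (res X) 0" "\<lambda>X. prj (res X) 0"
  proof
    fix X y n and Q :: "int \<Rightarrow> 'o \<Rightarrow> (nat \<times> 'm set) set \<Rightarrow> bool"
    assume X: "X \<in> Obj C" and y: "y \<in> carrier (Fobj (BC_functor C res hs A) n X)"
      and base: "\<And>n X x. X \<in> Obj C \<Longrightarrow> x \<in> carrier (Fobj (Ext_functor C (res A)) n X) \<Longrightarrow> Q n X (completion_map n X x)"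
      and step: "\<And>n X y. X \<in> Obj C \<Longrightarrow> y \<in> carrier (Fobj (BC_functor C res hs A) n X) \<Longrightarrow>
         Q (n + 1) (Dom C (inc (res X) 0)) (Fcon (BC_functor C res hs A) n (inc (res X) 0) (prj (res X) 0) y) \<Longrightarrow> Q n X y"
    obtain k f where k: "n + int k \<ge> 0" "f \<in> syzHom n X k" "y = bc_class n X k f"
      using bc_class_cases[OF X] y by (metis BC_functor_simps(1))
    show "Q n X y"
      unfolding k(3) by (rule bc_reach[of Q, OF _ _ X k(1,2)]) (use base step in simp_all)
  qed (use coh_morphism_completion vanishes_BC canonical_shift ext_killed in simp_all)
  show ?thesis by (rule mislin_completion)
qed

end

theorem theorem5p12:
  fixes C :: "('o, 'm) abcat"
    and res :: "'o \<Rightarrow> ('o, 'm) resolution"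
    and hs :: "'m \<Rightarrow> 'm \<Rightarrow> ('o, 'm) horseshoe"
    and A :: 'o
  assumes "abelian_category C"
    and "enough_projectives C"
    and "\<And>M. M \<in> Obj C \<Longrightarrow> proj_resolution C M (res M)"
    and "\<And>i p. short_exact C i p \<Longrightarrow>
           is_horseshoe C (res (Dom C i)) (res (Cod C p)) i p (hs i p)"
    and "A \<in> Obj C"
  shows "mislin_completion TYPE('h) C (Ext_functor C (res A)) (BC_functor C res hs A)
           (\<lambda>n B. beta_map C res A n B \<circ> canonical_map C res A n B)
       \<and> cohomological_functor C (BC_functor C res hs A)
       \<and> coh_isomorphism C (HatExt_functor C res hs A) (BC_functor C res hs A) (beta_map C res A)"
proof -
  interpret naive_setting C res hs A
    by (intro naive_setting.intro naive_setting_axioms.intro projective_abelian_category.intro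
        projective_abelian_category_axioms.intro assms)
  show ?thesis
    using mislin_completion_BC cohomological_functor_BC coh_isomorphism_beta by blast
qed

end
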